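(* Let $\tau=T/N$ with $N\in\mathbb{N}$, let $\beta\ge 0$ and put $\beta_0=1-\frac{\sqrt{4+\beta^2}-\beta}{2}$. Assume the finite element spaces $(\mathbf{X}_h^r,\mathbf{S}_h^r,Q_h^{r-1})$, $r\ge 1$, satisfy (A1)–(A4) of the context. Let initial values $(\mathbf{u}_h^0,p_h^0,\boldsymbol\eta_h^0)\in \mathbf{X}_h^r\times Q_h^{r-1}\times\mathbf{S}_h^r$ be given, and consider, for $n=1,\dots,N$, the following scheme, with $\boldsymbol\sigma_h^n=\boldsymbol\sigma(\mathbf{u}_h^n,p_h^n)$ and $D_\tau \mathbf{u}_h^n=(\mathbf{u}_h^n-\mathbf{u}_h^{n-1})/\tau$. Step 1: find $\mathbf{s}_h^n\in\mathbf{S}_h^r$ such that, with $\boldsymbol\eta_h^n=\boldsymbol\eta_h^{n-1}+\tau\mathbf{s}_h^n$, $$\rho_s\epsilon_s\Big(\frac{\mathbf{s}_h^n-\mathbf{u}_h^{n-1}}{\tau},\mathbf{w}_h\Big)_\Sigma+a_s(\boldsymbol\eta_h^n,\mathbf{w}_h)=-(\boldsymbol\sigma_h^{n-1}\mathbf{n},\mathbf{w}_h)_\Sigma\qquad\forall\,\mathbf{w}_h\in\mathbf{S}_h^r .$$ Step 2: find $(\mathbf{u}_h^n,p_h^n)\in\mathbf{X}_h^r\times Q_h^{r-1}$ such that for all $(\mathbf{v}_h,q_h)\in\mathbf{X}_h^r\times Q_h^{r-1}$ $$\rho_f(D_\tau\mathbf{u}_h^n,\mathbf{v}_h)+a_f(\mathbf{u}_h^n,\mathbf{v}_h)-b(p_h^n,\mathbf{v}_h)+b(q_h,\mathbf{u}_h^n)-(\boldsymbol\sigma_h^n\mathbf{n},\mathbf{v}_h)_\Sigma$$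 $$+\rho_s\epsilon_s\Big(\frac{\mathbf{u}_h^n-\mathbf{s}_h^n}{\tau},\mathbf{v}_h+\frac{\tau}{\rho_s\epsilon_s}\boldsymbol\sigma(\mathbf{v}_h,q_h)\mathbf{n}\Big)_\Sigma+\Big((\boldsymbol\sigma_h^n-\boldsymbol\sigma_h^{n-1})\mathbf{n},\mathbf{v}_h+\frac{\tau(1+\beta)}{\rho_s\epsilon_s}\boldsymbol\sigma(\mathbf{v}_h,q_h)\mathbf{n}\Big)_\Sigma=0 .$$ Then this system is uniquely solvable (at each time step $n$), and for $n=1,2,\dots,N$ $$E_0(\mathbf{u}_h^n,p_h^n,\boldsymbol\eta_h^n)+\sum_{m=1}^n\tau E_1(\mathbf{u}_h^m,\mathbf{s}_h^m,\boldsymbol\eta_h^m)\le E_0(\mathbf{u}_h^0,p_h^0,\boldsymbol\eta_h^0),$$ where $$E_0(\mathbf{u}_h^n,p_h^n,\boldsymbol\eta_h^n)=\frac{\rho_f}{2}\|\mathbf{u}_h^n\|^2+\frac12\|\boldsymbol\eta_h^n\|_s^2+\frac{\tau^2(1+\beta)}{2\rho_s\epsilon_s}\|\boldsymbol\sigma_h^n\mathbf{n}\|_\Sigma^2+\frac{\rho_s\epsilon_s}{2}\|\mathbf{u}_h^n\|_\Sigma^2,$$ $$E_1(\mathbf{u}_h^n,\mathbf{s}_h^n,\boldsymbol\eta_h^n)=2\mu\|\mathbf{u}_h^n\|_f^2+\frac{\rho_f}{2\tau}\|\mathbf{u}_h^n-\mathbf{u}_h^{n-1}\|^2+\frac{\rho_s\epsilon_s}{2\tau}\|\mathbf{s}_h^n-\mathbf{u}_h^{n-1}\|_\Sigma^2+\frac{\rho_s\epsilon_s\beta_0}{2\tau}\|\mathbf{s}_h^n-\mathbf{u}_h^n\|_\Sigma^2$$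 $$\qquad+\frac{\tau\beta_0}{2\rho_s\epsilon_s}\|(\boldsymbol\sigma_h^n-\boldsymbol\sigma_h^{n-1})\mathbf{n}\|_\Sigma^2+\frac{\tau}{2}\|D_\tau\boldsymbol\eta_h^n\|_s^2 .$$
   Context: Geometry. $d\in\{2,3\}$, $L>0$; $\Omega\subset\mathbb{R}^d$ is a bounded domain with $\partial\Omega=\Sigma_l\cup\Sigma_r\cup\Sigma$, where $\Sigma_l,\Sigma_r$ are two disks (line segments if $d=2$) with $\Sigma_r=\Sigma_l+L e_d$ ($e_d$ the last coordinate vector). The extended sets $\Omega_\infty=\{x:\exists k\in\mathbb{Z},\ x+kLe_d\in\Omega\cup\Sigma_l\}$ and $\Sigma_\infty=\{x:\exists k\in\mathbb{Z},\ x+kLe_d\in\overline\Sigma\}$ are smooth. All functions are $L$-periodic in the last variable: for $s\ge0$, $H^s(\Omega)$ (resp. $H^s(\Sigma)$) is the closure of the periodic smooth functions on $\Omega_\infty$ (resp. $\Sigma_\infty$) in the usual $H^s$ norm; $H^{-s}$ are the dual spaces. $\mathbf{n}$ is the outward unit normal. $(\cdot,\cdot),\|\cdot\|$ are the inner product and norm of $L^2(\Omega)$; $(\cdot,\cdot)_\Sigma,\|\cdot\|_\Sigma$ those of $L^2(\Sigma)$. $H^s$ without a domain means $H^s(\Omega)$. Spaces and forms. $\mathbf{X}=H^1(\Omega)^d$, $Q=L^2(\Omega)$, $\mathbf{S}=H^1(\Sigma)^d$. $\mu,\rho_f,\rho_s,\epsilon_s>0$ are constants. $\mathbf{D}(\mathbf{u})=\frac12(\nabla\mathbf{u}+(\nabla\mathbf{u})^T)$,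 $\boldsymbol\sigma(\mathbf{u},p)=-pI+2\mu\mathbf{D}(\mathbf{u})$, $a_f(\mathbf{u},\mathbf{v})=2\mu(\mathbf{D}(\mathbf{u}),\mathbf{D}(\mathbf{v}))$, $b(p,\mathbf{v})=(p,\nabla\cdot\mathbf{v})$, $a_s(\boldsymbol\eta,\mathbf{w})=(-\mathcal{L}_s\boldsymbol\eta,\mathbf{w})_\Sigma$, $\|\mathbf{u}\|_f=(\mathbf{D}(\mathbf{u}),\mathbf{D}(\mathbf{u}))^{1/2}$, $\|\boldsymbol\eta\|_s=a_s(\boldsymbol\eta,\boldsymbol\eta)^{1/2}$. Bulk functions appearing in $a_s$ or $(\cdot,\cdot)_\Sigma$ are understood through their traces on $\Sigma$. Operator $\mathcal{L}_s$: a second-order differential operator on $\Sigma$ with $\|\mathcal{L}_s\mathbf{w}\|_{H^k(\Sigma)}\le C\|\mathbf{w}\|_{H^{k+2}(\Sigma)}$ for all real $k\ge-1$ and $\mathbf{w}\in H^{k+2}(\Sigma)^d$; $a_s$ is symmetric with $a_s(\boldsymbol\eta,\boldsymbol\eta)\ge0$ on $H^1(\Sigma)^d$; and $\|\boldsymbol\eta\|_s+\|\boldsymbol\eta\|_\Sigma$ is equivalent to $\|\boldsymbol\eta\|_{H^1(\Sigma)}$. Finite element spaces. $\mathcal{T}_h$ is a quasi-uniform partition of $\Omega$ into curvilinear polyhedra/polygons $K$ with $\mathrm{diam}(K)\le h$; the boundary faces on $\Sigma$ form a partition $\mathcal{T}_h(\Sigma)$ of $\Sigma$; the faces on $\Sigma_l,\Sigma_r$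 form partitions of them which coincide after translation by $Le_d$. The spaces satisfy ($C$ independent of $h$): (A1) $\mathbf{X}_h^r\subseteq\mathbf{X}$, $\mathbf{S}_h^r\subseteq\mathbf{S}$, $\mathbb{R}\subseteq Q_h^{r-1}\subseteq Q$, $\mathbf{S}_h^r=\{\mathbf{v}_h|_\Sigma:\mathbf{v}_h\in\mathbf{X}_h^r\}$. (A2) For $0\le l\le k$, $1\le p,q\le\infty$, $K\in\mathcal{T}_h$: $\|\mathbf{v}_h\|_{W^{k,p}(K)}\le Ch^{-(k-l)+(d/p-d/q)}\|\mathbf{v}_h\|_{W^{l,q}(K)}$ for $\mathbf{v}_h$ in $\mathbf{X}_h^r$ or $Q_h^{r-1}$; and $\|\mathbf{w}_h\|_{H^s(\Sigma)}\le Ch^{k-s}\|\mathbf{w}_h\|_{H^k(\Sigma)}$ for $\mathbf{w}_h\in\mathbf{S}_h^r$, real $0\le k\le s\le1$. (A3) There are operators $I_h^X:\mathbf{X}\to\mathbf{X}_h^r$, $I_h^Q:Q\to Q_h^{r-1}$ with, for all $K$ and $1\le p\le\infty$, $\|I_h^X\mathbf{u}-\mathbf{u}\|_{L^p(K)}+h\|I_h^X\mathbf{u}-\mathbf{u}\|_{W^{1,p}(K)}\le Ch^{k+1}\|\mathbf{u}\|_{W^{k+1,p}(\Delta_K)}$ ($0\le k\le r$) and $\|I_h^Qp-p\|_{L^p(K)}\le Ch^{k+1}\|p\|_{W^{k+1,p}(\Delta_K)}$ ($0\le k\le r-1$), $\Delta_K$ being the union of elements sharing a vertex with $K$; and an operator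 $I_h^S:\mathbf{S}\to\mathbf{S}_h^r$ with $I_h^X\mathbf{u}|_\Sigma=I_h^S(\mathbf{u}|_\Sigma)$ whenever $\mathbf{u}\in\mathbf{X}$, $\mathbf{u}|_\Sigma\in\mathbf{S}$, and $\|I_h^S\mathbf{w}-\mathbf{w}\|_\Sigma+h\|I_h^S\mathbf{w}-\mathbf{w}\|_{H^1(\Sigma)}\le Ch^{k+1}\|\mathbf{w}\|_{H_h^{k+1}(\Sigma)}$ ($0\le k\le r$), $H_h^{k+1}(\Sigma)$ being the piecewise $H^{k+1}$ norm on $\mathcal{T}_h(\Sigma)$. (A4) With $\mathring{\mathbf{X}}_h^r=\{\mathbf{v}_h\in\mathbf{X}_h^r:\mathbf{v}_h|_\Sigma=0\}$ and $Q_{h,0}^{r-1}=Q_h^{r-1}\cap L_0^2(\Omega)$ ($L^2_0$: zero mean), $\|q_h\|\le C\sup_{0\ne\mathbf{v}_h\in\mathring{\mathbf{X}}_h^r}\frac{(\nabla\cdot\mathbf{v}_h,q_h)}{\|\mathbf{v}_h\|_{H^1}}$ for all $q_h\in Q_{h,0}^{r-1}$. *)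

theory Defs
  imports "HOL-Analysis.Analysis" "HOL-Probability.Essential_Supremum"
begin

section \<open>Smooth functions, weak derivatives and Sobolev norms on open sets\<close>

text \<open>
  Partial derivatives are indexed by lists of coordinate directions, so that the sum over all
  lists of length at most \<open>k\<close> runs over the entries of all derivative tensors of order at most \<open>k\<close>.
  All function spaces consist of genuine functions; equality is understood almost everywhere.
\<close>

definition pd :: "'d::finite \<Rightarrow> (real^'d \<Rightarrow> 'b::euclidean_space) \<Rightarrow> real^'d \<Rightarrow> 'b" where
  "pd i f x = frechet_derivative f (at x) (axis i 1)"

primrec pds :: "'d::finite list \<Rightarrow> (real^'d \<Rightarrow> 'b::euclidean_space) \<Rightarrow> real^'d \<Rightarrow> 'b" where
  "pds [] f = f"
| "pds (i # is) f = pd i (pds is f)"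

definition smooth_on :: "(real^'d::finite) set \<Rightarrow> (real^'d \<Rightarrow> 'b::euclidean_space) \<Rightarrow> bool" where
  "smooth_on U f \<longleftrightarrow> (\<forall>is. \<forall>x\<in>U. pds is f differentiable (at x))"

definition test_fun :: "(real^'d::finite) set \<Rightarrow> (real^'d \<Rightarrow> real) \<Rightarrow> bool" where
  "test_fun U \<phi> \<longleftrightarrow> smooth_on UNIV \<phi> \<and> (\<exists>K. compact K \<and> K \<subseteq> U \<and> (\<forall>x. x \<notin> K \<longrightarrow> \<phi> x = 0))"

definition loc_integrable :: "(real^'d::finite) set \<Rightarrow> (real^'d \<Rightarrow> 'b::euclidean_space) \<Rightarrow> bool" where
  "loc_integrable U f \<longleftrightarrow> (\<forall>K. compact K \<and> K \<subseteq> U \<longrightarrow> integrable (lebesgue_on K) f)"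

definition has_weak_deriv ::
  "(real^'d::finite) set \<Rightarrow> 'd list \<Rightarrow> (real^'d \<Rightarrow> 'b::euclidean_space) \<Rightarrow> (real^'d \<Rightarrow> 'b) \<Rightarrow> bool" where
  "has_weak_deriv U is f g \<longleftrightarrow>
     loc_integrable U f \<and> loc_integrable U g \<and>
     (\<forall>\<phi>. test_fun U \<phi> \<longrightarrow>
        (LINT x|lebesgue_on U. pds is \<phi> x *\<^sub>R f x)
          = (-1) ^ length is *\<^sub>R (LINT x|lebesgue_on U. \<phi> x *\<^sub>R g x))"

definition weak_deriv ::
  "(real^'d::finite) set \<Rightarrow> 'd list \<Rightarrow> (real^'d \<Rightarrow> 'b::euclidean_space) \<Rightarrow> real^'d \<Rightarrow> 'b" where
  "weak_deriv U is f = (SOME g. has_weak_deriv U is f g)"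

definition ennpowr :: "ennreal \<Rightarrow> real \<Rightarrow> ennreal" where
  "ennpowr x a = (if x = \<infinity> then \<infinity> else ennreal (enn2real x powr a))"

definition Lp_norm :: "ennreal \<Rightarrow> 'a measure \<Rightarrow> ('a \<Rightarrow> 'b::euclidean_space) \<Rightarrow> ennreal" where
  "Lp_norm p M f =
     (if f \<notin> borel_measurable M then \<infinity>
      else if p = \<infinity> then esssup M (\<lambda>x. ennreal (norm (f x)))
      else ennpowr (\<integral>\<^sup>+x. ennreal (norm (f x) powr enn2real p) \<partial>M) (1 / enn2real p))"

text \<open>The norm of \<open>W\<^bsup>k,p\<^esup>(U)\<close>; it is infinite precisely for functions outside that space.\<close>

definition sob_norm ::
  "nat \<Rightarrow> ennreal \<Rightarrow> (real^'d::finite) set \<Rightarrow> (real^'d \<Rightarrow> 'b::euclidean_space) \<Rightarrow> ennreal" where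
  "sob_norm k p U f =
     (if \<forall>is. length is \<le> k \<longrightarrow> (\<exists>g. has_weak_deriv U is f g)
      then \<Sum>is\<in>{is. length is \<le> k}. Lp_norm p (lebesgue_on U) (weak_deriv U is f)
      else \<infinity>)"

definition l2_fun :: "'a measure \<Rightarrow> ('a \<Rightarrow> 'b::euclidean_space) \<Rightarrow> bool" where
  "l2_fun M f \<longleftrightarrow> f \<in> borel_measurable M \<and> integrable M (\<lambda>x. (norm (f x))\<^sup>2)"

definition l2_inner :: "'a measure \<Rightarrow> ('a \<Rightarrow> 'b::euclidean_space) \<Rightarrow> ('a \<Rightarrow> 'b) \<Rightarrow> real" where
  "l2_inner M f g = (LINT x|M. f x \<bullet> g x)"

definition l2_norm :: "'a measure \<Rightarrow> ('a \<Rightarrow> 'b::euclidean_space) \<Rightarrow> real" where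
  "l2_norm M f = sqrt (l2_inner M f f)"


section \<open>Surface measure\<close>

definition hausdorff_pre :: "real \<Rightarrow> real \<Rightarrow> 'a::metric_space set \<Rightarrow> ennreal" where
  "hausdorff_pre s \<delta> A =
     (INF U\<in>{U :: nat \<Rightarrow> 'a set. A \<subseteq> (\<Union>i. U i) \<and> (\<forall>i. bounded (U i) \<and> diameter (U i) \<le> \<delta>)}.
        \<Sum>i. ennreal (unit_ball_vol s * (diameter (U i) / 2) powr s))"

definition hausdorff_outer :: "real \<Rightarrow> 'a::metric_space set \<Rightarrow> ennreal" where
  "hausdorff_outer s A = (SUP \<delta>\<in>{0<..}. hausdorff_pre s \<delta> A)"

definition hausdorff_measure :: "real \<Rightarrow> 'a::metric_space measure" where
  "hausdorff_measure s = measure_of UNIV (sets borel) (hausdorff_outer s)"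

definition surf :: "(real^'d::finite) set \<Rightarrow> (real^'d) measure" where
  "surf \<Gamma> = completion (restrict_space (hausdorff_measure (real CARD('d) - 1)) \<Gamma>)"


section \<open>Geometry\<close>

text \<open>
  A periodicity cell: the period \<open>L\<close>, the index of the last coordinate axis, the domain
  \<open>\<Omega>\<close> and the two disks \<open>\<Sigma>\<^sub>l\<close>, \<open>\<Sigma>\<^sub>r\<close>.
\<close>

record ('d::finite) cell =
  period :: real
  axl :: 'd
  dom :: "(real^'d) set"
  lft :: "(real^'d) set"
  rgt :: "(real^'d) set"

definition shift :: "('d::finite) cell \<Rightarrow> real^'d" where
  "shift G = period G *\<^sub>R axis (axl G) 1"

definition Sig :: "('d::finite) cell \<Rightarrow> (real^'d) set" where
  "Sig G = frontier (dom G) - (lft G \<union> rgt G)"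

definition Dom_inf :: "('d::finite) cell \<Rightarrow> (real^'d) set" where
  "Dom_inf G = {x. \<exists>k::int. x + of_int k *\<^sub>R shift G \<in> dom G \<union> lft G}"

definition Sig_inf :: "('d::finite) cell \<Rightarrow> (real^'d) set" where
  "Sig_inf G = {x. \<exists>k::int. x + of_int k *\<^sub>R shift G \<in> closure (Sig G)}"

definition open_disk :: "(real^'d::finite) set \<Rightarrow> bool" where
  "open_disk D \<longleftrightarrow> (\<exists>c \<nu> R. R > 0 \<and> norm \<nu> = 1 \<and> D = {x. (x - c) \<bullet> \<nu> = 0 \<and> dist x c < R})"

text \<open>
  Smooth boundary in the usual sense: up to relabelling and reorienting the axes, the set is
  locally the subgraph of a smooth function \<open>\<gamma>\<close> of the remaining coordinates.
\<close>

definition smooth_domain :: "(real^'d::finite) set \<Rightarrow> bool" where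
  "smooth_domain U \<longleftrightarrow> open U \<and>
     (\<forall>x\<in>frontier U. \<exists>i s r \<gamma>. (s = 1 \<or> s = - 1) \<and> r > 0 \<and> smooth_on UNIV \<gamma> \<and>
        (\<forall>y z. (\<forall>j. j \<noteq> i \<longrightarrow> y $ j = z $ j) \<longrightarrow> \<gamma> y = \<gamma> z) \<and>
        U \<inter> ball x r = {y \<in> ball x r. s * (y $ i) < (\<gamma> y :: real)})"

text \<open>
  That distinct translates of \<open>\<Omega>\<close> do not meet is part of the picture of a periodicity cell: only
  then does a function on \<open>\<Omega>\<close> have a periodic extension to \<open>\<Omega>\<^sub>\<infinity>\<close>.
\<close>

definition admissible_cell :: "('d::finite) cell \<Rightarrow> bool" where
  "admissible_cell G \<longleftrightarrow>
     CARD('d) \<in> {2, 3} \<and> period G > 0 \<and>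
     open (dom G) \<and> connected (dom G) \<and> bounded (dom G) \<and> dom G \<noteq> {} \<and>
     open_disk (lft G) \<and> rgt G = (+) (shift G) ` lft G \<and> lft G \<inter> rgt G = {} \<and>
     lft G \<union> rgt G \<subseteq> frontier (dom G) \<and>
     (\<forall>k::int. k \<noteq> 0 \<longrightarrow> dom G \<inter> (+) (of_int k *\<^sub>R shift G) ` dom G = {}) \<and>
     frontier (Dom_inf G) = Sig_inf G \<and> smooth_domain (Dom_inf G)"

definition periodic :: "('d::finite) cell \<Rightarrow> (real^'d \<Rightarrow> 'b) \<Rightarrow> bool" where
  "periodic G f \<longleftrightarrow> (\<forall>x. f (x + shift G) = f x)"

text \<open>
  Since \<open>\<Omega>\<^sub>\<infinity>\<close> and \<open>\<Sigma>\<^sub>\<infinity>\<close> are smooth, the periodic smooth functions on them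
  (up to the boundary) are the restrictions of periodic smooth functions on the whole space.
\<close>

definition smooth_per :: "('d::finite) cell \<Rightarrow> (real^'d \<Rightarrow> 'b::euclidean_space) \<Rightarrow> bool" where
  "smooth_per G f \<longleftrightarrow> smooth_on UNIV f \<and> periodic G f"

text \<open>
  The outward unit normal is the unit vector \<open>\<nu>\<close> for which the blow-up of \<open>U\<close> at \<open>x\<close> is the half
  space \<open>{z. z \<bullet> \<nu> < 0}\<close>.
\<close>

definition outward_normal :: "(real^'d::finite) set \<Rightarrow> real^'d \<Rightarrow> real^'d" where
  "outward_normal U x = (THE \<nu>. norm \<nu> = 1 \<and>
     (\<forall>\<epsilon>>0. \<forall>\<^sub>F y in at x. (y \<in> U \<longrightarrow> (y - x) \<bullet> \<nu> \<le> \<epsilon> * dist y x) \<and>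
                          (y \<notin> U \<longrightarrow> (y - x) \<bullet> \<nu> \<ge> - \<epsilon> * dist y x)))"

text \<open>On \<open>\<Sigma>\<close> the normals of \<open>\<Omega>\<close> and \<open>\<Omega>\<^sub>\<infinity>\<close> agree; the latter is also defined at the edges.\<close>

definition nrm :: "('d::finite) cell \<Rightarrow> real^'d \<Rightarrow> real^'d" where
  "nrm G x = outward_normal (Dom_inf G) x"


section \<open>Sobolev spaces on the surface\<close>

text \<open>
  Tangential derivatives in the directions \<open>e\<^sub>i - n\<^sub>i n\<close>. The derivative within \<open>\<Sigma>\<^sub>\<infinity>\<close> is
  only determined on tangent vectors, which is where it is evaluated.
\<close>

definition td :: "('d::finite) cell \<Rightarrow> 'd \<Rightarrow> (real^'d \<Rightarrow> 'b::euclidean_space) \<Rightarrow> real^'d \<Rightarrow> 'b" where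
  "td G i g x = frechet_derivative g (at x within Sig_inf G)
                  (axis i 1 - (nrm G x $ i) *\<^sub>R nrm G x)"

primrec tds :: "('d::finite) cell \<Rightarrow> 'd list \<Rightarrow> (real^'d \<Rightarrow> 'b::euclidean_space) \<Rightarrow> real^'d \<Rightarrow> 'b" where
  "tds G [] g = g"
| "tds G (i # is) g = td G i (tds G is g)"

definition pdist :: "('d::finite) cell \<Rightarrow> real^'d \<Rightarrow> real^'d \<Rightarrow> real" where
  "pdist G x y = (INF k::int. dist x (y + of_int k *\<^sub>R shift G))"

text \<open>
  The Sobolev--Slobodeckij norm of order \<open>s \<ge> 0\<close> of a smooth function on \<open>\<Gamma> \<subseteq> \<Sigma>\<close>, with
  distances on the (\<open>d - 1\<close>)-dimensional surface measured modulo the period.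
\<close>

definition smooth_surf_norm ::
  "('d::finite) cell \<Rightarrow> real \<Rightarrow> (real^'d) set \<Rightarrow> (real^'d \<Rightarrow> 'b::euclidean_space) \<Rightarrow> real" where
  "smooth_surf_norm G s \<Gamma> \<phi> = sqrt (
     (\<Sum>is\<in>{is. length is \<le> nat \<lfloor>s\<rfloor>}. (l2_norm (surf \<Gamma>) (tds G is \<phi>))\<^sup>2) +
     (if s \<in> \<int> then 0 else
      \<Sum>is\<in>{is. length is = nat \<lfloor>s\<rfloor>}.
        LINT x|surf \<Gamma>. LINT y|surf \<Gamma>.
          (norm (tds G is \<phi> x - tds G is \<phi> y))\<^sup>2 / pdist G x y powr (real CARD('d) - 1 + 2 * frac s)))"

text \<open>
  The closure of a class \<open>C\<close> of smooth functions in this norm: sequences in \<open>C\<close> that are Cauchy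
  in the norm and converge to \<open>w\<close> in \<open>L\<^sup>2(\<Gamma>)\<close>. All of them have the same limit of norms, which is
  the norm of \<open>w\<close>; if there is none, the infimum is infinite.
\<close>

definition surf_approx ::
  "('d::finite) cell \<Rightarrow> ((real^'d \<Rightarrow> 'b) \<Rightarrow> bool) \<Rightarrow> real \<Rightarrow> (real^'d) set \<Rightarrow>
   (real^'d \<Rightarrow> 'b::euclidean_space) \<Rightarrow> (nat \<Rightarrow> real^'d \<Rightarrow> 'b) \<Rightarrow> bool" where
  "surf_approx G C s \<Gamma> w \<phi> \<longleftrightarrow>
     l2_fun (surf \<Gamma>) w \<and> (\<forall>k. C (\<phi> k)) \<and>
     (\<lambda>k. l2_norm (surf \<Gamma>) (\<lambda>x. \<phi> k x - w x)) \<longlonglongrightarrow> 0 \<and>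
     (\<forall>\<epsilon>>0. \<exists>M. \<forall>m\<ge>M. \<forall>n\<ge>M. smooth_surf_norm G s \<Gamma> (\<lambda>x. \<phi> m x - \<phi> n x) < \<epsilon>)"

definition surf_norm ::
  "('d::finite) cell \<Rightarrow> ((real^'d \<Rightarrow> 'b) \<Rightarrow> bool) \<Rightarrow> real \<Rightarrow> (real^'d) set \<Rightarrow>
   (real^'d \<Rightarrow> 'b::euclidean_space) \<Rightarrow> ennreal" where
  "surf_norm G C s \<Gamma> w =
     (INF \<phi>\<in>{\<phi>. surf_approx G C s \<Gamma> w \<phi>}. liminf (\<lambda>k. ennreal (smooth_surf_norm G s \<Gamma> (\<phi> k))))"

text \<open>\<open>H\<^sup>s(\<Sigma>)\<close> and its norm, for real \<open>s \<ge> 0\<close>.\<close>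

definition HsS :: "('d::finite) cell \<Rightarrow> real \<Rightarrow> (real^'d \<Rightarrow> 'b::euclidean_space) set" where
  "HsS G s = {w. \<exists>\<phi>. surf_approx G (smooth_per G) s (Sig G) w \<phi>}"

definition HsS_norm :: "('d::finite) cell \<Rightarrow> real \<Rightarrow> (real^'d \<Rightarrow> 'b::euclidean_space) \<Rightarrow> ennreal" where
  "HsS_norm G s w = surf_norm G (smooth_per G) s (Sig G) w"

text \<open>
  The \<open>H\<^sup>k(\<Sigma>)\<close> norm, for real \<open>k \<ge> -1\<close>, of a functional \<open>l\<close> on \<open>H\<^sup>1(\<Sigma>)\<close>. For \<open>k < 0\<close> this is the
  dual norm (\<open>H\<^sup>1(\<Sigma>)\<close> is dense in \<open>H\<^bsup>-k\<^esup>(\<Sigma>)\<close>); for \<open>k \<ge> 0\<close> it is the norm of the function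
  representing \<open>l\<close> via the pairing of \<open>L\<^sup>2(\<Sigma>)\<close>, and infinite if there is none in \<open>H\<^sup>k(\<Sigma>)\<close>.
\<close>

definition HsS_fun_norm ::
  "('d::finite) cell \<Rightarrow> real \<Rightarrow> ((real^'d \<Rightarrow> 'b::euclidean_space) \<Rightarrow> real) \<Rightarrow> ennreal" where
  "HsS_fun_norm G k l =
     (if k < 0 then SUP w\<in>HsS G 1. ennreal \<bar>l w\<bar> / HsS_norm G (- k) w
      else INF f\<in>{f \<in> HsS G k. \<forall>w\<in>HsS G 1. l w = l2_inner (surf (Sig G)) f w}. HsS_norm G k f)"


section \<open>Bulk spaces, traces and forms\<close>

abbreviation bulk :: "('d::finite) cell \<Rightarrow> (real^'d) measure" where
  "bulk G \<equiv> lebesgue_on (dom G)"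

abbreviation wall :: "('d::finite) cell \<Rightarrow> (real^'d) measure" where
  "wall G \<equiv> surf (Sig G)"

text \<open>\<open>X = H\<^sup>1(\<Omega>)\<^sup>d\<close>, \<open>Q = L\<^sup>2(\<Omega>)\<close> and \<open>S = H\<^sup>1(\<Sigma>)\<^sup>d\<close>, periodicity included.\<close>

definition X_space :: "('d::finite) cell \<Rightarrow> (real^'d \<Rightarrow> real^'d) set" where
  "X_space G = {u. periodic G u \<and> sob_norm 1 2 (dom G) u < \<infinity> \<and>
     (\<exists>\<phi>. (\<forall>k. smooth_per G (\<phi> k)) \<and>
          (\<lambda>k::nat. sob_norm 1 2 (dom G) (\<lambda>x. \<phi> k x - u x)) \<longlonglongrightarrow> 0)}"

definition Q_space :: "('d::finite) cell \<Rightarrow> (real^'d \<Rightarrow> real) set" where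
  "Q_space G = {q. periodic G q \<and> l2_fun (bulk G) q}"

abbreviation S_space :: "('d::finite) cell \<Rightarrow> (real^'d \<Rightarrow> real^'d) set" where
  "S_space G \<equiv> HsS G 1"

text \<open>The trace on \<open>\<Sigma>\<close>: the continuous extension of the restriction of smooth functions.\<close>

definition is_trace ::
  "('d::finite) cell \<Rightarrow> (real^'d \<Rightarrow> 'b::euclidean_space) \<Rightarrow> (real^'d \<Rightarrow> 'b) \<Rightarrow> bool" where
  "is_trace G u g \<longleftrightarrow> l2_fun (wall G) g \<and>
     (\<exists>\<phi>. (\<forall>k. smooth_per G (\<phi> k)) \<and>
          (\<lambda>k::nat. sob_norm 1 2 (dom G) (\<lambda>x. \<phi> k x - u x)) \<longlonglongrightarrow> 0 \<and>
          (\<lambda>k. l2_norm (wall G) (\<lambda>x. \<phi> k x - g x)) \<longlonglongrightarrow> 0)"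

definition tr :: "('d::finite) cell \<Rightarrow> (real^'d \<Rightarrow> 'b::euclidean_space) \<Rightarrow> real^'d \<Rightarrow> 'b" where
  "tr G u = (SOME g. is_trace G u g)"

definition grad :: "('d::finite) cell \<Rightarrow> (real^'d \<Rightarrow> real^'d) \<Rightarrow> real^'d \<Rightarrow> real^'d^'d" where
  "grad G u x = (\<chi> i j. weak_deriv (dom G) [j] u x $ i)"

definition dvg :: "('d::finite) cell \<Rightarrow> (real^'d \<Rightarrow> real^'d) \<Rightarrow> real^'d \<Rightarrow> real" where
  "dvg G u x = (\<Sum>i\<in>UNIV. grad G u x $ i $ i)"

definition strain :: "('d::finite) cell \<Rightarrow> (real^'d \<Rightarrow> real^'d) \<Rightarrow> real^'d \<Rightarrow> real^'d^'d" where
  "strain G u x = (1/2) *\<^sub>R (grad G u x + transpose (grad G u x))"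

definition stress ::
  "('d::finite) cell \<Rightarrow> real \<Rightarrow> (real^'d \<Rightarrow> real^'d) \<Rightarrow> (real^'d \<Rightarrow> real) \<Rightarrow> real^'d \<Rightarrow> real^'d^'d" where
  "stress G \<mu> u p x = mat (- p x) + (2 * \<mu>) *\<^sub>R strain G u x"

definition a_f :: "('d::finite) cell \<Rightarrow> real \<Rightarrow> (real^'d \<Rightarrow> real^'d) \<Rightarrow> (real^'d \<Rightarrow> real^'d) \<Rightarrow> real" where
  "a_f G \<mu> u v = 2 * \<mu> * l2_inner (bulk G) (strain G u) (strain G v)"

definition b_form :: "('d::finite) cell \<Rightarrow> (real^'d \<Rightarrow> real) \<Rightarrow> (real^'d \<Rightarrow> real^'d) \<Rightarrow> real" where
  "b_form G p v = l2_inner (bulk G) p (dvg G v)"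

definition norm_f :: "('d::finite) cell \<Rightarrow> (real^'d \<Rightarrow> real^'d) \<Rightarrow> real" where
  "norm_f G u = sqrt (l2_inner (bulk G) (strain G u) (strain G u))"


section \<open>The surface operator\<close>

text \<open>
  \<open>Ls \<eta> w\<close> is the duality pairing of \<open>\<L>\<^sub>s \<eta> \<in> H\<^bsup>-1\<^esup>(\<Sigma>)\<^sup>d\<close> with \<open>w \<in> H\<^sup>1(\<Sigma>)\<^sup>d\<close>.
\<close>

type_synonym 'd surface_op = "(real^'d \<Rightarrow> real^'d) \<Rightarrow> (real^'d \<Rightarrow> real^'d) \<Rightarrow> real"

definition a_s :: "('d::finite) surface_op \<Rightarrow> (real^'d \<Rightarrow> real^'d) \<Rightarrow> (real^'d \<Rightarrow> real^'d) \<Rightarrow> real" where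
  "a_s Ls \<eta> w = - Ls \<eta> w"

definition norm_s :: "('d::finite) surface_op \<Rightarrow> (real^'d \<Rightarrow> real^'d) \<Rightarrow> real" where
  "norm_s Ls \<eta> = sqrt (a_s Ls \<eta> \<eta>)"

definition second_order_op :: "('d::finite) cell \<Rightarrow> 'd surface_op \<Rightarrow> bool" where
  "second_order_op G Ls \<longleftrightarrow>
     (\<exists>A :: 'd list \<Rightarrow> real^'d \<Rightarrow> real^'d^'d. (\<forall>is. smooth_per G (A is)) \<and>
        (\<forall>\<phi> w. smooth_per G \<phi> \<and> w \<in> S_space G \<longrightarrow>
           Ls \<phi> w = l2_inner (wall G) (\<lambda>x. \<Sum>is\<in>{is. length is \<le> 2}. A is x *v tds G is \<phi> x) w))"

definition surface_operator :: "('d::finite) cell \<Rightarrow> 'd surface_op \<Rightarrow> bool" where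
  "surface_operator G Ls \<longleftrightarrow>
     (\<forall>\<eta>\<in>S_space G. \<forall>\<xi>\<in>S_space G. \<forall>w\<in>S_space G. \<forall>a b.
        Ls (\<lambda>x. a *\<^sub>R \<eta> x + b *\<^sub>R \<xi> x) w = a * Ls \<eta> w + b * Ls \<xi> w \<and>
        Ls w (\<lambda>x. a *\<^sub>R \<eta> x + b *\<^sub>R \<xi> x) = a * Ls w \<eta> + b * Ls w \<xi>) \<and>
     second_order_op G Ls \<and>
     (\<forall>k\<ge>-1. \<exists>C>0. \<forall>w\<in>HsS G (k + 2). HsS_fun_norm G k (Ls w) \<le> ennreal C * HsS_norm G (k + 2) w) \<and>
     (\<forall>\<eta>\<in>S_space G. \<forall>w\<in>S_space G. a_s Ls \<eta> w = a_s Ls w \<eta>) \<and>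
     (\<forall>\<eta>\<in>S_space G. a_s Ls \<eta> \<eta> \<ge> 0) \<and>
     (\<exists>c>0. \<exists>C>0. \<forall>\<eta>\<in>S_space G.
        ennreal c * HsS_norm G 1 \<eta> \<le> ennreal (norm_s Ls \<eta> + l2_norm (wall G) \<eta>) \<and>
        ennreal (norm_s Ls \<eta> + l2_norm (wall G) \<eta>) \<le> ennreal C * HsS_norm G 1 \<eta>)"


section \<open>Meshes\<close>

text \<open>
  A curvilinear polyhedron (polygon) is a reference polytope together with a smooth
  diffeomorphism of a neighbourhood; its faces and vertices are the images of the facets and
  extreme points of the polytope.
\<close>

type_synonym 'd elem = "(real^'d) set \<times> (real^'d \<Rightarrow> real^'d)"

definition elset :: "('d::finite) elem \<Rightarrow> (real^'d) set" where
  "elset K = snd K ` interior (fst K)"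

definition elfaces :: "('d::finite) elem \<Rightarrow> (real^'d) set set" where
  "elfaces K = {snd K ` F |F. F facet_of fst K}"

definition elverts :: "('d::finite) elem \<Rightarrow> (real^'d) set" where
  "elverts K = snd K ` {v. v extreme_point_of fst K}"

definition curvilinear :: "('d::finite) elem \<Rightarrow> bool" where
  "curvilinear K \<longleftrightarrow> polytope (fst K) \<and> interior (fst K) \<noteq> {} \<and>
     (\<exists>U. open U \<and> fst K \<subseteq> U \<and> smooth_on U (snd K) \<and> inj_on (snd K) U \<and>
          (\<forall>x\<in>U. inj (frechet_derivative (snd K) (at x))))"

definition faces_in :: "('d::finite) elem set \<Rightarrow> (real^'d) set \<Rightarrow> ('d elem \<times> (real^'d) set) set" where
  "faces_in T \<Gamma> = {(K, e). K \<in> T \<and> e \<in> elfaces K \<and> e \<subseteq> \<Gamma>}"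

definition face_partition :: "('d::finite) elem set \<Rightarrow> (real^'d) set \<Rightarrow> bool" where
  "face_partition T \<Gamma> \<longleftrightarrow> (\<Union>(snd ` faces_in T \<Gamma>)) = \<Gamma> \<and>
     (\<forall>a\<in>faces_in T \<Gamma>. \<forall>b\<in>faces_in T \<Gamma>. a \<noteq> b \<longrightarrow>
        emeasure (hausdorff_measure (real CARD('d) - 1)) (snd a \<inter> snd b) = 0)"

text \<open>Quasi-uniform partition with mesh size \<open>h\<close>; each element contains a ball of radius \<open>c h\<close>.\<close>

definition mesh_partition :: "('d::finite) cell \<Rightarrow> real \<Rightarrow> real \<Rightarrow> 'd elem set \<Rightarrow> bool" where
  "mesh_partition G c h T \<longleftrightarrow>
     finite T \<and> (\<forall>K\<in>T. curvilinear K \<and> elset K \<subseteq> dom G) \<and>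
     (\<forall>K\<in>T. \<forall>K'\<in>T. K \<noteq> K' \<longrightarrow> elset K \<inter> elset K' = {}) \<and>
     closure (dom G) = (\<Union>K\<in>T. closure (elset K)) \<and>
     (\<forall>K\<in>T. diameter (elset K) \<le> h \<and> (\<exists>z. ball z (c * h) \<subseteq> elset K)) \<and>
     face_partition T (Sig G) \<and>
     face_partition T (closure (lft G)) \<and> face_partition T (closure (rgt G)) \<and>
     (\<lambda>e. (+) (shift G) ` e) ` snd ` faces_in T (closure (lft G))
       = snd ` faces_in T (closure (rgt G))"

text \<open>
  The patch \<open>\<Delta>\<^sub>K\<close> of elements sharing a vertex with \<open>K\<close>, in the periodic sense: elements adjacent
  to \<open>K\<close> across \<open>\<Sigma>\<^sub>l\<close> or \<open>\<Sigma>\<^sub>r\<close> are included, at their translated position.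
\<close>

definition patch :: "('d::finite) cell \<Rightarrow> 'd elem set \<Rightarrow> 'd elem \<Rightarrow> (real^'d) set" where
  "patch G T K = interior (\<Union>{(+) (of_int k *\<^sub>R shift G) ` closure (elset K') |K' (k::int).
      K' \<in> T \<and> elverts K \<inter> (+) (of_int k *\<^sub>R shift G) ` elverts K' \<noteq> {}})"

text \<open>The piecewise norm of \<open>H\<^sup>m\<close> on the boundary faces.\<close>

definition broken_surf_norm ::
  "('d::finite) cell \<Rightarrow> 'd elem set \<Rightarrow> nat \<Rightarrow> (real^'d \<Rightarrow> real^'d) \<Rightarrow> ennreal" where
  "broken_surf_norm G T m w =
     ennpowr (\<Sum>a\<in>faces_in T (Sig G). (surf_norm G (smooth_on UNIV) (real m) (snd a) w)\<^sup>2) (1/2)"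

text \<open>
  Traces of piecewise smooth functions, such as the discrete stress, are taken elementwise: the
  value at a boundary point \<open>x\<close> is the (essential) limit at \<open>x\<close> from inside the element one of
  whose faces on \<open>\<Sigma>\<close> contains \<open>x\<close>. That element is unique for almost all \<open>x\<close>.
\<close>

definition bdry_value :: "(real^'d::finite) set \<Rightarrow> (real^'d \<Rightarrow> 'b::euclidean_space) \<Rightarrow> real^'d \<Rightarrow> 'b" where
  "bdry_value U f x =
     (THE l. \<forall>\<epsilon>>0. \<exists>\<delta>>0. AE y in lebesgue_on (U \<inter> ball x \<delta>). dist (f y) l < \<epsilon>)"

definition bdry_elem :: "('d::finite) cell \<Rightarrow> 'd elem set \<Rightarrow> real^'d \<Rightarrow> 'd elem" where
  "bdry_elem G T x = (SOME K. \<exists>e. (K, e) \<in> faces_in T (Sig G) \<and> x \<in> e)"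

definition traction ::
  "('d::finite) cell \<Rightarrow> 'd elem set \<Rightarrow> real \<Rightarrow> (real^'d \<Rightarrow> real^'d) \<Rightarrow> (real^'d \<Rightarrow> real) \<Rightarrow> real^'d \<Rightarrow> real^'d" where
  "traction G T \<mu> u p x = bdry_value (elset (bdry_elem G T x)) (stress G \<mu> u p) x *v nrm G x"


section \<open>Finite element spaces\<close>

record ('d::finite) fe =
  mesh :: "'d elem set"
  XF :: "(real^'d \<Rightarrow> real^'d) set"
  SF :: "(real^'d \<Rightarrow> real^'d) set"
  QF :: "(real^'d \<Rightarrow> real) set"

definition fin_dim_space :: "'a measure \<Rightarrow> ('a \<Rightarrow> 'b::euclidean_space) set \<Rightarrow> bool" where
  "fin_dim_space M V \<longleftrightarrow> (\<lambda>_. 0) \<in> V \<and>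
     (\<forall>f\<in>V. \<forall>g\<in>V. \<forall>a b. (\<lambda>x. a *\<^sub>R f x + b *\<^sub>R g x) \<in> V) \<and>
     (\<exists>B. finite B \<and> B \<subseteq> V \<and> (\<forall>f\<in>V. \<exists>c. AE x in M. f x = (\<Sum>g\<in>B. c g *\<^sub>R g x)))"

definition fe_spaces :: "('d::finite) cell \<Rightarrow> 'd fe \<Rightarrow> bool" where
  "fe_spaces G V \<longleftrightarrow> fin_dim_space (bulk G) (XF V) \<and> fin_dim_space (wall G) (SF V) \<and>
     fin_dim_space (bulk G) (QF V)"

definition X0F :: "('d::finite) cell \<Rightarrow> 'd fe \<Rightarrow> (real^'d \<Rightarrow> real^'d) set" where
  "X0F G V = {v \<in> XF V. AE x in wall G. tr G v x = 0}"

definition Q0F :: "('d::finite) cell \<Rightarrow> 'd fe \<Rightarrow> (real^'d \<Rightarrow> real) set" where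
  "Q0F G V = {q \<in> QF V. (LINT x|bulk G. q x) = 0}"

text \<open>
  The assumptions on a family \<open>F\<close> of spaces indexed by the mesh sizes \<open>h \<in> H\<close>. In all of them the
  constant is independent of \<open>h\<close>; it may depend on the smoothness indices and exponents.
\<close>

definition A1 :: "('d::finite) cell \<Rightarrow> real set \<Rightarrow> (real \<Rightarrow> 'd fe) \<Rightarrow> bool" where
  "A1 G H F \<longleftrightarrow> (\<forall>h\<in>H.
     XF (F h) \<subseteq> X_space G \<and> SF (F h) \<subseteq> S_space G \<and>
     (\<forall>c. (\<lambda>_. c) \<in> QF (F h)) \<and> QF (F h) \<subseteq> Q_space G \<and>
     (\<forall>v\<in>XF (F h). \<exists>w\<in>SF (F h). is_trace G v w) \<and>
     (\<forall>w\<in>SF (F h). \<exists>v\<in>XF (F h). is_trace G v w))"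

definition A2 :: "('d::finite) cell \<Rightarrow> real set \<Rightarrow> (real \<Rightarrow> 'd fe) \<Rightarrow> bool" where
  "A2 G H F \<longleftrightarrow>
     (\<forall>k l p q. l \<le> k \<and> 1 \<le> p \<and> 1 \<le> q \<longrightarrow> (\<exists>C>0. \<forall>h\<in>H. \<forall>K\<in>mesh (F h).
        let \<kappa> = ennreal (C * h powr (- (real k - real l) +
                   (real CARD('d) * enn2real (inverse p) - real CARD('d) * enn2real (inverse q))))
        in (\<forall>v\<in>XF (F h). sob_norm k p (elset K) v \<le> \<kappa> * sob_norm l q (elset K) v) \<and>
           (\<forall>v\<in>QF (F h). sob_norm k p (elset K) v \<le> \<kappa> * sob_norm l q (elset K) v))) \<and>
     (\<forall>k s. 0 \<le> k \<and> k \<le> s \<and> s \<le> 1 \<longrightarrow> (\<exists>C>0. \<forall>h\<in>H. \<forall>w\<in>SF (F h).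
        HsS_norm G s w \<le> ennreal (C * h powr (k - s)) * HsS_norm G k w))"

definition A3 :: "('d::finite) cell \<Rightarrow> nat \<Rightarrow> real set \<Rightarrow> (real \<Rightarrow> 'd fe) \<Rightarrow> bool" where
  "A3 G r H F \<longleftrightarrow> (\<exists>IX IQ IS.
     (\<forall>h\<in>H. (\<forall>u\<in>X_space G. IX h u \<in> XF (F h)) \<and> (\<forall>q\<in>Q_space G. IQ h q \<in> QF (F h)) \<and>
            (\<forall>w\<in>S_space G. IS h w \<in> SF (F h)) \<and>
            (\<forall>u\<in>X_space G. \<forall>w\<in>S_space G. is_trace G u w \<longrightarrow> is_trace G (IX h u) (IS h w))) \<and>
     (\<forall>k p. k \<le> r \<and> 1 \<le> p \<longrightarrow> (\<exists>C>0. \<forall>h\<in>H. \<forall>K\<in>mesh (F h). \<forall>u\<in>X_space G.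
        Lp_norm p (lebesgue_on (elset K)) (\<lambda>x. IX h u x - u x)
          + ennreal h * sob_norm 1 p (elset K) (\<lambda>x. IX h u x - u x)
        \<le> ennreal (C * h ^ (k + 1)) * sob_norm (k + 1) p (patch G (mesh (F h)) K) u)) \<and>
     (\<forall>k p. k \<le> r - 1 \<and> 1 \<le> p \<longrightarrow> (\<exists>C>0. \<forall>h\<in>H. \<forall>K\<in>mesh (F h). \<forall>q\<in>Q_space G.
        Lp_norm p (lebesgue_on (elset K)) (\<lambda>x. IQ h q x - q x)
        \<le> ennreal (C * h ^ (k + 1)) * sob_norm (k + 1) p (patch G (mesh (F h)) K) q)) \<and>
     (\<forall>k. k \<le> r \<longrightarrow> (\<exists>C>0. \<forall>h\<in>H. \<forall>w\<in>S_space G.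
        ennreal (l2_norm (wall G) (\<lambda>x. IS h w x - w x))
          + ennreal h * HsS_norm G 1 (\<lambda>x. IS h w x - w x)
        \<le> ennreal (C * h ^ (k + 1)) * broken_surf_norm G (mesh (F h)) (k + 1) w)))"

definition A4 :: "('d::finite) cell \<Rightarrow> real set \<Rightarrow> (real \<Rightarrow> 'd fe) \<Rightarrow> bool" where
  "A4 G H F \<longleftrightarrow> (\<exists>C>0. \<forall>h\<in>H. \<forall>q\<in>Q0F G (F h).
     ennreal (l2_norm (bulk G) q) \<le> ennreal C *
       (SUP v\<in>{v \<in> X0F G (F h). \<not> (AE x in bulk G. v x = 0)}.
          ennreal (l2_inner (bulk G) (dvg G v) q / enn2real (sob_norm 1 2 (dom G) v))))"

definition quasi_uniform :: "('d::finite) cell \<Rightarrow> real set \<Rightarrow> (real \<Rightarrow> 'd fe) \<Rightarrow> bool" where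
  "quasi_uniform G H F \<longleftrightarrow> (\<exists>c>0. \<forall>h\<in>H. mesh_partition G c h (mesh (F h)))"


section \<open>The scheme and its energies\<close>

text \<open>\<open>\<mu>\<close>, \<open>\<rho>\<^sub>f\<close>, \<open>\<rho>\<^sub>s\<close>, \<open>\<epsilon>\<^sub>s\<close>, the time step \<open>\<tau>\<close> and the stabilisation parameter \<open>\<beta>\<close>.\<close>

record param =
  visc :: real
  rhof :: real
  rhos :: real
  epss :: real
  step :: real
  stab :: real

definition beta0 :: "real \<Rightarrow> real" where
  "beta0 \<beta> = 1 - (sqrt (4 + \<beta>\<^sup>2) - \<beta>) / 2"

text \<open>In both steps \<open>u'\<close>, \<open>p'\<close>, \<open>\<eta>'\<close> stand for the solution at the previous time level.\<close>

definition step1 ::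
  "('d::finite) cell \<Rightarrow> param \<Rightarrow> 'd surface_op \<Rightarrow> 'd fe \<Rightarrow>
   (real^'d \<Rightarrow> real^'d) \<Rightarrow> (real^'d \<Rightarrow> real) \<Rightarrow> (real^'d \<Rightarrow> real^'d) \<Rightarrow> (real^'d \<Rightarrow> real^'d) \<Rightarrow> bool" where
  "step1 G P Ls V u' p' \<eta>' s \<longleftrightarrow> s \<in> SF V \<and> (\<forall>w\<in>SF V.
     rhos P * epss P * l2_inner (wall G) (\<lambda>x. (s x - tr G u' x) /\<^sub>R step P) w
       + a_s Ls (\<lambda>x. \<eta>' x + step P *\<^sub>R s x) w
     = - l2_inner (wall G) (traction G (mesh V) (visc P) u' p') w)"

definition step2 ::
  "('d::finite) cell \<Rightarrow> param \<Rightarrow> 'd fe \<Rightarrow> (real^'d \<Rightarrow> real^'d) \<Rightarrow> (real^'d \<Rightarrow> real) \<Rightarrow>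
   (real^'d \<Rightarrow> real^'d) \<Rightarrow> (real^'d \<Rightarrow> real^'d) \<Rightarrow> (real^'d \<Rightarrow> real) \<Rightarrow> bool" where
  "step2 G P V u' p' s u p \<longleftrightarrow> u \<in> XF V \<and> p \<in> QF V \<and> (\<forall>v\<in>XF V. \<forall>q\<in>QF V.
     (let \<sigma>n = traction G (mesh V) (visc P); \<kappa> = rhos P * epss P; \<tau> = step P in
      rhof P * l2_inner (bulk G) (\<lambda>x. (u x - u' x) /\<^sub>R \<tau>) v + a_f G (visc P) u v
        - b_form G p v + b_form G q u - l2_inner (wall G) (\<sigma>n u p) (tr G v)
        + \<kappa> * l2_inner (wall G) (\<lambda>x. (tr G u x - s x) /\<^sub>R \<tau>)
                 (\<lambda>x. tr G v x + (\<tau> / \<kappa>) *\<^sub>R \<sigma>n v q x)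
        + l2_inner (wall G) (\<lambda>x. \<sigma>n u p x - \<sigma>n u' p' x)
                 (\<lambda>x. tr G v x + (\<tau> * (1 + stab P) / \<kappa>) *\<^sub>R \<sigma>n v q x)
      = 0))"

definition scheme ::
  "('d::finite) cell \<Rightarrow> param \<Rightarrow> 'd surface_op \<Rightarrow> 'd fe \<Rightarrow> nat \<Rightarrow>
   (nat \<Rightarrow> real^'d \<Rightarrow> real^'d) \<Rightarrow> (nat \<Rightarrow> real^'d \<Rightarrow> real) \<Rightarrow>
   (nat \<Rightarrow> real^'d \<Rightarrow> real^'d) \<Rightarrow> (nat \<Rightarrow> real^'d \<Rightarrow> real^'d) \<Rightarrow> bool" where
  "scheme G P Ls V N u p \<eta> s \<longleftrightarrow> (\<forall>n\<in>{1..N}.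
     step1 G P Ls V (u (n - 1)) (p (n - 1)) (\<eta> (n - 1)) (s n) \<and>
     \<eta> n = (\<lambda>x. \<eta> (n - 1) x + step P *\<^sub>R s n x) \<and>
     step2 G P V (u (n - 1)) (p (n - 1)) (s n) (u n) (p n))"

definition E0 ::
  "('d::finite) cell \<Rightarrow> param \<Rightarrow> 'd surface_op \<Rightarrow> 'd fe \<Rightarrow>
   (real^'d \<Rightarrow> real^'d) \<Rightarrow> (real^'d \<Rightarrow> real) \<Rightarrow> (real^'d \<Rightarrow> real^'d) \<Rightarrow> real" where
  "E0 G P Ls V u p \<eta> =
     rhof P / 2 * (l2_norm (bulk G) u)\<^sup>2 + 1/2 * (norm_s Ls \<eta>)\<^sup>2
     + (step P)\<^sup>2 * (1 + stab P) / (2 * rhos P * epss P)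
         * (l2_norm (wall G) (traction G (mesh V) (visc P) u p))\<^sup>2
     + rhos P * epss P / 2 * (l2_norm (wall G) (tr G u))\<^sup>2"

text \<open>\<open>u'\<close>, \<open>p'\<close>, \<open>\<eta>'\<close> are again the values at the previous time level, on which \<open>E\<^sub>1\<close> depends.\<close>

definition E1 ::
  "('d::finite) cell \<Rightarrow> param \<Rightarrow> 'd surface_op \<Rightarrow> 'd fe \<Rightarrow>
   (real^'d \<Rightarrow> real^'d) \<Rightarrow> (real^'d \<Rightarrow> real) \<Rightarrow> (real^'d \<Rightarrow> real^'d) \<Rightarrow>
   (real^'d \<Rightarrow> real^'d) \<Rightarrow> (real^'d \<Rightarrow> real^'d) \<Rightarrow> (real^'d \<Rightarrow> real) \<Rightarrow> (real^'d \<Rightarrow> real^'d) \<Rightarrow> real" where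
  "E1 G P Ls V u' p' \<eta>' s u p \<eta> =
     (let \<sigma>n = traction G (mesh V) (visc P); \<kappa> = rhos P * epss P; \<tau> = step P in
      2 * visc P * (norm_f G u)\<^sup>2
      + rhof P / (2 * \<tau>) * (l2_norm (bulk G) (\<lambda>x. u x - u' x))\<^sup>2
      + \<kappa> / (2 * \<tau>) * (l2_norm (wall G) (\<lambda>x. s x - tr G u' x))\<^sup>2
      + \<kappa> * beta0 (stab P) / (2 * \<tau>) * (l2_norm (wall G) (\<lambda>x. s x - tr G u x))\<^sup>2
      + \<tau> * beta0 (stab P) / (2 * \<kappa>) * (l2_norm (wall G) (\<lambda>x. \<sigma>n u p x - \<sigma>n u' p' x))\<^sup>2
      + \<tau> / 2 * (norm_s Ls (\<lambda>x. (\<eta> x - \<eta>' x) /\<^sub>R \<tau>))\<^sup>2)"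

end

theory Submission imports Defs "HOL-Computational_Algebra.Polynomial" begin

text \<open>
  Each step is a square linear system on a finite-dimensional space, so solvability follows from
  uniqueness. Testing Step 1 with \<open>s\<close> and Step 2 with \<open>(u, p)\<close> and adding gives the energy balance up to
  the quadratic form \<open>X\<^sup>2/2 - X Y + (1 + \<beta>) Y\<^sup>2/2\<close> in \<open>X = s - u\<close> and \<open>Y\<close>, the scaled increment of the
  traction; its smallest eigenvalue is \<open>\<beta>\<^sub>0/2\<close>. The homogeneous Step 2 forces \<open>u = 0\<close> and a vanishing
  traction. Since fields with zero trace have divergence of mean zero (a Hardy estimate in thin strips
  along \<open>\<Sigma>\<close>), the inf-sup condition makes \<open>p\<close> constant, and the traction \<open>- p n\<close> vanishes only for \<open>p = 0\<close>.
  Tractions exist because the inverse inequalities make the stress Lipschitz on each element.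
\<close>

text \<open>All spaces consist of genuine functions taken modulo null sets, and
  \<open>weak_deriv\<close>, \<open>tr\<close>, \<open>bdry_value\<close> and
  \<open>bdry_elem\<close> are choices. Hence every form of the scheme has to be shown linear and
  insensitive to null sets before finite-dimensional algebra applies. For \<open>tr\<close> this is
  uniqueness of traces; for \<open>a_s\<close> it comes from the norm equivalence together with
  nonnegativity; for tractions it needs the boundary limits to exist.

  A trace is only a limit of restrictions of smooth periodic functions, so uniqueness of traces and
  the divergence theorem are both obtained by integrating along the chart direction below the wall.
  A cut-off at distance \<open>ep\<close> costs a factor \<open>1 / ep\<close>, while the integral
  of a zero-trace function over a strip of width of order \<open>ep\<close> is at most
  \<open>ep\<close> times a gradient mass that tends to zero; the boundary term disappears in the
  limit. Shifts across the disks are harmless because \<Omega> is a fundamental domain.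

  Subtracting \<open>beta0\<close> from both diagonal entries makes the quadratic form in
  \<open>X\<close> and \<open>Y\<close> degenerate, that is, a multiple of a perfect square. This is
  why the dissipation carries exactly this constant.\<close>

notation LIMSEQ (infixr "---->" 60)

notation scaleR (infixr "*R" 75)

lemmas bm_contI = borel_measurable_continuous_onI

abbreviation NI :: "('a::euclidean_space => ennreal) => ennreal" where
 "NI \<equiv> nn_integral lborel"

section \<open>Hausdorff measure\<close>

lemma hausdorff_pre_le:
 fixes A :: "'a::metric_space set"
 assumes "A \<subseteq> (\<Union>i::nat. U i)" "!!i. bounded (U i)" "!!i. diameter (U i) <= de"
 shows "hausdorff_pre s de A <= (\<Sum>i. ennreal (unit_ball_vol s * (diameter (U i) / 2) powr s))"
 unfolding hausdorff_pre_def using assms by (intro INF_lower) auto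

lemma hausdorff_pre_less:
 fixes A :: "'a::metric_space set"
 assumes "hausdorff_pre s de A < x"
 shows "EX U :: nat => 'a set. A \<subseteq> (\<Union>i. U i) & (ALL i. bounded (U i) & diameter (U i) <= de) &
 (\<Sum>i. ennreal (unit_ball_vol s * (diameter (U i) / 2) powr s)) < x"
 using assms unfolding hausdorff_pre_def INF_less_iff by auto

lemma hausdorff_pre_mono: "A \<subseteq> B ==> hausdorff_pre s de A <= hausdorff_pre s de B"
 unfolding hausdorff_pre_def by (intro INF_superset_mono) auto

lemma hausdorff_pre_antimono: "de <= de' ==> hausdorff_pre s de' A <= hausdorff_pre s de A"
 unfolding hausdorff_pre_def by (intro INF_superset_mono) (auto intro: order_trans)

lemma hausdorff_pre_empty: "0 <= de ==> hausdorff_pre s de {} = 0"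
 using hausdorff_pre_le[of "{}" "%_. {}" de s] by simp

text \<open>Near-optimal covers of the \<open>A n\<close>, with excess \<open>e / 2^(n+1)\<close>,
  are merged into one sequence through \<open>prod_decode\<close>; the excesses sum to
  \<open>e\<close>.\<close>

lemma hausdorff_pre_UN:
 fixes A :: "nat => 'a::metric_space set"
 shows "hausdorff_pre s de (\<Union>n. A n) <= (\<Sum>n. hausdorff_pre s de (A n))"
proof (rule ennreal_le_epsilon)
 fix e :: real assume fin: "(\<Sum>n. hausdorff_pre s de (A n)) < top" and e: "0 < e"
 have "EX U :: nat => 'a set. A n \<subseteq> (\<Union>i. U i) & (ALL i. bounded (U i) & diameter (U i) <= de) &
 (\<Sum>i. ennreal (unit_ball_vol s * (diameter (U i) / 2) powr s)) <= hausdorff_pre s de (A n) + ennreal (e * (1/2)^Suc n)" for n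
 proof -
 have "hausdorff_pre s de (A n) ~= top"
 using ennreal_suminf_lessD[OF fin, of n] by simp
 hence "hausdorff_pre s de (A n) < hausdorff_pre s de (A n) + ennreal (e * (1/2)^Suc n)"
 using e by (cases "hausdorff_pre s de (A n)")
 (auto simp: ennreal_plus[symmetric] ennreal_less_iff simp del: ennreal_plus)
 from hausdorff_pre_less[OF this] show ?thesis
 by (elim exE conjE, intro exI conjI) (assumption, assumption, erule less_imp_le)
 qed
 hence "ALL n. EX U :: nat => 'a set. A n \<subseteq> (\<Union>i. U i) & (ALL i. bounded (U i) & diameter (U i) <= de) &
 (\<Sum>i. ennreal (unit_ball_vol s * (diameter (U i) / 2) powr s)) <= hausdorff_pre s de (A n) + ennreal (e * (1/2)^Suc n)"
 by blast
 from choice[OF this] obtain U :: "nat => nat => 'a set" where "ALL n. A n \<subseteq> (\<Union>i. U n i) &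
 (ALL i. bounded (U n i) & diameter (U n i) <= de) &
 (\<Sum>i. ennreal (unit_ball_vol s * (diameter (U n i) / 2) powr s)) <= hausdorff_pre s de (A n) + ennreal (e * (1/2)^Suc n)"
 by (elim exE)
 hence U: "!!n. A n \<subseteq> (\<Union>i. U n i)" "!!n i. bounded (U n i)" "!!n i. diameter (U n i) <= de"
 "!!n. (\<Sum>i. ennreal (unit_ball_vol s * (diameter (U n i) / 2) powr s)) <= hausdorff_pre s de (A n) + ennreal (e * (1/2)^Suc n)"
 by blast+
 define V where "V k = (case prod_decode k of (n, i) => U n i)" for k
 have "(\<Union>n. A n) \<subseteq> (\<Union>k. V k)"
 proof
 fix x assume "x : (\<Union>n. A n)"
 then obtain n i where "x : U n i" using U(1) by blast
 hence "x : V (prod_encode (n, i))" by (simp add: V_def)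
 thus "x : (\<Union>k. V k)" by blast
 qed
 hence "hausdorff_pre s de (\<Union>n. A n) <= (\<Sum>k. ennreal (unit_ball_vol s * (diameter (V k) / 2) powr s))"
 by (intro hausdorff_pre_le) (auto simp: V_def U split: prod.split)
 also have "... = (\<Sum>n. \<Sum>i. ennreal (unit_ball_vol s * (diameter (U n i) / 2) powr s))"
 using suminf_ennreal_2dimen[of "%n. \<Sum>i. ennreal (unit_ball_vol s * (diameter (U n i) / 2) powr s)"
 "%p. ennreal (unit_ball_vol s * (diameter (U (fst p) (snd p)) / 2) powr s)"]
 by (simp add: V_def o_def case_prod_beta)
 also have "... <= (\<Sum>n. hausdorff_pre s de (A n) + ennreal (e * (1/2)^Suc n))"
 using U(4) by (intro suminf_le) auto
 also have "... = (\<Sum>n. hausdorff_pre s de (A n)) + (\<Sum>n. ennreal (e * (1/2)^Suc n))"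
 by (intro suminf_add[symmetric]) auto
 also have "(\<Sum>n. ennreal (e * (1/2)^Suc n)) = ennreal e"
 using e sums_mult[OF power_half_series, of e] by (intro suminf_ennreal_eq) auto
 finally show "hausdorff_pre s de (\<Union>n. A n) <= (\<Sum>n. hausdorff_pre s de (A n)) + ennreal e" .
qed

lemma hausdorff_pre_le_outer: "0 < de ==> hausdorff_pre s de A <= hausdorff_outer s A"
 unfolding hausdorff_outer_def by (intro SUP_upper) auto

lemma hausdorff_outer_mono: "A \<subseteq> B ==> hausdorff_outer s A <= hausdorff_outer s B"
 unfolding hausdorff_outer_def by (intro SUP_mono) (auto intro: hausdorff_pre_mono)

lemma hausdorff_outer_UN: "hausdorff_outer s (\<Union>n::nat. A n) <= (\<Sum>n. hausdorff_outer s (A n))"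
 unfolding hausdorff_outer_def[of _ "\<Union>n. A n"]
proof (intro SUP_least)
 fix de :: real assume "de : {0<..}"
 thus "hausdorff_pre s de (\<Union>n. A n) <= (\<Sum>n. hausdorff_outer s (A n))"
 by (intro order_trans[OF hausdorff_pre_UN] suminf_le hausdorff_pre_le_outer) auto
qed

lemma hausdorff_outer_empty [simp]: "hausdorff_outer s {} = 0"
proof -
 have "hausdorff_outer s {} <= 0"
 unfolding hausdorff_outer_def by (intro SUP_least) (simp add: hausdorff_pre_empty)
 thus ?thesis by simp
qed

lemma outer_measure_space_hausdorff:
 "outer_measure_space (Pow (UNIV :: 'a::metric_space set)) (hausdorff_outer s)"
 unfolding outer_measure_space_def positive_def increasing_def countably_subadditive_def
 by (simp add: hausdorff_outer_mono hausdorff_outer_UN)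

lemma hausdorff_outer_Un_le: "hausdorff_outer s (A \<union> B) <= hausdorff_outer s A + hausdorff_outer s B"
proof -
 have "hausdorff_outer s (\<Union>n::nat. binaryset A B n) <= (\<Sum>n. hausdorff_outer s (binaryset A B n))"
 by (rule hausdorff_outer_UN)
 also have "... = hausdorff_outer s A + hausdorff_outer s B"
 by (rule suminf_binaryset_eq) simp
 finally show ?thesis by (simp add: UN_binaryset_eq)
qed

text \<open>A set of diameter at most \<open>de < ep\<close> cannot meet both \<open>A\<close> and
  \<open>B\<close>, so every cover of the union splits into a cover of \<open>A\<close> and one of
  \<open>B\<close> without shared members.\<close>

lemma hausdorff_pre_separated:
 fixes A B :: "'a::metric_space set"
 assumes sep: "!!x y. x : A ==> y : B ==> ep <= dist x y" and de: "0 <= de" "de < ep"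
 shows "hausdorff_pre s de A + hausdorff_pre s de B <= hausdorff_pre s de (A \<union> B)"
 unfolding hausdorff_pre_def[of _ _ "A \<union> B"]
proof (intro INF_greatest, clarify)
 fix U :: "nat => 'a set"
 assume U: "A \<union> B \<subseteq> (\<Union>i. U i)" "ALL i. bounded (U i) & diameter (U i) <= de"
 define V where "V i = (if U i \<inter> A = {} then {} else U i)" for i
 define W where "W i = (if U i \<inter> A = {} then U i else {})" for i
 have disj: "U i \<inter> A = {} \<or> U i \<inter> B = {}" for i
 proof (rule ccontr)
 assume "\<not> ?thesis"
 then obtain x y where xy: "x : U i" "x : A" "y : U i" "y : B" by auto
 hence "dist x y <= diameter (U i)" by (intro diameter_bounded_bound) (use U in auto)
 hence "dist x y <= de" using U(2) order_trans by blast
 thus False using sep[OF xy(2,4)] de by auto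
 qed
 have "hausdorff_pre s de A <= (\<Sum>i. ennreal (unit_ball_vol s * (diameter (V i) / 2) powr s))"
 proof (intro hausdorff_pre_le)
 show "A \<subseteq> (\<Union>i. V i)"
 proof
 fix y assume y: "y : A"
 then obtain i where i: "y : U i" using U(1) by blast
 hence "y : V i" using y by (auto simp: V_def)
 thus "y : (\<Union>i. V i)" by blast
 qed
 qed (use U de in \<open>auto simp: V_def\<close>)
 moreover have "hausdorff_pre s de B <= (\<Sum>i. ennreal (unit_ball_vol s * (diameter (W i) / 2) powr s))"
 proof (intro hausdorff_pre_le)
 show "B \<subseteq> (\<Union>i. W i)"
 proof
 fix y assume y: "y : B"
 then obtain i where i: "y : U i" using U(1) by blast
 hence "U i \<inter> A = {}" using disj[of i] y by blast
 hence "y : W i" using i by (simp add: W_def)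
 thus "y : (\<Union>i. W i)" by blast
 qed
 qed (use U de in \<open>auto simp: W_def\<close>)
 ultimately have "hausdorff_pre s de A + hausdorff_pre s de B <=
 (\<Sum>i. ennreal (unit_ball_vol s * (diameter (V i) / 2) powr s)) + (\<Sum>i. ennreal (unit_ball_vol s * (diameter (W i) / 2) powr s))"
 by (rule add_mono)
 also have "... = (\<Sum>i. ennreal (unit_ball_vol s * (diameter (V i) / 2) powr s) + ennreal (unit_ball_vol s * (diameter (W i) / 2) powr s))"
 by (rule suminf_add) auto
 \<comment> \<open>Discarded members became the empty set, which contributes nothing:
   \<open>diameter {} = 0\<close> and \<open>0 powr s = 0\<close>.\<close>
 also have "... = (\<Sum>i. ennreal (unit_ball_vol s * (diameter (U i) / 2) powr s))"
 by (intro suminf_cong) (auto simp: V_def W_def)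
 finally show "hausdorff_pre s de A + hausdorff_pre s de B <= (\<Sum>i. ennreal (unit_ball_vol s * (diameter (U i) / 2) powr s))" .
qed

text \<open>The two suprema run over independent scales; since premeasures grow as the scale
  shrinks, both may be evaluated at one scale below \<open>ep\<close>, where covers split.\<close>

lemma hausdorff_outer_separated:
 fixes A B :: "'a::metric_space set"
 assumes sep: "!!x y. x : A ==> y : B ==> ep <= dist x y" and ep: "0 < ep"
 shows "hausdorff_outer s A + hausdorff_outer s B <= hausdorff_outer s (A \<union> B)"
proof -
 have le: "hausdorff_pre s de1 A + hausdorff_pre s de2 B <= hausdorff_outer s (A \<union> B)" if "0 < de1" "0 < de2" for de1 de2
 proof -
 define de where "de = min (min de1 de2) (ep / 2)"
 have de: "0 < de" "de < ep" "de <= de1" "de <= de2" using that ep by (auto simp: de_def)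
 have "hausdorff_pre s de1 A + hausdorff_pre s de2 B <= hausdorff_pre s de A + hausdorff_pre s de B"
 using de by (intro add_mono hausdorff_pre_antimono)
 also have "... <= hausdorff_pre s de (A \<union> B)"
 using sep de by (intro hausdorff_pre_separated) auto
 also have "... <= hausdorff_outer s (A \<union> B)" using de by (intro hausdorff_pre_le_outer)
 finally show ?thesis .
 qed
 have "hausdorff_outer s A + hausdorff_pre s de2 B <= hausdorff_outer s (A \<union> B)" if "0 < de2" for de2
 unfolding hausdorff_outer_def[of _ A]
 using le that by (subst ennreal_SUP_add_left[symmetric]) (auto intro!: SUP_least)
 thus ?thesis
 unfolding hausdorff_outer_def[of _ B]
 by (subst ennreal_SUP_add_right) (auto intro!: SUP_least)
qed

lemma hausdorff_outer_separated_sum: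
 fixes R :: "nat => 'a::metric_space set"
 assumes "!!j k. j < k ==> EX ep>0. ALL x:R j. ALL y:R k. ep <= dist x y"
 shows "(\<Sum>k<n. hausdorff_outer s (R k)) <= hausdorff_outer s (\<Union>k<n. R k)"
proof (induction n)
 case (Suc n)
 have "ALL j. EX ep. j < n --> ep > 0 & (ALL x:R j. ALL y:R n. ep <= dist x y)"
 using assms by blast
 from choice[OF this] obtain e :: "nat => real"
 where e: "!!j. j < n ==> e j > 0" "!!j x y. j < n ==> x : R j ==> y : R n ==> e j <= dist x y"
 by blast
 define ep where "ep = Min (insert 1 (e ` {..<n}))"
 have "hausdorff_outer s (\<Union>k<n. R k) + hausdorff_outer s (R n) <= hausdorff_outer s ((\<Union>k<n. R k) \<union> R n)"
 proof (rule hausdorff_outer_separated)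
 show "0 < ep" using e by (auto simp: ep_def)
 show "ep <= dist x y" if xy: "x : (\<Union>k<n. R k)" "y : R n" for x y
 proof -
 obtain j where "j < n" "x : R j" using xy(1) by blast
 hence "ep <= e j" by (auto simp: ep_def)
 thus ?thesis using e(2)[OF \<open>j < n\<close> \<open>x : R j\<close> that(2)] by simp
 qed
 qed
 moreover have "(\<Union>k<n. R k) \<union> R n = (\<Union>k<Suc n. R k)" by (auto simp: lessThan_Suc)
 ultimately show ?case using Suc by (auto intro: order_trans add_mono)
qed simp

text \<open>Caratheodory's criterion for the metric outer measure: the shells around a closed set
  at even (odd) places are mutually separated, so the shells accumulating at it carry no mass.\<close>

lemma hausdorff_outer_closed:
 fixes C E :: "'a::metric_space set"
 assumes C: "closed C"
 shows "hausdorff_outer s (E \<inter> C) + hausdorff_outer s (E - C) <= hausdorff_outer s E"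
proof (cases "C = {} \<or> hausdorff_outer s E = top")
 case True thus ?thesis by auto
next
 case False
 let ?m = "hausdorff_outer s"
 let ?d = "%x. infdist x C"
 have Cne: "C ~= {}" and fin: "?m E < top" using False by (auto simp: less_top)
 define S where "S n = {x : E. ?d x >= 1 / real (Suc n)}" for n
 define R where "R n = {x : E. ?d x >= 1 / real (Suc (Suc n)) & ?d x < 1 / real (Suc n)}" for n
 have d_lip: "\<bar>?d x - ?d y\<bar> <= dist x y" for x y
 by (rule infdist_triangle_abs)
 \<comment> \<open>\<open>infdist\<close> is 1-Lipschitz, and a shell in between keeps its values on
   \<open>R j\<close> and \<open>R k\<close> apart. Neighbouring shells may touch, hence
   \<open>Suc j < k\<close>.\<close>
 have sepR: "EX ep>0. ALL x:R j. ALL y:R k. ep <= dist x y" if "Suc j < k" for j k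
 proof (intro exI[of _ "1 / real (Suc (Suc j)) - 1 / real (Suc k)"] conjI ballI)
 have "1 / real (Suc k) < 1 / real (Suc (Suc j))" using that by (intro frac_less2) auto
 thus "0 < 1 / real (Suc (Suc j)) - 1 / real (Suc k)" by simp
 show "1 / real (Suc (Suc j)) - 1 / real (Suc k) <= dist x y" if "x : R j" "y : R k" for x y
 using that d_lip[of x y] by (auto simp: R_def)
 qed
 have bound: "(\<Sum>k<n. ?m (R (2 * k + b))) <= ?m E" for n b
 proof -
 have "(\<Sum>k<n. ?m (R (2 * k + b))) <= ?m (\<Union>k<n. R (2 * k + b))"
 by (rule hausdorff_outer_separated_sum) (use sepR in force)
 also have "... <= ?m E" by (rule hausdorff_outer_mono) (auto simp: R_def)
 finally show ?thesis .
 qed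
 define r where "r k = enn2real (?m (R k))" for k
 define M where "M = enn2real (?m E)"
 have mR: "?m (R k) = ennreal (r k)" for k
 proof -
 have "?m (R k) <= ?m E" by (rule hausdorff_outer_mono) (auto simp: R_def)
 thus ?thesis using fin unfolding r_def by (metis ennreal_enn2real le_less_trans)
 qed
 have mE: "?m E = ennreal M" using fin by (simp add: M_def)
 have r0: "0 <= r k" for k by (simp add: r_def)
 have bound': "(\<Sum>k<n. r (2 * k + b)) <= M" for n b
 proof -
 have "ennreal (\<Sum>k<n. r (2 * k + b)) <= ennreal M"
 using bound[of b n] by (simp add: mR mE r0 sum_ennreal)
 thus ?thesis by (simp add: M_def)
 qed
 have "(\<Sum>k<2 * n. r k) = (\<Sum>k<n. r (2 * k + 0)) + (\<Sum>k<n. r (2 * k + 1))" for n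
 by (induction n) auto
 hence b2: "(\<Sum>k<2 * n. r k) <= 2 * M" for n using bound'[of 0 n] bound'[of 1 n] by simp
 have "(\<Sum>k<n. r k) <= 2 * M" for n
 using sum_mono2[of "{..<2 * n}" "{..<n}" r] r0 b2[of n] by (simp add: order_trans)
 hence sm: "summable r" using r0 by (intro summableI_nonneg_bounded) auto
 \<comment> \<open>\<open>E - C\<close> consists of \<open>S n\<close>, which keeps the distance
   \<open>1 / (n + 1)\<close> from \<open>C\<close>, and of the shells from \<open>n\<close> on,
   whose total mass is the tail of a convergent series.\<close>
 have main: "?m (E \<inter> C) + ?m (E - C) <= ?m E + ennreal (\<Sum>k. r (k + n))" for n
 proof -
 have "E - C \<subseteq> S n \<union> (\<Union>k. R (k + n))"
 proof
 fix x assume x: "x : E - C"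
 hence pos: "?d x > 0" using C Cne by (simp add: infdist_pos_not_in_closed)
 show "x : S n \<union> (\<Union>k. R (k + n))"
 proof (cases "?d x >= 1 / real (Suc n)")
 case True thus ?thesis using x by (auto simp: S_def)
 next
 case False
 obtain N where N: "1 / real (Suc N) < ?d x" using nat_approx_posE[OF pos] .
 define L where "L = (LEAST m. 1 / real (Suc m) <= ?d x)"
 have L1: "1 / real (Suc L) <= ?d x" unfolding L_def by (rule LeastI[of _ N]) (use N in auto)
 have "n < L"
 proof (rule ccontr)
 assume "\<not> n < L"
 hence "1 / real (Suc n) <= 1 / real (Suc L)" by (auto simp: field_simps)
 with L1 False show False by linarith
 qed
 then obtain k where k: "L = Suc (k + n)" by (metis add.commute less_iff_Suc_add)
 have "\<not> 1 / real (Suc (k + n)) <= ?d x" using not_less_Least[of "k + n" "%m. 1 / real (Suc m) <= ?d x"] k L_def by auto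
 hence "x : R (k + n)" using x L1 k by (auto simp: R_def)
 thus ?thesis by blast
 qed
 qed
 hence "?m (E - C) <= ?m (S n \<union> (\<Union>k. R (k + n)))" by (rule hausdorff_outer_mono)
 also have "... <= ?m (S n) + ?m (\<Union>k. R (k + n))" by (rule hausdorff_outer_Un_le)
 also have "?m (\<Union>k. R (k + n)) <= (\<Sum>k. ?m (R (k + n)))" by (rule hausdorff_outer_UN)
 also have "... = ennreal (\<Sum>k. r (k + n))"
 using sm r0 by (simp add: mR suminf_ennreal2 summable_ignore_initial_segment)
 finally have 1: "?m (E - C) <= ?m (S n) + ennreal (\<Sum>k. r (k + n))" by (simp add: add_left_mono)
 have "?m (E \<inter> C) + ?m (S n) <= ?m ((E \<inter> C) \<union> S n)"
 proof (rule hausdorff_outer_separated)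
 show "0 < 1 / real (Suc n)" by simp
 show "1 / real (Suc n) <= dist x y" if "x : E \<inter> C" "y : S n" for x y
 using that infdist_le[of x C y] by (auto simp: S_def dist_commute)
 qed
 also have "... <= ?m E" by (rule hausdorff_outer_mono) (auto simp: S_def)
 finally have 2: "?m (E \<inter> C) + ?m (S n) <= ?m E" .
 have "?m (E \<inter> C) + ?m (E - C) <= ?m (E \<inter> C) + (?m (S n) + ennreal (\<Sum>k. r (k + n)))"
 using 1 by (rule add_left_mono)
 also have "... <= ?m E + ennreal (\<Sum>k. r (k + n))"
 using 2 by (simp add: add.assoc[symmetric] add_right_mono)
 finally show ?thesis .
 qed
 have "(%n. \<Sum>k. r (k + n)) ----> 0"
 proof -
 have "(%n. suminf r - (\<Sum>k<n. r k)) ----> suminf r - suminf r"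
 using sm by (intro tendsto_intros summable_LIMSEQ)
 thus ?thesis by (simp add: suminf_minus_initial_segment[OF sm])
 qed
 hence "(%n. ?m E + ennreal (\<Sum>k. r (k + n))) ----> ?m E + ennreal 0"
 by (intro tendsto_intros)
 thus ?thesis using main by (intro LIMSEQ_le_const[of _ "?m E"]) auto
qed

text \<open>\<open>measure_of\<close> yields the zero measure unless its set function is a measure
  on the generated sigma-algebra, so this fact gives \<open>hausdorff_measure\<close> its content.
  Closed sets satisfy Caratheodory's criterion, and the sets that do form a sigma-algebra.\<close>

lemma measure_space_hausdorff:
 "measure_space UNIV (sets (borel :: 'a::metric_space measure)) (hausdorff_outer s)"
proof -
 let ?L = "lambda_system UNIV (Pow UNIV) (hausdorff_outer s :: 'a set => ennreal)"
 interpret P: sigma_algebra "UNIV :: 'a set" "Pow UNIV" by (rule sigma_algebra_Pow)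
 have ms: "measure_space UNIV ?L (hausdorff_outer s)"
 using P.caratheodory_lemma[OF outer_measure_space_hausdorff] .
 hence "sigma_algebra UNIV ?L" unfolding measure_space_def by blast
 then interpret L: sigma_algebra UNIV ?L .
 have "C : ?L" if "closed C" for C :: "'a set"
 proof -
 have "hausdorff_outer s (x \<inter> C) + hausdorff_outer s (x - C) = hausdorff_outer s x" for x
 proof (rule antisym[OF hausdorff_outer_closed[OF that]])
 have "(x \<inter> C) \<union> (x - C) = x" by auto
 thus "hausdorff_outer s x <= hausdorff_outer s (x \<inter> C) + hausdorff_outer s (x - C)"
 using hausdorff_outer_Un_le[of s "x \<inter> C" "x - C"] by simp
 qed
 thus ?thesis unfolding P.lambda_system_eq by blast
 qed
 hence "sigma_sets UNIV (Collect closed) \<subseteq> ?L"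
 by (intro L.sigma_sets_subset) auto
 hence sub: "sets (borel :: 'a measure) \<subseteq> ?L" by (simp add: borel_eq_closed)
 have "countably_additive (sets borel) (hausdorff_outer s :: 'a set => ennreal)"
 unfolding countably_additive_def
 proof (intro allI impI)
 fix A :: "nat => 'a set"
 assume A: "range A \<subseteq> sets borel" "disjoint_family A" "\<Union> (range A) \<in> sets borel"
 have "range A \<subseteq> ?L" using A(1) sub by (rule subset_trans)
 moreover have "\<Union> (range A) \<in> ?L" using A(3) sub by (rule subsetD[rotated])
 moreover have "countably_additive ?L (hausdorff_outer s)" using ms unfolding measure_space_def by blast
 ultimately show "(\<Sum>i. hausdorff_outer s (A i)) = hausdorff_outer s (\<Union> (range A))"
 using A(2) unfolding countably_additive_def by blast
 qed
 thus ?thesis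
 using sets.sigma_algebra_axioms[of "borel :: 'a measure"]
 by (simp add: measure_space_def positive_def)
qed

lemma sets_hausdorff_measure [simp, measurable_cong]: "sets (hausdorff_measure s :: 'a::metric_space measure) = sets borel"
 unfolding hausdorff_measure_def using sets.sigma_sets_eq[of "borel :: 'a measure"] by (simp add: sets_measure_of_conv)

lemma space_hausdorff_measure [simp]: "space (hausdorff_measure s) = UNIV"
 unfolding hausdorff_measure_def by (simp add: space_measure_of_conv)

lemma emeasure_hausdorff_measure:
 fixes A :: "'a::metric_space set"
 assumes "A : sets borel"
 shows "emeasure (hausdorff_measure s) A = hausdorff_outer s A"
 using measure_space_hausdorff[where 'a='a] assms sets.sigma_sets_eq[of "borel :: 'a measure"]
 unfolding hausdorff_measure_def by (subst emeasure_measure_of_conv) auto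

section \<open>The surface measure and its null sets\<close>

lemma space_surf [simp]: "space (surf Ga) = Ga"
 by (simp add: surf_def space_restrict_space)

lemma borel_measurable_surf:
 fixes Ga :: "(real^'d::finite) set"
 assumes "f : borel_measurable (restrict_space borel Ga)"
 shows "f : borel_measurable (surf Ga)"
proof -
 have "sets (restrict_space (hausdorff_measure (real CARD('d) - 1)) Ga) = sets (restrict_space borel Ga)"
 by (intro sets_restrict_space_cong) simp
 hence "f : borel_measurable (restrict_space (hausdorff_measure (real CARD('d) - 1)) Ga)"
 using assms by (simp cong: measurable_cong_sets)
 thus ?thesis unfolding surf_def by (rule measurable_completion)
qed

lemma emeasure_surf:
 fixes Ga :: "(real^'d::finite) set"
 assumes "Ga : sets borel"
 shows "emeasure (surf Ga) Ga = hausdorff_outer (real CARD('d) - 1) Ga"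
 unfolding surf_def using assms
 by (subst emeasure_completion) (auto simp: emeasure_restrict_space sets_restrict_space_iff emeasure_hausdorff_measure)

lemma AE_surf_iff:
 fixes Ga :: "(real^'d::finite) set"
 assumes "Ga : sets borel"
 shows "(AE x in surf Ga. Q x) \<longleftrightarrow>
 (EX N : sets borel. hausdorff_outer (real CARD('d) - 1) N = 0 & {x : Ga. \<not> Q x} \<subseteq> N)"
proof -
 have "(AE x in surf Ga. Q x) \<longleftrightarrow> (AE x in hausdorff_measure (real CARD('d) - 1). x : Ga --> Q x)"
 unfolding surf_def using assms by (simp add: AE_completion_iff AE_restrict_space_iff)
 also have "... \<longleftrightarrow> (EX N:null_sets (hausdorff_measure (real CARD('d) - 1)). {x. \<not> (x : Ga --> Q x)} \<subseteq> N)"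
 by (simp add: eventually_ae_filter)
 also have "... \<longleftrightarrow> (EX N : sets borel. hausdorff_outer (real CARD('d) - 1) N = 0 & {x : Ga. \<not> Q x} \<subseteq> N)"
 by (auto simp: null_sets_def emeasure_hausdorff_measure)
 finally show ?thesis .
qed

text \<open>Taking closures leaves diameters unchanged, and a countable union of closed sets is
  Borel.\<close>

lemma hausdorff_pre_closed_cover:
 fixes A :: "'a::metric_space set"
 assumes "0 < x" "hausdorff_pre s de A < x"
 obtains B where "B : sets borel" "A \<subseteq> B" "hausdorff_pre s de B < x"
proof -
 from hausdorff_pre_less[OF assms(2)] obtain U :: "nat => 'a set"
 where U: "A \<subseteq> (\<Union>i. U i)" "ALL i. bounded (U i) & diameter (U i) <= de"
 "(\<Sum>i. ennreal (unit_ball_vol s * (diameter (U i) / 2) powr s)) < x"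
 by (elim exE conjE)
 have "hausdorff_pre s de (\<Union>i. closure (U i)) <= (\<Sum>i. ennreal (unit_ball_vol s * (diameter (closure (U i)) / 2) powr s))"
 using U by (intro hausdorff_pre_le) (auto simp: diameter_closure)
 also have "... < x" using U by (simp add: diameter_closure)
 finally have "hausdorff_pre s de (\<Union>i. closure (U i)) < x" .
 moreover have "A \<subseteq> (\<Union>i. closure (U i))" by (rule order_trans[OF U(1)]) (intro UN_mono order_refl closure_subset)
 ultimately show ?thesis by (intro that[of "\<Union>i. closure (U i)"]) auto
qed

text \<open>Intersect Borel covers whose premeasure at scale \<open>1 / (n + 1)\<close> is below
  \<open>1 / (n + 1)\<close>. The measure lives on Borel sets only, so an exceptional set that is
  merely null for the outer measure has to be enclosed in such a set.\<close>

lemma hausdorff_null_borel: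
 fixes A :: "'a::metric_space set"
 assumes "hausdorff_outer s A = 0"
 obtains B where "B : sets borel" "A \<subseteq> B" "hausdorff_outer s B = 0"
proof -
 have "EX B. B : sets borel & A \<subseteq> B & hausdorff_pre s (1 / real (Suc n)) B < ennreal (1 / real (Suc n))" for n
 proof -
 have "hausdorff_pre s (1 / real (Suc n)) A <= 0"
 using hausdorff_pre_le_outer[of "1 / real (Suc n)" s A] assms by simp
 hence "hausdorff_pre s (1 / real (Suc n)) A < ennreal (1 / real (Suc n))" by (simp add: le_less_trans)
 thus ?thesis by (rule hausdorff_pre_closed_cover[rotated]) (auto simp: ennreal_less_zero_iff)
 qed
 then obtain B where B: "!!n. B n : sets borel" "!!n. A \<subseteq> B n"
 "!!n. hausdorff_pre s (1 / real (Suc n)) (B n) < ennreal (1 / real (Suc n))"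
 by metis
 define D where "D = (\<Inter>n. B n)"
 have "hausdorff_pre s de D <= 0" if de: "de > 0" for de
 proof (rule ennreal_le_epsilon)
 fix e :: real assume "0 < e"
 obtain n where n: "1 / real (Suc n) < min de e" using \<open>0 < e\<close> de nat_approx_posE[of "min de e"] by (metis min_less_iff_conj)
 have "hausdorff_pre s de D <= hausdorff_pre s (1 / real (Suc n)) (B n)"
 using n by (intro order_trans[OF hausdorff_pre_mono hausdorff_pre_antimono]) (auto simp: D_def)
 also have "... <= ennreal (1 / real (Suc n))" using B(3)[of n] by simp
 also have "... <= ennreal e" using n by (intro ennreal_leI) auto
 finally show "hausdorff_pre s de D <= 0 + ennreal e" by simp
 qed
 hence "hausdorff_outer s D <= 0" unfolding hausdorff_outer_def by (auto intro!: SUP_least)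
 thus ?thesis using B by (intro that[of D]) (auto simp: D_def)
qed

text \<open>Frees later arguments from measurability: a statement almost everywhere on the wall
  becomes the vanishing of the outer measure of its exceptional set.\<close>

lemma AE_surf_iff_null:
 fixes Ga :: "(real^'d::finite) set"
 assumes "Ga : sets borel"
 shows "(AE x in surf Ga. Q x) \<longleftrightarrow> hausdorff_outer (real CARD('d) - 1) {x : Ga. \<not> Q x} = 0"
proof
 assume "AE x in surf Ga. Q x"
 then obtain N where "hausdorff_outer (real CARD('d) - 1) N = 0" "{x : Ga. \<not> Q x} \<subseteq> N"
 unfolding AE_surf_iff[OF assms] by blast
 thus "hausdorff_outer (real CARD('d) - 1) {x : Ga. \<not> Q x} = 0"
 using hausdorff_outer_mono[of "{x : Ga. \<not> Q x}" N "real CARD('d) - 1"] by simp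
next
 assume "hausdorff_outer (real CARD('d) - 1) {x : Ga. \<not> Q x} = 0"
 thus "AE x in surf Ga. Q x" unfolding AE_surf_iff[OF assms] by (rule hausdorff_null_borel) blast
qed

lemma hausdorff_outer_null_UN:
 assumes "!!n::nat. hausdorff_outer s (A n) = 0"
 shows "hausdorff_outer s (\<Union>n. A n) = 0"
 using hausdorff_outer_UN[of s A] assms by simp

lemma diameter_translate:
 fixes a :: "'a::real_normed_vector"
 assumes "bounded U"
 shows "diameter ((+) a ` U) = diameter U"
proof -
 have le: "diameter ((+) a ` U) <= diameter U" if "bounded U" for a :: 'a and U
 proof (rule diameter_le)
 show "norm (x - y) <= diameter U" if "x : (+) a ` U" "y : (+) a ` U" for x y
 using that diameter_bounded_bound[OF \<open>bounded U\<close>] by (force simp: dist_norm)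
 qed (simp add: diameter_ge_0 that)
 show ?thesis
 using le[OF assms, of a] le[of "(+) a ` U" "- a"] assms by (simp add: image_image bounded_translation)
qed

lemma hausdorff_outer_translate_le:
 fixes a :: "'a::real_normed_vector"
 shows "hausdorff_outer s ((+) a ` A) <= hausdorff_outer s A"
 unfolding hausdorff_outer_def
proof (rule SUP_mono, intro bexI)
 fix de :: real
 show "hausdorff_pre s de ((+) a ` A) <= hausdorff_pre s de A"
 unfolding hausdorff_pre_def[of _ _ A]
 proof (intro INF_greatest, clarify)
 fix U :: "nat => 'a set"
 assume U: "A \<subseteq> (\<Union>i. U i)" "ALL i. bounded (U i) & diameter (U i) <= de"
 have d: "diameter ((+) a ` U i) = diameter (U i)" for i
 using U by (intro diameter_translate) auto
 have "hausdorff_pre s de ((+) a ` A) <= (\<Sum>i. ennreal (unit_ball_vol s * (diameter ((+) a ` U i) / 2) powr s))"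
 proof (intro hausdorff_pre_le)
 show "(+) a ` A \<subseteq> (\<Union>i. (+) a ` U i)" using U(1) by fastforce
 qed (use U in \<open>auto simp: d bounded_translation\<close>)
 thus "hausdorff_pre s de ((+) a ` A) <= (\<Sum>i. ennreal (unit_ball_vol s * (diameter (U i) / 2) powr s))"
 by (simp add: d)
 qed
qed

section \<open>Smooth functions and test functions\<close>

lemma has_derivative_pd:
 fixes f :: "real^'d::finite => 'b::euclidean_space"
 assumes "f differentiable at x"
 shows "(f has_derivative (%h. \<Sum>i\<in>UNIV. h $ i *R pd i f x)) (at x)"
proof -
 let ?D = "frechet_derivative f (at x)"
 have D: "(f has_derivative ?D) (at x)" using assms by (simp add: frechet_derivative_works)
 then interpret bounded_linear ?D by (rule has_derivative_bounded_linear)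
 have "?D h = (\<Sum>i\<in>UNIV. h $ i *R pd i f x)" for h
 proof -
 have "?D h = ?D (\<Sum>i\<in>UNIV. h $ i *R axis i 1)"
 using basis_expansion[of h] by (simp add: scalar_mult_eq_scaleR)
 also have "... = (\<Sum>i\<in>UNIV. h $ i *R pd i f x)"
 by (simp add: sum scale pd_def)
 finally show ?thesis .
 qed
 hence "?D = (%h. \<Sum>i\<in>UNIV. h $ i *R pd i f x)" by blast
 with D show ?thesis by metis
qed

lemma pd_eqI:
 fixes f :: "real^'d::finite => 'b::euclidean_space"
 assumes "(f has_derivative D) (at x)"
 shows "pd i f x = D (axis i 1)"
 unfolding pd_def by (simp add: frechet_derivative_at[OF assms, symmetric])

lemma pds_append: "pds (is @ js) f = pds is (pds js f)"
 by (induction "is") auto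

text \<open>Induction over the list of directions keeps all iterated derivatives in
  \<open>S\<close>. Exhibiting a class closed under \<open>pd\<close> thus replaces explicit
  formulas for higher derivatives of products and compositions.\<close>

lemma smooth_on_UNIV_coinduct:
 assumes "f : S" and "!!g x. g : S ==> g differentiable (at x)" and "!!g i. g : S ==> pd i g : S"
 shows "smooth_on UNIV f"
proof -
 have "pds is f : S" for "is" by (induction "is") (auto simp: assms)
 thus ?thesis unfolding smooth_on_def using assms(2) by blast
qed

lemma smooth_on_differentiable: "smooth_on U f ==> x : U ==> pds is f differentiable (at x)"
 by (simp add: smooth_on_def)

lemma smooth_on_differentiable0: "smooth_on U f ==> x : U ==> f differentiable (at x)"
 using smooth_on_differentiable[of U f x "[]"] by simp

lemma smooth_on_pds: "smooth_on U f ==> smooth_on U (pds is f)"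
 unfolding smooth_on_def by (simp add: pds_append[symmetric])

lemma smooth_on_pd: "smooth_on U f ==> smooth_on U (pd i f)"
 using smooth_on_pds[of U f "[i]"] by simp

lemma smooth_on_continuous: "smooth_on U f ==> continuous_on U (pds is f)"
 by (meson continuous_at_imp_continuous_on differentiable_imp_continuous_within smooth_on_differentiable)

lemma smooth_on_continuous0: "smooth_on U f ==> continuous_on U f"
 using smooth_on_continuous[of U f "[]"] by simp

lemma smooth_on_const [simp]: "smooth_on UNIV (%_. c)"
proof (rule smooth_on_UNIV_coinduct[of _ "{%_. c, %_. 0}"])
 show "pd i g : {%_. c, %_. 0}" if "g : {%_. c, %_. 0}" for i g
 proof -
 have "pd i (%_. c') = (%_. 0)" for c' :: 'b by (simp add: pd_def fun_eq_iff)
 thus ?thesis using that by auto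
 qed
qed auto

lemma pds_zero [simp]: "pds is (%_. 0 :: 'b::euclidean_space) = (%_. 0)"
proof (induction "is")
 case (Cons i "is")
 have "pd i (%_. 0 :: 'b) = (%_. 0)" by (simp add: pd_def fun_eq_iff)
 thus ?case by (simp add: Cons)
qed simp

lemma pd_linear:
 assumes "f differentiable (at x)" "g differentiable (at x)"
 shows "pd i (%x. a *R f x + b *R g x) x = a *R pd i f x + b *R pd i g x"
proof -
 note D = has_derivative_pd[OF assms(1)] has_derivative_pd[OF assms(2)]
 have "((%x. a *R f x + b *R g x) has_derivative
 (%h. a *R (\<Sum>i\<in>UNIV. h $ i *R pd i f x) + b *R (\<Sum>i\<in>UNIV. h $ i *R pd i g x))) (at x)"
 by (intro derivative_intros D)
 from pd_eqI[OF this, of i] show ?thesis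
 by (simp add: axis_def if_distrib[of "%c. c *R _"] cong: if_cong)
qed

lemma pds_linear:
 assumes "smooth_on UNIV f" "smooth_on UNIV g"
 shows "pds is (%x. a *R f x + b *R g x) = (%x. a *R pds is f x + b *R pds is g x)"
proof (induction "is")
 case (Cons i "is")
 show ?case
 using assms by (simp add: Cons fun_eq_iff) (intro allI pd_linear smooth_on_differentiable, auto)
qed simp

lemma smooth_on_linear:
 assumes "smooth_on UNIV f" "smooth_on UNIV g"
 shows "smooth_on UNIV (%x. a *R f x + b *R g x)"
 unfolding smooth_on_def pds_linear[OF assms]
 using assms by (auto intro!: derivative_intros simp: smooth_on_differentiable)

lemma smooth_on_diff:
 assumes "smooth_on UNIV f" "smooth_on UNIV g"
 shows "smooth_on UNIV (%x. f x - g x)"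
 using smooth_on_linear[OF assms, of 1 "-1"] by simp

lemma pd_mult:
 fixes f :: "real^'d::finite => real" and g :: "real^'d => 'b::euclidean_space"
 assumes "f differentiable (at x)" "g differentiable (at x)"
 shows "pd i (%x. f x *R g x) x = f x *R pd i g x + pd i f x *R g x"
proof -
 note D = has_derivative_scaleR[OF has_derivative_pd[OF assms(1)] has_derivative_pd[OF assms(2)]]
 from pd_eqI[OF D, of i] show ?thesis
 by (simp add: axis_def if_distrib[of "%c. c *R _"] if_distrib[of "%c. c * _"] cong: if_cong)
qed

text \<open>Invariant class for \<open>smooth_on_mult\<close>: by the product rule a derivative of a
  product is a sum of products, so the algebra generated by the smooth functions is closed under
  \<open>pd\<close>.\<close>

inductive_set alg_hull :: "((real^'d::finite) => real) set => ((real^'d) => real) set" for S where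
 base: "f : S ==> f : alg_hull S"
| add: "f : alg_hull S ==> g : alg_hull S ==> (%x. f x + g x) : alg_hull S"
| mult: "f : alg_hull S ==> g : alg_hull S ==> (%x. f x * g x) : alg_hull S"

lemma smooth_on_mult:
 fixes f g :: "real^'d::finite => real"
 assumes "smooth_on UNIV f" "smooth_on UNIV g"
 shows "smooth_on UNIV (%x. f x * g x)"
proof -
 let ?S = "Collect (smooth_on UNIV) :: (real^'d => real) set"
 have *: "(ALL x. h differentiable (at x)) & (ALL i. pd i h : alg_hull ?S)" if "h : alg_hull ?S" for h
 using that
 proof induction
 case (base f)
 thus ?case by (auto intro: alg_hull.base smooth_on_pd smooth_on_differentiable0)
 next
 case (add f g)
 have "pd i (%x. f x + g x) = (%x. pd i f x + pd i g x)" for i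
 using pd_linear[of f _ g i 1 1] add by (simp add: fun_eq_iff)
 thus ?case using add by (auto intro: alg_hull.add)
 next
 case (mult f g)
 have "pd i (%x. f x * g x) = (%x. f x * pd i g x + pd i f x * g x)" for i
 using pd_mult[of f _ g i] mult by (simp add: fun_eq_iff)
 moreover have "(%x. f x * pd i g x + pd i f x * g x) : alg_hull ?S" for i
 proof (rule alg_hull.add)
 show "(%x. f x * pd i g x) : alg_hull ?S" by (rule alg_hull.mult) (use mult in simp_all)
 show "(%x. pd i f x * g x) : alg_hull ?S" by (rule alg_hull.mult) (use mult in simp_all)
 qed
 ultimately show ?case using mult by auto
 qed
 have "(%x. f x * g x) : alg_hull ?S" using assms by (intro alg_hull.intros) auto
 thus ?thesis
 by (rule smooth_on_UNIV_coinduct) (use * in auto)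
qed

lemma smooth_on_prod:
 fixes f :: "'i => real^'d::finite => real"
 assumes "!!i. i : I ==> smooth_on UNIV (f i)"
 shows "smooth_on UNIV (%x. \<Prod>i\<in>I. f i x)"
 using assms by (induction I rule: infinite_finite_induct) (auto intro: smooth_on_mult)

lemma pd_compose_add: "pd i (%x. f (x + a)) x = pd i f (x + a)" if "f differentiable (at (x + a))"
 for f :: "real^'d::finite => 'b::euclidean_space"
proof -
 have "((%x. x + a) has_derivative (%h. h)) (at x)" by (auto intro!: derivative_eq_intros)
 from pd_eqI[OF has_derivative_compose[OF this has_derivative_pd[OF that]], of i] show ?thesis
 by (simp add: axis_def if_distrib[of "%c. c *R _"] cong: if_cong)
qed

lemma pds_compose_add:
 fixes f :: "real^'d::finite => 'b::euclidean_space"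
 assumes "smooth_on UNIV f"
 shows "pds is (%x. f (x + a)) = (%x. pds is f (x + a))"
proof (induction "is")
 case (Cons i "is")
 show ?case using assms
 by (simp add: Cons fun_eq_iff pd_compose_add smooth_on_differentiable)
qed simp

lemma differentiable_compose_add:
 fixes f :: "real^'d::finite => 'b::euclidean_space"
 assumes "f differentiable (at (x + a))"
 shows "(%x. f (x + a)) differentiable (at x)"
 using differentiable_chain_at[of "%x. x + a" x f] assms by (simp add: o_def)

lemma smooth_on_compose_add:
 fixes f :: "real^'d::finite => 'b::euclidean_space"
 assumes "smooth_on UNIV f"
 shows "smooth_on UNIV (%x. f (x + a))"
 unfolding smooth_on_def pds_compose_add[OF assms]
 using assms by (auto intro!: differentiable_compose_add simp: smooth_on_differentiable)

text \<open>The flat function \<open>exp (- 1 / t)\<close> and, through \<open>p\<close>, all its derivatives.\<close>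

definition flat :: "real poly => real => real" where
 "flat p t = (if t <= 0 then 0 else poly p (inverse t) * exp (- inverse t))"

text \<open>The free power \<open>s ^ k\<close> makes the induction on \<open>p\<close> work:
  splitting off the constant coefficient leaves a term with \<open>k + 1\<close>.\<close>

lemma poly_exp_tendsto_0: "((%s. s ^ k * poly p s * exp (- s)) \<longlongrightarrow> (0::real)) at_top"
proof (induction p arbitrary: k)
 case (pCons a p)
 have "((%s. a * (s ^ k / exp s) + s ^ Suc k * poly p s * exp (- s)) \<longlongrightarrow> a * 0 + 0) at_top"
 by (intro tendsto_intros tendsto_power_div_exp_0 pCons)
 thus ?case by (simp add: algebra_simps exp_minus field_simps)
qed simp

text \<open>With \<open>s = 1 / t\<close> the derivative of \<open>p(s) exp (- s)\<close> in
  \<open>t\<close> is \<open>s^2 (p - p')(s) exp (- s)\<close>, again of the form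
  \<open>flat\<close>. At \<open>t = 0\<close> the right difference quotient is
  \<open>s p(s) exp (- s)\<close>, which vanishes as \<open>s\<close> grows.\<close>

lemma flat_has_derivative:
 "(flat p has_real_derivative flat ([:0, 0, 1:] * (p - pderiv p)) t) (at t)"
proof -
 consider "t < 0" | "t > 0" | "t = 0" by linarith
 thus ?thesis
 proof cases
 case 1
 have "((%_. 0) has_real_derivative 0) (at t)" by simp
 hence "(flat p has_real_derivative 0) (at t)"
 by (rule has_field_derivative_transform_within_open[where S="{..<0}"]) (use 1 in \<open>auto simp: flat_def\<close>)
 thus ?thesis using 1 by (simp add: flat_def)
 next
 case 2
 have "((%t. poly p (inverse t) * exp (- inverse t)) has_real_derivative
 poly ([:0, 0, 1:] * (p - pderiv p)) (inverse t) * exp (- inverse t)) (at t)"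
 using 2 by (auto intro!: derivative_eq_intros DERIV_chain'[OF _ poly_DERIV] simp: power2_eq_square algebra_simps)
 hence "(flat p has_real_derivative poly ([:0, 0, 1:] * (p - pderiv p)) (inverse t) * exp (- inverse t)) (at t)"
 by (rule has_field_derivative_transform_within_open[where S="{0<..}"]) (use 2 in \<open>auto simp: flat_def\<close>)
 thus ?thesis using 2 by (simp add: flat_def)
 next
 case 3
 have "((%h. flat p h / h) \<longlongrightarrow> 0) (at_left 0)"
 by (rule tendsto_eventually) (auto simp: flat_def eventually_at_filter)
 moreover have "((%h. flat p h / h) \<longlongrightarrow> 0) (at_right 0)"
 proof (rule Lim_transform_eventually)
 show "((%h. inverse h ^ 1 * poly p (inverse h) * exp (- inverse h)) \<longlongrightarrow> 0) (at_right (0::real))"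
 by (rule filterlim_compose[OF poly_exp_tendsto_0 filterlim_inverse_at_top_right])
 show "\<forall>\<^sub>F h in at_right 0. inverse h ^ 1 * poly p (inverse h) * exp (- inverse h) = flat p h / h"
 by (auto simp: eventually_at_filter flat_def field_simps)
 qed
 ultimately have "((%h. flat p h / h) \<longlongrightarrow> 0) (at 0)" by (rule filterlim_split_at)
 thus ?thesis using 3 by (simp add: DERIV_def flat_def)
 qed
qed

lemma smooth_on_flat: "smooth_on UNIV (%x::real^'d::finite. flat p (c * x $ j + d))"
proof -
 have D: "((%x::real^'d. a * flat p (c * x $ j + d)) has_derivative
 (%h. a * (flat ([:0, 0, 1:] * (p - pderiv p)) (c * x $ j + d) * (c * h $ j)))) (at x)" for a p x
 proof -
 have "((%x::real^'d. c * x $ j + d) has_derivative (%h. c * h $ j)) (at x)"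
 by (rule has_derivative_add_const[OF has_derivative_mult_right[OF
 bounded_linear_imp_has_derivative[OF bounded_linear_vec_nth]]])
 from has_derivative_compose[OF this, of "flat p"]
 have "((%x::real^'d. flat p (c * x $ j + d)) has_derivative
 (%h. flat ([:0, 0, 1:] * (p - pderiv p)) (c * x $ j + d) * (c * h $ j))) (at x)"
 using flat_has_derivative[of p "c * x $ j + d"] by (simp add: has_field_derivative_def)
 thus ?thesis by (rule has_derivative_mult_right)
 qed
 show ?thesis
 proof (rule smooth_on_UNIV_coinduct[of _ "{%x. a * flat p (c * x $ j + d) | a p. True}"])
 show "(%x::real^'d. flat p (c * x $ j + d)) : {%x. a * flat p (c * x $ j + d) | a p. True}"
 by (rule CollectI, rule exI[of _ 1], rule exI[of _ p]) simp
 show "g differentiable at x" if "g : {%x::real^'d. a * flat p (c * x $ j + d) | a p. True}" for g x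
 using that D by (auto simp: differentiable_def)
 show "pd i g : {%x::real^'d. a * flat p (c * x $ j + d) | a p. True}"
 if "g : {%x::real^'d. a * flat p (c * x $ j + d) | a p. True}" for g i
 proof -
 from that obtain a p where g: "g = (%x. a * flat p (c * x $ j + d))" by (elim CollectE exE conjE)
 have "pd i g x = (a * (c * (axis i 1 :: real^'d) $ j)) * flat ([:0, 0, 1:] * (p - pderiv p)) (c * x $ j + d)" for x
 unfolding g pd_eqI[OF D] by (simp add: algebra_simps)
 thus ?thesis by blast
 qed
 qed
qed

text \<open>The parameter \<open>n\<close> steepens the flat factors, whose value
  \<open>exp (- 1 / (n t))\<close> tends to 1 for every \<open>t > 0\<close>: test functions with
  pointwise limit the indicator of an open box.\<close>

definition bump :: "real^'d::finite => real^'d => nat => real^'d => real" where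
 "bump a b n x = (\<Prod>j\<in>UNIV. flat 1 (real n * (x $ j - a $ j)) * flat 1 (real n * (b $ j - x $ j)))"

lemma flat_1_bounds: "0 <= flat 1 t" "flat 1 t <= 1"
 by (auto simp: flat_def)

lemma bump_bounds: "0 <= bump a b n x" "bump a b n x <= 1"
 unfolding bump_def
 by (auto intro!: prod_nonneg prod_le_1 mult_nonneg_nonneg mult_le_one simp: flat_1_bounds)

lemma bump_eq_0: "x ~: box a b ==> bump a b n x = 0"
proof -
 assume "x ~: box a b"
 then obtain j where "x $ j <= a $ j \<or> b $ j <= x $ j" by (auto simp: mem_box_cart not_less)
 hence "flat 1 (real n * (x $ j - a $ j)) * flat 1 (real n * (b $ j - x $ j)) = 0"
 by (auto simp: flat_def mult_nonneg_nonpos)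
 thus ?thesis unfolding bump_def by (intro prod_zero) auto
qed

lemma bump_tendsto: "(%n. bump a b n x) ----> indicator (box a b) x"
proof (cases "x : box a b")
 case True
 have *: "(%n. flat 1 (real n * t)) ----> 1" if "t > 0" for t
 proof (rule Lim_transform_eventually)
 show "(%n. exp (- inverse (real n * t))) ----> 1" using that by real_asymp
 show "\<forall>\<^sub>F n in sequentially. exp (- inverse (real n * t)) = flat 1 (real n * t)"
 using that by (auto simp: flat_def eventually_at_top_linorder mult_le_0_iff intro!: exI[of _ 1])
 qed
 have "(%n. bump a b n x) ----> (\<Prod>j\<in>(UNIV::'a set). 1 * 1)"
 unfolding bump_def using True by (intro tendsto_prod tendsto_mult *) (auto simp: mem_box_cart)
 thus ?thesis using True by simp
next
 case False
 thus ?thesis by (simp add: bump_eq_0)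
qed

lemma smooth_on_bump: "smooth_on UNIV (bump a b n)"
proof -
 have "smooth_on UNIV (%x. flat 1 (real n * (x $ j - a $ j)) * flat 1 (real n * (b $ j - x $ j)))" for j
 using smooth_on_mult[OF smooth_on_flat[of 1 "real n" j "- real n * a $ j"]
 smooth_on_flat[of 1 "- real n" j "real n * b $ j"]] by (simp add: algebra_simps)
 thus ?thesis unfolding bump_def[abs_def] by (intro smooth_on_prod)
qed

lemma test_fun_bump: "cbox a b \<subseteq> U ==> test_fun U (bump a b n)"
 unfolding test_fun_def using box_subset_cbox[of a b]
 by (auto intro!: smooth_on_bump bump_eq_0 exI[of _ "cbox a b"])

lemma pd_eq_0_outside:
 fixes f :: "real^'d::finite => 'b::euclidean_space"
 assumes "closed K" "!!x. x ~: K ==> f x = 0" "x ~: K"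
 shows "pd i f x = 0"
proof -
 have "(f has_derivative (%_. 0)) (at x)"
 by (rule has_derivative_transform_within_open[of "%_. 0" _ _ _ "- K"]) (use assms in auto)
 from pd_eqI[OF this] show ?thesis .
qed

lemma pds_eq_0_outside:
 fixes f :: "real^'d::finite => 'b::euclidean_space"
 assumes "closed K" "!!x. x ~: K ==> f x = 0"
 shows "x ~: K ==> pds is f x = 0"
 by (induction "is" arbitrary: x) (auto intro: pd_eq_0_outside assms)

lemma test_fun_pds:
 assumes "test_fun U ph" shows "test_fun U (pds is ph)"
proof -
 obtain K where K: "compact K" "K \<subseteq> U" "!!x. x ~: K ==> ph x = 0" and s: "smooth_on UNIV ph"
 using assms unfolding test_fun_def by blast
 have "pds is ph x = 0" if "x ~: K" for x
 using K(1,3) that by (intro pds_eq_0_outside) (auto intro: compact_imp_closed)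
 thus ?thesis unfolding test_fun_def using K s by (blast intro: smooth_on_pds)
qed

section \<open>The fundamental lemma of the calculus of variations\<close>

lemma compact_bound_norm:
 fixes f :: "'a::topological_space => 'b::real_normed_vector"
 assumes "continuous_on K f" "compact K"
 obtains M where "M >= 0" "!!x. x : K ==> norm (f x) <= M"
proof -
 have "bounded (f ` K)" using assms by (intro compact_imp_bounded compact_continuous_image)
 then obtain M where "ALL y:f ` K. norm y <= M" unfolding bounded_iff ..
 thus ?thesis by (intro that[of "max M 0"]) (auto simp: le_max_iff_disj)
qed

lemma continuous_imp_lebesgue_measurable:
 fixes f :: "'a::euclidean_space => 'b::topological_space"
 assumes "continuous_on UNIV f"
 shows "f : borel_measurable lebesgue"
proof (rule measurable_completion)
 show "f : borel_measurable lborel" using bm_contI[OF assms] by simp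
qed

lemma loc_integrable_mult:
 fixes pz :: "real^'d::finite => real" and f :: "real^'d => 'b::euclidean_space"
 assumes f: "loc_integrable U f" and U: "open U"
 and K: "compact K" "K \<subseteq> U" "!!x. x ~: K ==> pz x = 0" and pz: "continuous_on UNIV pz"
 shows "integrable (lebesgue_on U) (%x. pz x *R f x)" (is ?A)
 and "integrable lebesgue (%x. pz x *R f x)" (is ?B)
proof -
 have KL: "K : sets lebesgue" using K(1) by (simp add: borel_compact)
 have fK: "integrable lebesgue (%x. indicator K x *R f x)"
 using f K KL unfolding loc_integrable_def by (subst integrable_restrict_space[symmetric]) auto
 obtain M where M0: "M >= 0" and M: "!!x. x : K ==> norm (pz x) <= M"
 by (rule compact_bound_norm[OF continuous_on_subset[OF pz subset_UNIV] K(1)], rule that)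
 have bm: "pz : borel_measurable lebesgue" by (rule continuous_imp_lebesgue_measurable[OF pz])
 have eq: "(%x. pz x *R f x) = (%x. pz x *R (indicator K x *R f x))"
 using K(3) by (auto simp: indicator_def fun_eq_iff)
 have meas: "(%x. pz x *R f x) : borel_measurable lebesgue"
 unfolding eq using bm borel_measurable_integrable[OF fK] by (rule borel_measurable_scaleR)
 show ?B
 proof (rule Bochner_Integration.integrable_bound[OF integrable_scaleR_right[OF fK, of M]])
 show "AE x in lebesgue. norm (pz x *R f x) <= norm (M *R indicator K x *R f x)"
 proof (rule always_eventually, rule allI)
 fix x
 show "norm (pz x *R f x) <= norm (M *R indicator K x *R f x)"
 proof (cases "x : K")
 case True
 thus ?thesis using M[OF True] M0 by (simp add: mult_right_mono)
 next
 case False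
 thus ?thesis using K(3) by simp
 qed
 qed
 qed (fact meas)
 moreover have "(%x. indicator U x *R (pz x *R f x)) = (%x. pz x *R f x)"
 using K by (auto simp: indicator_def fun_eq_iff)
 ultimately show ?A using U by (subst integrable_restrict_space) (auto simp del: scaleR_scaleR)
qed

lemma integral_lebesgue_on_supp:
 fixes f :: "real^'d::finite => 'b::euclidean_space"
 assumes "U : sets lebesgue" "!!x. x ~: U ==> f x = 0"
 shows "integral\<^sup>L (lebesgue_on U) f = integral\<^sup>L lebesgue f"
proof -
 have "indicator U x *R f x = f x" for x using assms(2) by (auto simp: indicator_def)
 thus ?thesis using assms(1) by (subst integral_restrict_space) auto
qed

lemma integrable_lebesgue_on_supp:
 fixes f :: "real^'d::finite => 'b::euclidean_space"
 assumes "U : sets lebesgue" "!!x. x ~: U ==> f x = 0"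
 shows "integrable (lebesgue_on U) f \<longleftrightarrow> integrable lebesgue f"
proof -
 have "indicator U x *R f x = f x" for x using assms(2) by (auto simp: indicator_def)
 thus ?thesis using assms(1) by (subst integrable_restrict_space) auto
qed

lemma AE_lebesgue_on: "U : sets lebesgue ==> (AE x in lebesgue_on U. Q x) \<longleftrightarrow> (AE x in lebesgue. x : U --> Q x)"
 by (simp add: AE_restrict_space_iff)

lemma AE_lebesgue_on_subset:
 assumes "AE x in lebesgue_on U. Q x" "V \<subseteq> U" "U : sets lebesgue" "V : sets lebesgue"
 shows "AE x in lebesgue_on V. Q x"
 using assms by (auto simp: AE_lebesgue_on elim!: eventually_mono)

text \<open>Bumps turn the hypothesis into nonnegative integrals over small boxes, and Lebesgue
  differentiation turns these into a pointwise sign off a negligible set. The inequality is the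
  basic form: it also serves the one-sided shift estimate for functions with bounded weak
  derivatives, and equations follow by testing with both signs.\<close>

lemma fundamental_nonneg:
 fixes g :: "real^'d::finite => real"
 assumes U: "open U" and g: "loc_integrable U g"
 and nonneg: "!!ph. test_fun U ph ==> (!!x. 0 <= ph x) ==> 0 <= (LINT x|lebesgue_on U. ph x * g x)"
 shows "AE x in lebesgue_on U. 0 <= g x"
proof -
 have gQ: "integrable lebesgue (%x. indicator (cbox a b) x * g x)" if "cbox a b \<subseteq> U" for a b
 proof -
 have "integrable (lebesgue_on (cbox a b)) g"
 using g[unfolded loc_integrable_def, rule_format, of "cbox a b"] that by simp
 thus ?thesis by (subst (asm) integrable_restrict_space) auto
 qed
 have box: "0 <= (LINT x|lebesgue. indicator (box a b) x * g x)" if ab: "cbox a b \<subseteq> U" for a b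
 proof (rule LIMSEQ_le_const)
 show "(%n. LINT x|lebesgue. bump a b n x * (indicator (cbox a b) x * g x))
 ----> (LINT x|lebesgue. indicator (box a b) x * g x)"
 proof (rule integral_dominated_convergence[where w="%x. norm (indicator (cbox a b) x * g x)"])
 have gm: "(%x. indicator (cbox a b) x * g x) : borel_measurable lebesgue"
 using gQ[OF ab] by (rule borel_measurable_integrable)
 have "(%x. indicator (box a b) x * (indicator (cbox a b) x * g x)) = (%x. indicator (box a b) x * g x)"
 using box_subset_cbox[of a b] by (auto simp: indicator_def fun_eq_iff)
 moreover have "(%x. indicator (box a b) x * (indicator (cbox a b) x * g x)) : borel_measurable lebesgue"
 by (intro borel_measurable_times gm borel_measurable_indicator) auto
 ultimately show "(%x. indicator (box a b) x * g x) : borel_measurable lebesgue" by metis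
 have "bump a b n : borel_measurable lebesgue" for n
 by (rule continuous_imp_lebesgue_measurable[OF smooth_on_continuous0[OF smooth_on_bump]])
 thus "(%x. bump a b n x * (indicator (cbox a b) x * g x)) : borel_measurable lebesgue" for n
 by (intro borel_measurable_times gm)
 show "integrable lebesgue (%x. norm (indicator (cbox a b) x * g x))" using gQ[OF ab] by (rule integrable_norm)
 show "AE x in lebesgue. (%n. bump a b n x * (indicator (cbox a b) x * g x)) ----> indicator (box a b) x * g x"
 proof (rule always_eventually, rule allI)
 fix x
 have "(%n. bump a b n x * (indicator (cbox a b) x * g x)) ----> indicator (box a b) x * (indicator (cbox a b) x * g x)"
 by (intro tendsto_intros bump_tendsto)
 also have "indicator (box a b) x * (indicator (cbox a b) x * g x) = indicator (box a b) x * g x"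
 using box_subset_cbox[of a b] by (auto simp: indicator_def)
 finally show "(%n. bump a b n x * (indicator (cbox a b) x * g x)) ----> indicator (box a b) x * g x" .
 qed
 show "AE x in lebesgue. norm (bump a b n x * (indicator (cbox a b) x * g x)) <= norm (indicator (cbox a b) x * g x)" for n
 using bump_bounds[of a b n] by (auto simp: abs_mult mult_left_le_one_le)
 qed
 have eq: "(LINT x|lebesgue. bump a b n x * (indicator (cbox a b) x * g x)) = (LINT x|lebesgue_on U. bump a b n x * g x)" for n
 proof -
 have "bump a b n x = 0" if "x ~: cbox a b" for x
 using bump_eq_0[of x a b n] box_subset_cbox[of a b] that by blast
 hence *: "(%x. bump a b n x * (indicator (cbox a b) x * g x)) = (%x. bump a b n x * g x)"
 by (auto simp: indicator_def fun_eq_iff)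
 have "bump a b n x * g x = 0" if "x ~: U" for x
 using bump_eq_0[of x a b n] box_subset_cbox[of a b] ab that by auto
 thus ?thesis unfolding *
 by (intro integral_lebesgue_on_supp[symmetric]) (use U in simp_all)
 qed
 have "0 <= (LINT x|lebesgue. bump a b n x * (indicator (cbox a b) x * g x))" for n
 unfolding eq by (rule nonneg[OF test_fun_bump[OF ab] bump_bounds(1)])
 thus "EX N. ALL n>=N. 0 <= (LINT x|lebesgue. bump a b n x * (indicator (cbox a b) x * g x))" by blast
 qed
 have local: "AE x in lebesgue. x : cbox a b --> 0 <= g x" if ab: "cbox a b \<subseteq> U" for a b
 proof -
 define f where "f x = indicator (cbox a b) x * g x" for x
 have fi: "integrable lebesgue f" using gQ[OF ab] by (simp add: f_def[abs_def])
 have fint: "f integrable_on cbox c d" for c d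
 using integrable_on_lebesgue[OF fi] by (rule integrable_on_subcbox) simp
 \<comment> \<open>Lebesgue differentiation over cubes with lower corner \<open>x\<close>;
   \<open>f\<close> is \<open>g\<close> cut off outside the box, which makes it integrable on the
   whole space.\<close>
 obtain N where N: "negligible N" "!!x e. x ~: N ==> 0 < e ==>
 EX d>0. ALL h. 0 < h & h < d --> norm (integral (cbox x (x + h *R One)) f /\<^sub>R h ^ DIM(real^'d) - f x) < e"
 by (rule integrable_ccontinuous_explicit[OF fint], rule that)
 have "0 <= g x" if x: "x : box a b" "x ~: N" for x
 proof (rule ccontr)
 assume neg: "\<not> 0 <= g x"
 have fx: "f x = g x" using x box_subset_cbox[of a b] by (auto simp: f_def)
 obtain de where de: "de > 0" "!!h. 0 < h ==> h < de ==>
 norm (integral (cbox x (x + h *R One)) f /\<^sub>R h ^ DIM(real^'d) - f x) < - g x"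
 using N(2)[OF x(2), of "- g x"] neg by auto
 obtain r where r: "r > 0" "cball x r \<subseteq> box a b"
 using open_box[of a b] x(1) unfolding open_contains_cball by (elim ballE exE conjE) auto
 \<comment> \<open>The first bound keeps \<open>h\<close> strictly below \<open>de\<close>; the
   second places the whole cube inside \<open>cball x r\<close>.\<close>
 define h where "h = min (de / 2) (r / (1 + norm (One :: real^'d)))"
 have h: "0 < h" "h < de" using de r by (auto simp: h_def add_pos_nonneg)
 have hr: "h * norm (One :: real^'d) <= r"
 proof -
 have "h * norm (One :: real^'d) <= h * (1 + norm (One :: real^'d))" using h by simp
 also have "... <= r / (1 + norm (One :: real^'d)) * (1 + norm (One :: real^'d))"
 by (intro mult_right_mono) (auto simp: h_def)
 also have "... = r" by (smt (verit) norm_ge_zero nonzero_eq_divide_eq)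
 finally show ?thesis .
 qed
 have sub: "cbox x (x + h *R One) \<subseteq> box a b"
 proof (rule order_trans[OF _ r(2)], rule)
 fix y assume y: "y : cbox x (x + h *R One)"
 have "norm (y - x) <= norm (h *R (One :: real^'d))"
 by (rule norm_le_componentwise) (use y h in \<open>auto simp: mem_box algebra_simps\<close>)
 thus "y : cball x r" using h hr by (auto simp: dist_norm norm_minus_commute)
 qed
 let ?Q = "cbox x (x + h *R One)"
 have QU: "?Q \<subseteq> U" using sub ab box_subset_cbox[of a b] by blast
 have "integral ?Q f = integral\<^sup>L (lebesgue_on ?Q) f"
 using integrable_mult_indicator[OF _ fi, of ?Q]
 by (intro lebesgue_integral_eq_integral[symmetric]) (simp_all add: integrable_restrict_space)
 also have "... = (LINT y|lebesgue. indicator ?Q y * f y)"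
 by (subst integral_restrict_space) auto
 also have "... = (LINT y|lebesgue. indicator (box x (x + h *R One)) y * g y)"
 proof (rule integral_cong_AE)
 show "(%y. indicator ?Q y * f y) : borel_measurable lebesgue"
 by (intro borel_measurable_times borel_measurable_integrable[OF fi] borel_measurable_indicator) simp
 have "(%y. indicator (box x (x + h *R One)) y * f y) : borel_measurable lebesgue"
 by (intro borel_measurable_times borel_measurable_integrable[OF fi] borel_measurable_indicator) simp
 moreover have "(%y. indicator (box x (x + h *R One)) y * f y) = (%y. indicator (box x (x + h *R One)) y * g y)"
 using sub box_subset_cbox[of a b] box_subset_cbox[of x "x + h *R One"] by (fastforce simp: indicator_def f_def fun_eq_iff)
 ultimately show "(%y. indicator (box x (x + h *R One)) y * g y) : borel_measurable lebesgue" by metis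
 have "negligible (?Q - box x (x + h *R One))" by (rule negligible_frontier_interval)
 hence "AE y in lebesgue. y ~: ?Q - box x (x + h *R One)"
 by (intro AE_not_in) (simp add: negligible_iff_null_sets)
 thus "AE y in lebesgue. indicator ?Q y * f y = indicator (box x (x + h *R One)) y * g y"
 proof (rule eventually_mono)
 fix y assume y: "y ~: ?Q - box x (x + h *R One)"
 show "indicator ?Q y * f y = indicator (box x (x + h *R One)) y * g y"
 using y sub box_subset_cbox[of a b] box_subset_cbox[of x "x + h *R One"]
 by (cases "y : ?Q") (auto simp: indicator_def f_def subset_iff)
 qed
 qed
 also have "... >= 0" by (rule box[OF QU])
 finally have "0 <= integral ?Q f /\<^sub>R h ^ DIM(real^'d)" using h by simp
 thus False using de(2)[OF h] neg by (simp add: fx)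
 qed
 moreover have "AE x in lebesgue. x ~: N & x ~: cbox a b - box a b"
 using N(1) negligible_frontier_interval[of a b]
 unfolding negligible_iff_null_sets by (intro AE_conjI AE_not_in)
 ultimately show ?thesis by (elim eventually_mono) blast
 qed
 obtain \<D> where \<D>: "countable \<D>" "\<D> \<subseteq> Pow U" "!!X. X : \<D> ==> EX a b. X = cbox a b" "\<Union>\<D> = U"
 by (rule open_countable_Union_open_cbox[OF U], rule that)
 have "AE x in lebesgue. ALL X:\<D>. x : X --> 0 <= g x"
 unfolding AE_ball_countable[OF \<D>(1)]
 proof
 fix X assume X: "X : \<D>"
 obtain a b where ab: "X = cbox a b" using \<D>(3)[OF X] by (elim exE)
 show "AE x in lebesgue. x : X --> 0 <= g x" unfolding ab using \<D>(2) X ab by (intro local) auto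
 qed
 hence "AE x in lebesgue. x : U --> 0 <= g x"
 using \<D>(4) by (auto elim!: eventually_mono)
 thus ?thesis using U by (simp add: AE_lebesgue_on)
qed

lemma loc_integrable_linear:
 assumes "loc_integrable U f" "loc_integrable U g"
 shows "loc_integrable U (%x. a *R f x + b *R g x)"
 using assms unfolding loc_integrable_def by auto

lemma loc_integrable_inner:
 fixes f :: "real^'d::finite => 'b::euclidean_space"
 assumes "loc_integrable U f"
 shows "loc_integrable U (%x. f x \<bullet> c)"
 using assms unfolding loc_integrable_def by auto

lemma loc_integrable_continuous:
 fixes f :: "real^'d::finite => 'b::euclidean_space"
 assumes "continuous_on U f"
 shows "loc_integrable U f"
 unfolding loc_integrable_def
proof safe
 fix K assume K: "compact K" "K \<subseteq> U"
 have "set_integrable lborel K f"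
 unfolding set_integrable_def
 by (rule borel_integrable_compact[OF K(1) continuous_on_subset[OF assms K(2)]])
 hence "integrable lebesgue (%x. indicator K x *R f x)"
 unfolding set_integrable_def by (simp add: integrable_completion)
 thus "integrable (lebesgue_on K) f" using K(1) by (subst integrable_restrict_space) (auto simp: borel_compact)
qed

text \<open>The sign version, applied to the components \<open>g x \<bullet> c\<close> and
  \<open>g x \<bullet> (- c)\<close>.\<close>

lemma fundamental_zero:
 fixes g :: "real^'d::finite => 'b::euclidean_space"
 assumes U: "open U" and g: "loc_integrable U g"
 and zero: "!!ph. test_fun U ph ==> (LINT x|lebesgue_on U. ph x *R g x) = 0"
 shows "AE x in lebesgue_on U. g x = 0"
proof -
 have *: "AE x in lebesgue_on U. 0 <= g x \<bullet> c" for c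
 proof (rule fundamental_nonneg[OF U loc_integrable_inner[OF g]])
 fix ph assume t: "test_fun U ph"
 then obtain K where K: "compact K" "K \<subseteq> U" "!!x. x ~: K ==> ph x = 0" and s: "smooth_on UNIV ph"
 unfolding test_fun_def by blast
 have int: "integrable (lebesgue_on U) (%x. ph x *R g x)"
 by (rule loc_integrable_mult[OF g U K smooth_on_continuous0[OF s]])
 have "(LINT x|lebesgue_on U. ph x * (g x \<bullet> c)) = (LINT x|lebesgue_on U. (ph x *R g x) \<bullet> c)" by simp
 also have "... = (LINT x|lebesgue_on U. ph x *R g x) \<bullet> c"
 using int by (intro integral_inner_left) auto
 also have "... = 0" using zero[OF t] by simp
 finally show "0 <= (LINT x|lebesgue_on U. ph x * (g x \<bullet> c))" by simp
 qed
 have "AE x in lebesgue_on U. ALL c:Basis. 0 <= g x \<bullet> c & 0 <= g x \<bullet> (- c)"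
 using * by (intro AE_finite_allI finite_Basis AE_conjI)
 thus ?thesis
 proof (rule eventually_mono)
 fix x assume "ALL c:Basis. 0 <= g x \<bullet> c & 0 <= g x \<bullet> (- c)"
 hence "ALL c:Basis. g x \<bullet> c = 0" by (simp add: order_antisym)
 thus "g x = 0" by (simp add: euclidean_all_zero_iff)
 qed
qed

section \<open>Weak derivatives\<close>

lemma has_weak_derivD:
 assumes "has_weak_deriv U is f g"
 shows "loc_integrable U f" "loc_integrable U g"
 "test_fun U ph ==> (LINT x|lebesgue_on U. pds is ph x *R f x) = (-1) ^ length is *R (LINT x|lebesgue_on U. ph x *R g x)"
 using assms unfolding has_weak_deriv_def by simp_all

lemma weak_deriv_unique:
 fixes f :: "real^'d::finite => 'b::euclidean_space"
 assumes U: "open U" and g: "has_weak_deriv U is f g" and g': "has_weak_deriv U is f g'"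
 shows "AE x in lebesgue_on U. g x = g' x"
proof -
 have li: "loc_integrable U g" "loc_integrable U g'" using has_weak_derivD(2)[OF g] has_weak_derivD(2)[OF g'] .
 have lid: "loc_integrable U (%x. g x - g' x)" using loc_integrable_linear[OF li, of 1 "-1"] by simp
 have "AE x in lebesgue_on U. g x - g' x = 0"
 proof (rule fundamental_zero[OF U lid])
 fix ph assume t: "test_fun U ph"
 then obtain K where K: "compact K" "K \<subseteq> U" "!!x. x ~: K ==> ph x = 0" and s: "smooth_on UNIV ph"
 unfolding test_fun_def by blast
 have "(-1) ^ length is *R (LINT x|lebesgue_on U. ph x *R g x) = (-1) ^ length is *R (LINT x|lebesgue_on U. ph x *R g' x)"
 using has_weak_derivD(3)[OF g t] has_weak_derivD(3)[OF g' t] by simp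
 hence "(LINT x|lebesgue_on U. ph x *R g x) = (LINT x|lebesgue_on U. ph x *R g' x)" by simp
 moreover have "(LINT x|lebesgue_on U. ph x *R (g x - g' x)) = (LINT x|lebesgue_on U. ph x *R g x) - (LINT x|lebesgue_on U. ph x *R g' x)"
 unfolding scaleR_diff_right
 by (intro Bochner_Integration.integral_diff loc_integrable_mult[OF _ U K smooth_on_continuous0[OF s]] li)
 ultimately show "(LINT x|lebesgue_on U. ph x *R (g x - g' x)) = 0" by simp
 qed
 thus ?thesis by simp
qed

lemma weak_derivI: "has_weak_deriv U is f g ==> has_weak_deriv U is f (weak_deriv U is f)"
 unfolding weak_deriv_def by (rule someI[of "has_weak_deriv U is f"])

lemma weak_deriv_AE_eq:
 "open U ==> has_weak_deriv U is f g ==> AE x in lebesgue_on U. weak_deriv U is f x = g x"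
 by (rule weak_deriv_unique[OF _ weak_derivI])

lemma has_weak_deriv_Nil: "loc_integrable U f ==> has_weak_deriv U [] f f"
 by (simp add: has_weak_deriv_def)

lemma has_weak_deriv_linear:
 fixes f f' :: "real^'d::finite => 'b::euclidean_space"
 assumes U: "open U" and f: "has_weak_deriv U is f g" and f': "has_weak_deriv U is f' g'"
 shows "has_weak_deriv U is (%x. a *R f x + b *R f' x) (%x. a *R g x + b *R g' x)"
proof -
 have li: "loc_integrable U f" "loc_integrable U g" "loc_integrable U f'" "loc_integrable U g'"
 using has_weak_derivD(1,2)[OF f] has_weak_derivD(1,2)[OF f'] .
 have lin: "(LINT x|lebesgue_on U. ph x *R (a *R h x + b *R h' x)) =
 a *R (LINT x|lebesgue_on U. ph x *R h x) + b *R (LINT x|lebesgue_on U. ph x *R h' x)"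
 if t: "test_fun U ph" and h: "loc_integrable U h" "loc_integrable U h'" for ph and h h' :: "real^'d => 'b"
 proof -
 obtain K where K: "compact K" "K \<subseteq> U" "!!x. x ~: K ==> ph x = 0" and s: "smooth_on UNIV ph"
 using t unfolding test_fun_def by blast
 note int = loc_integrable_mult(1)[OF _ U K smooth_on_continuous0[OF s]]
 have "(LINT x|lebesgue_on U. ph x *R (a *R h x + b *R h' x)) =
 (LINT x|lebesgue_on U. a *R (ph x *R h x) + b *R (ph x *R h' x))"
 by (simp add: algebra_simps)
 also have "... = a *R (LINT x|lebesgue_on U. ph x *R h x) + b *R (LINT x|lebesgue_on U. ph x *R h' x)"
 by (subst Bochner_Integration.integral_add)
 (auto intro!: integrable_scaleR_right int h simp del: scaleR_scaleR)
 finally show ?thesis .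
 qed
 show ?thesis unfolding has_weak_deriv_def
 proof (intro conjI allI impI)
 fix ph assume t: "test_fun U ph"
 show "(LINT x|lebesgue_on U. pds is ph x *R (a *R f x + b *R f' x)) =
 (- 1) ^ length is *R (LINT x|lebesgue_on U. ph x *R (a *R g x + b *R g' x))"
 unfolding lin[OF t li(2,4)] lin[OF test_fun_pds[OF t] li(1,3)]
 has_weak_derivD(3)[OF f t] has_weak_derivD(3)[OF f' t]
 by (simp add: algebra_simps)
 qed (intro loc_integrable_linear li)+
qed

lemma loc_integrable_subset: "loc_integrable U f ==> V \<subseteq> U ==> loc_integrable V f"
 unfolding loc_integrable_def by blast

lemma has_weak_deriv_subset:
 fixes f :: "real^'d::finite => 'b::euclidean_space"
 assumes f: "has_weak_deriv U is f g" and V: "V \<subseteq> U" "open V" "open U"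
 shows "has_weak_deriv V is f g"
 unfolding has_weak_deriv_def
proof (intro conjI allI impI)
 fix ph assume t: "test_fun V ph"
 hence tU: "test_fun U ph" using V(1) unfolding test_fun_def by (meson subset_trans)
 have z: "pds js ph x = 0" if "x ~: V" for x js
 using test_fun_pds[OF t, of js] that unfolding test_fun_def by blast
 have eq: "(LINT x|lebesgue_on V. pds js ph x *R h x) = (LINT x|lebesgue_on U. pds js ph x *R h x)" for js and h :: "real^'d => 'b"
 using V z by (subst (1 2) integral_lebesgue_on_supp) auto
 show "(LINT x|lebesgue_on V. pds is ph x *R f x) = (- 1) ^ length is *R (LINT x|lebesgue_on V. ph x *R g x)"
 using has_weak_derivD(3)[OF f tU] eq[of "is" f] eq[of "[]" g] by simp
qed (intro loc_integrable_subset[OF _ V(1)] has_weak_derivD(1,2)[OF f])+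

text \<open>Test the first relation with \<open>pd i ph\<close>: since \<open>pds [j, i] ph\<close>
  is \<open>pd j (pd i ph)\<close>, the head of the list is the derivative already taken. This reads
  second-order weak derivatives as weak derivatives of the gradient.\<close>

lemma has_weak_deriv_swap:
 fixes f :: "real^'d::finite => 'b::euclidean_space"
 assumes f: "has_weak_deriv U [j] f g" and w: "has_weak_deriv U [j, i] f w"
 shows "has_weak_deriv U [i] g w"
 unfolding has_weak_deriv_def
proof (intro conjI allI impI)
 fix ph assume t: "test_fun U ph"
 have ti: "test_fun U (pd i ph)" using test_fun_pds[OF t, of "[i]"] by simp
 show "(LINT x|lebesgue_on U. pds [i] ph x *R g x) = (- 1) ^ length [i] *R (LINT x|lebesgue_on U. ph x *R w x)"
 using has_weak_derivD(3)[OF f ti] has_weak_derivD(3)[OF w t] by (simp add: minus_equation_iff)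
qed (rule has_weak_derivD[OF f] has_weak_derivD[OF w])+

lemma has_weak_deriv_inner:
 fixes f :: "real^'d::finite => 'b::euclidean_space"
 assumes U: "open U" and f: "has_weak_deriv U is f g"
 shows "has_weak_deriv U is (%x. f x \<bullet> c) (%x. g x \<bullet> c)"
 unfolding has_weak_deriv_def
proof (intro conjI allI impI)
 have li: "loc_integrable U f" "loc_integrable U g" using has_weak_derivD(1,2)[OF f] .
 thus "loc_integrable U (%x. f x \<bullet> c)" "loc_integrable U (%x. g x \<bullet> c)" by (auto intro: loc_integrable_inner)
 fix ph assume t: "test_fun U ph"
 have lin: "(LINT x|lebesgue_on U. pds js ph x *R (h x \<bullet> c)) = (LINT x|lebesgue_on U. pds js ph x *R h x) \<bullet> c"
 if h: "loc_integrable U h" for js and h :: "real^'d => 'b"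
 proof -
 obtain K where K: "compact K" "K \<subseteq> U" "!!x. x ~: K ==> pds js ph x = 0" and s: "smooth_on UNIV (pds js ph)"
 using test_fun_pds[OF t, of js] unfolding test_fun_def by blast
 have "(LINT x|lebesgue_on U. (pds js ph x *R h x) \<bullet> c) = (LINT x|lebesgue_on U. pds js ph x *R h x) \<bullet> c"
 using loc_integrable_mult(1)[OF h U K smooth_on_continuous0[OF s]] by (intro integral_inner_left) auto
 thus ?thesis by simp
 qed
 show "(LINT x|lebesgue_on U. pds is ph x *R (f x \<bullet> c)) = (- 1) ^ length is *R (LINT x|lebesgue_on U. ph x *R (g x \<bullet> c))"
 using lin[OF li(1), of "is"] lin[OF li(2), of "[]"] has_weak_derivD(3)[OF f t] by simp
qed

text \<open>By translation invariance every difference quotient of \<open>F\<close> has integral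
  zero, and the quotients converge to \<open>pd i F\<close> boundedly, with supports in a common
  ball.\<close>

lemma integral_pd_eq_0:
 fixes F :: "real^'d::finite => 'b::euclidean_space"
 assumes diff: "!!x. F differentiable (at x)" and cont: "continuous_on UNIV (pd i F)"
 and K: "compact K" "!!x. x ~: K ==> F x = 0"
 shows "integral\<^sup>L lborel (pd i F) = 0"
proof -
 have Fc: "continuous_on UNIV F"
 using diff by (simp add: continuous_at_imp_continuous_on differentiable_imp_continuous_within)
 obtain M where "M >= 0" and M: "!!x. x : K ==> norm (pd i F x) <= M"
 by (rule compact_bound_norm[OF continuous_on_subset[OF cont subset_UNIV] K(1)], rule that)
 have z: "pd i F x = 0" if "x ~: K" for x
 using K that by (intro pd_eq_0_outside[of K]) (auto intro: compact_imp_closed)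
 have M': "norm (pd i F x) <= max M 0" for x using M[of x] z[of x] by (cases "x : K") auto
 let ?e = "axis i 1 :: real^'d"
 have der: "((%t. F (x + t *R ?e)) has_vector_derivative pd i F (x + t *R ?e)) (at t)" for x t
 proof -
 have "((%t. x + t *R ?e) has_derivative (%t. t *R ?e)) (at t)" by (auto intro!: derivative_eq_intros)
 from has_derivative_compose[OF this has_derivative_pd[OF diff]]
 show ?thesis
 by (simp add: has_vector_derivative_def axis_def if_distrib[of "%c. _ * c"] if_distrib[of "%c. c *R _"] cong: if_cong)
 qed
 have lip: "norm (F (x + t *R ?e) - F x) <= max M 0 * \<bar>t\<bar>" for x t
 proof -
 have "norm ((%t. F (x + t *R ?e)) t - (%t. F (x + t *R ?e)) 0) <= max M 0 * norm (t - 0)"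
 proof (rule differentiable_bound[of UNIV])
 show "((%t. F (x + t *R ?e)) has_derivative (%h. h *R pd i F (x + s *R ?e))) (at s within UNIV)" for s
 using der[of x s] by (simp add: has_vector_derivative_def)
 show "onorm (%h. h *R pd i F (x + s *R ?e)) <= max M 0" for s
 using M'[of "x + s *R ?e"] by (intro onorm_le) (simp add: mult.commute mult_left_mono)
 qed auto
 thus ?thesis by simp
 qed
 obtain R where R: "!!x. x : K ==> norm x <= R"
 by (rule compact_bound_norm[OF continuous_on_id K(1)], rule that)
 define q where "q n x = real (Suc n) *R (F (x + (1 / real (Suc n)) *R ?e) - F x)" for n x
 have Fi: "integrable lborel F"
 proof -
 have "integrable lborel (%x. indicator K x *R F x)"
 by (rule borel_integrable_compact[OF K(1) continuous_on_subset[OF Fc subset_UNIV]])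
 moreover have "(%x. indicator K x *R F x) = F" using K(2) by (auto simp: indicator_def fun_eq_iff)
 ultimately show ?thesis by simp
 qed
 have Fm: "F : borel_measurable borel" using Fc by (rule bm_contI)
 have shift: "has_bochner_integral lborel (%x. F (x + a)) (integral\<^sup>L lborel F)" for a
 proof -
 have "integrable (distr lborel borel ((+) a)) F" using Fi by (simp add: lborel_distr_plus)
 hence 1: "integrable lborel (%x. F (a + x))" by (subst (asm) integrable_distr_eq) (auto simp: Fm)
 have "integral\<^sup>L lborel (%x. F (a + x)) = integral\<^sup>L (distr lborel borel ((+) a)) F"
 by (subst integral_distr) (auto simp: Fm)
 with 1 show ?thesis by (simp add: has_bochner_integral_iff lborel_distr_plus add.commute)
 qed
 have q0: "integral\<^sup>L lborel (q n) = 0" for n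
 using shift[of "(1 / real (Suc n)) *R ?e"] Fi
 unfolding q_def has_bochner_integral_iff by simp
 \<comment> \<open>Steps have length at most 1 and \<open>K\<close> lies in the ball of radius
   \<open>R\<close>, so all quotients live in the ball of radius \<open>R + 1\<close> and are
   bounded by the Lipschitz constant of \<open>F\<close> along the axis.\<close>
 have "(%n. integral\<^sup>L lborel (q n)) ----> integral\<^sup>L lborel (pd i F)"
 proof (rule integral_dominated_convergence[where w="%x. indicator (cball 0 (R + 1)) x * max M 0"])
 show "pd i F : borel_measurable lborel" using cont bm_contI by simp
 have "continuous_on UNIV (%x. F (x + a))" for a
 by (intro continuous_on_compose2[OF Fc]) (auto intro!: continuous_intros)
 hence "continuous_on UNIV (q n)" for n unfolding q_def by (intro continuous_intros Fc)
 thus "q n : borel_measurable lborel" for n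
 by (simp add: bm_contI)
 show "integrable lborel (%x::real^'d. indicator (cball 0 (R + 1)) x * max M 0)"
 using emeasure_lborel_cball_finite[of "0::real^'d" "R+1"] by (intro integrable_mult_left) auto
 show "AE x in lborel. (%n. q n x) ----> pd i F x"
 proof (rule always_eventually, rule allI)
 fix x
 have "((%t. (F (x + t *R ?e) - F x) /\<^sub>R t) \<longlongrightarrow> pd i F x) (at 0)"
 proof -
 have "((%h. norm (F (x + h *R ?e) - F x - h *R pd i F x) / norm h) \<longlongrightarrow> 0) (at 0)"
 using der[of x 0] by (simp add: has_vector_derivative_def has_derivative_at)
 hence "((%h. norm ((F (x + h *R ?e) - F x) /\<^sub>R h - pd i F x)) \<longlongrightarrow> 0) (at 0)"
 proof (rule Lim_transform_eventually)
 have "norm (F (x + h *R ?e) - F x - h *R pd i F x) / norm h = norm ((F (x + h *R ?e) - F x) /\<^sub>R h - pd i F x)"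
 if "h ~= 0" for h
 proof -
 have "(F (x + h *R ?e) - F x) /\<^sub>R h - pd i F x = (F (x + h *R ?e) - F x - h *R pd i F x) /\<^sub>R h"
 using that by (simp add: scaleR_diff_right)
 thus ?thesis by (simp add: divide_inverse_commute)
 qed
 thus "\<forall>\<^sub>F h in at 0. norm (F (x + h *R ?e) - F x - h *R pd i F x) / norm h = norm ((F (x + h *R ?e) - F x) /\<^sub>R h - pd i F x)"
 by (auto simp: eventually_at_filter)
 qed
 thus ?thesis unfolding tendsto_norm_zero_iff by (rule LIM_zero_cancel)
 qed
 hence "(%n. (F (x + (1 / real (Suc n)) *R ?e) - F x) /\<^sub>R (1 / real (Suc n))) ----> pd i F x"
 proof (rule filterlim_compose)
 have "(%n. 1 / real (Suc n)) ----> 0"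
 using LIMSEQ_inverse_real_of_nat by (simp add: inverse_eq_divide)
 thus "filterlim (%n. 1 / real (Suc n)) (at 0) sequentially" by (simp add: filterlim_at)
 qed
 thus "(%n. q n x) ----> pd i F x" by (simp add: q_def)
 qed
 show "AE x in lborel. norm (q n x) <= indicator (cball 0 (R + 1)) x * max M 0" for n
 proof (rule always_eventually, rule allI)
 fix x
 show "norm (q n x) <= indicator (cball 0 (R + 1)) x * max M 0"
 proof (cases "norm x <= R + 1")
 case True
 have "norm (q n x) <= real (Suc n) * (max M 0 * \<bar>1 / real (Suc n)\<bar>)"
 unfolding q_def norm_scaleR using lip[of x "1 / real (Suc n)"] by (intro mult_mono) auto
 thus ?thesis using True by simp
 next
 case False
 have "x ~: K" using False R[of x] by auto
 moreover have "x + (1 / real (Suc n)) *R ?e ~: K"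
 proof
 assume "x + (1 / real (Suc n)) *R ?e : K"
 hence "norm (x + (1 / real (Suc n)) *R ?e) <= R" by (rule R)
 moreover have "norm x - norm ((1 / real (Suc n)) *R ?e) <= norm (x + (1 / real (Suc n)) *R ?e)"
 using norm_triangle_ineq4[of "x + (1 / real (Suc n)) *R ?e" "(1 / real (Suc n)) *R ?e"] by simp
 moreover have "norm ((1 / real (Suc n)) *R ?e) <= 1" by simp
 ultimately show False using False by linarith
 qed
 ultimately show ?thesis using False by (simp add: q_def K(2))
 qed
 qed
 qed
 thus ?thesis unfolding q0 using LIMSEQ_unique[OF _ tendsto_const] by blast
qed

text \<open>Integrate the product rule for \<open>ph x *R f x\<close>, a compactly supported
  function to which \<open>integral_pd_eq_0\<close> applies.\<close>

lemma smooth_has_weak_deriv: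
 fixes f :: "real^'d::finite => 'b::euclidean_space"
 assumes U: "open U" and f: "smooth_on UNIV f"
 shows "has_weak_deriv U [i] f (pd i f)"
 unfolding has_weak_deriv_def
proof (intro conjI allI impI)
 have c: "continuous_on UNIV f" "continuous_on UNIV (pd i f)"
 using smooth_on_continuous0[OF f] smooth_on_continuous0[OF smooth_on_pd[OF f]] .
 show li: "loc_integrable U f" "loc_integrable U (pd i f)"
 by (rule loc_integrable_continuous[OF continuous_on_subset[OF c(1) subset_UNIV]]
 loc_integrable_continuous[OF continuous_on_subset[OF c(2) subset_UNIV]])+
 fix ph assume t: "test_fun U ph"
 obtain K where K: "compact K" "K \<subseteq> U" "!!x. x ~: K ==> ph x = 0" and s: "smooth_on UNIV ph"
 using t unfolding test_fun_def by blast
 have z: "pd i ph x = 0" if "x ~: K" for x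
 using K that by (intro pd_eq_0_outside[of K]) (auto intro: compact_imp_closed)
 have sc: "continuous_on UNIV ph" "continuous_on UNIV (pd i ph)"
 using smooth_on_continuous0[OF s] smooth_on_continuous0[OF smooth_on_pd[OF s]] .
 define F where "F x = ph x *R f x" for x
 have pdF: "pd i F = (%x. ph x *R pd i f x + pd i ph x *R f x)"
 unfolding F_def using smooth_on_differentiable0[OF s] smooth_on_differentiable0[OF f]
 by (auto simp: fun_eq_iff intro!: pd_mult)
 have "integral\<^sup>L lborel (pd i F) = 0"
 proof (rule integral_pd_eq_0[of F i K])
 show "F differentiable at x" for x
 unfolding F_def using smooth_on_differentiable0[OF s] smooth_on_differentiable0[OF f]
 by (intro differentiable_scaleR) auto
 show "continuous_on UNIV (pd i F)" unfolding pdF by (intro continuous_intros c sc)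
 show "F x = 0" if "x ~: K" for x using K(3)[OF that] by (simp add: F_def)
 qed (fact K)
 moreover have "integral\<^sup>L lebesgue (pd i F) = integral\<^sup>L lborel (pd i F)"
 by (rule integral_completion) (auto simp: pdF intro!: bm_contI continuous_intros c sc)
 moreover have "integral\<^sup>L lebesgue (pd i F) = integral\<^sup>L (lebesgue_on U) (pd i F)"
 proof (intro integral_lebesgue_on_supp[symmetric])
 show "pd i F x = 0" if "x ~: U" for x
 proof -
 have "x ~: K" using that K(2) by blast
 thus ?thesis using z[of x] K(3)[of x] by (simp add: pdF)
 qed
 qed (use U in simp)
 moreover have "integral\<^sup>L (lebesgue_on U) (pd i F) = (LINT x|lebesgue_on U. ph x *R pd i f x) + (LINT x|lebesgue_on U. pd i ph x *R f x)"
 unfolding pdF by (intro Bochner_Integration.integral_add loc_integrable_mult(1)[OF _ U K(1,2)] li sc K z)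
 ultimately show "(LINT x|lebesgue_on U. pds [i] ph x *R f x) = (- 1) ^ length [i] *R (LINT x|lebesgue_on U. ph x *R pd i f x)"
 by (simp add: add_eq_0_iff)
qed

lemma loc_integrable_AE_cong:
 fixes f f' :: "real^'d::finite => 'b::euclidean_space"
 assumes U: "open U" and eq: "AE x in lebesgue_on U. f x = f' x" and f: "loc_integrable U f"
 shows "loc_integrable U f'"
 unfolding loc_integrable_def
proof safe
 fix K assume K: "compact K" "K \<subseteq> U"
 have KL: "K : sets lebesgue" using K(1) by (simp add: borel_compact)
 have 1: "integrable lebesgue (%x. indicator K x *R f x)"
 using f K KL unfolding loc_integrable_def by (subst integrable_restrict_space[symmetric]) auto
 have ae: "AE x in lebesgue. indicator K x *R f x = indicator K x *R f' x"
 using eq U K(2) by (auto simp: AE_lebesgue_on indicator_def elim!: eventually_mono)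
 have "integrable lebesgue (%x. indicator K x *R f' x)"
 using integrable_cong_AE_imp[OF 1 _ ae] borel_measurable_AE[OF borel_measurable_integrable[OF 1] ae] by (auto simp: eq_commute)
 thus "integrable (lebesgue_on K) f'" using KL by (subst integrable_restrict_space) auto
qed

lemma has_weak_deriv_AE_cong:
 fixes f f' :: "real^'d::finite => 'b::euclidean_space"
 assumes U: "open U" and eq: "AE x in lebesgue_on U. f x = f' x"
 shows "has_weak_deriv U is f = has_weak_deriv U is f'"
proof -
 have *: "has_weak_deriv U is h' g" if h: "has_weak_deriv U is h g" and e: "AE x in lebesgue_on U. h x = h' x"
 for g and h h' :: "real^'d => 'b"
 unfolding has_weak_deriv_def
 proof (intro conjI allI impI)
 have li: "loc_integrable U h" by (rule has_weak_derivD(1)[OF h])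
 show li': "loc_integrable U h'" by (rule loc_integrable_AE_cong[OF U e li])
 fix ph assume t: "test_fun U ph"
 obtain K where K: "compact K" "K \<subseteq> U" "!!x. x ~: K ==> pds is ph x = 0" and s: "smooth_on UNIV (pds is ph)"
 using test_fun_pds[OF t, of "is"] unfolding test_fun_def by blast
 note int = loc_integrable_mult(1)[OF _ U K smooth_on_continuous0[OF s], THEN borel_measurable_integrable]
 have "(LINT x|lebesgue_on U. pds is ph x *R h' x) = (LINT x|lebesgue_on U. pds is ph x *R h x)"
 using e by (intro integral_cong_AE int li li') (auto elim!: eventually_mono)
 thus "(LINT x|lebesgue_on U. pds is ph x *R h' x) = (- 1) ^ length is *R (LINT x|lebesgue_on U. ph x *R g x)"
 using has_weak_derivD(3)[OF h t] by simp
 qed (rule has_weak_derivD(2)[OF h])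
 have eq': "AE x in lebesgue_on U. f' x = f x" using eq by (auto simp: eq_commute)
 show ?thesis using *[OF _ eq] *[OF _ eq'] by (auto simp: fun_eq_iff)
qed

text \<open>The predicate \<open>has_weak_deriv U is\<close> is the same for both functions, so
  \<open>SOME\<close> picks the same witness: an equality of functions, not only almost
  everywhere.\<close>

lemma weak_deriv_AE_cong:
 fixes f f' :: "real^'d::finite => 'b::euclidean_space"
 assumes U: "open U" and eq: "AE x in lebesgue_on U. f x = f' x"
 shows "weak_deriv U is f = weak_deriv U is f'"
 unfolding weak_deriv_def has_weak_deriv_AE_cong[OF assms] ..

section \<open>Functions with bounded weak derivatives\<close>

lemma distr_lebesgue_shift:
 "(%x. x + a) : lebesgue \<rightarrow>\<^sub>M lebesgue" "distr lebesgue lebesgue (%x. x + a) = lebesgue"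
 for a :: "'a::euclidean_space"
proof -
 have T: "(%x. a + (\<Sum>j\<in>Basis. (1 * (x \<bullet> j)) *R j)) = (%x. x + a)"
 by (simp add: euclidean_representation add.commute)
 show "(%x. x + a) : lebesgue \<rightarrow>\<^sub>M lebesgue"
 using lebesgue_affine_measurable[of "%_. 1" a] by (simp add: euclidean_representation add.commute)
 show "distr lebesgue lebesgue (%x. x + a) = lebesgue"
 using lebesgue_affine_euclidean[of "%_. 1" a] by (simp add: euclidean_representation add.commute density_1)
qed

lemma has_bochner_integral_lebesgue_shift:
 fixes f :: "'a::euclidean_space => 'b::euclidean_space"
 assumes "integrable lebesgue f"
 shows "integrable lebesgue (%x. f (x + a))" "integral\<^sup>L lebesgue (%x. f (x + a)) = integral\<^sup>L lebesgue f"
proof -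
 have "integrable (distr lebesgue lebesgue (%x. x + a)) f" unfolding distr_lebesgue_shift by (rule assms)
 thus "integrable lebesgue (%x. f (x + a))"
 using integrable_distr_eq[OF distr_lebesgue_shift(1)[of a] borel_measurable_integrable[OF assms]] by blast
 have "integral\<^sup>L (distr lebesgue lebesgue (%x. x + a)) f = integral\<^sup>L lebesgue (%x. f (x + a))"
 by (rule integral_distr[OF distr_lebesgue_shift(1) borel_measurable_integrable[OF assms]])
 thus "integral\<^sup>L lebesgue (%x. f (x + a)) = integral\<^sup>L lebesgue f"
 by (simp only: distr_lebesgue_shift)
qed

lemma pd_bound_lipschitz:
 fixes f :: "real^'d::finite => 'b::euclidean_space"
 assumes C: "convex C" and d: "!!x. x : C ==> f differentiable (at x)"
 and M: "!!i x. x : C ==> norm (pd i f x) <= M" and xy: "x : C" "y : C"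
 shows "norm (f x - f y) <= real CARD('d) * M * norm (x - y)"
proof (rule differentiable_bound[OF C _ _ xy])
 show "(f has_derivative (%h. \<Sum>i\<in>UNIV. h $ i *R pd i f x)) (at x within C)" if "x : C" for x
 using has_derivative_pd[OF d[OF that]] by (rule has_derivative_at_withinI)
 show "onorm (%h. \<Sum>i\<in>UNIV. h $ i *R pd i f x) <= real CARD('d) * M" if "x : C" for x
 proof (rule onorm_le)
 fix h :: "real^'d"
 have "norm (\<Sum>i\<in>UNIV. h $ i *R pd i f x) <= (\<Sum>i\<in>(UNIV::'d set). norm h * M)"
 by (intro sum_norm_le) (simp add: mult_mono[OF component_le_norm_cart M[OF that]])
 thus "norm (\<Sum>i\<in>UNIV. h $ i *R pd i f x) <= real CARD('d) * M * norm h" by (simp add: algebra_simps)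
 qed
qed

lemma compact_support_bound:
 fixes f :: "real^'d::finite => 'b::euclidean_space"
 assumes "continuous_on UNIV f" "compact K" "!!x. x ~: K ==> f x = 0"
 obtains M where "M >= 0" "!!x. norm (f x) <= M"
proof -
 obtain M where M: "M >= 0" "!!x. x : K ==> norm (f x) <= M"
 by (rule compact_bound_norm[OF continuous_on_subset[OF assms(1) subset_UNIV] assms(2)], rule that)
 have "norm (f x) <= M" for x using M assms(3)[of x] by (cases "x : K") auto
 thus ?thesis using M(1) that by blast
qed

lemma test_fun_lipschitz:
 assumes "test_fun U ph"
 obtains L where "L >= 0" "!!x y. \<bar>ph x - ph y\<bar> <= L * norm (x - y)"
proof -
 obtain K where K: "compact K" "!!x. x ~: K ==> ph x = 0" and s: "smooth_on UNIV ph"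
 using assms unfolding test_fun_def by blast
 have "EX M. M >= 0 & (ALL x. norm (pd i ph x) <= M)" for i
 using K by (rule_tac compact_support_bound[of "pd i ph" K])
 (auto intro!: smooth_on_continuous0 smooth_on_pd s pd_eq_0_outside[of K] compact_imp_closed)
 then obtain M where M: "!!i. M i >= 0" "!!i x. norm (pd i ph x) <= M i" by metis
 have "norm (pd i ph x) <= (\<Sum>i\<in>UNIV. M i)" for i x
 using M by (intro order_trans[OF M(2)] member_le_sum) auto
 hence "norm (ph x - ph y) <= real CARD('a) * (\<Sum>i\<in>UNIV. M i) * norm (x - y)" for x y
 by (intro pd_bound_lipschitz[of UNIV]) (auto simp: smooth_on_differentiable0[OF s])
 thus ?thesis using M(1) by (intro that[of "real CARD('a) * (\<Sum>i\<in>UNIV. M i)"]) (auto intro!: mult_nonneg_nonneg sum_nonneg)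
qed

text \<open>Moving a test function along \<open>h\<close> in \<open>n\<close> small steps, each of which costs a derivative of the
  test function, hence a weak derivative of \<open>f\<close>.\<close>

lemma weak_deriv_bounded_shift:
 fixes f :: "real^'d::finite => real"
 assumes B: "open B" "convex B" and w: "!!i. has_weak_deriv B [i] f (w i)"
 and M: "!!i. AE x in lebesgue_on B. \<bar>w i x\<bar> <= M" and M0: "0 <= M"
 shows "AE x in lebesgue_on {x : B. x + h : B}. f (x + h) - f x <= M * (\<Sum>i\<in>UNIV. \<bar>h $ i\<bar>)"
proof -
 define C where "C = M * (\<Sum>i\<in>UNIV. \<bar>h $ i\<bar>)"
 define W where "W = {x : B. x + h : B}"
 have "W = B \<inter> (%x. x + h) -` B" by (auto simp: W_def)
 moreover have "open ((%x. x + h) -` B)" using B(1) by (intro open_vimage continuous_intros)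
 ultimately have W: "open W" using B(1) by auto
 have fB: "loc_integrable B f" by (rule has_weak_derivD(1)[OF w])
 have fW: "loc_integrable W f" by (rule loc_integrable_subset[OF fB]) (auto simp: W_def)
 have fhK: "integrable lebesgue (%x. indicator K x *R f (x + h))" if K: "compact K" "K \<subseteq> W" for K
 proof -
 have K': "compact ((%x. x + h) ` K)" "(%x. x + h) ` K \<subseteq> B" using K by (auto simp: W_def compact_translation[of _ h, simplified add.commute] intro!: compact_continuous_image continuous_intros)
 hence "integrable (lebesgue_on ((%x. x + h) ` K)) f" using fB unfolding loc_integrable_def by simp
 hence "integrable lebesgue (%x. indicator ((%x. x + h) ` K) x *R f x)"
 using K'(1) by (subst (asm) integrable_restrict_space) (auto simp: borel_compact)
 from has_bochner_integral_lebesgue_shift(1)[OF this, of h]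
 show ?thesis by (rule Bochner_Integration.integrable_cong[OF refl, THEN iffD1, rotated]) (auto simp: indicator_def)
 qed
 have fhW: "loc_integrable W (%x. f (x + h))"
 unfolding loc_integrable_def
 proof (intro allI impI, elim conjE)
 fix K assume K: "compact K" "K \<subseteq> W"
 show "integrable (lebesgue_on K) (%x. f (x + h))"
 using fhK[OF K] K(1) by (subst integrable_restrict_space) (auto simp: borel_compact)
 qed
 have CW: "loc_integrable W (%_. C)" by (rule loc_integrable_continuous) simp
 define g where "g x = C - (f (x + h) - f x)" for x
 have gW: "loc_integrable W g"
 using loc_integrable_linear[OF CW loc_integrable_linear[OF fhW fW, of 1 "-1"], of 1 "-1"]
 by (simp add: g_def[abs_def] diff_diff_eq2 add_diff_eq)
 have "AE x in lebesgue_on W. 0 <= g x"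
 proof (rule fundamental_nonneg[OF W gW])
 fix ph assume t: "test_fun W ph" and pos: "!!x. 0 <= ph x"
 obtain K where K: "compact K" "K \<subseteq> W" "!!x. x ~: K ==> ph x = 0" and s: "smooth_on UNIV ph"
 using t unfolding test_fun_def by blast
 note sc = smooth_on_continuous0[OF s]
 \<comment> \<open>The region swept by \<open>K\<close> as it moves along \<open>h\<close>. Both end
   positions lie in \<open>B\<close>, so convexity keeps it inside, and every intermediate translate
   of \<open>ph\<close> is a test function on \<open>B\<close>.\<close>
 define Kh where "Kh = (%(s, x). x + s *R h) ` ({0..1} \<times> K)"
 have Kh: "compact Kh" unfolding Kh_def using K(1)
 by (intro compact_continuous_image compact_Times) (auto simp: case_prod_beta intro!: continuous_intros)
 have KhB: "Kh \<subseteq> B"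
 proof
 fix y assume "y : Kh"
 then obtain s x where sx: "0 <= s" "s <= 1" "x : K" "y = x + s *R h" by (auto simp: Kh_def)
 hence "x : B" "x + h : B" using K(2) by (auto simp: W_def)
 hence "(1 - s) *R x + s *R (x + h) : B" using B(2) sx by (intro convexD) auto
 thus "y : B" using sx(4) by (simp add: algebra_simps)
 qed
 define phs where "phs s x = ph (x - s *R h)" for s x
 have phs0: "phs s x = 0" if "0 <= s" "s <= 1" "x ~: Kh" for s x
 proof -
 have "x - s *R h ~: K"
 proof
 assume "x - s *R h : K"
 hence "(%(s, x). x + s *R h) (s, x - s *R h) : Kh" unfolding Kh_def using that by (intro imageI) auto
 thus False using that by simp
 qed
 thus ?thesis by (simp add: phs_def K(3))
 qed
 have sm: "smooth_on UNIV (phs s)" for s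
 using smooth_on_compose_add[OF s, of "- s *R h"] by (simp add: phs_def[abs_def])
 have ts: "test_fun B (phs s)" if "0 <= s" "s <= 1" for s
 unfolding test_fun_def using sm Kh KhB phs0[OF that] by blast
 have cs: "continuous_on UNIV (phs s)" for s by (rule smooth_on_continuous0[OF sm])
 define pz where "pz y = (\<Sum>i\<in>UNIV. h $ i * pd i ph y)" for y
 have "EX L. L >= 0 & (ALL x y. \<bar>pd i ph x - pd i ph y\<bar> <= L * norm (x - y))" for i
 using test_fun_pds[OF t, of "[i]"] by (rule_tac test_fun_lipschitz[of W "pd i ph"]) auto
 then obtain Li where Li: "!!i. Li i >= 0" "!!i x y. \<bar>pd i ph x - pd i ph y\<bar> <= Li i * norm (x - y)" by metis
 define L where "L = (\<Sum>i\<in>UNIV. \<bar>h $ i\<bar> * Li i)"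
 have L0: "0 <= L" unfolding L_def using Li(1) by (intro sum_nonneg mult_nonneg_nonneg) auto
 have L: "\<bar>pz x - pz y\<bar> <= L * norm (x - y)" for x y
 proof -
 have "\<bar>pz x - pz y\<bar> = \<bar>\<Sum>i\<in>UNIV. h $ i * (pd i ph x - pd i ph y)\<bar>"
 by (simp add: pz_def sum_subtractf algebra_simps)
 also have "... <= (\<Sum>i\<in>UNIV. \<bar>h $ i\<bar> * (Li i * norm (x - y)))"
 by (intro order_trans[OF sum_abs] sum_mono) (simp add: abs_mult mult_left_mono Li)
 finally show ?thesis by (simp add: L_def sum_distrib_right mult.assoc)
 qed
 \<comment> \<open>Second-order remainder: the derivative of \<open>u\<close> is a difference of two
   values of \<open>pz\<close>, bounded by the Lipschitz constant of \<open>pz\<close> times the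
   distance moved.\<close>
 have taylor: "\<bar>ph (y - de *R h) - ph y + de * pz y\<bar> <= L * norm h * de^2" if de: "0 <= de" for y de
 proof -
 define u where "u t = ph (y - t *R h) + t * pz y" for t
 have "norm (u de - u 0) <= (L * norm h * de) * norm (de - 0)"
 proof (rule field_differentiable_bound[of "{0..de}"])
 fix t assume t: "t : {0..de}"
 have "((%t. y - t *R h) has_derivative (%t. - t *R h)) (at t)" by (auto intro!: derivative_eq_intros)
 from has_derivative_compose[OF this has_derivative_pd[OF smooth_on_differentiable0[OF s UNIV_I]]]
 have "((%t. ph (y - t *R h)) has_field_derivative - pz (y - t *R h)) (at t)"
 unfolding has_field_derivative_def
 by (rule has_derivative_eq_rhs) (simp add: pz_def fun_eq_iff sum_distrib_left sum_negf[symmetric] algebra_simps)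
 hence "(u has_field_derivative - pz (y - t *R h) + pz y) (at t)"
 unfolding u_def by (auto intro!: derivative_eq_intros)
 thus "(u has_field_derivative - pz (y - t *R h) + pz y) (at t within {0..de})"
 by (rule has_field_derivative_at_within)
 have "\<bar>pz y - pz (y - t *R h)\<bar> <= L * norm (t *R h)" using L[of y "y - t *R h"] by simp
 also have "... <= L * norm h * de" using t L0 by (auto simp: mult.assoc mult.commute[of "norm h"] intro!: mult_left_mono mult_right_mono)
 finally show "norm (- pz (y - t *R h) + pz y) <= L * norm h * de" by simp
 qed (use de in auto)
 thus ?thesis using de by (simp add: u_def power2_eq_square algebra_simps)
 qed
 define I where "I hh v = (LINT x|lebesgue_on B. hh x *R v x)" for hh v :: "real^'d => real"
 define A where "A = (LINT x|lebesgue_on B. indicator Kh x * \<bar>f x\<bar>)"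
 have fKh: "integrable (lebesgue_on B) (%x. indicator Kh x * f x)"
 proof -
 have "integrable (lebesgue_on Kh) f" using fB Kh KhB unfolding loc_integrable_def by simp
 hence "integrable lebesgue (%x. indicator Kh x * f x)"
 using Kh by (subst (asm) integrable_restrict_space) (auto simp: borel_compact)
 thus ?thesis using B(1) KhB by (subst integrable_lebesgue_on_supp) (auto simp: indicator_def)
 qed
 have AKh: "integrable (lebesgue_on B) (%x. indicator Kh x * \<bar>f x\<bar>)"
 using integrable_abs[OF fKh] by (simp add: abs_mult)
 note int = loc_integrable_mult(1)[OF _ B(1) Kh KhB]
 \<comment> \<open>One step from \<open>s\<close> to \<open>s + de\<close>: the linear term is
   turned into weak derivatives, bounded by \<open>M\<close>; the remainder is of order
   \<open>de^2\<close> times the mass \<open>A\<close> of \<open>f\<close> on the swept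
   region.\<close>
 have step: "I (phs (s + de)) f - I (phs s) f <= de * (C * integral\<^sup>L lebesgue ph) + L * norm h * de^2 * A"
 if sde: "0 <= s" "0 <= de" "s + de <= 1" for s de
 proof -
 have s01: "0 <= s" "s <= 1" using sde by auto
 have pds0: "pd i (phs s) x = 0" if "x ~: Kh" for i x
 using that Kh phs0[OF s01] by (intro pd_eq_0_outside[of Kh]) (auto intro: compact_imp_closed)
 have pdsc: "continuous_on UNIV (pd i (phs s))" for i by (rule smooth_on_continuous0[OF smooth_on_pd[OF sm]])
 have pds_eq: "pd i (phs s) x = pd i ph (x - s *R h)" for i x
 using pd_compose_add[of ph x "- s *R h" i] smooth_on_differentiable0[OF s] by (simp add: phs_def[abs_def])
 have i1: "integrable (lebesgue_on B) (%x. phs (s + de) x *R f x)" "integrable (lebesgue_on B) (%x. phs s x *R f x)"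
 proof -
 have z1: "!!x. x ~: Kh ==> phs (s + de) x = 0" using phs0 sde by simp
 show "integrable (lebesgue_on B) (%x. phs (s + de) x *R f x)" by (rule int[OF fB z1 cs])
 show "integrable (lebesgue_on B) (%x. phs s x *R f x)" by (rule int[OF fB phs0[OF s01] cs])
 qed
 have i2: "integrable (lebesgue_on B) (%x. pd i (phs s) x *R f x)" for i
 by (rule int[OF fB pds0 pdsc])
 have i3: "integrable (lebesgue_on B) (%x. phs s x *R w i x)" for i
 by (rule int[OF has_weak_derivD(2)[OF w] phs0[OF s01] cs])
 define r where "r x = phs (s + de) x - phs s x + de * (\<Sum>i\<in>UNIV. h $ i * pd i (phs s) x)" for x
 have r: "\<bar>r x\<bar> <= indicator Kh x * (L * norm h * de^2)" for x
 proof (cases "x : Kh")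
 case True
 thus ?thesis using taylor[OF sde(2), of "x - s *R h"]
 by (simp add: r_def phs_def pds_eq pz_def[symmetric] algebra_simps)
 next
 case False
 thus ?thesis using phs0[of "s + de" x] phs0[of s x] pds0[of x] sde by (simp add: r_def)
 qed
 have split: "r x *R f x = phs (s + de) x *R f x - phs s x *R f x + de * (\<Sum>i\<in>UNIV. h $ i * (pd i (phs s) x *R f x))" for x
 by (simp add: r_def algebra_simps sum_distrib_left sum_distrib_right)
 have i2': "integrable (lebesgue_on B) (%x. de * (\<Sum>i\<in>UNIV. h $ i * (pd i (phs s) x *R f x)))"
 by (intro integrable_mult_right Bochner_Integration.integrable_sum i2)
 have "(LINT x|lebesgue_on B. r x *R f x) = I (phs (s + de)) f - I (phs s) f +
 de * (\<Sum>i\<in>UNIV. h $ i * (LINT x|lebesgue_on B. pd i (phs s) x *R f x))"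
 unfolding split I_def
 by (subst Bochner_Integration.integral_add[OF Bochner_Integration.integrable_diff[OF i1] i2'],
 subst Bochner_Integration.integral_diff[OF i1], subst integral_mult_right_zero,
 subst Bochner_Integration.integral_sum) (use i2 in auto)
 also have "(\<Sum>i\<in>UNIV. h $ i * (LINT x|lebesgue_on B. pd i (phs s) x *R f x)) = - (\<Sum>i\<in>UNIV. h $ i * I (phs s) (w i))"
 unfolding sum_negf[symmetric] using has_weak_derivD(3)[OF w ts[OF s01]]
 by (intro sum.cong refl) (simp add: I_def)
 finally have 1: "I (phs (s + de)) f - I (phs s) f = de * (\<Sum>i\<in>UNIV. h $ i * I (phs s) (w i)) + (LINT x|lebesgue_on B. r x *R f x)"
 by (simp add: algebra_simps)
 have ir: "integrable (lebesgue_on B) (%x. r x *R f x)"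
 unfolding split by (intro Bochner_Integration.integrable_add Bochner_Integration.integrable_diff i1 i2')
 have 2: "(LINT x|lebesgue_on B. r x *R f x) <= L * norm h * de^2 * A"
 proof -
 have "(LINT x|lebesgue_on B. r x *R f x) <= (LINT x|lebesgue_on B. (L * norm h * de^2) * (indicator Kh x * \<bar>f x\<bar>))"
 proof (rule integral_mono[OF ir integrable_mult_right[OF AKh]])
 fix x
 have "r x *R f x <= \<bar>r x\<bar> * \<bar>f x\<bar>" by (simp add: abs_mult[symmetric])
 also have "... <= (indicator Kh x * (L * norm h * de^2)) * \<bar>f x\<bar>" using r[of x] by (intro mult_right_mono) auto
 finally show "r x *R f x <= (L * norm h * de^2) * (indicator Kh x * \<bar>f x\<bar>)" by (simp add: algebra_simps)
 qed
 thus ?thesis by (simp add: A_def)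
 qed
 have ip: "integrable (lebesgue_on B) (phs s)"
 using int[OF loc_integrable_continuous[of B "%_. 1::real"] phs0[OF s01] cs] by simp
 have 3: "h $ i * I (phs s) (w i) <= \<bar>h $ i\<bar> * (M * integral\<^sup>L lebesgue ph)" for i
 proof -
 have "\<bar>I (phs s) (w i)\<bar> <= (LINT x|lebesgue_on B. \<bar>phs s x *R w i x\<bar>)" unfolding I_def by (rule integral_abs_bound)
 also have "... <= (LINT x|lebesgue_on B. M * phs s x)"
 proof (rule integral_mono_AE)
 show "AE x in lebesgue_on B. \<bar>phs s x *R w i x\<bar> <= M * phs s x"
 using M[of i] by (rule eventually_mono) (use pos in \<open>auto simp: abs_mult phs_def mult.commute[of M] intro!: mult_left_mono\<close>)
 qed (use i3 ip in auto)
 also have "... = M * (LINT x|lebesgue_on B. phs s x)" by simp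
 also have "(LINT x|lebesgue_on B. phs s x) = integral\<^sup>L lebesgue (phs s)"
 using B(1) KhB phs0[OF s01] by (intro integral_lebesgue_on_supp) (auto simp: subset_iff)
 also have "integral\<^sup>L lebesgue (phs s) = integral\<^sup>L lebesgue ph"
 proof -
 have "integrable lebesgue ph"
 using loc_integrable_mult(2)[OF loc_integrable_continuous[of W "%_. 1::real"] W K sc] by simp
 from has_bochner_integral_lebesgue_shift(2)[OF this, of "- s *R h"] show ?thesis by (simp add: phs_def[abs_def])
 qed
 finally have "\<bar>I (phs s) (w i)\<bar> <= M * integral\<^sup>L lebesgue ph" .
 hence "\<bar>h $ i\<bar> * \<bar>I (phs s) (w i)\<bar> <= \<bar>h $ i\<bar> * (M * integral\<^sup>L lebesgue ph)" by (rule mult_left_mono) simp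
 thus ?thesis by (simp add: abs_mult[symmetric])
 qed
 have "(\<Sum>i\<in>UNIV. h $ i * I (phs s) (w i)) <= (\<Sum>i\<in>UNIV. \<bar>h $ i\<bar> * (M * integral\<^sup>L lebesgue ph))" by (rule sum_mono[OF 3])
 also have "... = (\<Sum>i\<in>UNIV. \<bar>h $ i\<bar>) * (M * integral\<^sup>L lebesgue ph)" by (rule sum_distrib_right[symmetric])
 also have "... = C * integral\<^sup>L lebesgue ph" by (simp add: C_def)
 finally show ?thesis unfolding 1 using 2 sde(2) by (intro add_mono mult_left_mono) auto
 qed
 \<comment> \<open>\<open>n + 1\<close> steps of length \<open>1 / (n + 1)\<close> accumulate a
   remainder of order \<open>1 / (n + 1)\<close> only.\<close>
 have main: "I (phs 1) f - I (phs 0) f <= C * integral\<^sup>L lebesgue ph + L * norm h * A / real (Suc n)" for n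
 proof -
 let ?de = "1 / real (Suc n)"
 define b where "b = ?de * (C * integral\<^sup>L lebesgue ph) + L * norm h * ?de\<^sup>2 * A"
 have "I (phs (real k * ?de)) f - I (phs 0) f <= real k * b"
 if "k <= Suc n" for k
 using that
 proof (induction k)
 case (Suc k)
 have "real k * ?de + ?de = real (Suc k) * ?de" by (simp add: algebra_simps add_divide_distrib)
 moreover have "real (Suc k) * ?de <= 1" using Suc.prems by (simp add: field_simps)
 ultimately have "I (phs (real (Suc k) * ?de)) f - I (phs (real k * ?de)) f <= b"
 using step[of "real k * ?de" ?de] unfolding b_def by simp
 moreover have "I (phs (real k * ?de)) f - I (phs 0) f <= real k * b"
 using Suc by simp
 moreover have "real (Suc k) * b = real k * b + b" by (simp add: algebra_simps)
 ultimately show ?case by linarith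
 qed simp
 from this[of "Suc n"] have "I (phs 1) f - I (phs 0) f <= real (Suc n) * b" by simp
 also have "... = C * integral\<^sup>L lebesgue ph + L * norm h * A / real (Suc n)"
 proof -
 have "m * (1 / m * X + Y * (1 / m)^2 * A) = X + Y * A / m" if "m > 0" for m X Y :: real
 using that by (simp add: power2_eq_square field_simps)
 thus ?thesis unfolding b_def by simp
 qed
 finally show ?thesis .
 qed
 have "(%n. C * integral\<^sup>L lebesgue ph + L * norm h * A * inverse (real (Suc n))) ----> C * integral\<^sup>L lebesgue ph + L * norm h * A * 0"
 by (intro tendsto_intros LIMSEQ_inverse_real_of_nat)
 hence fin: "I (phs 1) f - I (phs 0) f <= C * integral\<^sup>L lebesgue ph"
 using main by (intro LIMSEQ_le_const[where X="%n. C * integral\<^sup>L lebesgue ph + L * norm h * A * inverse (real (Suc n))"])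
 (auto simp: divide_inverse)
 have e0: "I (phs 0) f = (LINT x|lebesgue. ph x * f x)"
 unfolding I_def using B(1) phs0[of 0] KhB by (subst integral_lebesgue_on_supp) (auto simp: phs_def subset_iff)
 \<comment> \<open>Translating the integral moves the full shift from the test function to
   \<open>f\<close>.\<close>
 have e1: "I (phs 1) f = (LINT x|lebesgue. ph x * f (x + h))"
 proof -
 have "I (phs 1) f = (LINT x|lebesgue. phs 1 x * f x)"
 unfolding I_def using B(1) phs0[of 1] KhB by (subst integral_lebesgue_on_supp) (auto simp: subset_iff)
 also have "... = (LINT x|lebesgue. phs 1 (x + h) * f (x + h))"
 proof (rule has_bochner_integral_lebesgue_shift(2)[symmetric])
 show "integrable lebesgue (%x. phs 1 x * f x)"
 proof -
 have z1: "!!x. x ~: Kh ==> phs 1 x = 0" using phs0 by simp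
 show ?thesis using loc_integrable_mult(2)[OF fB B(1) Kh KhB z1 cs] by simp
 qed
 qed
 finally show ?thesis by (simp add: phs_def)
 qed
 note iW = loc_integrable_mult(2)[OF _ W K sc]
 have supp: "(LINT x|lebesgue_on W. ph x * g x) = (LINT x|lebesgue. ph x * g x)"
 using W K by (intro integral_lebesgue_on_supp) (auto simp: subset_iff)
 have i1: "integrable lebesgue (%x. ph x * C)" using iW[OF CW] by simp
 have i2: "integrable lebesgue (%x. ph x * f (x + h))" using iW[OF fhW] by simp
 have i3: "integrable lebesgue (%x. ph x * f x)" using iW[OF fW] by simp
 have "(LINT x|lebesgue. ph x * g x) = (LINT x|lebesgue. ph x * C - (ph x * f (x + h) - ph x * f x))"
 by (simp add: g_def right_diff_distrib)
 also have "... = (LINT x|lebesgue. ph x * C) - ((LINT x|lebesgue. ph x * f (x + h)) - (LINT x|lebesgue. ph x * f x))"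
 using Bochner_Integration.integral_diff[OF i1 Bochner_Integration.integrable_diff[OF i2 i3]]
 Bochner_Integration.integral_diff[OF i2 i3] by simp
 also have "... = C * integral\<^sup>L lebesgue ph - (I (phs 1) f - I (phs 0) f)" by (simp add: e0 e1)
 also have "... >= 0" using fin by simp
 finally show "0 <= (LINT x|lebesgue_on W. ph x * g x)" by (simp add: supp)
 qed
 thus ?thesis unfolding g_def W_def C_def by simp
qed

lemma AE_ex_open:
 fixes U :: "'a::euclidean_space set"
 assumes "AE y in lebesgue. P y" "open U" "U ~= {}"
 shows "EX y:U. P y"
proof -
 obtain N where N: "N : null_sets lebesgue" "{y. \<not> P y} \<subseteq> N"
 using assms(1) by (auto simp: eventually_ae_filter)
 have "\<not> U \<subseteq> N"
 proof
 assume "U \<subseteq> N"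
 hence "negligible U" using N(1) negligible_iff_null_sets negligible_subset by blast
 thus False using open_not_negligible assms by blast
 qed
 thus ?thesis using N(2) by blast
qed

text \<open>By Fubini, almost every pair of points satisfies the Lipschitz bound; comparing two points with a
  third one close to the first gives the bound on a set of full measure.\<close>

lemma AE_lipschitz_rep:
 fixes f :: "real^'d::finite => real"
 assumes B: "open B" and f: "f : borel_measurable (lebesgue_on B)" and C: "0 <= C"
 and h: "!!h. AE x in lebesgue_on {x : B. x + h : B}. \<bar>f (x + h) - f x\<bar> <= C * norm h"
 obtains G where "C-lipschitz_on B G" "AE x in lebesgue_on B. f x = G x"
proof -
 \<comment> \<open>The exchange of quantifiers below needs a Borel function, so \<open>f\<close>,
   cut off outside \<open>B\<close>, is replaced by a Borel representative \<open>g\<close>.\<close>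
 have "(%x. indicator B x * f x) : borel_measurable lebesgue"
 using f B borel_measurable_restrict_space_iff[of B lebesgue f] by simp
 then obtain g where g: "g : borel_measurable lborel" "AE x in lborel. indicator B x * f x = g x"
 using completion_ex_borel_measurable_real by blast
 have gm: "g : borel_measurable borel" using g(1) by simp
 have fg: "AE x in lebesgue. x : B --> f x = g x"
 using AE_completion[OF g(2)] by (rule eventually_mono) (auto simp: indicator_def)
 have fgs: "AE x in lebesgue. x + a : B --> f (x + a) = g (x + a)" for a
 proof -
 have "AE x in distr lebesgue lebesgue (%x. x + a). x : B --> f x = g x"
 unfolding distr_lebesgue_shift by (rule fg)
 then obtain N where N: "N : null_sets lebesgue" "{x. \<not> (x : B --> f x = g x)} \<subseteq> N"
 using fg by (auto simp: eventually_ae_filter)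
 have "AE x in distr lebesgue lebesgue (%x. x + a). x ~: N" unfolding distr_lebesgue_shift using N(1) by (rule AE_not_in)
 hence "AE x in lebesgue. x + a ~: N"
 proof (subst (asm) AE_distr_iff[OF distr_lebesgue_shift(1)])
 have "{x : space lebesgue. x ~: N} = space lebesgue - N" by auto
 thus "{x : space lebesgue. x ~: N} : sets lebesgue"
 using N(1) sets.compl_sets[of N lebesgue] by (simp add: null_sets_def)
 qed
 thus ?thesis by (rule eventually_mono) (use N(2) in auto)
 qed
 define Q where "Q h x \<longleftrightarrow> (x : B & x + h : B --> \<bar>g (x + h) - g x\<bar> <= C * norm h)" for h x
 have Qh: "AE x in lborel. Q h x" for h
 proof -
 have "{x : B. x + h : B} = B \<inter> (%x. x + h) -` B" by auto
 hence "open {x : B. x + h : B}" using B by (auto intro!: open_Int open_vimage continuous_intros)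
 hence "AE x in lebesgue. x : B & x + h : B --> \<bar>f (x + h) - f x\<bar> <= C * norm h"
 using h[of h] by (simp add: AE_lebesgue_on)
 with fg fgs[of h] have "AE x in lebesgue. Q h x" by eventually_elim (auto simp: Q_def)
 thus ?thesis by (simp add: AE_completion_iff)
 qed
 have Bm [measurable]: "B : sets borel" using B by simp
 have "AE x in lborel. AE h in lborel. Q h x"
 proof (rule lborel_pair.AE_commute[THEN iffD1])
 have [measurable]: "g : borel_measurable borel" by (rule gm)
 show "{p : space (lborel \<Otimes>\<^sub>M lborel). Q (fst p) (snd p)} : sets (lborel \<Otimes>\<^sub>M lborel)"
 unfolding Q_def by measurable
 show "AE h in lborel. AE x in lborel. Q h x" using Qh by simp
 qed
 hence Qx: "AE x in lebesgue. AE h in lborel. Q h x" by (rule AE_completion)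
 define A where "A = {x : B. f x = g x & (AE h in lborel. Q h x)}"
 have AB: "AE x in lebesgue. x : B --> x : A"
 using fg Qx by eventually_elim (simp add: A_def)
 have good: "AE y in lebesgue. y : B --> \<bar>g y - g x\<bar> <= C * norm (y - x)" if x: "x : A" for x
 proof -
 have [measurable]: "g : borel_measurable borel" by (rule gm)
 have "AE h in lborel. Q h x" using x by (simp add: A_def)
 hence "AE h in lborel. x + h : B --> \<bar>g (x + h) - g x\<bar> <= C * norm ((x + h) - x)"
 using x by (auto simp: Q_def A_def elim!: eventually_mono)
 hence "AE y in distr lborel borel ((+) x). y : B --> \<bar>g y - g x\<bar> <= C * norm (y - x)"
 by (subst AE_distr_iff) auto
 thus ?thesis unfolding lborel_distr_plus by (rule AE_completion)
 qed
 have lip: "C-lipschitz_on A g"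
 proof (rule lipschitz_onI)
 fix x x' assume x: "x : A" "x' : A"
 have "\<bar>g x - g x'\<bar> <= C * norm (x - x') + e" if e: "e > 0" for e
 proof -
 define ep where "ep = e / (2 * (C + 1))"
 have ep: "ep > 0" using e C by (simp add: ep_def)
 have "AE y in lebesgue. (y : B --> \<bar>g y - g x\<bar> <= C * norm (y - x)) & (y : B --> \<bar>g y - g x'\<bar> <= C * norm (y - x'))"
 using good[OF x(1)] good[OF x(2)] by (rule AE_conjI)
 moreover have "open (ball x ep \<inter> B)" using B by auto
 moreover have "x : ball x ep \<inter> B" using x ep by (simp add: A_def)
 hence "ball x ep \<inter> B ~= {}" by blast
 ultimately have "EX y:ball x ep \<inter> B. (y : B --> \<bar>g y - g x\<bar> <= C * norm (y - x)) & (y : B --> \<bar>g y - g x'\<bar> <= C * norm (y - x'))"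
 by (rule AE_ex_open)
 then obtain y where y: "y : ball x ep \<inter> B" "(y : B --> \<bar>g y - g x\<bar> <= C * norm (y - x)) & (y : B --> \<bar>g y - g x'\<bar> <= C * norm (y - x'))"
 by (elim bexE)
 have yx: "norm (y - x) <= ep" using y by (simp add: dist_norm norm_minus_commute)
 have "norm (y - x') <= norm (y - x) + norm (x - x')" using norm_triangle_ineq[of "y - x" "x - x'"] by simp
 hence "C * norm (y - x') <= C * (ep + norm (x - x'))" using yx C by (intro mult_left_mono) auto
 moreover have "C * norm (y - x) <= C * ep" using yx C by (intro mult_left_mono)
 ultimately have "\<bar>g x - g x'\<bar> <= C * norm (x - x') + 2 * C * ep" using y by (auto simp: algebra_simps)
 also have "2 * C * ep <= 2 * (C + 1) * ep" using ep by simp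
 also have "2 * (C + 1) * ep = e" using C by (simp add: ep_def)
 finally show ?thesis by simp
 qed
 hence "\<bar>g x - g x'\<bar> <= C * norm (x - x')" by (rule field_le_epsilon)
 thus "dist (g x) (g x') <= C * dist x x'" by (simp add: dist_norm)
 qed (fact C)
 then obtain G where G: "C-lipschitz_on (closure A) G" "ALL x:A. G x = g x"
 using lipschitz_extend_closure by blast
 \<comment> \<open>A set of full measure in the open set \<open>B\<close> meets every nonempty open
   subset of it, so the extension to \<open>closure A\<close> is defined on all of
   \<open>B\<close>.\<close>
 have "B \<subseteq> closure A"
 proof
 fix x assume x: "x : B"
 show "x : closure A"
 unfolding closure_approachable
 proof (intro allI impI)
 fix e :: real assume "e > 0"
 hence "x : ball x e \<inter> B" using x by simp
 hence ne: "ball x e \<inter> B ~= {}" by blast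
 have "open (ball x e \<inter> B)" using B by auto
 from this ne have "EX y:ball x e \<inter> B. y : B --> y : A" by (rule AE_ex_open[OF AB])
 thus "EX y:A. dist y x < e" by (elim bexE) (auto simp: dist_commute)
 qed
 qed
 hence "C-lipschitz_on B G" by (rule lipschitz_on_subset[OF G(1)])
 moreover have "AE x in lebesgue_on B. f x = G x"
 using AB B G(2) by (auto simp: AE_lebesgue_on A_def elim!: eventually_mono)
 ultimately show ?thesis by (rule that)
qed

lemma lipschitz_agree:
 fixes G G' :: "'a::euclidean_space => real"
 assumes U: "open U" "x : U" and c: "continuous_on U G" "continuous_on U G'"
 and e: "AE y in lebesgue. y : U --> G y = G' y"
 shows "G x = G' x"
proof (rule ccontr)
 assume ne: "G x ~= G' x"
 define V where "V = U \<inter> (%y. G y - G' y) -` (- {0})"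
 have "continuous_on U (%y. G y - G' y)" by (intro continuous_intros c)
 hence V: "open V" unfolding V_def using U(1) by (intro continuous_open_preimage) auto
 moreover have "V ~= {}" using ne U(2) by (auto simp: V_def)
 ultimately have "EX y:V. y : U --> G y = G' y" by (rule AE_ex_open[OF e])
 thus False by (auto simp: V_def)
qed

text \<open>Two continuous representatives agree on overlaps, since they agree almost everywhere
  there. Lindelof's theorem reduces the cover to countably many balls, so the exceptional sets still
  add up to a null set.\<close>

lemma glue_lipschitz_rep:
 fixes f :: "real^'d::finite => real"
 assumes K: "open K"
 and loc: "!!c r. ball c r \<subseteq> K ==> EX G. C-lipschitz_on (ball c r) G & (AE x in lebesgue_on (ball c r). f x = G x)"
 obtains G where "!!c r. ball c r \<subseteq> K ==> C-lipschitz_on (ball c r) G" "AE x in lebesgue_on K. f x = G x"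
proof -
 have "ALL x. EX r. x : K --> r > 0 & ball x r \<subseteq> K" using K open_contains_ball by blast
 from choice[OF this] obtain r where r: "ALL x. x : K --> r x > 0 & ball x (r x) \<subseteq> K" ..
 have "ALL x. EX G. x : K --> C-lipschitz_on (ball x (r x)) G & (AE y in lebesgue_on (ball x (r x)). f y = G y)"
 using loc r by blast
 from choice[OF this] obtain Gx
 where Gx: "ALL x. x : K --> C-lipschitz_on (ball x (r x)) (Gx x) & (AE y in lebesgue_on (ball x (r x)). f y = Gx x y)" ..
 define G where "G y = Gx y y" for y
 have agree: "G y = G' y" if c: "ball c ro \<subseteq> K" and G': "C-lipschitz_on (ball c ro) G'"
 and e: "AE x in lebesgue_on (ball c ro). f x = G' x" and y: "y : ball c ro" for c ro G' y
 proof -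
 have yK: "y : K" using c y by blast
 let ?U = "ball c ro \<inter> ball y (r y)"
 show ?thesis unfolding G_def
 proof (rule lipschitz_agree[of ?U y "Gx y" G'])
 show "open ?U" by auto
 show "y : ?U" using y r yK by auto
 show "continuous_on ?U (Gx y)" using Gx yK by (intro lipschitz_on_continuous_on[OF lipschitz_on_subset]) auto
 show "continuous_on ?U G'" using G' by (intro lipschitz_on_continuous_on[OF lipschitz_on_subset]) auto
 have "AE x in lebesgue. x : ball c ro --> f x = G' x" using e by (simp add: AE_lebesgue_on)
 moreover have "AE x in lebesgue. x : ball y (r y) --> f x = Gx y x" using Gx yK by (simp add: AE_lebesgue_on)
 ultimately show "AE x in lebesgue. x : ?U --> Gx y x = G' x" by eventually_elim auto
 qed
 qed
 show ?thesis
 proof (rule that[of G])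
 fix c ro assume c: "ball c ro \<subseteq> K"
 obtain G' where G': "C-lipschitz_on (ball c ro) G'" "AE x in lebesgue_on (ball c ro). f x = G' x" using loc[OF c] by blast
 show "C-lipschitz_on (ball c ro) G"
 using G'(1) by (rule lipschitz_on_transform) (use agree[OF c G'] in auto)
 next
 define \<F> where "\<F> = (%x. ball x (r x)) ` K"
 obtain \<F>' where F': "\<F>' \<subseteq> \<F>" "countable \<F>'" "\<Union>\<F>' = \<Union>\<F>"
 by (rule Lindelof[of \<F>]) (auto simp: \<F>_def)
 have "AE x in lebesgue. ALL S:\<F>'. x : S --> f x = G x"
 unfolding AE_ball_countable[OF F'(2)]
 proof
 fix S assume "S : \<F>'"
 then obtain x where x: "x : K" "S = ball x (r x)" using F'(1) by (auto simp: \<F>_def)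
 have s: "ball x (r x) \<subseteq> K" using r x by simp
 have l: "C-lipschitz_on (ball x (r x)) (Gx x)" and e: "AE y in lebesgue_on (ball x (r x)). f y = Gx x y" using Gx x by auto
 have "AE y in lebesgue. y : ball x (r x) --> f y = Gx x y" using e by (simp add: AE_lebesgue_on)
 thus "AE y in lebesgue. y : S --> f y = G y"
 unfolding x(2) by (rule eventually_mono) (use agree[OF s l e] in auto)
 qed
 hence "AE x in lebesgue. x : K --> f x = G x"
 proof (rule eventually_mono)
 fix y assume y: "ALL S:\<F>'. y : S --> f y = G y"
 show "y : K --> f y = G y"
 proof
 assume "y : K"
 hence "y : ball y (r y)" "ball y (r y) : \<F>" using r by (auto simp: \<F>_def)
 hence "y : \<Union>\<F>'" unfolding F'(3) by blast
 thus "f y = G y" using y by blast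
 qed
 qed
 thus "AE x in lebesgue_on K. f x = G x" using K by (simp add: AE_lebesgue_on)
 qed
qed

section \<open>Boundary values on curvilinear elements\<close>

text \<open>The condition under the definite description in \<open>bdry_value\<close>, named so that
  limits can be combined before the description is evaluated.\<close>

definition esslim :: "(real^'d::finite) set => (real^'d => 'b::euclidean_space) => real^'d => 'b => bool" where
 "esslim U f x l \<longleftrightarrow> (ALL ep>0. EX de>0. AE y in lebesgue_on (U \<inter> ball x de). dist (f y) l < ep)"

lemma bdry_value_esslim: "bdry_value U f x = (THE l. esslim U f x l)"
 by (simp add: bdry_value_def esslim_def)

text \<open>Since \<open>x\<close> lies in the closure of the open set \<open>U\<close>, every
  \<open>U \<inter> ball x de\<close> is open and nonempty, hence not null; \<open>f\<close> cannot
  be almost everywhere close to two values on it.\<close>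

lemma esslim_unique:
 assumes U: "open U" "x : closure U" and l: "esslim U f x l" "esslim U f x l'"
 shows "l = l'"
proof (rule ccontr)
 assume "l ~= l'"
 hence e: "dist l l' / 2 > 0" by simp
 obtain de de' where d: "de > 0" "AE y in lebesgue_on (U \<inter> ball x de). dist (f y) l < dist l l' / 2"
 "de' > 0" "AE y in lebesgue_on (U \<inter> ball x de'). dist (f y) l' < dist l l' / 2"
 using l e unfolding esslim_def by meson
 have "AE y in lebesgue. y : U \<inter> ball x de --> dist (f y) l < dist l l' / 2"
 "AE y in lebesgue. y : U \<inter> ball x de' --> dist (f y) l' < dist l l' / 2"
 using d U(1) by (simp_all add: AE_lebesgue_on open_Int)
 hence ae: "AE y in lebesgue. y ~: U \<inter> ball x (min de de')"
 proof eventually_elim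
 case (elim y)
 show ?case
 proof
 assume "y : U \<inter> ball x (min de de')"
 hence "dist (f y) l < dist l l' / 2" "dist (f y) l' < dist l l' / 2" using elim by auto
 thus False using dist_triangle_half_r[of "f y" l "dist l l'" l'] by (simp add: dist_commute)
 qed
 qed
 have "open (U \<inter> ball x (min de de'))" using U(1) by auto
 moreover have "U \<inter> ball x (min de de') ~= {}"
 proof -
 obtain y where "y : U" "dist y x < min de de'"
 using U(2) d(1,3) unfolding closure_approachable by (metis min_less_iff_conj)
 thus ?thesis by (auto simp: dist_commute)
 qed
 ultimately have "EX y:U \<inter> ball x (min de de'). y ~: U \<inter> ball x (min de de')" by (rule AE_ex_open[OF ae])
 thus False by blast
qed

lemma bdry_value_eqI:
 "open U ==> x : closure U ==> esslim U f x l ==> bdry_value U f x = l"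
 unfolding bdry_value_esslim by (rule the_equality) (auto intro: esslim_unique)

lemma esslim_linear:
 assumes U: "open U" and l: "esslim U f x l" "esslim U g x m"
 shows "esslim U (%y. a *R f y + b *R g y) x (a *R l + b *R m)"
 unfolding esslim_def
proof (intro allI impI)
 fix ep :: real assume ep: "ep > 0"
 define e where "e = ep / (2 * (\<bar>a\<bar> + \<bar>b\<bar> + 1))"
 have e: "e > 0" using ep by (simp add: e_def add_nonneg_pos)
 obtain de de' where d: "de > 0" "AE y in lebesgue_on (U \<inter> ball x de). dist (f y) l < e"
 "de' > 0" "AE y in lebesgue_on (U \<inter> ball x de'). dist (g y) m < e"
 using l e unfolding esslim_def by meson
 have "AE y in lebesgue. y : U \<inter> ball x de --> dist (f y) l < e"
 "AE y in lebesgue. y : U \<inter> ball x de' --> dist (g y) m < e"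
 using d U by (simp_all add: AE_lebesgue_on open_Int)
 hence "AE y in lebesgue. y : U \<inter> ball x (min de de') --> dist (a *R f y + b *R g y) (a *R l + b *R m) < ep"
 proof eventually_elim
 case (elim y)
 show ?case
 proof
 assume "y : U \<inter> ball x (min de de')"
 hence 1: "norm (f y - l) <= e" "norm (g y - m) <= e" using elim by (auto simp: dist_norm)
 have "(a *R f y + b *R g y) - (a *R l + b *R m) = a *R (f y - l) + b *R (g y - m)" by (simp add: algebra_simps)
 hence "norm ((a *R f y + b *R g y) - (a *R l + b *R m)) <= \<bar>a\<bar> * norm (f y - l) + \<bar>b\<bar> * norm (g y - m)"
 using norm_triangle_ineq[of "a *R (f y - l)" "b *R (g y - m)"] by simp
 also have "... <= \<bar>a\<bar> * e + \<bar>b\<bar> * e" using 1 by (intro add_mono mult_left_mono) auto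
 also have "... <= (\<bar>a\<bar> + \<bar>b\<bar> + 1) * e" using e by (simp add: algebra_simps)
 also have "... = ep / 2" using e unfolding e_def by (simp add: field_simps add_nonneg_pos)
 also have "... < ep" using ep by simp
 finally show "dist (a *R f y + b *R g y) (a *R l + b *R m) < ep" by (simp add: dist_norm)
 qed
 qed
 moreover have "U \<inter> ball x (min de de') : sets lebesgue" using U by auto
 ultimately show "EX de>0. AE y in lebesgue_on (U \<inter> ball x de). dist (a *R f y + b *R g y) (a *R l + b *R m) < ep"
 using d by (intro exI[of _ "min de de'"]) (simp add: AE_lebesgue_on)
qed

lemma esslim_zero: "esslim U (%_. 0) x 0"
 unfolding esslim_def by (intro allI impI exI[of _ 1]) simp

lemma esslim_scaleR:
 assumes U: "open U" and l: "esslim U f x l"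
 shows "esslim U (%y. f y *R c) x (l *R c)"
 unfolding esslim_def
proof (intro allI impI)
 fix ep :: real assume ep: "ep > 0"
 have e: "ep / (norm c + 1) > 0" using ep by (simp add: add_nonneg_pos)
 then obtain de where d: "de > 0" "AE y in lebesgue_on (U \<inter> ball x de). dist (f y) l < ep / (norm c + 1)"
 using l unfolding esslim_def by meson
 have "AE y in lebesgue_on (U \<inter> ball x de). dist (f y *R c) (l *R c) < ep"
 using d(2)
 proof (rule eventually_mono)
 fix y assume "dist (f y) l < ep / (norm c + 1)"
 hence 1: "\<bar>f y - l\<bar> * (norm c + 1) < ep" by (simp add: dist_norm pos_less_divide_eq add_nonneg_pos)
 have "norm (f y *R c - l *R c) = \<bar>f y - l\<bar> * norm c" by (simp add: scaleR_left_diff_distrib[symmetric])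
 also have "... <= \<bar>f y - l\<bar> * (norm c + 1)" by (intro mult_left_mono) auto
 finally show "dist (f y *R c) (l *R c) < ep" using 1 by (simp add: dist_norm)
 qed
 thus "EX de>0. AE y in lebesgue_on (U \<inter> ball x de). dist (f y *R c) (l *R c) < ep" using d(1) by blast
qed

lemma esslim_sum:
 assumes U: "open U" and l: "!!i. i : I ==> esslim U (f i) x (l i)"
 shows "esslim U (%y. \<Sum>i\<in>I. f i y *R c i) x (\<Sum>i\<in>I. l i *R c i)"
 using l
proof (induction I rule: infinite_finite_induct)
 case (insert i I)
 have "esslim U (%y. 1 *R (f i y *R c i) + 1 *R (\<Sum>i\<in>I. f i y *R c i)) x (1 *R (l i *R c i) + 1 *R (\<Sum>i\<in>I. l i *R c i))"
 using insert by (intro esslim_linear[OF U] esslim_scaleR[OF U]) auto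
 thus ?case using insert by simp
qed (auto intro: esslim_zero)

lemma esslim_AE_cong:
 assumes U: "open U" and e: "AE y in lebesgue_on U. f y = g y"
 shows "esslim U f x = esslim U g x"
proof -
 have *: "esslim U g x l" if e: "AE y in lebesgue_on U. f y = g y" and l: "esslim U f x l" for f g :: "real^'a => 'b" and l
 unfolding esslim_def
 proof (intro allI impI)
 fix ep :: real assume "ep > 0"
 then obtain de where d: "de > 0" "AE y in lebesgue_on (U \<inter> ball x de). dist (f y) l < ep"
 using l unfolding esslim_def by meson
 have "AE y in lebesgue_on (U \<inter> ball x de). f y = g y" by (rule AE_lebesgue_on_subset[OF e]) (use U in auto)
 with d(2) have "AE y in lebesgue_on (U \<inter> ball x de). dist (g y) l < ep" by eventually_elim simp
 thus "EX de>0. AE y in lebesgue_on (U \<inter> ball x de). dist (g y) l < ep" using d(1) by blast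
 qed
 have e': "AE y in lebesgue_on U. g y = f y" using e by (simp add: eq_commute)
 show ?thesis using *[OF e] *[OF e'] by blast
qed

text \<open>The reference map is smooth and injective near a compact polytope. Invariance of domain
  makes the image of the interior open, compactness identifies its closure with the image of the
  polytope, and bounded derivatives on a convex set give the Lipschitz constant.\<close>

lemma
 fixes K :: "('d::finite) elem"
 assumes K: "curvilinear K"
 shows open_elset: "open (elset K)"
 and compact_elem: "compact (snd K ` fst K)"
 and closure_elset: "closure (elset K) = snd K ` fst K"
 and lipschitz_elem: "EX La>=0. ALL x:fst K. ALL y:fst K. norm (snd K x - snd K y) <= La * norm (x - y)"
 and inj_on_elem: "inj_on (snd K) (fst K)"
 and convex_elem: "convex (fst K)" "interior (fst K) ~= {}" "closure (interior (fst K)) = fst K"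
 and continuous_on_elem: "continuous_on (fst K) (snd K)"
proof -
 obtain U where U: "open U" "fst K \<subseteq> U" "smooth_on U (snd K)" "inj_on (snd K) U"
 using K unfolding curvilinear_def by blast
 have p: "polytope (fst K)" and ne: "interior (fst K) ~= {}" using K unfolding curvilinear_def by auto
 have cpt: "compact (fst K)" by (rule polytope_imp_compact[OF p])
 show cvx: "convex (fst K)" by (rule polytope_imp_convex[OF p])
 show "interior (fst K) ~= {}" by (rule ne)
 show cl: "closure (interior (fst K)) = fst K"
 using convex_closure_interior[OF cvx ne] cpt by (simp add: closure_closed compact_imp_closed)
 have cU: "continuous_on U (snd K)" by (rule smooth_on_continuous0[OF U(3)])
 show c: "continuous_on (fst K) (snd K)" by (rule continuous_on_subset[OF cU U(2)])
 show inj: "inj_on (snd K) (fst K)" by (rule inj_on_subset[OF U(4,2)])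
 show "compact (snd K ` fst K)" by (rule compact_continuous_image[OF c cpt])
 show op: "open (elset K)" unfolding elset_def
 by (rule invariance_of_domain[OF continuous_on_subset[OF c interior_subset] open_interior inj_on_subset[OF inj interior_subset]])
 show "closure (elset K) = snd K ` fst K"
 proof
 show "closure (elset K) \<subseteq> snd K ` fst K"
 using interior_subset[of "fst K"] compact_imp_closed[OF compact_continuous_image[OF c cpt]]
 by (intro closure_minimal) (auto simp: elset_def)
 show "snd K ` fst K \<subseteq> closure (elset K)"
 using image_closure_subset[of "interior (fst K)" "snd K" "closure (elset K)"] c cl closure_subset[of "elset K"]
 by (simp add: elset_def)
 qed
 have "EX M. M >= 0 & (ALL x:fst K. norm (pd i (snd K) x) <= M)" for i
 proof -
 have "continuous_on (fst K) (pd i (snd K))"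
 using smooth_on_continuous[OF U(3), of "[i]"] U(2) by (auto intro: continuous_on_subset)
 then obtain M where "M >= 0" "!!x. x : fst K ==> norm (pd i (snd K) x) <= M"
 by (rule compact_bound_norm[OF _ cpt]) blast
 thus ?thesis by blast
 qed
 then obtain M where M: "!!i. M i >= 0" "!!i x. x : fst K ==> norm (pd i (snd K) x) <= M i" by metis
 have "norm (pd i (snd K) x) <= (\<Sum>i\<in>UNIV. M i)" if "x : fst K" for i x
 using M(1) by (intro order_trans[OF M(2)[OF that]] member_le_sum) auto
 hence "norm (snd K x - snd K y) <= real CARD('d) * (\<Sum>i\<in>UNIV. M i) * norm (x - y)" if "x : fst K" "y : fst K" for x y
 using U by (intro pd_bound_lipschitz[OF cvx _ _ that]) (auto intro: smooth_on_differentiable0)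
 moreover have "0 <= real CARD('d) * (\<Sum>i\<in>UNIV. M i)" using M(1) by (intro mult_nonneg_nonneg sum_nonneg) auto
 ultimately show "EX La>=0. ALL x:fst K. ALL y:fst K. norm (snd K x - snd K y) <= La * norm (x - y)" by blast
qed

text \<open>The element may be non-convex, so Lipschitz bounds on balls inside it do not add up
  directly. Pulled back to the convex interior of the polytope they do: the image of a segment is
  followed by a chain of small balls, so \<open>G \<circ> snd K\<close> is Lipschitz there, extends
  to the closed polytope and returns through the continuous inverse.\<close>

lemma elem_boundary_extension:
 fixes K :: "('d::finite) elem" and G :: "real^'d => real"
 assumes K: "curvilinear K" and C: "0 <= C"
 and G: "!!c r. ball c r \<subseteq> elset K ==> C-lipschitz_on (ball c r) G"
 and f: "AE x in lebesgue_on (elset K). f x = G x"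
 obtains V where "continuous_on (snd K ` fst K) V" "!!x. x : snd K ` fst K ==> esslim (elset K) f x (V x)"
proof -
 let ?P = "fst K" and ?\<Phi> = "snd K"
 obtain La where La: "La >= 0" "!!x y. x : ?P ==> y : ?P ==> norm (?\<Phi> x - ?\<Phi> y) <= La * norm (x - y)"
 using lipschitz_elem[OF K] by blast
 have intP: "interior ?P \<subseteq> ?P" by (rule interior_subset)
 have lip: "(C * La)-lipschitz_on (interior ?P) (G \<circ> ?\<Phi>)"
 proof (rule lipschitz_onI)
 fix a b assume ab: "a : interior ?P" "b : interior ?P"
 have seg: "closed_segment a b \<subseteq> interior ?P"
 using ab convex_interior[OF convex_elem(1)[OF K]] by (rule closed_segment_subset)
 have "compact (?\<Phi> ` closed_segment a b)"
 by (intro compact_continuous_image continuous_on_subset[OF continuous_on_elem[OF K]]) (use seg intP in auto)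
 moreover have "?\<Phi> ` closed_segment a b \<subseteq> elset K" using seg by (auto simp: elset_def)
 ultimately obtain ro where ro: "ro > 0" "(\<Union>x\<in>?\<Phi> ` closed_segment a b. ball x ro) \<subseteq> elset K"
 using compact_subset_open_imp_ball_epsilon_subset[OF _ open_elset[OF K]] by blast
 \<comment> \<open>So many pieces that consecutive image points are less than \<open>ro\<close>
   apart and share a ball on which \<open>G\<close> is \<open>C\<close>-Lipschitz.\<close>
 obtain n where n: "La * norm (b - a) / ro < real n" using reals_Archimedean2 by blast
 have n0: "real n > 0" using n La(1) ro(1) by (smt (verit) divide_nonneg_pos mult_nonneg_nonneg norm_ge_zero)
 define c where "c k = a + (real k / real n) *R (b - a)" for k :: nat
 have cseg: "c k : closed_segment a b" if "k <= n" for k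
 unfolding closed_segment_def c_def using that n0
 by (intro CollectI exI[of _ "real k / real n"]) (auto simp: algebra_simps)
 have stp: "\<bar>G (?\<Phi> (c (Suc k))) - G (?\<Phi> (c k))\<bar> <= C * La * norm (b - a) / real n" if k: "Suc k <= n" for k
 proof -
 have inP: "c (Suc k) : ?P" "c k : ?P" using cseg[OF k] cseg[of k] k seg intP by auto
 have "c (Suc k) - c k = (1 / real n) *R (b - a)"
 by (simp add: c_def scaleR_left_diff_distrib[symmetric] diff_divide_distrib[symmetric])
 hence d: "norm (?\<Phi> (c (Suc k)) - ?\<Phi> (c k)) <= La * norm (b - a) / real n"
 using La(2)[OF inP] n0 by (simp add: norm_minus_commute)
 also have "... < ro" using n ro(1) n0 by (simp add: field_simps)
 finally have nb: "?\<Phi> (c (Suc k)) : ball (?\<Phi> (c k)) ro" by (simp add: dist_norm norm_minus_commute)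
 have "ball (?\<Phi> (c k)) ro \<subseteq> elset K" using ro(2) cseg[of k] k by auto
 from lipschitz_onD[OF G[OF this] nb, of "?\<Phi> (c k)"] ro(1)
 have "\<bar>G (?\<Phi> (c (Suc k))) - G (?\<Phi> (c k))\<bar> <= C * norm (?\<Phi> (c (Suc k)) - ?\<Phi> (c k))" by (simp add: dist_norm)
 also have "... <= C * (La * norm (b - a) / real n)" using d C by (rule mult_left_mono)
 finally show ?thesis by simp
 qed
 have "\<bar>G (?\<Phi> (c k)) - G (?\<Phi> (c 0))\<bar> <= real k * (C * La * norm (b - a) / real n)" if "k <= n" for k
 using that
 proof (induction k)
 case (Suc k)
 have "\<bar>G (?\<Phi> (c (Suc k))) - G (?\<Phi> (c 0))\<bar> <= \<bar>G (?\<Phi> (c (Suc k))) - G (?\<Phi> (c k))\<bar> + \<bar>G (?\<Phi> (c k)) - G (?\<Phi> (c 0))\<bar>" by linarith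
 also have "... <= C * La * norm (b - a) / real n + real k * (C * La * norm (b - a) / real n)"
 using Suc stp[of k] by (intro add_mono) auto
 finally show ?case by (simp add: algebra_simps add_divide_distrib)
 qed simp
 from this[of n] n0 have "\<bar>G (?\<Phi> b) - G (?\<Phi> a)\<bar> <= C * La * norm (b - a)" by (simp add: c_def)
 thus "dist ((G \<circ> ?\<Phi>) a) ((G \<circ> ?\<Phi>) b) <= C * La * dist a b" by (simp add: dist_norm abs_minus_commute norm_minus_commute)
 qed (use C La in auto)
 obtain H where H: "(C * La)-lipschitz_on (closure (interior ?P)) H" "ALL x:interior ?P. H x = (G \<circ> ?\<Phi>) x"
 using lipschitz_extend_closure[OF lip] by blast
 have Hc: "continuous_on ?P H" using lipschitz_on_continuous_on[OF H(1)] by (simp add: convex_elem(3)[OF K])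
 define \<Psi> where "\<Psi> = inv_into ?P ?\<Phi>"
 have \<Psi>: "\<Psi> (?\<Phi> x) = x" if "x : ?P" for x unfolding \<Psi>_def by (rule inv_into_f_f[OF inj_on_elem[OF K] that])
 have cptP: "compact ?P" using K by (simp add: curvilinear_def polytope_imp_compact)
 have \<Psi>c: "continuous_on (?\<Phi> ` ?P) \<Psi>"
 by (rule continuous_on_inv[OF continuous_on_elem[OF K] cptP]) (use \<Psi> in auto)
 define V where "V x = H (\<Psi> x)" for x
 have Vc: "continuous_on (?\<Phi> ` ?P) V"
 unfolding V_def by (rule continuous_on_compose2[OF Hc \<Psi>c]) (use \<Psi> in auto)
 have VG: "V y = G y" if "y : elset K" for y
 using that H(2) \<Psi> intP by (auto simp: elset_def V_def)
 show ?thesis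
 proof (rule that[OF Vc])
 fix x assume x: "x : ?\<Phi> ` ?P"
 show "esslim (elset K) f x (V x)"
 unfolding esslim_def
 proof (intro allI impI)
 fix ep :: real assume "ep > 0"
 then obtain de where de: "de > 0" "!!y. y : ?\<Phi> ` ?P ==> dist y x < de ==> dist (V y) (V x) < ep"
 using Vc x unfolding continuous_on_iff by metis
 have "AE y in lebesgue_on (elset K \<inter> ball x de). f y = G y"
 by (rule AE_lebesgue_on_subset[OF f]) (use open_elset[OF K] in auto)
 hence "AE y in lebesgue_on (elset K \<inter> ball x de). dist (f y) (V x) < ep"
 proof (rule lebesgue_on_mono)
 fix y assume y: "f y = G y" "y : elset K \<inter> ball x de"
 hence "y : ?\<Phi> ` ?P" using intP by (auto simp: elset_def)
 thus "dist (f y) (V x) < ep" using de(2)[of y] y VG[of y] by (simp add: dist_commute)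
 qed
 thus "EX de>0. AE y in lebesgue_on (elset K \<inter> ball x de). dist (f y) (V x) < ep" using de(1) by blast
 qed
 qed
qed

text \<open>The shift estimate for \<open>f\<close> and \<open>- f\<close> gives a two-sided
  difference bound on every ball of the element. The dimension enters \<open>C\<close> because the
  sum of the \<open>\<bar>h $ i\<bar>\<close> is at most that many times \<open>norm h\<close>.
  Local Lipschitz representatives are glued and extended to the boundary.\<close>

lemma elem_boundary_value:
 fixes K :: "('d::finite) elem" and f :: "real^'d => real"
 assumes K: "curvilinear K" and f: "f : borel_measurable (lebesgue_on (elset K))"
 and w: "!!i. has_weak_deriv (elset K) [i] f (w i)"
 and M: "!!i. AE x in lebesgue_on (elset K). \<bar>w i x\<bar> <= M" and M0: "0 <= M"
 obtains V where "continuous_on (snd K ` fst K) V" "!!x. x : snd K ` fst K ==> esslim (elset K) f x (V x)"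
proof -
 note op = open_elset[OF K]
 define C where "C = M * real CARD('d)"
 have C0: "0 <= C" using M0 by (simp add: C_def)
 have loc: "EX G. C-lipschitz_on (ball c r) G & (AE x in lebesgue_on (ball c r). f x = G x)" if s: "ball c r \<subseteq> elset K" for c r
 proof -
 let ?B = "ball c r"
 have wB: "has_weak_deriv ?B [i] f (w i)" for i by (rule has_weak_deriv_subset[OF w s _ op]) simp
 have wBm: "has_weak_deriv ?B [i] (%x. - f x) (%x. - w i x)" for i
 using has_weak_deriv_linear[OF _ wB wB, where a="-1" and b=0] by simp
 have MB: "AE x in lebesgue_on ?B. \<bar>w i x\<bar> <= M" for i by (rule AE_lebesgue_on_subset[OF M s]) (use op in auto)
 have fB: "f : borel_measurable (lebesgue_on ?B)"
 by (rule measurable_restrict_mono[OF f s])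
 have hb: "M * (\<Sum>i\<in>UNIV. \<bar>h $ i\<bar>) <= C * norm h" for h :: "real^'d"
 proof -
 have "(\<Sum>i\<in>UNIV. \<bar>h $ i\<bar>) <= (\<Sum>i\<in>(UNIV::'d set). norm h)" by (intro sum_mono component_le_norm_cart)
 thus ?thesis using M0 unfolding C_def by (simp add: mult.assoc mult_left_mono)
 qed
 have "AE x in lebesgue_on {x : ?B. x + h : ?B}. \<bar>f (x + h) - f x\<bar> <= C * norm h" for h
 proof -
 have "AE x in lebesgue_on {x : ?B. x + h : ?B}. f (x + h) - f x <= M * (\<Sum>i\<in>UNIV. \<bar>h $ i\<bar>)"
 by (rule weak_deriv_bounded_shift[OF _ _ wB MB M0]) auto
 moreover have "AE x in lebesgue_on {x : ?B. x + h : ?B}. - f (x + h) - - f x <= M * (\<Sum>i\<in>UNIV. \<bar>h $ i\<bar>)"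
 by (rule weak_deriv_bounded_shift[OF _ _ wBm _ M0]) (use MB in auto)
 ultimately show ?thesis by eventually_elim (use hb[of h] in linarith)
 qed
 from AE_lipschitz_rep[OF _ fB C0 this] show ?thesis by blast
 qed
 obtain G where G: "!!c r. ball c r \<subseteq> elset K ==> C-lipschitz_on (ball c r) G" "AE x in lebesgue_on (elset K). f x = G x"
 using glue_lipschitz_rep[OF op loc] by metis
 show ?thesis using elem_boundary_extension[OF K C0 G] that by metis
qed

section \<open>Graph charts and Hausdorff measure\<close>

text \<open>Near a boundary point the domain is \<open>{F < 0}\<close>, where \<open>F\<close> grows at unit speed along the axis
  direction \<open>e\<close>; thus \<open>y - F y *\<^sub>R e\<close> is the boundary point above \<open>y\<close>.\<close>

definition chart :: "(real^'d::finite) set => real^'d => real => real^'d => (real^'d => real) => real => bool" where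
 "chart U x r e F La \<longleftrightarrow> open U & r > 0 & (EX i. e = axis i 1 \<or> e = - axis i 1) & (ALL y t. F (y + t *R e) = F y + t) &
 La >= 1 & (ALL y:ball x r. ALL z:ball x r. \<bar>F y - F z\<bar> <= La * norm (y - z)) & smooth_on UNIV F &
 U \<inter> ball x r = {y : ball x r. F y < 0}"

lemma smooth_on_vec_nth: "smooth_on UNIV (%x::real^'d::finite. x $ i)"
proof -
 have D: "((%x::real^'d. x $ i) has_derivative (%h. h $ i)) (at x)" for x
 by (rule bounded_linear_imp_has_derivative[OF bounded_linear_vec_nth])
 show ?thesis
 proof (rule smooth_on_UNIV_coinduct[of _ "insert (%x. x $ i) (range (%c _. c))"])
 show "g differentiable at x" if "g : insert (%x::real^'d. x $ i) (range (%c _. c))" for g x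
 proof -
 have "(%x::real^'d. x $ i) differentiable at x" using D unfolding differentiable_def by blast
 thus ?thesis using that by auto
 qed
 show "pd j g : insert (%x::real^'d. x $ i) (range (%c _. c))" if "g : insert (%x::real^'d. x $ i) (range (%c _. c))" for g j
 proof -
 have "pd j (%x::real^'d. x $ i) = (%_. axis j 1 $ i)" using pd_eqI[OF D] by (simp add: fun_eq_iff)
 moreover have "pd j (%x::real^'d. c) = (%_. 0)" for c :: real by (simp add: pd_def fun_eq_iff)
 ultimately show ?thesis using that by auto
 qed
 qed simp
qed

text \<open>\<open>F\<close> is the signed height \<open>s * y $ i - gg y\<close>. The graph
  function ignores coordinate \<open>i\<close>, so a step \<open>t\<close> along \<open>e\<close>,
  which is \<open>s\<close> times the axis vector, changes \<open>F\<close> by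
  \<open>s * s * t = t\<close>. The summand 1 in \<open>La\<close> ensures
  \<open>La \<ge> 1\<close>.\<close>

lemma chart_exists:
 fixes U :: "(real^'d::finite) set"
 assumes U: "smooth_domain U" and x: "x : frontier U"
 obtains r e F La where "chart U x r e F La"
proof -
 have "open U" using U by (simp add: smooth_domain_def)
 have "ALL x:frontier U. EX i s r gg. (s = 1 \<or> s = - 1) & r > 0 & smooth_on UNIV gg &
 (ALL y z. (ALL j. j ~= i --> y $ j = z $ j) --> gg y = gg z) &
 U \<inter> ball x r = {y : ball x r. s * (y $ i) < (gg y :: real)}"
 using U unfolding smooth_domain_def by (rule conjunct2)
 from bspec[OF this x] obtain i s r gg where s: "s = 1 \<or> s = - 1" and r: "r > 0" and gg: "smooth_on UNIV gg"
 "ALL y z. (ALL j. j ~= i --> y $ j = z $ j) --> gg y = gg z" "U \<inter> ball x r = {y : ball x r. s * (y $ i) < (gg y :: real)}"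
 by (elim exE conjE)
 define F where "F y = s *R y $ i - 1 *R gg y" for y
 define e where "e = s *R (axis i 1 :: real^'d)"
 have ss: "s * s = 1" using s by auto
 have Fs: "smooth_on UNIV F" unfolding F_def[abs_def]
 using smooth_on_linear[OF smooth_on_vec_nth[of i] gg(1), of s "-1"] by simp
 have Fe: "F (y + t *R e) = F y + t" for y t
 proof -
 have "gg (y + t *R e) = gg y" using gg(2) by (simp add: e_def axis_def)
 thus ?thesis using ss by (simp add: F_def e_def axis_def algebra_simps)
 qed
 have "EX M. M >= 0 & (ALL y:cball x r. norm (pd i F y) <= M)" for i
 proof -
 obtain M where "M >= 0" "!!y. y : cball x r ==> norm (pd i F y) <= M"
 by (rule compact_bound_norm[OF continuous_on_subset[OF smooth_on_continuous0[OF smooth_on_pd[OF Fs, of i]] subset_UNIV] compact_cball[of x r]], rule that)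
 thus ?thesis by blast
 qed
 then obtain M where M: "!!i. M i >= 0" "!!i y. y : cball x r ==> norm (pd i F y) <= M i" by metis
 have M': "norm (pd i F y) <= (\<Sum>i\<in>UNIV. M i)" if "y : ball x r" for i y
 using M(1) that by (intro order_trans[OF M(2)] member_le_sum) auto
 define La where "La = real CARD('d) * (\<Sum>i\<in>UNIV. M i) + 1"
 have "\<bar>F y - F z\<bar> <= La * norm (y - z)" if "y : ball x r" "z : ball x r" for y z
 proof -
 have "norm (F y - F z) <= real CARD('d) * (\<Sum>i\<in>UNIV. M i) * norm (y - z)"
 using that M' by (intro pd_bound_lipschitz[of "ball x r"]) (auto simp: smooth_on_differentiable0[OF Fs])
 also have "... <= La * norm (y - z)" unfolding La_def by (intro mult_right_mono) auto
 finally show ?thesis by simp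
 qed
 moreover have "La >= 1" unfolding La_def using M(1) by (simp add: sum_nonneg)
 moreover have "EX i. e = axis i 1 \<or> e = - axis i 1" using s by (auto simp: e_def)
 moreover have "U \<inter> ball x r = {y : ball x r. F y < 0}" using gg(3) by (simp add: F_def)
 ultimately have "chart U x r e F La" unfolding chart_def using \<open>open U\<close> r Fs Fe by simp
 thus ?thesis by (rule that)
qed

locale boundary_chart =
 fixes U :: "(real^'d::finite) set" and x :: "real^'d" and r :: real and e :: "real^'d" and F :: "real^'d => real" and La :: real
 assumes chart: "chart U x r e F La"
begin

lemma open_dom: "open U" and r_pos: "r > 0" and F_shift: "F (y + t *R e) = F y + t" and La_ge: "La >= 1"
 and F_lip: "y : ball x r ==> z : ball x r ==> \<bar>F y - F z\<bar> <= La * norm (y - z)" and F_smooth: "smooth_on UNIV F"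
 and dom_iff: "y : ball x r ==> y : U \<longleftrightarrow> F y < 0"
proof -
 note c = chart[unfolded chart_def]
 show "open U" "r > 0" "F (y + t *R e) = F y + t" "La >= 1" "smooth_on UNIV F" using c by simp_all
 show "y : ball x r ==> z : ball x r ==> \<bar>F y - F z\<bar> <= La * norm (y - z)" using c by simp
 have "U \<inter> ball x r = {y : ball x r. F y < 0}" using c by simp
 hence "y : U \<inter> ball x r \<longleftrightarrow> y : {y : ball x r. F y < 0}" by simp
 thus "y : ball x r ==> y : U \<longleftrightarrow> F y < 0" by simp
qed

lemma norm_e: "norm e = 1" and e_axis: "EX i. e = axis i 1 \<or> e = - axis i 1"
 using chart unfolding chart_def by auto

lemma F_shift_minus: "F (y - t *R e) = F y - t"
 using F_shift[of y "- t"] by simp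

lemma F_continuous: "continuous_on UNIV F"
 by (rule smooth_on_continuous0[OF F_smooth])

text \<open>Where \<open>F > 0\<close> a neighbourhood misses \<open>U\<close>; where
  \<open>F = 0\<close> moving against \<open>e\<close> enters \<open>U\<close> at once, since
  \<open>F\<close> drops at unit speed.\<close>

lemma frontier_iff:
 assumes y: "y : ball x r"
 shows "y : frontier U \<longleftrightarrow> F y = 0"
proof -
 have int: "interior U = U" using open_dom by (rule interior_open)
 consider "F y < 0" | "F y > 0" | "F y = 0" by linarith
 thus ?thesis
 proof cases
 case 1
 hence "y : U" using dom_iff[OF y] by simp
 thus ?thesis using 1 int by (simp add: frontier_def)
 next
 case 2
 define V where "V = ball x r \<inter> F -` {0<..}"
 have V: "open V" unfolding V_def by (intro open_Int open_ball open_vimage F_continuous open_greaterThan)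
 have "V \<inter> U = {}" using dom_iff by (auto simp: V_def)
 hence "V \<inter> closure U = {}" using V by (simp add: open_Int_closure_eq_empty)
 hence "y ~: closure U" using 2 y by (auto simp: V_def)
 thus ?thesis using 2 by (simp add: frontier_def)
 next
 case 3
 have "y ~: U" using dom_iff[OF y] 3 by simp
 moreover have "y : closure U"
 unfolding closure_approachable
 proof (intro allI impI)
 fix ep :: real assume ep: "ep > 0"
 define t where "t = min (ep / 2) ((r - dist x y) / 2)"
 have t: "0 < t" "t < ep" "t < r - dist x y" using ep y by (auto simp: t_def min_def)
 have d: "dist (y - t *R e) y = t" using t norm_e by (simp add: dist_norm)
 have "y - t *R e : ball x r" using t d dist_triangle[of x "y - t *R e" y] by (simp add: dist_commute)
 hence "y - t *R e : U" using dom_iff t 3 by (simp add: F_shift_minus)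
 thus "EX z:U. dist z y < ep" by (rule bexI[rotated]) (simp only: d t)
 qed
 ultimately show ?thesis using 3 int by (simp add: frontier_def)
 qed
qed

text \<open>The slices \<open>t\<close> with \<open>N \<inter> (Q j + t e) \<noteq> {}\<close> lie in an interval of length comparable to
  the diameter of \<open>Q j\<close>; averaging over \<open>t\<close> bounds the size of \<open>N\<close> by the volume of the cover.\<close>

lemma hausdorff_pre_slices:
 assumes N: "N \<subseteq> {y : ball x (r / 2). F y = 0}" and t0: "0 < t0" "t0 <= r / 2"
 and Q: "!!j::nat. bounded (Q j)" "!!j. diameter (Q j) <= l j" "!!j. 0 <= l j" "!!j. l j <= de"
 and cover: "!!y t. y : N ==> 0 < t ==> t < t0 ==> y - t *R e : (\<Union>j. Q j)"
 shows "ennreal t0 * hausdorff_pre (real CARD('d) - 1) de N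
 <= (\<Sum>j. ennreal (2 * La * unit_ball_vol (real CARD('d) - 1) * l j ^ CARD('d)))"
proof -
 let ?s = "real CARD('d) - 1"
 let ?v = "unit_ball_vol ?s"
 have d1: "CARD('d) >= 1" by (simp add: Suc_leI)
 have v0: "0 <= ?v" by (rule unit_ball_vol_nonneg) (use d1 in simp)
 define T where "T j = {t. 0 < t & t < t0 & (EX y:Q j. y + t *R e : N)}" for j
 have T: "\<bar>t - t'\<bar> <= La * l j" if "t : T j" "t' : T j" for t t' j
 proof -
 obtain y y' where y: "y : Q j" "y + t *R e : N" "y' : Q j" "y' + t' *R e : N" and t: "0 < t" "t < t0" "0 < t'" "t' < t0"
 using \<open>t : T j\<close> \<open>t' : T j\<close> by (auto simp: T_def)
 have inb: "z : ball x r" if "z + u *R e : N" "0 < u" "u < t0" for z u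
 proof -
 have "dist x (z + u *R e) < r / 2" using that(1) N by auto
 moreover have "dist (z + u *R e) z <= r / 2" using that t0 norm_e by (simp add: dist_norm)
 ultimately show ?thesis using dist_triangle[of x z "z + u *R e"] by simp
 qed
 have "F y + t = 0" "F y' + t' = 0" using y(2,4) N F_shift by auto
 hence "\<bar>t - t'\<bar> = \<bar>F y - F y'\<bar>" by linarith
 also have "... <= La * norm (y - y')" using inb y t by (intro F_lip) auto
 also have "... <= La * l j"
 proof (rule mult_left_mono)
 have "dist y y' <= diameter (Q j)" by (rule diameter_bounded_bound[OF Q(1) y(1,3)])
 thus "norm (y - y') <= l j" using Q(2)[of j] by (simp add: dist_norm)
 qed (use La_ge in simp)
 finally show ?thesis .
 qed
 \<comment> \<open>All heights in \<open>T j\<close> lie within \<open>La * l j\<close> of any one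
   of them; the interval \<open>J j\<close> is a measurable stand-in for \<open>T j\<close>.\<close>
 define J where "J j = (if T j = {} then {} else {(SOME t. t : T j) - La * l j .. (SOME t. t : T j) + La * l j})" for j
 have TJ: "T j \<subseteq> J j" for j
 proof
 fix t assume t: "t : T j"
 hence "(SOME t. t : T j) : T j" by (rule someI)
 from T[OF t this] t show "t : J j" by (auto simp: J_def abs_le_iff)
 qed
 have Jm [measurable]: "J j : sets lborel" for j by (simp add: J_def)
 have Je: "emeasure lborel (J j) <= ennreal (2 * La * l j)" for j
 using Q(3)[of j] La_ge by (auto simp: J_def)
 define a where "a j = ennreal (?v * l j powr ?s)" for j
 have pt: "indicator {0<..<t0} t * hausdorff_pre ?s de N <= (\<Sum>j. a j * indicator (J j) t)" for t
 proof (cases "t : {0<..<t0}")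
 case True
 \<comment> \<open>At the fixed height \<open>t\<close> the pieces with \<open>t : J j\<close>,
   moved up by \<open>t\<close>, cover \<open>N\<close>; the others are dropped.\<close>
 define V where "V j = (if t : J j then (+) (t *R e) ` Q j else {})" for j
 have bV: "bounded (V j)" for j using Q(1) by (simp add: V_def bounded_translation)
 have dV: "diameter (V j) <= l j" for j using Q(1-3) by (simp add: V_def diameter_translate)
 have "hausdorff_pre ?s de N <= (\<Sum>j. ennreal (?v * (diameter (V j) / 2) powr ?s))"
 proof (rule hausdorff_pre_le)
 show "N \<subseteq> (\<Union>j. V j)"
 proof
 fix y assume y: "y : N"
 obtain j where j: "y - t *R e : Q j" using cover[OF y, of t] True by auto
 have "t : T j" using j y True by (auto simp: T_def intro!: bexI[OF _ j])
 hence "t : J j" using TJ by blast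
 moreover have "y : (+) (t *R e) ` Q j" using j by (intro image_eqI[of _ _ "y - t *R e"]) auto
 ultimately have "y : V j" by (simp add: V_def)
 thus "y : (\<Union>j. V j)" by blast
 qed
 show "diameter (V j) <= de" for j using dV[of j] Q(4)[of j] by linarith
 qed (fact bV)
 also have "... <= (\<Sum>j. a j * indicator (J j) t)"
 proof (intro suminf_le)
 fix j
 show "ennreal (?v * (diameter (V j) / 2) powr ?s) <= a j * indicator (J j) t"
 proof (cases "t : J j")
 case True
 have "(diameter (V j) / 2) powr ?s <= l j powr ?s"
 using dV[of j] d1 diameter_ge_0[OF bV, of j] by (intro powr_mono2) auto
 thus ?thesis using True v0 by (auto simp: a_def intro!: ennreal_leI mult_left_mono)
 next
 case False
 thus ?thesis by (simp add: V_def)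
 qed
 qed auto
 finally show ?thesis using True by simp
 qed simp
 have "ennreal t0 * hausdorff_pre ?s de N = (NI (%t. indicator {0<..<t0} t * hausdorff_pre ?s de N))"
 using t0 by (simp add: nn_integral_multc)
 also have "... <= (NI (%t. (\<Sum>j. a j * indicator (J j) t)))" by (intro nn_integral_mono pt)
 also have "... = (\<Sum>j. NI (%t. a j * indicator (J j) t))" by (intro nn_integral_suminf) simp
 also have "... = (\<Sum>j. a j * emeasure lborel (J j))" by (intro suminf_cong nn_integral_cmult_indicator Jm)
 also have "... <= (\<Sum>j. ennreal (2 * La * ?v * l j ^ CARD('d)))"
 proof (intro suminf_le)
 fix j
 have "a j * emeasure lborel (J j) <= a j * ennreal (2 * La * l j)" using Je by (intro mult_left_mono) auto
 also have "... = ennreal (?v * l j powr ?s * (2 * La * l j))"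
 using v0 La_ge Q(3)[of j] by (simp add: a_def ennreal_mult[symmetric])
 also have "?v * l j powr ?s * (2 * La * l j) = 2 * La * ?v * l j ^ CARD('d)"
 proof (cases "l j = 0")
 case False
 hence "l j > 0" using Q(3)[of j] by simp
 hence "l j powr ?s * l j = l j powr ?s * l j powr 1" by simp
 also have "... = l j powr real CARD('d)" by (simp only: powr_add[symmetric]) simp
 also have "... = l j ^ CARD('d)" using \<open>l j > 0\<close> by (rule powr_realpow)
 finally show ?thesis by (simp add: mult.assoc mult.left_commute)
 qed simp
 finally show "a j * emeasure lborel (J j) <= ennreal (2 * La * ?v * l j ^ CARD('d))" .
 qed auto
 finally show ?thesis .
qed

text \<open>A null cylinder is covered by non-overlapping dyadic cubes of arbitrarily small total
  volume. For cubes the \<open>CARD('d)\<close>-th power of the diameter is comparable to the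
  volume, so the slicing bound makes the premeasure of \<open>N\<close> arbitrarily small at every
  scale.\<close>

lemma hausdorff_null_of_cylinder:
 assumes N: "N \<subseteq> {y : ball x (r / 2). F y = 0}" and t0: "0 < t0" "t0 <= r / 2"
 and null: "{y - t *R e | y t. y : N & 0 < t & t < t0} : null_sets lebesgue"
 shows "hausdorff_outer (real CARD('d) - 1) N = 0"
proof -
 let ?s = "real CARD('d) - 1"
 let ?v = "unit_ball_vol ?s"
 define Z where "Z = {y - t *R e | y t. y : N & 0 < t & t < t0}"
 have d1: "CARD('d) >= 1" by (simp add: Suc_leI)
 have v0: "0 <= ?v" by (rule unit_ball_vol_nonneg) (use d1 in simp)
 define R where "R = norm x + r"
 have R0: "R > 0" using r_pos by (simp add: R_def add_nonneg_pos)
 have ZR: "norm z <= R" if z: "z : Z" for z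
 proof -
 obtain y t where yt: "z = y - t *R e" "y : N" "0 < t" "t < t0" using z unfolding Z_def by blast
 have "dist x y < r / 2" using yt N by auto
 moreover have "norm z <= norm x + dist x y + t"
 using yt(1,3) norm_e norm_triangle_ineq4[of y "t *R e"] norm_triangle_sub[of y x] by (simp add: dist_norm norm_minus_commute)
 ultimately show ?thesis using yt t0 by (simp add: R_def)
 qed
 \<comment> \<open>All sides are equal, so the dyadic subdivisions of this box are cubes.\<close>
 define A B where "A = (\<chi> i::'d. - R)" and "B = (\<chi> i::'d. R)"
 have Zc: "Z \<subseteq> cbox A B"
 proof
 fix z assume "z : Z"
 hence "\<bar>z $ i\<bar> <= R" for i using ZR component_le_norm_cart[of z i] by (meson order_trans)
 thus "z : cbox A B" by (auto simp: mem_box_cart A_def B_def abs_le_iff minus_le_iff)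
 qed
 have Zn: "Z : null_sets lebesgue" using null by (simp add: Z_def)
 hence Zl: "Z : lmeasurable" "measure lebesgue Z = 0" by (auto simp: null_sets_def fmeasurable_def measure_def)
 define K where "K = 2 * La * ?v * sqrt (real CARD('d)) ^ CARD('d)"
 have K0: "0 <= K" using La_ge v0 by (simp add: K_def)
 \<comment> \<open>The second bound on \<open>ep\<close> ensures that a cube of volume at most
   \<open>ep\<close> has diameter at most \<open>de\<close>, as the covering scale demands.\<close>
 have main: "ennreal t0 * hausdorff_pre ?s de N <= ennreal (K * ep)"
 if de: "de > 0" and ep: "ep > 0" "ep <= (de / sqrt (real CARD('d))) ^ CARD('d)" for de ep
 proof -
 obtain \<D> where D: "countable \<D>" "!!K. K : \<D> ==> K \<subseteq> cbox A B & K ~= {} & (EX c d. K = cbox c d)"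
 "pairwise (%A B. interior A \<inter> interior B = {}) \<D>"
 "!!u v. cbox u v : \<D> ==> EX n. ALL i:Basis. v \<bullet> i - u \<bullet> i = (B \<bullet> i - A \<bullet> i) / 2 ^ n"
 "Z \<subseteq> \<Union>\<D>" "\<Union>\<D> : lmeasurable" "measure lebesgue (\<Union>\<D>) <= measure lebesgue Z + ep"
 using measurable_outer_intervals_bounded[OF Zl(1) Zc ep(1)] by metis
 have eU: "emeasure lebesgue (\<Union>\<D>) <= ennreal ep"
 using D(6,7) Zl(2) by (simp add: emeasure_eq_measure2 ennreal_leI)
 have "EX s. s > 0 & (EX u v. C = cbox u v & (ALL i. v $ i - u $ i = s))" if C: "C : \<D>" for C
 proof -
 obtain u v where uv: "C = cbox u v" using D(2)[OF C] by blast
 then obtain n where n: "ALL i:Basis. v \<bullet> i - u \<bullet> i = (B \<bullet> i - A \<bullet> i) / 2 ^ n" using D(4) C by blast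
 have "v $ i - u $ i = 2 * R / 2 ^ n" for i
 using n[rule_format, of "axis i 1"] by (simp add: axis_in_Basis_iff inner_axis A_def B_def)
 thus ?thesis using uv R0 by (intro exI[of _ "2 * R / 2 ^ n"]) auto
 qed
 hence "ALL C. EX s. C : \<D> --> s > 0 & (EX u v. C = cbox u v & (ALL i. v $ i - u $ i = s))" by blast
 from choice[OF this] obtain s where s: "!!C. C : \<D> ==> s C > 0 & (EX u v. C = cbox u v & (ALL i. v $ i - u $ i = s C))" by blast
 have emC: "emeasure lebesgue C = ennreal (s C ^ CARD('d))" "emeasure lebesgue (interior C) = ennreal (s C ^ CARD('d))"
 "diameter C <= sqrt (real CARD('d)) * s C" if C: "C : \<D>" for C
 proof -
 obtain u v where uv: "C = cbox u v" "!!i. v $ i - u $ i = s C" using s[OF C] by blast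
 have ne: "cbox u v ~= {}" using D(2)[OF C] uv by blast
 have "measure lborel (cbox u v) = s C ^ CARD('d)" using content_cbox_cart[OF ne] uv(2) by simp
 thus 1: "emeasure lebesgue C = ennreal (s C ^ CARD('d))"
 using uv(1) by (simp add: emeasure_eq_measure2)
 have "emeasure lebesgue (box u v) = emeasure lebesgue (cbox u v)"
 by (simp add: emeasure_lborel_cbox_eq emeasure_lborel_box_eq)
 thus "emeasure lebesgue (interior C) = ennreal (s C ^ CARD('d))"
 using 1 uv(1) by (simp add: interior_cbox)
 show "diameter C <= sqrt (real CARD('d)) * s C"
 proof (rule diameter_le)
 show "C ~= {} \<or> 0 <= sqrt (real CARD('d)) * s C" using D(2)[OF C] by blast
 fix p q assume pq: "p : C" "q : C"
 have "\<bar>(p - q) $ i\<bar> <= s C" for i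
 proof -
 have "u $ i <= p $ i" "p $ i <= v $ i" "u $ i <= q $ i" "q $ i <= v $ i" using pq uv(1) by (auto simp: mem_box_cart)
 thus ?thesis using uv(2)[of i] by (simp add: abs_le_iff)
 qed
 hence "(\<Sum>i\<in>UNIV. ((p - q) $ i)^2) <= (\<Sum>i\<in>(UNIV::'d set). (s C)^2)"
 using s[OF C] by (intro sum_mono) (simp add: abs_le_square_iff[symmetric])
 hence "norm (p - q) <= sqrt (real CARD('d) * (s C)^2)"
 unfolding norm_vec_def L2_set_def by simp
 thus "norm (p - q) <= sqrt (real CARD('d)) * s C"
 using s[OF C] by (simp add: real_sqrt_mult)
 qed
 qed
 define Q where "Q j = (if j : to_nat_on \<D> ` \<D> then from_nat_into \<D> j else {})" for j
 define l where "l j = (if j : to_nat_on \<D> ` \<D> then sqrt (real CARD('d)) * s (from_nat_into \<D> j) else 0)" for j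
 have inj: "inj_on (to_nat_on \<D>) \<D>" using D(1) by (rule inj_on_to_nat_on)
 have Qin: "from_nat_into \<D> j : \<D>" if "j : to_nat_on \<D> ` \<D>" for j
 using that D(1) by (auto)
 have sle: "sqrt (real CARD('d)) * s C <= de" if C: "C : \<D>" for C
 proof -
 have "emeasure lebesgue C <= emeasure lebesgue (\<Union>\<D>)"
 using C D(6) by (intro emeasure_mono) auto
 hence "ennreal (s C ^ CARD('d)) <= ennreal ep" using eU emC(1)[OF C] by simp
 hence "s C ^ CARD('d) <= ep" using ep by (simp add: ennreal_le_iff)
 hence "s C ^ CARD('d) <= (de / sqrt (real CARD('d))) ^ CARD('d)" using ep by simp
 hence "s C <= de / sqrt (real CARD('d))"
 using power_le_imp_le_base[of "s C" "CARD('d) - 1" "de / sqrt (real CARD('d))"] de d1 by simp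
 thus ?thesis by (simp add: field_simps)
 qed
 have "ennreal t0 * hausdorff_pre ?s de N <= (\<Sum>j. ennreal (2 * La * ?v * l j ^ CARD('d)))"
 proof (rule hausdorff_pre_slices[OF N t0, of Q])
 fix j
 show "bounded (Q j)"
 proof (cases "j : to_nat_on \<D> ` \<D>")
 case True
 then obtain c d where "Q j = cbox c d" using D(2)[OF Qin[OF True]] by (auto simp: Q_def)
 thus ?thesis by (simp add: bounded_cbox)
 qed (simp add: Q_def)
 show "diameter (Q j) <= l j" using emC(3) Qin by (auto simp: Q_def l_def)
 show "0 <= l j" using s Qin by (auto simp: l_def intro!: mult_nonneg_nonneg less_imp_le)
 show "l j <= de" using sle Qin de by (auto simp: l_def)
 next
 fix y t assume "y : N" "0 < t" "t < t0"
 hence "y - t *R e : Z" unfolding Z_def by blast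
 then obtain C where C: "C : \<D>" "y - t *R e : C" using D(5) by blast
 hence "y - t *R e : Q (to_nat_on \<D> C)" using D(1) by (simp add: Q_def)
 thus "y - t *R e : (\<Union>j. Q j)" by blast
 qed
 also have "... = (\<Sum>j. ennreal K * emeasure lebesgue (interior (Q j)))"
 proof (rule suminf_cong)
 fix j
 show "ennreal (2 * La * ?v * l j ^ CARD('d)) = ennreal K * emeasure lebesgue (interior (Q j))"
 proof (cases "j : to_nat_on \<D> ` \<D>")
 case True
 hence "emeasure lebesgue (interior (Q j)) = ennreal (s (from_nat_into \<D> j) ^ CARD('d))"
 using emC(2)[OF Qin[OF True]] by (simp add: Q_def)
 thus ?thesis using True K0 s[OF Qin[OF True]]
 by (simp add: l_def K_def ennreal_mult[symmetric] power_mult_distrib algebra_simps)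
 next
 case False
 thus ?thesis by (simp add: l_def Q_def zero_power)
 qed
 qed
 also have "... = ennreal K * (\<Sum>j. emeasure lebesgue (interior (Q j)))" by (rule ennreal_suminf_cmult)
 also have "(\<Sum>j. emeasure lebesgue (interior (Q j))) = emeasure lebesgue (\<Union>j. interior (Q j))"
 proof (rule suminf_emeasure)
 show "range (%j. interior (Q j)) \<subseteq> sets lebesgue" by auto
 show "disjoint_family (%j. interior (Q j))"
 unfolding disjoint_family_on_def
 proof (intro ballI impI)
 fix m n :: nat assume "m ~= n"
 show "interior (Q m) \<inter> interior (Q n) = {}"
 proof (cases "m : to_nat_on \<D> ` \<D> & n : to_nat_on \<D> ` \<D>")
 case True
 hence "from_nat_into \<D> m ~= from_nat_into \<D> n" using \<open>m ~= n\<close> D(1) by auto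
 thus ?thesis using True D(3) Qin unfolding pairwise_def Q_def by simp
 qed (auto simp: Q_def)
 qed
 qed
 also have "... <= emeasure lebesgue (\<Union>\<D>)"
 proof (rule emeasure_mono)
 show "(\<Union>j. interior (Q j)) \<subseteq> \<Union>\<D>"
 proof
 fix y assume "y : (\<Union>j. interior (Q j))"
 then obtain j where j: "y : interior (Q j)" by blast
 hence "y : Q j" using interior_subset by blast
 thus "y : \<Union>\<D>" using Qin[of j] by (cases "j : to_nat_on \<D> ` \<D>") (auto simp: Q_def)
 qed
 qed (use D(6) in auto)
 also have "... <= ennreal ep" by (rule eU)
 finally show ?thesis using K0 ep by (simp add: mult_left_mono ennreal_mult)
 qed
 have zero: "hausdorff_pre ?s de N = 0" if de: "de > 0" for de
 proof -
 define ep0 where "ep0 = (de / sqrt (real CARD('d))) ^ CARD('d)"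
 have e0: "ep0 > 0" using de by (simp add: ep0_def)
 have "ennreal t0 * hausdorff_pre ?s de N <= 0"
 proof (rule ennreal_le_epsilon)
 fix ht :: real assume ht: "ht > 0"
 define ep where "ep = min ep0 (ht / (K + 1))"
 have "ep > 0" using e0 ht K0 by (simp add: ep_def)
 hence "ennreal t0 * hausdorff_pre ?s de N <= ennreal (K * ep)" by (intro main de) (auto simp: ep_def ep0_def)
 also have "K * ep <= (K + 1) * (ht / (K + 1))" using K0 \<open>ep > 0\<close> by (intro mult_mono) (auto simp: ep_def)
 also have "... = ht" using K0 by simp
 finally show "ennreal t0 * hausdorff_pre ?s de N <= 0 + ennreal ht" by (simp add: ennreal_leI)
 qed
 thus ?thesis using t0 by simp
 qed
 thus ?thesis unfolding hausdorff_outer_def by simp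
qed

text \<open>Slicing again, now with a grid of cubes of diameter at most \<open>de\<close>. Their
  number grows like \<open>1 / de ^ CARD('d)\<close>, which balances the factor
  \<open>de ^ CARD('d)\<close>, so the bound is uniform in \<open>de\<close>.\<close>

lemma hausdorff_finite:
 assumes N: "N \<subseteq> {y : ball x (r / 2). F y = 0}"
 shows "hausdorff_outer (real CARD('d) - 1) N < \<infinity>"
proof -
 let ?s = "real CARD('d) - 1"
 let ?v = "unit_ball_vol ?s"
 have d1: "CARD('d) >= 1" by (simp add: Suc_leI)
 have v0: "0 <= ?v" by (rule unit_ball_vol_nonneg) (use d1 in simp)
 define t0 where "t0 = r / 2"
 have t0: "0 < t0" "t0 <= r / 2" using r_pos by (auto simp: t0_def)
 define R where "R = norm x + r"
 have R0: "R > 0" using r_pos by (simp add: R_def add_nonneg_pos)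
 define D where "D = sqrt (real CARD('d))"
 have D1: "D >= 1" using d1 by (simp add: D_def)
 \<comment> \<open>Below, \<open>m \<le> R / s + 2\<close> gives
   \<open>(2 * m + 1) * s \<le> 2 * R + 5 * s\<close>, and \<open>s \<le> 1\<close>.\<close>
 define K where "K = 2 * La * ?v * ((2 * R + 5) * D) ^ CARD('d)"
 have main: "ennreal t0 * hausdorff_pre ?s de N <= ennreal K" if de: "0 < de" "de <= 1" for de
 proof -
 define s where "s = de / D"
 have s: "0 < s" "s <= 1" using de D1 by (auto simp: s_def divide_le_eq)
 define m where "m = \<lceil>R / s\<rceil> + 1"
 define I where "I = (UNIV :: 'd set) \<rightarrow>\<^sub>E {-m..m}"
 have finI: "finite I" unfolding I_def by (intro finite_PiE) auto
 have mR: "R / s <= real_of_int m" "real_of_int m <= R / s + 2" by (auto simp: m_def) linarith+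
 have m0: "0 <= m" using R0 s mR(1) by (metis divide_pos_pos le_less_trans less_eq_real_def of_int_0_less_iff not_le of_int_0_le_iff order.strict_implies_order order_less_le_trans)
 have cardI: "card I = nat (2 * m + 1) ^ CARD('d)" unfolding I_def by (subst card_PiE) auto
 define cb where "cb k = {y :: real^'d. ALL i. s * real_of_int (k i) <= y $ i & y $ i <= s * (real_of_int (k i) + 1)}" for k :: "'d => int"
 have cbd: "norm (p - q) <= D * s" if pq: "p : cb k" "q : cb k" for p q k
 proof -
 have "\<bar>(p - q) $ i\<bar> <= s" for i
 proof -
 have "s * real_of_int (k i) <= p $ i" "p $ i <= s * real_of_int (k i) + s" "s * real_of_int (k i) <= q $ i" "q $ i <= s * real_of_int (k i) + s"
 using pq by (auto simp: cb_def algebra_simps)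
 thus ?thesis by (simp add: abs_le_iff)
 qed
 hence "(\<Sum>i\<in>UNIV. ((p - q) $ i)^2) <= (\<Sum>i\<in>(UNIV::'d set). s^2)"
 using s by (intro sum_mono) (simp add: abs_le_square_iff[symmetric])
 hence "norm (p - q) <= sqrt (real CARD('d) * s^2)" unfolding norm_vec_def L2_set_def by simp
 thus ?thesis using s by (simp add: real_sqrt_mult D_def)
 qed
 have Ds: "D * s = de" using D1 by (simp add: s_def)
 obtain f where f: "bij_betw f {..<card I} I" using ex_bij_betw_nat_finite[OF finI] by (auto simp: atLeast0LessThan)
 define Q where "Q j = (if j < card I then cb (f j) else {})" for j
 define l where "l j = (if j < card I then de else 0)" for j
 have "ennreal t0 * hausdorff_pre ?s de N <= (\<Sum>j. ennreal (2 * La * ?v * l j ^ CARD('d)))"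
 proof (rule hausdorff_pre_slices[OF N t0, of Q])
 fix j
 show "bounded (Q j)"
 proof (cases "Q j = {}")
 case False
 then obtain q where "q : Q j" by blast
 hence "Q j \<subseteq> cball q (D * s)" using cbd by (auto simp: Q_def dist_norm split: if_splits)
 thus ?thesis using bounded_subset bounded_cball by blast
 qed simp
 show "diameter (Q j) <= l j"
 by (rule diameter_le) (use cbd Ds de in \<open>auto simp: Q_def l_def\<close>)
 show "0 <= l j" "l j <= de" using de by (auto simp: l_def)
 next
 fix y t assume y: "y : N" "0 < t" "t < t0"
 let ?z = "y - t *R e"
 have "dist x y < r / 2" using y N by auto
 moreover have "norm ?z <= norm x + dist x y + t"
 using y(2) norm_e norm_triangle_ineq4[of y "t *R e"] norm_triangle_sub[of y x] by (simp add: dist_norm norm_minus_commute)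
 ultimately have zR: "norm ?z <= R" using y t0 by (simp add: R_def)
 define k where "k i = \<lfloor>?z $ i / s\<rfloor>" for i
 have zi: "\<bar>?z $ i\<bar> <= R" for i using zR component_le_norm_cart[of ?z i] by linarith
 have "k : I" unfolding I_def
 proof (intro PiE_I)
 fix i
 have a: "- (R / s) <= ?z $ i / s" "?z $ i / s <= R / s"
 using zi[of i] s by (auto simp: abs_le_iff divide_right_mono minus_divide_left[symmetric] intro: order_trans[OF _ divide_right_mono[of "- R"]])
 have "k i <= m" using a(2) mR(1) unfolding k_def by linarith
 moreover have "- m <= k i" using a(1) unfolding k_def m_def by linarith
 ultimately show "k i : {-m..m}" by simp
 qed simp
 hence "k : f ` {..<card I}" using f by (simp add: bij_betw_def)
 then obtain j where j: "j < card I" "f j = k" by blast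
 have "?z : cb k"
 proof -
 have "s * real_of_int (k i) <= ?z $ i & ?z $ i <= s * (real_of_int (k i) + 1)" for i
 proof -
 have "real_of_int (k i) <= ?z $ i / s" "?z $ i / s <= real_of_int (k i) + 1" unfolding k_def by linarith+
 thus ?thesis using s by (simp add: field_simps)
 qed
 thus ?thesis unfolding cb_def by blast
 qed
 hence "?z : Q j" using j by (simp add: Q_def)
 thus "?z : (\<Union>j. Q j)" by blast
 qed
 also have "... = (\<Sum>j<card I. ennreal (2 * La * ?v * l j ^ CARD('d)))"
 by (intro suminf_finite) (auto simp: l_def zero_power)
 also have "... = ennreal (\<Sum>j<card I. 2 * La * ?v * l j ^ CARD('d))"
 using La_ge v0 de by (intro sum_ennreal) (auto simp: l_def)
 also have "(\<Sum>j<card I. 2 * La * ?v * l j ^ CARD('d)) = real (card I) * (2 * La * ?v * de ^ CARD('d))" by (simp add: l_def)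
 also have "... = 2 * La * ?v * (real_of_int (2 * m + 1) * de) ^ CARD('d)"
 using m0 by (simp add: cardI power_mult_distrib of_nat_nat)
 also have "... <= K" unfolding K_def
 proof (intro mult_left_mono power_mono)
 have "real_of_int (2 * m + 1) * de = real_of_int (2 * m + 1) * s * D" by (simp add: Ds[symmetric])
 also have "real_of_int (2 * m + 1) * s <= (2 * (R / s + 2) + 1) * s" using mR(2) s by (intro mult_right_mono) auto
 also have "... = 2 * R + 5 * s" using s by (simp add: field_simps)
 also have "... <= 2 * R + 5" using s by simp
 finally show "real_of_int (2 * m + 1) * de <= (2 * R + 5) * D" using D1 by simp
 qed (use m0 de La_ge v0 in auto)
 finally show ?thesis by (simp add: ennreal_leI)
 qed
 have "hausdorff_pre ?s de N <= ennreal (K / t0)" if "de > 0" for de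
 proof -
 have "hausdorff_pre ?s de N <= hausdorff_pre ?s (min de 1) N" by (rule hausdorff_pre_antimono) simp
 also have "... = ennreal (1 / t0) * (ennreal t0 * hausdorff_pre ?s (min de 1) N)"
 using t0 by (simp add: mult.assoc[symmetric] ennreal_mult[symmetric])
 also have "... <= ennreal (1 / t0) * ennreal K" using that by (intro mult_left_mono main) auto
 also have "... = ennreal (K / t0)" using t0 by (simp add: ennreal_mult'[symmetric])
 finally show ?thesis .
 qed
 hence "hausdorff_outer ?s N <= ennreal (K / t0)" unfolding hausdorff_outer_def by (auto intro!: SUP_least)
 from le_less_trans[OF this ennreal_less_top] show ?thesis by (simp add: infinity_ennreal_def)
qed

end

text \<open>A cover of \<open>N\<close> by small sets becomes a cover of the cylinder by boxes whose
  side in direction \<open>i\<close> is bounded and whose other sides are proportional to the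
  diameters, so the total volume is a constant times the Hausdorff sum. In dimension at least 2 the
  exponent is positive, and sets of diameter zero contribute nothing on either side.\<close>

lemma cylinder_null:
 fixes N :: "(real^'d::finite) set"
 assumes d: "CARD('d) >= 2" and N: "hausdorff_outer (real CARD('d) - 1) N = 0" and t0: "0 < t0"
 shows "{y + t *R axis i 1 | y t. y : N & \<bar>t\<bar> <= t0} : null_sets lebesgue"
proof -
 let ?s = "real CARD('d) - 1"
 let ?v = "unit_ball_vol ?s"
 let ?Z = "{y + t *R axis i 1 | y t. y : N & \<bar>t\<bar> <= t0} :: (real^'d) set"
 have v0: "0 < ?v" by (rule unit_ball_vol_pos) (use d in simp)
 \<comment> \<open>Sides \<open>2 * ro j\<close> give the power of 4 relative to
   \<open>ro j / 2\<close>, and diameters at most 1 bound the remaining side by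
   \<open>2 + 2 * t0\<close>.\<close>
 define K where "K = 4 ^ CARD('d) * (2 + 2 * t0) / ?v"
 have K0: "K > 0" using v0 t0 by (simp add: K_def add_pos_pos)
 have "EX T. ?Z \<subseteq> T & T : lmeasurable & measure lebesgue T < ep" if ep: "ep > 0" for ep
 proof -
 have "hausdorff_pre ?s 1 N < ennreal (ep / (2 * K))"
 using hausdorff_pre_le_outer[of 1 ?s N] N ep K0 by (simp add: le_less_trans)
 from hausdorff_pre_less[OF this] obtain U :: "nat => (real^'d) set" where
 U: "N \<subseteq> (\<Union>j. U j)" "ALL j. bounded (U j) & diameter (U j) <= 1" "(\<Sum>j. ennreal (?v * (diameter (U j) / 2) powr ?s)) < ennreal (ep / (2 * K))"
 by (elim exE conjE)
 define p where "p j = (SOME u. u : U j)" for j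
 define ro where "ro j = diameter (U j)" for j
 have ro: "0 <= ro j" "ro j <= 1" for j using U(2) by (auto simp: ro_def diameter_ge_0)
 define w where "w j = (\<chi> k. ro j + (if k = i then t0 else 0))" for j
 define C where "C j = (if U j = {} then {} else cbox (p j - w j) (p j + w j))" for j
 have "?Z \<subseteq> (\<Union>j. C j)"
 proof
 fix z assume "z : ?Z"
 then obtain y t where z: "z = y + t *R axis i 1" "y : N" "\<bar>t\<bar> <= t0" by blast
 then obtain j where j: "y : U j" using U(1) by blast
 hence "p j : U j" unfolding p_def by (rule someI)
 hence "dist y (p j) <= ro j" unfolding ro_def using U(2) j by (intro diameter_bounded_bound) auto
 hence c: "\<bar>(y - p j) $ k\<bar> <= ro j" for k
 using component_le_norm_cart[of "y - p j" k] by (simp add: dist_norm)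
 have "z : cbox (p j - w j) (p j + w j)"
 unfolding mem_box_cart
 proof
 fix k
 show "(p j - w j) $ k <= z $ k & z $ k <= (p j + w j) $ k"
 using c[of k] z(3) unfolding z(1) w_def by (auto simp: axis_def abs_le_iff)
 qed
 hence "z : C j" using j by (auto simp: C_def)
 thus "z : (\<Union>j. C j)" by blast
 qed
 have eC: "emeasure lebesgue (C j) <= ennreal K * ennreal (?v * (ro j / 2) powr ?s)" for j
 proof (cases "U j = {}")
 case False
 have w0: "0 <= w j $ k" for k using ro(1)[of j] t0 by (simp add: w_def)
 hence ne: "cbox (p j - w j) (p j + w j) ~= {}" by (auto simp: interval_ne_empty_cart algebra_simps)
 have "measure lborel (cbox (p j - w j) (p j + w j)) = (\<Prod>k\<in>UNIV. 2 * w j $ k)"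
 using content_cbox_cart[OF ne] by simp
 also have "... = (2 * w j $ i) * (\<Prod>k\<in>UNIV - {i}. 2 * w j $ k)" by (rule prod.remove) auto
 also have "(\<Prod>k\<in>UNIV - {i}. 2 * w j $ k) = (\<Prod>k\<in>(UNIV::'d set) - {i}. 2 * ro j)" by (rule prod.cong) (auto simp: w_def)
 also have "... = (2 * ro j) ^ (CARD('d) - 1)" by (simp add: card_Diff_singleton)
 also have "2 * w j $ i = 2 * ro j + 2 * t0" by (simp add: w_def)
 finally have 1: "measure lborel (cbox (p j - w j) (p j + w j)) = (2 * ro j + 2 * t0) * (2 * ro j) ^ (CARD('d) - 1)" .
 also have "... <= (2 + 2 * t0) * (2 * ro j) ^ (CARD('d) - 1)" using ro[of j] by (intro mult_right_mono) auto
 also have "(2 * ro j) ^ (CARD('d) - 1) = 4 ^ (CARD('d) - 1) * (ro j / 2) ^ (CARD('d) - 1)"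
 using power_mult_distrib[of 4 "ro j / 2" "CARD('d) - 1"] by simp
 also have "(ro j / 2) ^ (CARD('d) - 1) = (ro j / 2) powr ?s"
 proof (cases "ro j = 0")
 case True thus ?thesis using d by simp
 next
 case False
 hence "ro j / 2 > 0" using ro(1)[of j] by simp
 hence "(ro j / 2) powr real (CARD('d) - 1) = (ro j / 2) ^ (CARD('d) - 1)" by (rule powr_realpow)
 thus ?thesis using d by (simp add: of_nat_diff)
 qed
 also have "(2 + 2 * t0) * (4 ^ (CARD('d) - 1) * (ro j / 2) powr ?s) <= K * (?v * (ro j / 2) powr ?s)"
 proof -
 have "(4::real) ^ (CARD('d) - 1) <= 4 ^ CARD('d)" by (intro power_increasing) auto
 hence "(2 + 2 * t0) * (4 ^ (CARD('d) - 1) * (ro j / 2) powr ?s) <= (2 + 2 * t0) * (4 ^ CARD('d) * (ro j / 2) powr ?s)"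
 using t0 by (intro mult_left_mono mult_right_mono) auto
 also have "... = K * (?v * (ro j / 2) powr ?s)"
 proof -
 have "?v ~= 0" using v0 by linarith
 thus ?thesis by (simp only: K_def) simp
 qed
 finally show ?thesis .
 qed
 finally have "measure lborel (cbox (p j - w j) (p j + w j)) <= K * (?v * (ro j / 2) powr ?s)" .
 hence "emeasure lebesgue (C j) <= ennreal (K * (?v * (ro j / 2) powr ?s))"
 using False by (simp add: C_def emeasure_eq_measure2 ennreal_leI)
 thus ?thesis using K0 v0 by (simp add: ennreal_mult)
 qed (simp add: C_def)
 have Cm: "C j : sets lebesgue" for j by (simp add: C_def)
 have "emeasure lebesgue (\<Union>j. C j) <= (\<Sum>j. emeasure lebesgue (C j))"
 by (rule emeasure_subadditive_countably) (use Cm in auto)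
 also have "... <= (\<Sum>j. ennreal K * ennreal (?v * (ro j / 2) powr ?s))" using eC by (intro suminf_le) auto
 also have "... = ennreal K * (\<Sum>j. ennreal (?v * (ro j / 2) powr ?s))" by (rule ennreal_suminf_cmult)
 also have "... <= ennreal K * ennreal (ep / (2 * K))" using U(3) by (intro mult_left_mono) (auto simp: ro_def)
 also have "... = ennreal (ep / 2)" using K0 ep by (simp add: ennreal_mult[symmetric])
 finally have e: "emeasure lebesgue (\<Union>j. C j) <= ennreal (ep / 2)" .
 have m: "(\<Union>j. C j) : sets lebesgue" using Cm by auto
 have l: "(\<Union>j. C j) : lmeasurable" using e m by (intro fmeasurableI) (auto simp: le_less_trans)
 have "measure lebesgue (\<Union>j. C j) <= ep / 2" using e ep unfolding measure_def by (intro enn2real_leI) auto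
 hence "measure lebesgue (\<Union>j. C j) < ep" using ep by simp
 thus ?thesis using \<open>?Z \<subseteq> (\<Union>j. C j)\<close> l by blast
 qed
 hence "negligible ?Z" unfolding negligible_outer by blast
 thus ?thesis by (simp add: negligible_iff_null_sets)
qed

section \<open>The outward normal\<close>

text \<open>Existence is the first-order expansion of \<open>F\<close>. For uniqueness, rays in
  directions \<open>z\<close> with \<open>z \<bullet> g < 0\<close> enter \<open>U\<close>, so any
  other candidate is nonpositive on this half space and on its closure; two unit vectors in this
  relation coincide.\<close>

lemma outward_normal_eq:
 fixes F :: "real^'d::finite => real" and g :: "real^'d"
 assumes F: "(F has_derivative (%h. h \<bullet> g)) (at y)" and F0: "F y = 0" and g: "g ~= 0"
 and U: "\<forall>\<^sub>F z in at y. z : U \<longleftrightarrow> F z < 0"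
 shows "outward_normal U y = g /\<^sub>R norm g"
proof -
 define nv where "nv = g /\<^sub>R norm g"
 have nv1: "norm nv = 1" using g by (simp add: nv_def)
 have gnv: "g = norm g *R nv" using g by (simp add: nv_def)
 have lin: "\<forall>\<^sub>F z in at y. \<bar>F z - (z - y) \<bullet> g\<bar> <= ep * dist z y" if ep: "ep > 0" for ep
 proof -
 obtain d where d: "d > 0" "!!z. norm (z - y) < d ==> norm (F z - F y - (z - y) \<bullet> g) <= ep * norm (z - y)"
 using F ep unfolding has_derivative_at_alt by blast
 show ?thesis unfolding eventually_at
 by (rule exI[of _ d]) (use d F0 in \<open>auto simp: dist_norm\<close>)
 qed
 have hprop: "\<forall>\<^sub>F z in at y. (z : U --> (z - y) \<bullet> nv <= ep * dist z y) & (z ~: U --> (z - y) \<bullet> nv >= - ep * dist z y)"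
 if ep: "ep > 0" for ep
 proof -
 have "norm g * ep > 0" using ep g by simp
 from lin[OF this] U show ?thesis
 proof eventually_elim
 case (elim z)
 have e: "(z - y) \<bullet> g = norm g * ((z - y) \<bullet> nv)" by (subst gnv) simp
 have ng: "norm g > 0" using g by simp
 have "norm g * ((z - y) \<bullet> nv) <= norm g * (ep * dist z y)" if "z : U"
 using elim that e by (simp add: abs_le_iff mult.assoc)
 moreover have "norm g * (- ep * dist z y) <= norm g * ((z - y) \<bullet> nv)" if "z ~: U"
 using elim that e by (simp add: abs_le_iff mult.assoc)
 ultimately show ?case using ng by (auto simp only: mult_le_cancel_left_pos)
 qed
 qed
 have uniq: "nv' = nv" if n': "norm nv' = 1" and p': "ALL ep>0. \<forall>\<^sub>F z in at y. (z : U --> (z - y) \<bullet> nv' <= ep * dist z y) &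
 (z ~: U --> (z - y) \<bullet> nv' >= - ep * dist z y)" for nv'
 proof -
 have strict: "z \<bullet> nv' <= 0" if z: "z \<bullet> g < 0" for z
 proof -
 have z0: "z ~= 0" using z by auto
 have "z \<bullet> nv' <= 0 + ep" if ep: "ep > 0" for ep
 proof -
 have e1: "ep / norm z > 0" using ep z0 by simp
 have e2: "- (z \<bullet> g) / (2 * norm z) > 0" using z z0 by (simp add: divide_neg_pos)
 have "\<forall>\<^sub>F w in at y. w : U --> (w - y) \<bullet> nv' <= ep / norm z * dist w y"
 using p'[rule_format, OF e1] by (rule eventually_mono) blast
 with lin[OF e2] U have ev: "\<forall>\<^sub>F w in at y. \<bar>F w - (w - y) \<bullet> g\<bar> <= - (z \<bullet> g) / (2 * norm z) * dist w y &
 (w : U \<longleftrightarrow> F w < 0) & (w : U --> (w - y) \<bullet> nv' <= ep / norm z * dist w y)"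
 by eventually_elim blast
 have "filterlim (%t. y + t *R z) (at y) (at_right 0)"
 unfolding filterlim_at
 proof
 show "((%t. y + t *R z) \<longlongrightarrow> y) (at_right 0)" by (auto intro!: tendsto_eq_intros)
 show "\<forall>\<^sub>F t in at_right 0. y + t *R z : UNIV & y + t *R z ~= y"
 using z0 by (auto simp: eventually_at_filter)
 qed
 from eventually_compose_filterlim[OF ev this] have "\<forall>\<^sub>F t in at_right 0. \<bar>F (y + t *R z) - (t *R z) \<bullet> g\<bar> <= - (z \<bullet> g) / (2 * norm z) * norm (t *R z) &
 (y + t *R z : U \<longleftrightarrow> F (y + t *R z) < 0) & (y + t *R z : U --> (t *R z) \<bullet> nv' <= ep / norm z * norm (t *R z))"
 by (simp add: dist_norm)
 moreover have "\<forall>\<^sub>F t in at_right (0::real). 0 < t" by (simp add: eventually_at_right_less)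
 ultimately have "\<forall>\<^sub>F t in at_right (0::real). z \<bullet> nv' <= ep"
 proof eventually_elim
 case (elim t)
 have "\<bar>F (y + t *R z) - t * (z \<bullet> g)\<bar> <= t * (- (z \<bullet> g) / 2)"
 using elim z0 by (simp add: mult.commute)
 hence "F (y + t *R z) <= t * (z \<bullet> g) + t * (- (z \<bullet> g) / 2)" by linarith
 also have "... = t * (z \<bullet> g) / 2" by (simp add: field_simps)
 also have "... < 0" using elim(2) z by (simp add: mult_pos_neg)
 finally have "(t *R z) \<bullet> nv' <= ep / norm z * norm (t *R z)" using elim(1) by blast
 hence "t * (z \<bullet> nv') <= t * ep" using elim(2) z0 by (simp add: mult.commute)
 thus ?case using elim(2) by simp
 qed
 hence "EX t::real. z \<bullet> nv' <= ep" using eventually_happens'[OF trivial_limit_at_right_real] by fast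
 thus ?thesis by simp
 qed
 thus ?thesis by (rule field_le_epsilon)
 qed
 have weak: "z \<bullet> nv' <= 0" if z: "z \<bullet> nv <= 0" for z
 proof (rule field_le_epsilon)
 fix ep :: real assume ep: "ep > 0"
 have "(z - ep *R nv) \<bullet> nv < 0" using z ep nv1 by (simp add: inner_diff_left dot_square_norm)
 hence "(z - ep *R nv) \<bullet> g < 0" by (subst gnv) (use g in \<open>simp add: mult_pos_neg\<close>)
 hence "(z - ep *R nv) \<bullet> nv' <= 0" by (rule strict)
 hence "z \<bullet> nv' <= ep * (nv \<bullet> nv')" by (simp add: inner_diff_left)
 also have "... <= ep * 1" using norm_cauchy_schwarz[of nv nv'] nv1 n' ep by (intro mult_left_mono) auto
 finally show "z \<bullet> nv' <= 0 + ep" by simp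
 qed
 \<comment> \<open>Testing the closed half space with \<open>- nv\<close> and with
   \<open>nv' - c *R nv\<close> gives \<open>c \<ge> 0\<close> and \<open>1 - c^2 \<le> 0\<close>,
   the equality case of Cauchy-Schwarz.\<close>
 define c where "c = nv' \<bullet> nv"
 have "(- nv) \<bullet> nv' <= 0" by (rule weak) (simp add: dot_square_norm nv1)
 hence c0: "0 <= c" by (simp add: c_def inner_commute)
 have "(nv' - c *R nv) \<bullet> nv' <= 0" by (rule weak) (simp add: inner_diff_left c_def dot_square_norm nv1)
 moreover have "(nv' - c *R nv) \<bullet> nv' = 1 - c^2"
 using n' by (simp add: inner_diff_left dot_square_norm c_def inner_commute[of nv nv'] power2_eq_square)
 ultimately have "1 <= c^2" by simp
 hence "1 <= c" using c0 by (smt (verit) power2_eq_square mult_left_le)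
 hence "nv' \<bullet> nv = norm nv' * norm nv" using norm_cauchy_schwarz[of nv' nv] n' nv1 by (simp add: c_def)
 thus ?thesis using norm_cauchy_schwarz_eq[of nv' nv] n' nv1 by simp
 qed
 have "(THE nv. norm nv = 1 & (ALL ep>0. \<forall>\<^sub>F z in at y. (z : U --> (z - y) \<bullet> nv <= ep * dist z y) &
 (z ~: U --> (z - y) \<bullet> nv >= - ep * dist z y))) = nv"
 proof (rule the_equality)
 show "norm nv = 1 & (ALL ep>0. \<forall>\<^sub>F z in at y. (z : U --> (z - y) \<bullet> nv <= ep * dist z y) &
 (z ~: U --> (z - y) \<bullet> nv >= - ep * dist z y))"
 by (rule conjI[OF nv1], rule allI, rule impI, rule hprop)
 qed (elim conjE, rule uniq)
 thus ?thesis unfolding outward_normal_def nv_def .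
qed

context boundary_chart
begin

definition gradF :: "real^'d => real^'d" where "gradF y = (\<chi> i. pd i F y)"

lemma F_has_derivative: "(F has_derivative (%h. h \<bullet> gradF y)) (at y)"
 using has_derivative_pd[OF smooth_on_differentiable0[OF F_smooth UNIV_I]] by (simp add: gradF_def inner_vec_def)

text \<open>The derivative of \<open>F\<close> along \<open>e\<close> is 1.\<close>

lemma gradF_nonzero: "gradF y ~= 0"
proof
 assume z: "gradF y = 0"
 have "((%t. y + t *R e) has_derivative (%t. t *R e)) (at (0::real))" by (auto intro!: derivative_eq_intros)
 from has_derivative_compose[OF this, of F "%h. h \<bullet> gradF y"] F_has_derivative[of y]
 have "((%t. F (y + t *R e)) has_derivative (%t. 0)) (at 0)" by (simp add: z)
 moreover have "((%t. F (y + t *R e)) has_derivative (%t. t)) (at 0)" unfolding F_shift by (auto intro!: derivative_eq_intros)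
 ultimately have "(%t::real. 0::real) = (%t. t)" by (rule has_derivative_unique)
 thus False by (metis zero_neq_one)
qed

lemma gradF_continuous: "continuous_on UNIV gradF"
 unfolding gradF_def by (intro continuous_on_vec_lambda smooth_on_continuous0 smooth_on_pd F_smooth)

lemma outward_normal_chart:
 assumes y: "y : ball x r" "y : frontier U"
 shows "outward_normal U y = gradF y /\<^sub>R norm (gradF y)"
proof (rule outward_normal_eq[OF F_has_derivative _ gradF_nonzero])
 show "F y = 0" using frontier_iff y by simp
 have "\<forall>\<^sub>F z in at y. z : ball x r" using y(1) by (intro eventually_at_in_open') auto
 thus "\<forall>\<^sub>F z in at y. z : U \<longleftrightarrow> F z < 0" by (rule eventually_mono) (rule dom_iff)
qed

end

section \<open>Geometry of the periodicity cell\<close>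

lemma periodic_int:
 assumes "periodic G f"
 shows "f (x + of_int k *R shift G) = f x"
proof -
 have p: "f (y + shift G) = f y" for y using assms by (simp add: periodic_def)
 have nat: "f (y + of_nat n *R shift G) = f y" for n y
 proof (induction n)
 case (Suc n)
 have "y + of_nat (Suc n) *R shift G = (y + of_nat n *R shift G) + shift G" by (simp add: algebra_simps)
 thus ?case using Suc p by metis
 qed simp
 show ?thesis
 proof (cases "k >= 0")
 case True
 thus ?thesis using nat[of x "nat k"] by simp
 next
 case False
 hence "f (x + of_int k *R shift G) = f ((x + of_int k *R shift G) + of_nat (nat (- k)) *R shift G)" by (rule_tac nat[symmetric])
 also have "(x + of_int k *R shift G) + of_nat (nat (- k)) *R shift G = x" using False by (simp add: algebra_simps)
 finally show ?thesis .
 qed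
qed

text \<open>Compactness of \<open>Sig G\<close> enters as a separate assumption, supplied later by
  the finitely many compact faces of the mesh. It makes \<open>Sig G\<close> closed, so that
  \<open>Sig_inf G\<close> is the union of its translates.\<close>

locale periodic_cell =
 fixes G :: "('d::finite) cell"
 assumes cell: "admissible_cell G" and compact_Sig: "compact (Sig G)"
begin

abbreviation "S \<equiv> shift G"

abbreviation iD :: "real^'d => 'b::zero_neq_one" where
 "iD \<equiv> indicator (dom G)"

abbreviation "wd \<equiv> weak_deriv (dom G)"

lemma card_d: "CARD('d) >= 2" and period_pos: "period G > 0" and open_dom: "open (dom G)"
 and bounded_dom: "bounded (dom G)" and dom_nonempty: "dom G ~= {}" and lft_disk: "open_disk (lft G)"
 and lft_subset: "lft G \<subseteq> frontier (dom G)" and frontier_inf: "frontier (Dom_inf G) = Sig_inf G"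
 and smooth_dom: "smooth_domain (Dom_inf G)"
proof -
 note c = cell[unfolded admissible_cell_def]
 have "CARD('d) : {2, 3}" using c by (rule conjunct1)
 thus "CARD('d) >= 2" by auto
 show "0 < period G" using c by (elim conjE)
 show "open (dom G)" using c by (elim conjE)
 show "bounded (dom G)" using c by (elim conjE)
 show "dom G ~= {}" using c by (elim conjE)
 show "open_disk (lft G)" using c by (elim conjE)
 show "frontier (Dom_inf G) = Sig_inf G" using c by (elim conjE)
 show "smooth_domain (Dom_inf G)" using c by (elim conjE)
 have "lft G \<union> rgt G \<subseteq> frontier (dom G)" using c by (elim conjE)
 thus "lft G \<subseteq> frontier (dom G)" by simp
qed

lemma dom_disjoint: "k ~= 0 ==> x : dom G ==> x + of_int k *R S ~: dom G"
proof
 assume k: "k ~= 0" and x: "x : dom G" "x + of_int k *R S : dom G"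
 have "ALL k::int. k ~= 0 --> dom G \<inter> (+) (of_int k *R S) ` dom G = {}"
 using cell unfolding admissible_cell_def by (elim conjE)
 hence "dom G \<inter> (+) (of_int k *R S) ` dom G = {}" using k by blast
 moreover have "x + of_int k *R S : (+) (of_int k *R S) ` dom G" using x(1) by (intro image_eqI[of _ _ x]) (auto simp: add.commute)
 ultimately show False using x(2) by blast
qed

lemma norm_S: "norm S = period G"
 using period_pos by (simp add: shift_def)

lemma open_Dom_inf: "open (Dom_inf G)"
 using smooth_dom by (simp add: smooth_domain_def)

lemma dom_subset: "dom G \<subseteq> Dom_inf G"
proof
 fix x assume "x : dom G"
 hence "x + of_int 0 *R S : dom G \<union> lft G" by simp
 thus "x : Dom_inf G" unfolding Dom_inf_def by blast
qed

lemma Sig_inf_iff: "x : Sig_inf G \<longleftrightarrow> (EX k::int. x + of_int k *R S : Sig G)"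
 using compact_Sig by (simp add: Sig_inf_def closure_closed compact_imp_closed)

lemma Sig_subset: "Sig G \<subseteq> Sig_inf G"
proof
 fix x assume "x : Sig G"
 hence "x + of_int 0 *R S : Sig G" by simp
 thus "x : Sig_inf G" unfolding Sig_inf_iff by blast
qed

lemma Sig_inf_shift: "x + of_int k *R S : Sig_inf G \<longleftrightarrow> x : Sig_inf G"
proof -
 have *: "x + of_int k *R S : Sig_inf G" if x: "x : Sig_inf G" for x k
 proof -
 obtain j :: int where "x + of_int j *R S : Sig G" using x unfolding Sig_inf_iff by blast
 hence "(x + of_int k *R S) + of_int (j - k) *R S : Sig G" by (simp add: algebra_simps)
 thus ?thesis unfolding Sig_inf_iff by blast
 qed
 show ?thesis using *[of x k] *[of "x + of_int k *R S" "- k"] by auto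
qed

lemma Dom_inf_shift: "x + of_int k *R S : Dom_inf G \<longleftrightarrow> x : Dom_inf G"
proof -
 have *: "x + of_int k *R S : Dom_inf G" if x: "x : Dom_inf G" for x k
 proof -
 obtain j :: int where "x + of_int j *R S : dom G \<union> lft G" using x unfolding Dom_inf_def by blast
 hence "(x + of_int k *R S) + of_int (j - k) *R S : dom G \<union> lft G" by (simp add: algebra_simps)
 thus ?thesis unfolding Dom_inf_def by blast
 qed
 show ?thesis using *[of x k] *[of "x + of_int k *R S" "- k"] by auto
qed

lemma closed_Sig_inf: "closed (Sig_inf G)"
 unfolding frontier_inf[symmetric] by (rule frontier_closed)

lemma dom_lft_bound: obtains R where "R > 0" "!!x. x : dom G \<union> lft G ==> norm x <= R"
proof -
 have "bounded (closure (dom G))" using bounded_dom by (rule bounded_closure)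
 then obtain R where "ALL x:closure (dom G). norm x <= R" unfolding bounded_iff by blast
 moreover have "dom G \<union> lft G \<subseteq> closure (dom G)" using lft_subset closure_subset by (auto simp: frontier_def)
 ultimately show ?thesis by (intro that[of "max R 1"]) (auto simp: subset_iff le_max_iff_disj)
qed

text \<open>With empty frontier \<open>Dom_inf G\<close> would be empty or, the space being
  connected, everything. It is neither: it contains the domain and is bounded in every coordinate
  direction other than the periodic one, and dimension at least 2 provides such a direction.\<close>

lemma Sig_inf_nonempty: "Sig_inf G ~= {}"
proof
 assume "Sig_inf G = {}"
 hence "Dom_inf G = {} \<or> Dom_inf G = UNIV" using frontier_inf frontier_eq_empty[of "Dom_inf G"] by simp
 moreover have "Dom_inf G ~= {}" using dom_subset dom_nonempty by blast
 moreover have "Dom_inf G ~= UNIV"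
 proof
 assume U: "Dom_inf G = UNIV"
 obtain R where R: "R > 0" "!!x. x : dom G \<union> lft G ==> norm x <= R" by (rule dom_lft_bound, rule that)
 have "EX j. j ~= axl G"
 proof (rule ccontr)
 assume "\<not> ?thesis"
 hence "(UNIV :: 'd set) = {axl G}" by auto
 hence "CARD('d) = card {axl G}" by simp
 hence "CARD('d) = 1" by simp
 thus False using card_d by simp
 qed
 then obtain j where j: "j ~= axl G" by blast
 let ?x = "axis j (R + 1) :: real^'d"
 have "?x : Dom_inf G" using U by simp
 then obtain k :: int where k: "?x + of_int k *R S : dom G \<union> lft G" unfolding Dom_inf_def by blast
 have cj: "(?x + of_int k *R S) $ j = R + 1" using j by (simp add: shift_def axis_def)
 have "\<bar>(?x + of_int k *R S) $ j\<bar> <= norm (?x + of_int k *R S)" by (rule component_le_norm_cart)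
 hence "R + 1 <= norm (?x + of_int k *R S)" unfolding cj by linarith
 thus False using R(2)[OF k] by simp
 qed
 ultimately show False by blast
qed

section \<open>Finite chart covers and the measure of the wall\<close>

definition charts :: "((real^'d) \<times> real \<times> (real^'d) \<times> (real^'d => real) \<times> real) set" where
 "charts = {(x, r, e, F, La). chart (Dom_inf G) x r e F La}"

text \<open>Balls of a quarter of the chart radius leave room for the shifted and enlarged
  neighbourhoods of the strip estimates.\<close>

lemma chart_cover:
 assumes K: "compact K" "K \<subseteq> Sig_inf G"
 obtains C where "finite C" "C \<subseteq> charts" "K \<subseteq> (\<Union>(x, r, e, F, La)\<in>C. ball x (r / 4))"
proof -
 have "ALL x. EX c. x : K --> c : charts & fst c = x"
 proof
 fix x
 show "EX c. x : K --> c : charts & fst c = x"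
 proof (cases "x : K")
 case True
 hence "x : frontier (Dom_inf G)" using K(2) frontier_inf by blast
 then obtain r e F La where "chart (Dom_inf G) x r e F La" by (rule chart_exists[OF smooth_dom])
 thus ?thesis by (intro exI[of _ "(x, r, e, F, La)"]) (simp add: charts_def)
 qed auto
 qed
 from choice[OF this] obtain c where c: "ALL x. x : K --> c x : charts & fst (c x) = x" ..
 define B where "B p = (case p of (x, r, e, F, La) => ball x (r / 4))" for p :: "(real^'d) \<times> real \<times> (real^'d) \<times> (real^'d => real) \<times> real"
 have op: "open (B p)" for p by (simp add: B_def split: prod.split)
 have xB: "x : B (c x)" if "x : K" for x
 proof -
 obtain x' r e F La where p: "c x = (x', r, e, F, La)" by (cases "c x") auto
 have "c x : charts" "fst (c x) = x" using c that by auto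
 hence "chart (Dom_inf G) x r e F La" "x' = x" by (simp_all add: p charts_def)
 thus ?thesis by (simp add: p B_def chart_def)
 qed
 have "K \<subseteq> (\<Union>x\<in>K. B (c x))" using xB by blast
 then obtain K' where K': "K' \<subseteq> K" "finite K'" "K \<subseteq> (\<Union>x\<in>K'. B (c x))"
 using compactE_image[OF K(1), of K "%x. B (c x)"] op by metis
 show ?thesis
 proof (rule that[of "c ` K'"])
 show "finite (c ` K')" using K' by simp
 show "c ` K' \<subseteq> charts" using K' c by blast
 have "(\<Union>x\<in>K'. B (c x)) = (\<Union>(x, r, e, F, La)\<in>c ` K'. ball x (r / 4))" by (auto simp: B_def)
 thus "K \<subseteq> (\<Union>(x, r, e, F, La)\<in>c ` K'. ball x (r / 4))" using K'(3) by simp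
 qed
qed

lemma chartsD: "(x, r, e, F, La) : charts ==> boundary_chart (Dom_inf G) x r e F La"
 by (simp add: charts_def boundary_chart_def)

lemma Sig_borel: "Sig G : sets borel"
 using compact_Sig by (rule borel_compact)

text \<open>Finitely many charts, each of finite measure by \<open>hausdorff_finite\<close>.
  Finiteness makes bounded tractions square integrable and lets \<open>L^2\<close> convergence on
  the wall imply \<open>L^1\<close> convergence.\<close>

lemma wall_finite: "emeasure (wall G) (space (wall G)) < \<infinity>"
proof -
 let ?m = "hausdorff_outer (real CARD('d) - 1)"
 obtain C where C: "finite C" "C \<subseteq> charts" "Sig G \<subseteq> (\<Union>(x, r, e, F, La)\<in>C. ball x (r / 4))"
 by (rule chart_cover[OF compact_Sig Sig_subset], rule that)
 define N where "N p = (case p of (x, r, e, F, La) => Sig G \<inter> ball x (r / 4))" for p :: "(real^'d) \<times> real \<times> (real^'d) \<times> (real^'d => real) \<times> real"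
 have fin: "?m (N p) < \<infinity>" if p: "p : C" for p
 proof -
 obtain x r e F La where pp: "p = (x, r, e, F, La)" by (cases p) auto
 have "(x, r, e, F, La) : charts" using C(2) p pp by blast
 then interpret boundary_chart "Dom_inf G" x r e F La by (rule chartsD)
 have "N p \<subseteq> {y : ball x (r / 2). F y = 0}"
 proof
 fix y assume "y : N p"
 hence y: "y : Sig G" "dist x y < r / 4" by (auto simp: N_def pp)
 hence "y : ball x r" "y : frontier (Dom_inf G)" using r_pos Sig_subset frontier_inf by auto
 thus "y : {y : ball x (r / 2). F y = 0}" using frontier_iff y r_pos by auto
 qed
 thus ?thesis by (rule hausdorff_finite)
 qed
 have "?m (\<Union>p\<in>C'. N p) < \<infinity>" if "C' \<subseteq> C" for C'
 using finite_subset[OF that C(1)] that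
 proof (induction C' rule: finite_induct)
 case (insert p C')
 have "?m (\<Union>p\<in>insert p C'. N p) <= ?m (N p) + ?m (\<Union>p\<in>C'. N p)" using hausdorff_outer_Un_le by simp
 also have "... < \<infinity>" using insert fin by simp
 finally show ?case .
 qed simp
 from this[of C] have "?m (\<Union>p\<in>C. N p) < \<infinity>" by simp
 moreover have "Sig G \<subseteq> (\<Union>p\<in>C. N p)"
 proof
 fix y assume y: "y : Sig G"
 hence "y : (\<Union>(x, r, e, F, La)\<in>C. ball x (r / 4))" using C(3) by blast
 then obtain p where p: "p : C" "y : (case p of (x, r, e, F, La) => ball x (r / 4))" by blast
 hence "y : N p" using y by (auto simp: N_def split: prod.splits)
 thus "y : (\<Union>p\<in>C. N p)" using p(1) by blast
 qed
 ultimately have "?m (Sig G) < \<infinity>" using hausdorff_outer_mono le_less_trans by blast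
 thus ?thesis by (simp add: emeasure_surf[OF Sig_borel])
qed

text \<open>Countably many translates of a null set, listed by \<open>int_decode\<close>.\<close>

lemma Sig_inf_null:
 assumes "A \<subseteq> Sig G" "hausdorff_outer s A = 0"
 shows "hausdorff_outer s {y. EX k::int. y + of_int k *R S : A} = 0"
proof -
 have z: "hausdorff_outer s ((+) a ` A) = 0" for a
 using hausdorff_outer_translate_le[of s a A] assms(2) by simp
 have "{y. EX k::int. y + of_int k *R S : A} \<subseteq> (\<Union>n. (+) (- (of_int (int_decode n) *R S)) ` A)"
 proof
 fix y assume "y : {y. EX k::int. y + of_int k *R S : A}"
 then obtain k :: int where k: "y + of_int k *R S : A" by blast
 have "y : (+) (- (of_int (int_decode (int_encode k)) *R S)) ` A"
 by (rule image_eqI[OF _ k]) simp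
 thus "y : (\<Union>n. (+) (- (of_int (int_decode n) *R S)) ` A)" by blast
 qed
 from hausdorff_outer_mono[OF this, of s] show ?thesis
 unfolding hausdorff_outer_null_UN[of s "%n. (+) (- (of_int (int_decode n) *R S)) ` A", OF z] by simp
qed

text \<open>Were the wall null, so would be the whole frontier of \<open>Dom_inf G\<close>, and with
  it the cylinder over it. But near a frontier point that cylinder contains a ball, since each
  \<open>y\<close> there lies on the line through the frontier point \<open>y - F y *R e\<close>.
  Positivity is what excludes a nonzero constant pressure with zero traction.\<close>

lemma wall_positive: "emeasure (wall G) (space (wall G)) > 0"
proof -
 let ?m = "hausdorff_outer (real CARD('d) - 1)"
 have "?m (Sig G) ~= 0"
 proof
 assume "?m (Sig G) = 0"
 hence z: "?m (Sig_inf G) = 0" using Sig_inf_null[of "Sig G"] by (simp add: Sig_inf_iff[abs_def, symmetric] Sig_inf_iff[symmetric])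
 obtain x where x: "x : frontier (Dom_inf G)" using Sig_inf_nonempty frontier_inf by blast
 obtain r e F La where "chart (Dom_inf G) x r e F La" by (rule chart_exists[OF smooth_dom x])
 then interpret boundary_chart "Dom_inf G" x r e F La by (rule boundary_chart.intro)
 obtain i where i: "e = axis i 1 \<or> e = - axis i 1" using e_axis by blast
 have null: "{y + t *R axis i 1 | y t. y : Sig_inf G & \<bar>t\<bar> <= r} : null_sets lebesgue"
 by (rule cylinder_null[OF card_d z r_pos])
 \<comment> \<open>On this ball the Lipschitz bound keeps \<open>\<bar>F y\<bar>\<close> within
   \<open>r / 4\<close>, so the foot point stays inside the chart.\<close>
 define ro where "ro = r / (4 * La)"
 have ro: "ro > 0" "La * ro = r / 4" "ro <= r / 4" using r_pos La_ge by (auto simp: ro_def field_simps)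
 have Fx: "F x = 0" using frontier_iff[of x] x r_pos by simp
 have "ball x ro \<subseteq> {y + t *R axis i 1 | y t. y : Sig_inf G & \<bar>t\<bar> <= r}"
 proof
 fix y assume y: "y : ball x ro"
 hence yr: "y : ball x r" using ro r_pos by simp
 have "\<bar>F y - F x\<bar> <= La * norm (y - x)" using yr r_pos by (intro F_lip) auto
 also have "... <= La * ro" using y La_ge by (intro mult_left_mono) (auto simp: dist_norm norm_minus_commute)
 finally have Fy: "\<bar>F y\<bar> <= r / 4" using ro Fx by simp
 define z where "z = y - F y *R e"
 have "dist y z = \<bar>F y\<bar>" by (simp add: z_def dist_norm norm_e)
 hence "dist x z < r" using dist_triangle[of x z y] y Fy ro r_pos by simp
 moreover have "F z = 0" by (simp add: z_def F_shift_minus)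
 ultimately have zS: "z : Sig_inf G" using frontier_iff[of z] frontier_inf by simp
 show "y : {y + t *R axis i 1 | y t. y : Sig_inf G & \<bar>t\<bar> <= r}"
 using i
 proof
 assume "e = axis i 1"
 thus ?thesis using zS Fy r_pos by (intro CollectI exI[of _ z] exI[of _ "F y"]) (auto simp: z_def)
 next
 assume "e = - axis i 1"
 thus ?thesis using zS Fy r_pos by (intro CollectI exI[of _ z] exI[of _ "- F y"]) (auto simp: z_def)
 qed
 qed
 hence "negligible (ball x ro)" using null negligible_iff_null_sets negligible_subset by blast
 thus False using open_not_negligible[of "ball x ro"] ro(1) by simp
 qed
 thus ?thesis by (simp add: emeasure_surf[OF Sig_borel] zero_less_iff_neq_zero)
qed

text \<open>In each chart the normal is the normalised gradient of the smooth function
  \<open>F\<close>.\<close>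

lemma norm_nrm: "y : Sig G ==> norm (nrm G y) = 1"
 and continuous_on_nrm: "continuous_on (Sig G) (nrm G)"
proof -
 have loc: "norm (nrm G y) = 1 & continuous (at y within Sig G) (nrm G)" if y: "y : Sig G" for y
 proof -
 have yf: "y : frontier (Dom_inf G)" using y Sig_subset frontier_inf by blast
 obtain r e F La where "chart (Dom_inf G) y r e F La" by (rule chart_exists[OF smooth_dom yf])
 then interpret boundary_chart "Dom_inf G" y r e F La by (rule boundary_chart.intro)
 have eq: "nrm G z = gradF z /\<^sub>R norm (gradF z)" if "z : Sig G" "z : ball y r" for z
 unfolding nrm_def using that Sig_subset frontier_inf by (intro outward_normal_chart) auto
 have "norm (nrm G y) = 1" using eq[OF y] r_pos gradF_nonzero[of y] by simp
 moreover have "continuous (at y within Sig G) (nrm G)"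
 proof (rule continuous_transform_within[where \<delta>=r])
 have "continuous (at y) (%z. gradF z /\<^sub>R norm (gradF z))"
 using gradF_continuous gradF_nonzero[of y] by (intro continuous_intros) (auto simp: continuous_on_eq_continuous_at)
 thus "continuous (at y within Sig G) (%z. gradF z /\<^sub>R norm (gradF z))" by (rule continuous_at_imp_continuous_at_within)
 qed (use eq y r_pos in \<open>auto simp: dist_commute\<close>)
 ultimately show ?thesis ..
 qed
 show "y : Sig G ==> norm (nrm G y) = 1" using loc by blast
 show "continuous_on (Sig G) (nrm G)" unfolding continuous_on_eq_continuous_within using loc by blast
qed

end

section \<open>Estimates along the lines transversal to the boundary\<close>

lemma nn_integral_lborel_shift:
 fixes f :: "'a::euclidean_space => ennreal"
 assumes [measurable]: "f : borel_measurable borel"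
 shows "(NI (%y. f (y + a))) = (NI (%y. f y))"
proof -
 have "(NI (%y. f y)) = (\<integral>\<^sup>+y. f y \<partial>distr lborel borel ((+) a))" by (simp add: lborel_distr_plus)
 also have "... = (NI (%y. f (a + y)))" by (subst nn_integral_distr) auto
 finally show ?thesis by (simp add: add.commute)
qed

text \<open>The l1 norm of the gradient; it dominates the derivative along every axis, in particular
  along the chart direction.\<close>

definition gsum :: "(real^'d::finite => real) => real^'d => real" where
 "gsum f y = (\<Sum>i\<in>UNIV. \<bar>pd i f y\<bar>)"

lemma gsum_continuous: "smooth_on UNIV f ==> continuous_on UNIV (gsum f)"
 unfolding gsum_def by (intro continuous_intros smooth_on_continuous0 smooth_on_pd)

lemma gsum_nonneg: "0 <= gsum f y"
 unfolding gsum_def by (intro sum_nonneg) auto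

context boundary_chart
begin

abbreviation proj :: "real^'d => real^'d" where "proj y \<equiv> y - F y *R e"

lemma F_proj: "F (proj y) = 0"
 by (simp add: F_shift_minus)

text \<open>Fundamental theorem of calculus on the segment from \<open>y\<close> up to
  \<open>proj y\<close>, of length \<open>- F y < t1\<close>. The indicator records that the segment
  stays under the boundary and close to \<open>y\<close>, which is what the integration over
  \<open>y\<close> retains.\<close>

lemma line_pointwise:
 assumes f: "smooth_on UNIV f" and y: "- t1 < F y" "F y < 0" and t1: "0 < t1"
 shows "ennreal \<bar>f (proj y) - f y\<bar> <= (NI (%t. indicator {0..t1} t * (indicator {z. - t1 < F z & F z < 0 & dist y z <= t1} (y + t *R e) * ennreal (gsum f (y + t *R e)))))"
proof -
 define ta where "ta = - F y"
 have ta: "0 < ta" "ta < t1" using y by (auto simp: ta_def)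
 define D where "D t = (\<Sum>i\<in>UNIV. e $ i *R pd i f (y + t *R e))" for t
 have der: "((%t. f (y + t *R e)) has_vector_derivative D t) (at t)" for t
 proof -
 have "((%t. y + t *R e) has_derivative (%t. t *R e)) (at t)" by (auto intro!: derivative_eq_intros)
 from has_derivative_compose[OF this has_derivative_pd[OF smooth_on_differentiable0[OF f UNIV_I]]]
 show ?thesis unfolding has_vector_derivative_def
 by (rule has_derivative_eq_rhs) (simp add: D_def fun_eq_iff sum_distrib_left mult.assoc)
 qed
 have Db: "\<bar>D t\<bar> <= gsum f (y + t *R e)" for t
 proof -
 have "\<bar>D t\<bar> <= (\<Sum>i\<in>UNIV. \<bar>e $ i *R pd i f (y + t *R e)\<bar>)" unfolding D_def by (rule sum_abs)
 also have "... <= (\<Sum>i\<in>UNIV. \<bar>pd i f (y + t *R e)\<bar>)"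
 using component_le_norm_cart[of e] norm_e by (intro sum_mono) (simp add: abs_mult mult_left_le_one_le)
 finally show ?thesis by (simp add: gsum_def)
 qed
 let ?g = "%t. gsum f (y + t *R e)"
 have gc: "continuous_on UNIV ?g" by (rule continuous_on_compose2[OF gsum_continuous[OF f]]) (auto intro!: continuous_intros)
 have gi: "?g integrable_on {0..ta}" by (intro integrable_continuous_interval continuous_on_subset[OF gc]) auto
 have "(D has_integral f (y + ta *R e) - f (y + 0 *R e)) {0..ta}"
 using ta by (intro fundamental_theorem_of_calculus) (auto intro: has_vector_derivative_at_within der)
 hence "norm (f (y + ta *R e) - f (y + 0 *R e)) <= integral {0..ta} ?g"
 using gi Db by (intro integral_norm_bound_integral[of D, THEN order_trans[rotated]]) (auto simp: has_integral_iff)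
 hence "\<bar>f (proj y) - f y\<bar> <= integral {0..ta} ?g" by (simp add: ta_def)
 hence "ennreal \<bar>f (proj y) - f y\<bar> <= ennreal (integral {0..ta} ?g)" by (rule ennreal_leI)
 also have "... = (NI (%t. ennreal (indicator {0..ta} t * ?g t)))"
 proof (rule nn_integral_has_integral_lborel[symmetric])
 show "(%t. indicator {0..ta} t * ?g t) : borel_measurable borel"
 by (intro borel_measurable_times bm_contI gc borel_measurable_indicator) auto
 show "0 <= indicator {0..ta} t * ?g t" for t by (simp add: gsum_nonneg)
 have "((%t. if t : {0..ta} then ?g t else 0) has_integral integral {0..ta} ?g) UNIV"
 using gi by (simp only: has_integral_restrict_UNIV integrable_integral)
 thus "((%t. indicator {0..ta} t * ?g t) has_integral integral {0..ta} ?g) UNIV"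
 by (rule has_integral_eq[rotated]) (auto simp: indicator_def)
 qed
 also have "... <= (NI (%t. indicator {0..t1} t * (indicator {z. - t1 < F z & F z < 0 & dist y z <= t1} (y + t *R e) * ennreal (?g t))))"
 proof (rule nn_integral_mono_AE)
 \<comment> \<open>The end point \<open>ta\<close> lies on the boundary, outside the strip; a single
   value of \<open>t\<close> is null.\<close>
 have "AE t in lborel. t ~= ta" by (rule AE_lborel_singleton)
 thus "AE t in lborel. ennreal (indicator {0..ta} t * ?g t) <= indicator {0..t1} t * (indicator {z. - t1 < F z & F z < 0 & dist y z <= t1} (y + t *R e) * ennreal (?g t))"
 proof (rule eventually_mono)
 fix t assume t: "t ~= ta"
 show "ennreal (indicator {0..ta} t * ?g t) <= indicator {0..t1} t * (indicator {z. - t1 < F z & F z < 0 & dist y z <= t1} (y + t *R e) * ennreal (?g t))"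
 proof (cases "t : {0..ta}")
 case True
 hence t': "0 <= t" "t < ta" using t by auto
 hence "- t1 < F (y + t *R e)" "F (y + t *R e) < 0" using y unfolding F_shift by (auto simp: ta_def)
 moreover have "dist y (y + t *R e) <= t1" using t' ta norm_e by (simp add: dist_norm)
 ultimately show ?thesis using True t' ta by simp
 qed simp
 qed
 qed
 finally show ?thesis .
qed

text \<open>After exchanging the integrals, translation invariance makes the integral over
  \<open>y\<close> independent of the height \<open>t\<close>, and the heights contribute the factor
  \<open>t1\<close>. This gain of one power of the width is the source of the Hardy
  estimate.\<close>

lemma line_estimate:
 assumes f: "smooth_on UNIV f" and t1: "0 < t1"
 and D: "D : sets borel" "D \<subseteq> {y : ball x ro. - t1 < F y & F y < 0}"
 shows "(NI (%y. indicator D y * ennreal \<bar>f (proj y) - f y\<bar>))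
 <= ennreal t1 * (NI (%y. indicator {y : ball x (ro + t1). - t1 < F y & F y < 0} y * ennreal (gsum f y)))"
proof -
 define D' where "D' = {y : ball x (ro + t1). - t1 < F y & F y < 0}"
 have [measurable]: "F : borel_measurable borel" by (rule bm_contI[OF F_continuous])
 have [measurable]: "gsum f : borel_measurable borel" by (rule bm_contI[OF gsum_continuous[OF f]])
 have D'm [measurable]: "D' : sets borel"
 proof -
 have "D' = ball x (ro + t1) \<inter> F -` {- t1<..<0}" by (auto simp: D'_def)
 moreover have "open (ball x (ro + t1) \<inter> F -` {- t1<..<0})" by (intro open_Int open_ball open_vimage F_continuous open_greaterThanLessThan)
 ultimately show ?thesis by simp
 qed
 define h where "h z = indicator D' z * ennreal (gsum f z)" for z
 have hm [measurable]: "h : borel_measurable borel" unfolding h_def by measurable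
 have "(NI (%y. indicator D y * ennreal \<bar>f (proj y) - f y\<bar>)) <= (NI (%y. NI (%t. indicator {0..t1} t * h (y + t *R e))))"
 proof (rule nn_integral_mono)
 fix y
 show "indicator D y * ennreal \<bar>f (proj y) - f y\<bar> <= (NI (%t. indicator {0..t1} t * h (y + t *R e)))"
 proof (cases "y : D")
 case True
 hence y: "dist x y < ro" "- t1 < F y" "F y < 0" using D(2) by auto
 have "ennreal \<bar>f (proj y) - f y\<bar> <= (NI (%t. indicator {0..t1} t * (indicator {z. - t1 < F z & F z < 0 & dist y z <= t1} (y + t *R e) * ennreal (gsum f (y + t *R e)))))"
 by (rule line_pointwise[OF f y(2,3) t1])
 also have "... <= (NI (%t. indicator {0..t1} t * h (y + t *R e)))"
 proof (intro nn_integral_mono mult_left_mono)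
 fix t
 show "indicator {z. - t1 < F z & F z < 0 & dist y z <= t1} (y + t *R e) * ennreal (gsum f (y + t *R e)) <= h (y + t *R e)"
 proof (cases "y + t *R e : {z. - t1 < F z & F z < 0 & dist y z <= t1}")
 case True
 hence "y + t *R e : D'" using y(1) dist_triangle[of x "y + t *R e" y] by (auto simp: D'_def)
 thus ?thesis using True by (simp add: h_def)
 qed simp
 qed simp
 finally show ?thesis using True by simp
 qed simp
 qed
 also have "... = (NI (%t. NI (%y. indicator {0..t1} t * h (y + t *R e))))"
 by (rule lborel_pair.Fubini'[symmetric]) measurable
 also have "... = (NI (%t. indicator {0..t1} t * (NI (%y. h y))))"
 by (simp add: nn_integral_cmult nn_integral_lborel_shift)
 also have "... = ennreal t1 * (NI (%y. h y))" using t1 by (simp add: nn_integral_multc)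
 finally show ?thesis by (simp add: h_def D'_def)
qed

end

context periodic_cell
begin

lemma AE_not_lft: "AE y in lborel. y + a ~: lft G"
proof -
 obtain c nv R where nv: "norm nv = 1" "lft G = {x. (x - c) \<bullet> nv = 0 & dist x c < R}"
 using lft_disk unfolding open_disk_def by blast
 define H where "H = {x. nv \<bullet> x = nv \<bullet> (c - a)}"
 have "negligible H" unfolding H_def by (rule negligible_hyperplane) (use nv(1) in auto)
 hence "H : null_sets lebesgue" by (simp add: negligible_iff_null_sets)
 moreover have "closed H" unfolding H_def by (rule closed_hyperplane)
 ultimately have "H : null_sets lborel" by (simp add: null_sets_def)
 hence "AE y in lborel. y ~: H" by (rule AE_not_in)
 thus ?thesis
 by (rule eventually_mono) (auto simp: H_def nv(2) inner_commute inner_diff_left inner_diff_right inner_add_left inner_add_right)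
qed

lemma dom_borel [measurable]: "dom G : sets borel"
 using open_dom by simp

lemma Dom_inf_borel [measurable]: "Dom_inf G : sets borel"
 using open_Dom_inf by simp

text \<open>\<open>B\<close> meets only translates whose index is bounded by
  \<open>(R + R1) / period G\<close>, and \<open>m\<close> counts these; the translates of the disk
  are null.\<close>

lemma periodic_integral_le:
 assumes B: "bounded B"
 obtains m :: nat where "!!g :: real^'d => ennreal. g : borel_measurable borel ==> periodic G g ==>
 (NI (%y. indicator (B \<inter> Dom_inf G) y * g y)) <= of_nat m * (NI (%y. iD y * g y))"
proof -
 obtain R where R: "R > 0" "!!x. x : dom G \<union> lft G ==> norm x <= R" by (rule dom_lft_bound, rule that)
 obtain R1 where R1: "!!y. y : B ==> norm y <= R1" using B unfolding bounded_iff by blast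
 define m0 where "m0 = \<lceil>(R + R1) / period G\<rceil>"
 define I where "I = {- m0..m0}"
 show ?thesis
 proof (rule that[of "card I"])
 fix g :: "real^'d => ennreal" assume gm [measurable]: "g : borel_measurable borel" and p: "periodic G g"
 have "(NI (%y. indicator (B \<inter> Dom_inf G) y * g y)) <= (NI (%y. (\<Sum>k\<in>I. iD (y + of_int k *R S) * g (y + of_int k *R S))))"
 proof (rule nn_integral_mono_AE)
 have "AE y in lborel. ALL k:I. y + of_int k *R S ~: lft G"
 by (intro AE_finite_allI AE_not_lft) (auto simp: I_def)
 thus "AE y in lborel. indicator (B \<inter> Dom_inf G) y * g y <= (\<Sum>k\<in>I. iD (y + of_int k *R S) * g (y + of_int k *R S))"
 proof (rule eventually_mono)
 fix y assume nl: "ALL k:I. y + of_int k *R S ~: lft G"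
 show "indicator (B \<inter> Dom_inf G) y * g y <= (\<Sum>k\<in>I. iD (y + of_int k *R S) * g (y + of_int k *R S))"
 proof (cases "y : B \<inter> Dom_inf G")
 case True
 then obtain k :: int where k: "y + of_int k *R S : dom G \<union> lft G" unfolding Dom_inf_def by blast
 have "\<bar>of_int k\<bar> * period G = norm ((y + of_int k *R S) - y)" by (simp add: norm_S)
 also have "... <= norm (y + of_int k *R S) + norm y" by (rule norm_triangle_ineq4)
 also have "... <= R + R1" using R(2)[OF k] R1[of y] True by simp
 finally have "\<bar>of_int k\<bar> <= (R + R1) / period G" using period_pos by (simp add: pos_le_divide_eq)
 hence "\<bar>k\<bar> <= m0" unfolding m0_def by linarith
 hence kI: "k : I" by (auto simp: I_def)
 hence "y + of_int k *R S : dom G" using k nl by blast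
 hence "indicator (B \<inter> Dom_inf G) y * g y = iD (y + of_int k *R S) * g (y + of_int k *R S)"
 using True periodic_int[OF p, of y k] by simp
 also have "... <= (\<Sum>k\<in>I. iD (y + of_int k *R S) * g (y + of_int k *R S))"
 using kI by (intro member_le_sum) (auto simp: I_def)
 finally show ?thesis .
 qed simp
 qed
 qed
 also have "... = (\<Sum>k\<in>I. NI (%y. iD (y + of_int k *R S) * g (y + of_int k *R S)))"
 by (intro nn_integral_sum) measurable
 also have "... = (\<Sum>k\<in>I. NI (%y. iD y * g y))"
 proof (intro sum.cong refl)
 fix k
 show "(NI (%y. iD (y + of_int k *R S) * g (y + of_int k *R S))) = (NI (%y. iD y * g y))"
 by (rule nn_integral_lborel_shift[of "%y. iD y * g y"]) measurable
 qed
 also have "... = of_nat (card I) * (NI (%y. iD y * g y))" by simp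
 finally show "(NI (%y. indicator (B \<inter> Dom_inf G) y * g y)) <= of_nat (card I) * (NI (%y. iD y * g y))" .
 qed
qed

lemma periodic_pd:
 fixes f :: "real^'d => 'b::euclidean_space"
 assumes "smooth_per G f"
 shows "periodic G (pd i f)"
proof -
 have s: "smooth_on UNIV f" and p: "periodic G f" using assms by (auto simp: smooth_per_def)
 have "(%x. f (x + S)) = f" using p by (auto simp: periodic_def)
 hence "pd i (%x. f (x + S)) x = pd i f x" for x by simp
 moreover have "pd i (%x. f (x + S)) x = pd i f (x + S)" for x
 by (rule pd_compose_add[OF smooth_on_differentiable0[OF s UNIV_I]])
 ultimately show ?thesis by (simp add: periodic_def)
qed

lemma periodic_gsum: "smooth_per G f ==> periodic G (gsum f)"
 using periodic_pd unfolding periodic_def gsum_def by fastforce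

text \<open>Choose integrals below \<open>(1/2) ^ Suc n\<close>: the series of the functions is
  integrable, hence finite almost everywhere, and its terms tend to zero.\<close>

lemma tendsto_zero_AE_subseq:
 fixes u :: "nat => 'a => ennreal"
 assumes m: "!!k. u k : borel_measurable M" and lim: "(%k. \<integral>\<^sup>+y. u k y \<partial>M) ----> 0"
 obtains s where "strict_mono s" "AE y in M. (%k. u (s k) y) ----> 0"
proof -
 have ex: "EX N. ALL k>=N. (\<integral>\<^sup>+y. u k y \<partial>M) < ennreal ((1/2) ^ Suc n)" for n
 using order_tendstoD(2)[OF lim, of "ennreal ((1/2) ^ Suc n)"] by (auto simp: eventually_sequentially)
 then obtain N where N: "!!n k. k >= N n ==> (\<integral>\<^sup>+y. u k y \<partial>M) < ennreal ((1/2) ^ Suc n)" by metis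
 define s where "s = rec_nat (N 0) (%n m. max (Suc m) (N (Suc n)))"
 have s_Suc: "s (Suc n) = max (Suc (s n)) (N (Suc n))" for n by (simp add: s_def)
 have sm: "strict_mono s" by (rule strict_monoI_Suc) (simp add: s_Suc)
 have sN: "s n >= N n" for n by (cases n) (simp_all add: s_Suc, simp add: s_def)
 have "(\<integral>\<^sup>+y. (\<Sum>n. u (s n) y) \<partial>M) = (\<Sum>n. \<integral>\<^sup>+y. u (s n) y \<partial>M)" by (rule nn_integral_suminf[OF m])
 also have "... <= (\<Sum>n. ennreal ((1/2) ^ Suc n))" using N[OF sN] by (intro suminf_le) (auto intro: less_imp_le)
 also have "... = ennreal 1" using power_half_series by (intro suminf_ennreal_eq) auto
 finally have "(\<integral>\<^sup>+y. (\<Sum>n. u (s n) y) \<partial>M) ~= \<infinity>" by (auto simp: top_unique)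
 hence "AE y in M. (\<Sum>n. u (s n) y) ~= \<infinity>" by (intro nn_integral_noteq_infinite) (use m in auto)
 hence "AE y in M. (%k. u (s k) y) ----> 0"
 proof (rule eventually_mono)
 fix y assume fin: "(\<Sum>n. u (s n) y) ~= \<infinity>"
 have f: "u (s n) y ~= top" for n
 using fin ennreal_suminf_lessD[of "%n. u (s n) y" top n] by (auto simp: less_top)
 hence e: "u (s n) y = ennreal (enn2real (u (s n) y))" for n by (simp add: less_top)
 have "summable (%n. enn2real (u (s n) y))"
 using fin by (intro summable_suminf_not_top) (auto simp: e[symmetric])
 hence "(%n. enn2real (u (s n) y)) ----> 0" by (rule summable_LIMSEQ_zero)
 hence "(%n. ennreal (enn2real (u (s n) y))) ----> ennreal 0" by (rule tendsto_ennrealI)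
 thus "(%k. u (s k) y) ----> 0" by (simp add: e[symmetric])
 qed
 with sm show ?thesis by (rule that)
qed

text \<open>On a chart, the boundary values \<open>f k \<circ> proj\<close> tend to zero almost everywhere below the
  boundary, so the set of boundary points where they do not is null by slicing.\<close>

lemma trace_null:
 fixes f :: "nat => real^'d => real" and g :: "real^'d => real"
 assumes f: "!!k. smooth_per G (f k)"
 and f0: "(%k. NI (%y. iD y * ennreal \<bar>f k y\<bar>)) ----> 0"
 and g0: "(%k. NI (%y. iD y * ennreal (gsum (f k) y))) ----> 0"
 and lim: "AE y in wall G. (%k. f k y) ----> g y"
 shows "AE y in wall G. g y = 0"
proof -
 let ?A = "%k. NI (%y. iD y * ennreal \<bar>f k y\<bar>)" and ?B = "%k. NI (%y. iD y * ennreal (gsum (f k) y))"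
 let ?m = "hausdorff_outer (real CARD('d) - 1)"
 obtain C where C: "finite C" "C \<subseteq> charts" "Sig G \<subseteq> (\<Union>(x, r, e, F, La)\<in>C. ball x (r / 4))"
 by (rule chart_cover[OF compact_Sig Sig_subset], rule that)
 have fs: "smooth_on UNIV (f k)" and fp: "periodic G (f k)" for k using f by (auto simp: smooth_per_def)
 have fm [measurable]: "f k : borel_measurable borel" for k
 by (rule bm_contI[OF smooth_on_continuous0[OF fs]])
 have gm [measurable]: "gsum (f k) : borel_measurable borel" for k
 by (rule bm_contI[OF gsum_continuous[OF fs]])
 \<comment> \<open>Only points at which the values converge are collected; those at which they do
   not are null by \<open>lim\<close>.\<close>
 define N where "N p = (case p of (x, r, e, F, La) => {z : Sig G \<inter> ball x (r / 4). (%k. f k z) ----> g z & g z ~= 0})" for p :: "(real^'d) \<times> real \<times> (real^'d) \<times> (real^'d => real) \<times> real"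
 have null: "?m (N p) = 0" if p: "p : C" for p
 proof -
 obtain x r e F La where pp: "p = (x, r, e, F, La)" by (cases p) auto
 have "(x, r, e, F, La) : charts" using C(2) p pp by blast
 then interpret boundary_chart "Dom_inf G" x r e F La by (rule chartsD)
 have [measurable]: "F : borel_measurable borel" by (rule bm_contI[OF F_continuous])
 define t0 where "t0 = r / 4"
 have t0: "0 < t0" "t0 <= r / 2" using r_pos by (auto simp: t0_def)
 define D where "D = {y : ball x (r / 2). - t0 < F y & F y < 0}"
 define D' where "D' = {y : ball x (r / 2 + t0). - t0 < F y & F y < 0}"
 have Dm [measurable]: "D : sets borel"
 proof -
 have "D = ball x (r / 2) \<inter> F -` {- t0<..<0}" by (auto simp: D_def)
 moreover have "open (ball x (r / 2) \<inter> F -` {- t0<..<0})" by (intro open_Int open_ball open_vimage F_continuous open_greaterThanLessThan)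
 ultimately show ?thesis by simp
 qed
 have DD: "D \<subseteq> ball x r \<inter> Dom_inf G" "D' \<subseteq> ball x r \<inter> Dom_inf G"
 using r_pos dom_iff by (auto simp: D_def D'_def t0_def)
 obtain m :: nat where m: "!!g :: real^'d => ennreal. g : borel_measurable borel ==> periodic G g ==>
 (NI (%y. indicator (ball x r \<inter> Dom_inf G) y * g y)) <= of_nat m * (NI (%y. iD y * g y))"
 by (rule periodic_integral_le[OF bounded_ball[of x r]], rule that)
 have b1: "(NI (%y. indicator D y * ennreal \<bar>f k y\<bar>)) <= of_nat m * ?A k" for k
 proof -
 have "(NI (%y. indicator D y * ennreal \<bar>f k y\<bar>)) <= (NI (%y. indicator (ball x r \<inter> Dom_inf G) y * ennreal \<bar>f k y\<bar>))"
 using DD(1) by (intro nn_integral_mono mult_right_mono) (auto simp: indicator_def)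
 also have "... <= of_nat m * ?A k"
 by (rule m) (use fp in \<open>auto simp: periodic_def\<close>)
 finally show ?thesis .
 qed
 have b2: "(NI (%y. indicator D' y * ennreal (gsum (f k) y))) <= of_nat m * ?B k" for k
 proof -
 have "(NI (%y. indicator D' y * ennreal (gsum (f k) y))) <= (NI (%y. indicator (ball x r \<inter> Dom_inf G) y * ennreal (gsum (f k) y)))"
 using DD(2) by (intro nn_integral_mono mult_right_mono) (auto simp: indicator_def)
 also have "... <= of_nat m * ?B k"
 by (rule m) (use periodic_gsum[OF f] in \<open>auto simp: periodic_def\<close>)
 finally show ?thesis .
 qed
 \<comment> \<open>Values at the foot point are controlled by those at \<open>y\<close> and by the
   gradient on the segment between, and both tend to zero in mean.\<close>
 have b3: "(NI (%y. indicator D y * ennreal \<bar>f k (proj y)\<bar>)) <=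
 ennreal t0 * (of_nat m * ?B k) + of_nat m * ?A k" for k
 proof -
 have "(NI (%y. indicator D y * ennreal \<bar>f k (proj y)\<bar>)) <= (NI (%y. indicator D y * ennreal \<bar>f k (proj y) - f k y\<bar> + indicator D y * ennreal \<bar>f k y\<bar>))"
 proof (rule nn_integral_mono)
 fix y
 have "ennreal \<bar>f k (proj y)\<bar> <= ennreal (\<bar>f k (proj y) - f k y\<bar> + \<bar>f k y\<bar>)" by (rule ennreal_leI) linarith
 thus "indicator D y * ennreal \<bar>f k (proj y)\<bar> <= indicator D y * ennreal \<bar>f k (proj y) - f k y\<bar> + indicator D y * ennreal \<bar>f k y\<bar>"
 by (simp add: distrib_left[symmetric] mult_left_mono)
 qed
 also have "... = (NI (%y. indicator D y * ennreal \<bar>f k (proj y) - f k y\<bar>)) + (NI (%y. indicator D y * ennreal \<bar>f k y\<bar>))"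
 by (rule nn_integral_add) measurable
 also have "... <= ennreal t0 * (of_nat m * ?B k) + of_nat m * ?A k"
 proof (rule add_mono[OF _ b1])
 have "(NI (%y. indicator D y * ennreal \<bar>f k (proj y) - f k y\<bar>)) <= ennreal t0 * (NI (%y. indicator D' y * ennreal (gsum (f k) y)))"
 unfolding D'_def by (rule line_estimate[OF fs t0(1) Dm]) (simp add: D_def)
 also have "... <= ennreal t0 * (of_nat m * ?B k)"
 by (rule mult_left_mono[OF b2]) simp
 finally show "(NI (%y. indicator D y * ennreal \<bar>f k (proj y) - f k y\<bar>)) <= ennreal t0 * (of_nat m * ?B k)" .
 qed
 finally show ?thesis .
 qed
 have "(%k. ennreal t0 * (of_nat m * ?B k) + of_nat m * ?A k)
 ----> ennreal t0 * (of_nat m * 0) + of_nat m * 0"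
 by (intro tendsto_add ennreal_tendsto_cmult g0 f0) (auto simp: of_nat_less_top)
 hence "(%k. ennreal t0 * (of_nat m * ?B k) + of_nat m * ?A k) ----> 0" by simp
 hence lim0: "(%k. NI (%y. indicator D y * ennreal \<bar>f k (proj y)\<bar>)) ----> 0"
 proof (rule tendsto_sandwich[of "%_. 0", rotated 3])
 show "\<forall>\<^sub>F k in sequentially. (NI (%y. indicator D y * ennreal \<bar>f k (proj y)\<bar>)) <=
 ennreal t0 * (of_nat m * ?B k) + of_nat m * ?A k"
 by (rule always_eventually, rule allI, rule b3)
 qed auto
 have um: "(%y. indicator D y * ennreal \<bar>f k (proj y)\<bar>) : borel_measurable lborel" for k by measurable
 obtain s where s: "strict_mono s" "AE y in lborel. (%k. indicator D y * ennreal \<bar>f (s k) (proj y)\<bar>) ----> 0"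
 by (rule tendsto_zero_AE_subseq[OF um lim0], rule that)
 show ?thesis
 proof (rule hausdorff_null_of_cylinder[OF _ t0])
 have NF: "F z = 0 & dist x z < r / 4 & (%k. f k z) ----> g z & g z ~= 0" if z: "z : N p" for z
 proof -
 have "z : Sig G" "dist x z < r / 4" "(%k. f k z) ----> g z" "g z ~= 0" using z by (auto simp: N_def pp)
 moreover have "z : frontier (Dom_inf G)" using \<open>z : Sig G\<close> Sig_subset frontier_inf by blast
 ultimately show ?thesis using frontier_iff[of z] r_pos by simp
 qed
 show "N p \<subseteq> {y : ball x (r / 2). F y = 0}" using NF r_pos by fastforce
 have "AE y in lebesgue. (%k. indicator D y * ennreal \<bar>f (s k) (proj y)\<bar>) ----> 0" by (rule AE_completion[OF s(2)])
 then obtain Z where Z: "Z : null_sets lebesgue" "{y. \<not> (%k. indicator D y * ennreal \<bar>f (s k) (proj y)\<bar>) ----> 0} \<subseteq> Z"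
 by (auto simp: eventually_ae_filter)
 have "{z - t *R e |z t. z : N p & 0 < t & t < t0} \<subseteq> Z"
 proof
 fix y assume "y : {z - t *R e |z t. z : N p & 0 < t & t < t0}"
 then obtain z t where z: "y = z - t *R e" "z : N p" "0 < t" "t < t0" by blast
 note n = NF[OF z(2)]
 have Fy: "F y = - t" using n by (simp add: z(1) F_shift_minus)
 have pz: "proj y = z" using Fy by (simp add: z(1))
 have "dist x y <= dist x z + t" using dist_triangle[of x y z] z norm_e by (simp add: dist_norm)
 hence "y : D" using Fy z n by (simp add: D_def t0_def)
 have "(%k. ennreal \<bar>f (s k) z\<bar>) ----> ennreal \<bar>g z\<bar>"
 using LIMSEQ_subseq_LIMSEQ[OF _ s(1), of "%k. f k z" "g z"] n by (intro tendsto_ennrealI tendsto_rabs) (auto simp: o_def)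
 moreover have "ennreal \<bar>g z\<bar> ~= 0" using n by simp
 ultimately have "\<not> (%k. ennreal \<bar>f (s k) z\<bar>) ----> 0" using LIMSEQ_unique by blast
 thus "y : Z" using Z(2) \<open>y : D\<close> pz by auto
 qed
 thus "{z - t *R e |z t. z : N p & 0 < t & t < t0} : null_sets lebesgue"
 using Z(1) by (rule null_sets_completion_subset)
 qed
 qed
 have "?m (\<Union>p\<in>C'. N p) = 0" if "C' \<subseteq> C" for C'
 using finite_subset[OF that C(1)] that
 proof (induction C' rule: finite_induct)
 case (insert p C')
 have "?m (\<Union>p\<in>insert p C'. N p) <= ?m (N p) + ?m (\<Union>p\<in>C'. N p)" using hausdorff_outer_Un_le by simp
 thus ?case using insert null by simp
 qed simp
 from this[of C] have zC: "?m (\<Union>p\<in>C. N p) = 0" by simp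
 have "{y : Sig G. \<not> ((%k. f k y) ----> g y --> g y = 0)} \<subseteq> (\<Union>p\<in>C. N p)"
 proof
 fix y assume y: "y : {y : Sig G. \<not> ((%k. f k y) ----> g y --> g y = 0)}"
 hence "y : (\<Union>(x, r, e, F, La)\<in>C. ball x (r / 4))" using C(3) by blast
 then obtain p where p: "p : C" "y : (case p of (x, r, e, F, La) => ball x (r / 4))" by blast
 hence "y : N p" using y by (auto simp: N_def split: prod.splits)
 thus "y : (\<Union>p\<in>C. N p)" using p(1) by blast
 qed
 from hausdorff_outer_mono[OF this, of "real CARD('d) - 1"]
 have "AE y in wall G. (%k. f k y) ----> g y --> g y = 0"
 unfolding AE_surf_iff_null[OF Sig_borel] using zC by simp
 with lim show ?thesis by eventually_elim simp
qed

end

section \<open>The divergence of functions with vanishing trace\<close>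

context periodic_cell
begin

text \<open>Translates of the domain are disjoint and, together with the null disks, fill
  \<open>Dom_inf G\<close>, so almost every point of it is hit exactly once. \<open>sv\<close>
  enumerates the integers, which turns sums over translates into series.\<close>

lemma AE_sum_translates:
 assumes "bij sv"
 shows "AE y in lborel. (\<Sum>n::nat. iD (y + a + of_int (sv n) *R S) :: ennreal) = indicator (Dom_inf G) (y + a)"
proof -
 have "AE y in lborel. ALL n. y + (a + of_int (sv n) *R S) ~: lft G"
 unfolding AE_all_countable using AE_not_lft by blast
 thus ?thesis
 proof (rule eventually_mono)
 fix y assume nl: "ALL n. y + (a + of_int (sv n) *R S) ~: lft G"
 show "(\<Sum>n::nat. iD (y + a + of_int (sv n) *R S) :: ennreal) = indicator (Dom_inf G) (y + a)"
 proof (cases "y + a : Dom_inf G")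
 case True
 then obtain k :: int where "(y + a) + of_int k *R S : dom G \<union> lft G" unfolding Dom_inf_def by blast
 moreover obtain n0 where n0: "sv n0 = k" using assms by (metis bij_pointE)
 ultimately have k: "(y + a) + of_int (sv n0) *R S : dom G" using nl[rule_format, of n0] by (simp add: add.assoc)
 have z: "y + a + of_int (sv n) *R S ~: dom G" if "n ~= n0" for n
 proof -
 have "sv n - sv n0 ~= 0" using that assms by (simp add: bij_is_inj inj_eq)
 from dom_disjoint[OF this k] show ?thesis by (simp add: algebra_simps)
 qed
 have "(\<Sum>n::nat. iD (y + a + of_int (sv n) *R S) :: ennreal) = (\<Sum>n\<in>{n0}. iD (y + a + of_int (sv n) *R S))"
 by (rule suminf_finite) (use z in auto)
 thus ?thesis using k True by simp
 next
 case False
 hence "y + a + of_int (sv n) *R S ~: dom G" for n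
 using Dom_inf_shift[of "y + a" "sv n"] dom_subset by blast
 thus ?thesis using False by simp
 qed
 qed
qed

lemma bij_int_decode: "bij int_decode" "bij (%n. - int_decode n)"
proof -
 show "bij int_decode" by (rule bij_int_decode)
 hence "bij (uminus \<circ> int_decode)" by (rule bij_comp) (rule bij_uminus)
 thus "bij (%n. - int_decode n)" by (simp add: o_def)
qed

text \<open>\<open>\<Omega>\<close> is a fundamental domain of \<open>\<Omega>\<^sub>\<infinity>\<close>, hence so is every translate of it.\<close>

lemma periodic_integral_shift:
 fixes H :: "real^'d => ennreal"
 assumes [measurable]: "H : borel_measurable borel" and p: "periodic G H"
 and z: "!!y. y ~: Dom_inf G ==> H y = 0" "!!y. y + a ~: Dom_inf G ==> H y = 0"
 shows "(NI (%y. iD y * H (y - a))) = (NI (%y. iD y * H y))"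
proof -
 \<comment> \<open>\<open>?P\<close> inserts the partition into translates. Shifting its
   \<open>n\<close>-th term by the period, which \<open>H\<close> does not notice, produces the
   \<open>n\<close>-th term of \<open>?Q\<close>, and \<open>?Q\<close> is summed up by the
   partition shifted by \<open>a\<close>.\<close>
 let ?P = "%y. \<Sum>n. (iD (y + a) * H y) * iD (y + of_int (int_decode n) *R S)" and ?Q = "%y. \<Sum>n. (iD y * H y) * iD (y + a + of_int (- int_decode n) *R S)"
 have "(NI (%y. iD y * H (y - a))) = (NI (%y. iD (y + a) * H (y + a - a)))"
 by (rule nn_integral_lborel_shift[symmetric]) measurable
 also have "... = (NI (%y. ?P y))"
 proof (rule nn_integral_cong_AE)
 have "AE y in lborel. (\<Sum>n::nat. iD (y + 0 + of_int (int_decode n) *R S) :: ennreal) = indicator (Dom_inf G) (y + 0)"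
 by (rule AE_sum_translates[OF bij_int_decode(1)])
 thus "AE y in lborel. iD (y + a) * H (y + a - a) = ?P y"
 proof (rule eventually_mono)
 fix y assume e: "(\<Sum>n::nat. iD (y + 0 + of_int (int_decode n) *R S) :: ennreal) = indicator (Dom_inf G) (y + 0)"
 have "?P y = (iD (y + a) * H y) * indicator (Dom_inf G) y"
 using e by simp
 also have "... = iD (y + a) * H y" using z(1)[of y] by (cases "y : Dom_inf G") auto
 finally show "iD (y + a) * H (y + a - a) = ?P y" by simp
 qed
 qed
 also have "... = (\<Sum>n. NI (%y. (iD (y + a) * H y) * iD (y + of_int (int_decode n) *R S)))"
 by (rule nn_integral_suminf) measurable
 also have "... = (\<Sum>n. NI (%y. (iD y * H y) * iD (y + a + of_int (- int_decode n) *R S)))"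
 proof (rule suminf_cong)
 fix n
 let ?k = "int_decode n"
 have "(NI (%y. (iD (y + a) * H y) * iD (y + of_int ?k *R S)))
 = (NI (%y. (iD ((y + of_int (- ?k) *R S) + a) * H (y + of_int (- ?k) *R S)) * iD ((y + of_int (- ?k) *R S) + of_int ?k *R S)))"
 by (rule nn_integral_lborel_shift[symmetric, of "%y. (iD (y + a) * H y) * iD (y + of_int ?k *R S)"]) measurable
 also have "... = (NI (%y. (iD y * H y) * iD (y + a + of_int (- ?k) *R S)))"
 proof (rule nn_integral_cong)
 fix y
 have e1: "(y + of_int (- ?k) *R S) + a = y + a + of_int (- ?k) *R S" by (simp add: algebra_simps)
 have e2: "(y + of_int (- ?k) *R S) + of_int ?k *R S = y" by (simp add: algebra_simps)
 show "(iD ((y + of_int (- ?k) *R S) + a) * H (y + of_int (- ?k) *R S)) * iD ((y + of_int (- ?k) *R S) + of_int ?k *R S)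
 = (iD y * H y) * iD (y + a + of_int (- ?k) *R S)"
 unfolding e1 e2 periodic_int[OF p] by (simp only: ac_simps)
 qed
 finally show "(NI (%y. (iD (y + a) * H y) * iD (y + of_int ?k *R S))) = (NI (%y. (iD y * H y) * iD (y + a + of_int (- ?k) *R S)))" .
 qed
 also have "... = (NI (%y. ?Q y))"
 by (rule nn_integral_suminf[symmetric]) measurable
 also have "... = (NI (%y. iD y * H y))"
 proof (rule nn_integral_cong_AE)
 have "AE y in lborel. (\<Sum>n::nat. iD (y + a + of_int (- int_decode n) *R S) :: ennreal) = indicator (Dom_inf G) (y + a)"
 by (rule AE_sum_translates[OF bij_int_decode(2)])
 thus "AE y in lborel. ?Q y = iD y * H y"
 proof (rule eventually_mono)
 fix y assume e: "(\<Sum>n::nat. iD (y + a + of_int (- int_decode n) *R S) :: ennreal) = indicator (Dom_inf G) (y + a)"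
 have "?Q y = (iD y * H y) * indicator (Dom_inf G) (y + a)"
 unfolding e[symmetric] by (rule ennreal_suminf_cmult)
 also have "... = iD y * H y" using z(2)[of y] by (cases "y + a : Dom_inf G") auto
 finally show "?Q y = iD y * H y" .
 qed
 qed
 finally show ?thesis .
qed

lemma integrable_dom_continuous:
 fixes f :: "real^'d => real"
 assumes "continuous_on UNIV f"
 shows "integrable lborel (%y. iD y * f y)"
proof -
 have c: "compact (closure (dom G))" using bounded_dom by (simp add: compact_closure)
 have "integrable lborel (%y. indicator (closure (dom G)) y *R f y)"
 by (rule borel_integrable_compact[OF c continuous_on_subset[OF assms subset_UNIV]])
 thus ?thesis
 proof (rule Bochner_Integration.integrable_bound)
 show "(%y. iD y * f y) : borel_measurable lborel"
 using bm_contI[OF assms] by simp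
 show "AE y in lborel. norm (iD y * f y) <= norm (indicator (closure (dom G)) y *R f y)"
 using closure_subset[of "dom G"] by (intro always_eventually) (auto simp: indicator_def)
 qed
qed

text \<open>Integration by parts for difference quotients, as \<open>hh\<close> is only Lipschitz:
  invariance of the periodic integral moves the shift from \<open>f\<close> to \<open>hh\<close>.
  Shifts shorter than \<open>ep\<close> do not leave \<open>Dom_inf G\<close> from the support of
  \<open>hh\<close>, and the quotient of \<open>hh\<close> vanishes at points of the domain outside
  \<open>A\<close>.\<close>

lemma cutoff_parts:
 fixes f hh :: "real^'d => real"
 assumes f: "smooth_per G f"
 and hh: "!!y. 0 <= hh y" "!!y. hh y <= 1" "periodic G hh" "continuous_on UNIV hh"
 and L: "!!y z. \<bar>hh y - hh z\<bar> <= L * norm (y - z)" "0 <= L"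
 and ep: "0 < ep" "!!y. hh y ~= 0 ==> ball y ep \<subseteq> Dom_inf G"
 and A: "A : sets borel" "!!y a. y : dom G ==> y ~: A ==> norm a < ep ==> hh (y - a) = hh y"
 shows "\<bar>LINT y|lborel. iD y * (hh y * pd i f y)\<bar> <= L * (LINT y|lborel. iD y * (indicator A y * \<bar>f y\<bar>))"
proof -
 have fs: "smooth_on UNIV f" and fp: "periodic G f" using f by (auto simp: smooth_per_def)
 have fc: "continuous_on UNIV f" by (rule smooth_on_continuous0[OF fs])
 have pc: "continuous_on UNIV (pd i f)" by (rule smooth_on_continuous0[OF smooth_on_pd[OF fs]])
 have [measurable]: "f : borel_measurable borel" "hh : borel_measurable borel" "pd i f : borel_measurable borel"
 using fc pc hh(4) by (auto intro: bm_contI)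
 have [measurable]: "A : sets borel" by (rule A)
 let ?e = "axis i 1 :: real^'d"
 have sc: "continuous_on UNIV (%y. g (y + a))" if "continuous_on UNIV g" for g :: "real^'d => real" and a
 by (rule continuous_on_compose2[OF that]) (auto intro!: continuous_intros)
 have move: "(LINT y|lborel. iD y * (hh y * f (y + t *R ?e))) = (LINT y|lborel. iD y * (hh (y - t *R ?e) * f y))"
 if t: "0 < t" "t < ep" for t
 proof -
 \<comment> \<open>\<open>periodic_integral_shift\<close> concerns nonnegative functions, so this is
   used for \<open>f\<close> and for \<open>- f\<close>, that is, for positive and negative parts
   separately.\<close>
 have nn: "(NI (%y. iD y * ennreal (hh (y - t *R ?e) * g y))) = (NI (%y. iD y * ennreal (hh y * g (y + t *R ?e))))"
 if gm [measurable]: "g : borel_measurable borel" and gp: "periodic G g" for g :: "real^'d => real"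
 proof -
 define H where "H y = ennreal (hh y * g (y + t *R ?e))" for y
 have z0: "hh y = 0" if "y ~: Dom_inf G \<or> y + t *R ?e ~: Dom_inf G" for y
 proof (rule ccontr)
 assume "hh y ~= 0"
 hence "ball y ep \<subseteq> Dom_inf G" by (rule ep(2))
 moreover have "y : ball y ep" "y + t *R ?e : ball y ep" using t ep(1) by (auto simp: dist_norm)
 ultimately show False using that by blast
 qed
 have "(NI (%y. iD y * H (y - t *R ?e))) = (NI (%y. iD y * H y))"
 proof (rule periodic_integral_shift)
 show "H : borel_measurable borel" unfolding H_def by measurable
 show "periodic G H"
 unfolding periodic_def
 proof
 fix y
 have "y + S + t *R ?e = (y + t *R ?e) + S" by (simp add: algebra_simps)
 thus "H (y + S) = H y" using hh(3) gp unfolding H_def periodic_def by metis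
 qed
 qed (use z0 in \<open>auto simp: H_def\<close>)
 thus ?thesis by (simp add: H_def)
 qed
 have i1: "integrable lborel (%y. iD y * (hh y * f (y + t *R ?e)))"
 by (intro integrable_dom_continuous continuous_intros hh(4) sc fc)
 have i2: "integrable lborel (%y. iD y * (hh (y - t *R ?e) * f y))"
 using sc[OF hh(4), of "- t *R ?e"] by (intro integrable_dom_continuous continuous_intros fc) simp
 have "(NI (%y. ennreal (iD y * (hh (y - t *R ?e) * f y)))) = (NI (%y. ennreal (iD y * (hh y * f (y + t *R ?e)))))"
 using nn[OF _ fp] by (simp add: ennreal_mult' ennreal_indicator)
 moreover have "(NI (%y. ennreal (- (iD y * (hh (y - t *R ?e) * f y))))) = (NI (%y. ennreal (- (iD y * (hh y * f (y + t *R ?e))))))"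
 proof -
 have "periodic G (%y. - f y)" using fp by (simp add: periodic_def)
 have "(%y. - f y) : borel_measurable borel" by measurable
 note n = nn[OF this \<open>periodic G (%y. - f y)\<close>]
 have e: "ennreal (- (iD y * r)) = iD y * ennreal (- r)" for y and r :: real
 by (simp add: indicator_def)
 show ?thesis unfolding e using n by simp
 qed
 ultimately show ?thesis unfolding real_lebesgue_integral_def[OF i1] real_lebesgue_integral_def[OF i2] by simp
 qed
 define B where "B = L * (LINT y|lborel. iD y * (indicator A y * \<bar>f y\<bar>))"
 \<comment> \<open>The summand 2 makes every step, including that for \<open>n = 0\<close>, strictly
   shorter than \<open>ep\<close>.\<close>
 define t where "t n = ep / (real n + 2)" for n :: nat
 have t: "0 < t n" "t n < ep" for n using ep(1) by (auto simp: t_def divide_less_eq)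
 define q where "q n y = iD y * (hh y * ((f (y + t n *R ?e) - f y) / t n))" for n y
 have qc: "integrable lborel (q n)" for n
 unfolding q_def using t(1)[of n] by (intro integrable_dom_continuous continuous_intros hh(4) sc fc) auto
 have qb: "\<bar>integral\<^sup>L lborel (q n)\<bar> <= B" for n
 proof -
 have i1: "integrable lborel (%y. iD y * (hh y * f (y + t n *R ?e)))"
 by (intro integrable_dom_continuous continuous_intros hh(4) sc fc)
 have i2: "integrable lborel (%y. iD y * (hh (y - t n *R ?e) * f y))"
 using sc[OF hh(4), of "- t n *R ?e"] by (intro integrable_dom_continuous continuous_intros fc) simp
 have i3: "integrable lborel (%y. iD y * (hh y * f y))"
 by (intro integrable_dom_continuous continuous_intros hh(4) fc)
 have i4: "integrable lborel (%y. iD y * (indicator A y * \<bar>f y\<bar>))"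
 proof (rule Bochner_Integration.integrable_bound[OF integrable_dom_continuous[OF fc]])
 show "AE y in lborel. norm (iD y * (indicator A y * \<bar>f y\<bar>)) <= norm (iD y * f y)"
 by (intro always_eventually) (auto simp: indicator_def)
 qed measurable
 have "integral\<^sup>L lborel (q n) = (LINT y|lborel. (iD y * (hh y * f (y + t n *R ?e)) - iD y * (hh y * f y)) / t n)"
 by (intro Bochner_Integration.integral_cong refl) (simp add: q_def right_diff_distrib diff_divide_distrib)
 also have "... = ((LINT y|lborel. iD y * (hh (y - t n *R ?e) * f y)) - (LINT y|lborel. iD y * (hh y * f y))) / t n"
 using i1 i3 by (simp add: move[OF t])
 also have "... = (LINT y|lborel. (iD y * (hh (y - t n *R ?e) * f y) - iD y * (hh y * f y)) / t n)"
 using i2 i3 by simp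
 finally have e: "integral\<^sup>L lborel (q n) = (LINT y|lborel. (iD y * (hh (y - t n *R ?e) * f y) - iD y * (hh y * f y)) / t n)" .
 have "\<bar>integral\<^sup>L lborel (q n)\<bar> <= (LINT y|lborel. L * (iD y * (indicator A y * \<bar>f y\<bar>)))"
 unfolding e
 proof (rule order_trans[OF integral_abs_bound integral_mono])
 show "integrable lborel (%y. \<bar>(iD y * (hh (y - t n *R ?e) * f y) - iD y * (hh y * f y)) / t n\<bar>)"
 using i2 i3 by (intro integrable_abs integrable_divide Bochner_Integration.integrable_diff)
 show "integrable lborel (%y. L * (iD y * (indicator A y * \<bar>f y\<bar>)))" using i4 by (rule integrable_mult_right)
 fix y
 show "\<bar>(iD y * (hh (y - t n *R ?e) * f y) - iD y * (hh y * f y)) / t n\<bar> <= L * (iD y * (indicator A y * \<bar>f y\<bar>))"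
 proof (cases "y : dom G & y : A")
 case True
 have "\<bar>hh (y - t n *R ?e) - hh y\<bar> <= L * t n" using L(1)[of "y - t n *R ?e" y] t(1)[of n] by simp
 hence "\<bar>hh (y - t n *R ?e) - hh y\<bar> / t n <= L" using t(1)[of n] by (simp add: divide_le_eq)
 hence "\<bar>hh (y - t n *R ?e) - hh y\<bar> / t n * \<bar>f y\<bar> <= L * \<bar>f y\<bar>" by (rule mult_right_mono) simp
 moreover have "\<bar>(hh (y - t n *R ?e) * f y - hh y * f y) / t n\<bar> = \<bar>hh (y - t n *R ?e) - hh y\<bar> / t n * \<bar>f y\<bar>"
 using t(1)[of n] by (simp add: abs_mult[symmetric] left_diff_distrib abs_divide)
 ultimately show ?thesis using True by simp
 next
 case False
 thus ?thesis using A(2)[of y "t n *R ?e"] t[of n] by (cases "y : dom G") auto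
 qed
 qed
 thus ?thesis by (simp add: B_def)
 qed
 obtain R where R: "R > 0" "!!x. x : dom G \<union> lft G ==> norm x <= R" by (rule dom_lft_bound, rule that)
 have "EX M. M >= 0 & (ALL y:cball 0 (R + ep). norm (pd j f y) <= M)" for j
 proof -
 obtain M where "M >= 0" "!!y. y : cball 0 (R + ep) ==> norm (pd j f y) <= M"
 by (rule compact_bound_norm[OF continuous_on_subset[OF smooth_on_continuous0[OF smooth_on_pd[OF fs, of j]] subset_UNIV] compact_cball[of 0 "R + ep"]], rule that)
 thus ?thesis by blast
 qed
 then obtain M where M: "!!j. M j >= 0" "!!j y. y : cball 0 (R + ep) ==> norm (pd j f y) <= M j" by metis
 define M' where "M' = real CARD('d) * (\<Sum>j\<in>UNIV. M j)"
 have lip: "\<bar>f (y + t n *R ?e) - f y\<bar> <= M' * t n" if "y : dom G" for y n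
 proof -
 have 1: "norm y <= R" using R(2) that by blast
 have "norm (y + t n *R ?e) <= norm y + t n" using norm_triangle_ineq[of y "t n *R ?e"] t(1)[of n] by simp
 hence 2: "y + t n *R ?e : cball 0 (R + ep)" "y : cball 0 (R + ep)" using 1 t(2)[of n] ep(1) by auto
 have "norm (pd j f z) <= (\<Sum>j\<in>UNIV. M j)" if "z : cball 0 (R + ep)" for j z
 using M(1) that by (intro order_trans[OF M(2)] member_le_sum) auto
 hence "norm (f (y + t n *R ?e) - f y) <= M' * norm ((y + t n *R ?e) - y)"
 unfolding M'_def by (intro pd_bound_lipschitz[of "cball 0 (R + ep)"] 2) (auto simp: smooth_on_differentiable0[OF fs])
 thus ?thesis using t(1)[of n] by simp
 qed
 have "(%n. integral\<^sup>L lborel (q n)) ----> (LINT y|lborel. iD y * (hh y * pd i f y))"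
 proof (rule integral_dominated_convergence[where w="%y. iD y * M'"])
 show "integrable lborel (%y. iD y * M')" by (rule integrable_dom_continuous) simp
 show "AE y in lborel. (%n. q n y) ----> iD y * (hh y * pd i f y)"
 proof (rule always_eventually, rule allI)
 fix y
 have "((%t. y + t *R ?e) has_derivative (%t. t *R ?e)) (at 0)" by (auto intro!: derivative_eq_intros)
 from has_derivative_compose[OF this has_derivative_pd[OF smooth_on_differentiable0[OF fs UNIV_I]]]
 have "((%t. f (y + t *R ?e)) has_field_derivative pd i f y) (at 0)"
 unfolding has_field_derivative_def
 by (rule has_derivative_eq_rhs) (simp add: fun_eq_iff axis_def if_distrib[of "%c. _ * c"] if_distrib[of "%c. c * _"] cong: if_cong)
 hence "((%t. (f (y + t *R ?e) - f y) / t) \<longlongrightarrow> pd i f y) (at 0)"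
 by (simp add: DERIV_def)
 moreover have "filterlim t (at 0) sequentially"
 unfolding filterlim_at
 proof
 show "t ----> 0" unfolding t_def using LIMSEQ_ignore_initial_segment[OF lim_const_over_n[of ep], of 2] by (simp add: add.commute)
 show "\<forall>\<^sub>F n in sequentially. t n : UNIV & t n ~= 0" using t(1) by (auto intro!: always_eventually simp: less_imp_neq[symmetric] neq_iff)
 qed
 ultimately have "(%n. (f (y + t n *R ?e) - f y) / t n) ----> pd i f y" by (rule filterlim_compose)
 thus "(%n. q n y) ----> iD y * (hh y * pd i f y)" unfolding q_def by (intro tendsto_intros)
 qed
 show "AE y in lborel. norm (q n y) <= iD y * M'" for n
 proof (rule always_eventually, rule allI)
 fix y
 show "norm (q n y) <= iD y * M'"
 proof (cases "y : dom G")
 case True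
 have "\<bar>(f (y + t n *R ?e) - f y) / t n\<bar> <= M'" using lip[OF True, of n] t(1)[of n] by (simp add: abs_divide divide_le_eq)
 hence "hh y * \<bar>(f (y + t n *R ?e) - f y) / t n\<bar> <= 1 * M'" using hh(1,2) by (intro mult_mono) auto
 thus ?thesis using True hh(1)[of y] by (simp add: q_def abs_mult)
 qed (simp add: q_def)
 qed
 qed (use qc in \<open>auto intro: borel_measurable_integrable\<close>)
 hence "(%n. \<bar>integral\<^sup>L lborel (q n)\<bar>) ----> \<bar>LINT y|lborel. iD y * (hh y * pd i f y)\<bar>" by (rule tendsto_rabs)
 hence "\<bar>LINT y|lborel. iD y * (hh y * pd i f y)\<bar> <= B" by (rule LIMSEQ_le_const2) (use qb in blast)
 thus ?thesis by (simp add: B_def)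
qed

section \<open>Distance to the wall and the cut-off built from it\<close>

abbreviation bdist :: "real^'d => real" where "bdist y \<equiv> infdist y (Sig_inf G)"

lemma bdist_lip: "\<bar>bdist y - bdist z\<bar> <= norm (y - z)"
 using infdist_triangle_abs[of y "Sig_inf G" z] by (simp add: dist_norm)

lemma bdist_continuous: "continuous_on UNIV bdist"
 by (intro continuous_on_infdist continuous_on_id)

lemma bdist_shift: "bdist (y + S) = bdist y"
proof -
 have *: "bdist (y + of_int k *R S) <= bdist y" for y k
 unfolding infdist_def[of y]
 proof (simp only: Sig_inf_nonempty if_False, rule cINF_greatest)
 fix z assume z: "z : Sig_inf G"
 have "bdist (y + of_int k *R S) <= dist (y + of_int k *R S) (z + of_int k *R S)"
 by (rule infdist_le) (simp add: Sig_inf_shift z)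
 thus "bdist (y + of_int k *R S) <= dist y z" by simp
 qed (simp add: Sig_inf_nonempty)
 show ?thesis using *[of y 1] *[of "y + S" "-1"] by simp
qed

text \<open>A connected set that meets \<open>Dom_inf G\<close> and avoids its frontier lies
  inside.\<close>

lemma ball_subset_Dom_inf:
 assumes "y : Dom_inf G" "ro <= bdist y"
 shows "ball y ro \<subseteq> Dom_inf G"
proof (cases "ro > 0")
 case True
 have "ball y ro \<inter> frontier (Dom_inf G) = {}"
 unfolding frontier_inf using assms(2) infdist_le[of _ "Sig_inf G" y] by force
 moreover have "ball y ro \<inter> Dom_inf G ~= {}" using True assms(1) by (metis centre_in_ball disjoint_iff)
 moreover have "connected (ball y ro)" by simp
 ultimately have "ball y ro - Dom_inf G = {}" using connected_Int_frontier[of "ball y ro" "Dom_inf G"] by blast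
 thus ?thesis by blast
qed (simp add: not_less ball_empty)

lemma bdist_pos: "y : dom G ==> 0 < bdist y"
proof -
 assume "y : dom G"
 hence "y ~: Sig_inf G" using dom_subset open_Dom_inf by (auto simp: frontier_inf[symmetric] frontier_def interior_open)
 thus ?thesis using closed_Sig_inf Sig_inf_nonempty infdist_pos_not_in_closed by blast
qed

text \<open>It vanishes up to distance \<open>ep\<close> from the wall, which leaves room for
  shifts, and has reached 1 at distance \<open>2 * ep\<close>.\<close>

definition cutoff :: "real => real^'d => real" where
 "cutoff ep y = (if y : Dom_inf G then max 0 (min 1 (bdist y / ep - 1)) else 0)"

lemma cutoff_bounds: "0 <= cutoff ep y" "cutoff ep y <= 1"
 by (auto simp: cutoff_def)

lemma cutoff_lip:
 assumes "ep > 0"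
 shows "\<bar>cutoff ep y - cutoff ep z\<bar> <= (1 / ep) * norm (y - z)"
proof -
 have m: "\<bar>max 0 (min 1 (a - 1)) - max 0 (min 1 (b - 1))\<bar> <= \<bar>a - b\<bar>" for a b :: real by linarith
 \<comment> \<open>Leaving \<open>Dom_inf G\<close> from \<open>y\<close> takes at least the
   distance \<open>bdist y\<close>, which dominates \<open>ep\<close> times the value of the
   cut-off.\<close>
 have one: "cutoff ep y <= (1 / ep) * norm (y - z)" if yz: "y : Dom_inf G" "z ~: Dom_inf G" for y z
 proof -
 have "z ~: ball y (bdist y)" using ball_subset_Dom_inf[OF yz(1), of "bdist y"] yz(2) by blast
 hence "bdist y <= norm (y - z)" by (simp add: dist_norm)
 hence "bdist y / ep <= norm (y - z) / ep" using assms by (simp add: divide_right_mono)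
 moreover have "cutoff ep y <= bdist y / ep"
 proof -
 have "max 0 (min 1 (q - 1)) <= q" if "0 <= q" for q :: real using that by linarith
 moreover have "0 <= bdist y / ep" using assms infdist_nonneg[of y "Sig_inf G"] by simp
 ultimately show ?thesis using yz(1) by (simp add: cutoff_def)
 qed
 ultimately show ?thesis by simp
 qed
 consider "y : Dom_inf G" "z : Dom_inf G" | "y : Dom_inf G" "z ~: Dom_inf G" | "y ~: Dom_inf G" "z : Dom_inf G" | "y ~: Dom_inf G" "z ~: Dom_inf G" by blast
 thus ?thesis
 proof cases
 case 1
 have "\<bar>bdist y / ep - bdist z / ep\<bar> = \<bar>bdist y - bdist z\<bar> / ep" using assms by (simp add: diff_divide_distrib[symmetric] abs_divide)
 also have "... <= norm (y - z) / ep" using bdist_lip assms by (simp add: divide_right_mono)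
 finally show ?thesis using 1 m[of "bdist y / ep" "bdist z / ep"] by (simp add: cutoff_def)
 next
 case 2
 thus ?thesis using one[OF 2] cutoff_bounds[of ep y] by (simp add: cutoff_def[of ep z])
 next
 case 3
 thus ?thesis using one[OF 3(2,1)] cutoff_bounds[of ep z] by (simp add: cutoff_def[of ep y] norm_minus_commute)
 qed (use assms in \<open>simp add: cutoff_def\<close>)
qed

lemma cutoff_continuous: "ep > 0 ==> continuous_on UNIV (cutoff ep)"
 using cutoff_lip[of ep] by (intro lipschitz_on_continuous_on[of "1 / ep"] lipschitz_onI) (auto simp: dist_norm)

lemma cutoff_periodic: "periodic G (cutoff ep)"
 using Dom_inf_shift[of _ 1] by (simp add: periodic_def cutoff_def bdist_shift)

lemma cutoff_supp: "ep > 0 ==> cutoff ep y ~= 0 ==> ball y ep \<subseteq> Dom_inf G"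
proof (rule ball_subset_Dom_inf)
 assume a: "ep > 0" "cutoff ep y ~= 0"
 show "y : Dom_inf G" using a(2) by (auto simp: cutoff_def split: if_splits)
 show "ep <= bdist y"
 proof (rule ccontr)
 assume "\<not> ep <= bdist y"
 hence "bdist y / ep - 1 <= 0" using a(1) by simp
 thus False using a(2) by (simp add: cutoff_def split: if_splits)
 qed
qed

lemma cutoff_eq_1: "ep > 0 ==> y : Dom_inf G ==> 2 * ep <= bdist y ==> cutoff ep y = 1"
proof -
 assume a: "ep > 0" "y : Dom_inf G" "2 * ep <= bdist y"
 hence "2 <= bdist y / ep" by (simp add: pos_le_divide_eq)
 thus ?thesis using a(2) by (simp add: cutoff_def)
qed

text \<open>The width \<open>3 * ep\<close> is the distance \<open>2 * ep\<close> beyond which the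
  cut-off is constant, plus the bound \<open>ep\<close> on the shifts.\<close>

lemma cutoff_parts':
 assumes "smooth_per G f" "ep > 0"
 shows "\<bar>LINT y|lborel. iD y * (cutoff ep y * pd i f y)\<bar> <= (1 / ep) * (LINT y|lborel. iD y * (indicator {y. bdist y <= 3 * ep} y * \<bar>f y\<bar>))"
proof (rule cutoff_parts[OF assms(1) cutoff_bounds cutoff_periodic cutoff_continuous[OF assms(2)] cutoff_lip[OF assms(2)] _ assms(2) cutoff_supp[OF assms(2)]])
 show "0 <= 1 / ep" using assms(2) by simp
 have "{y. bdist y <= 3 * ep} = bdist -` {..3 * ep}" by auto
 moreover have "closed (bdist -` {..3 * ep})" by (intro closed_vimage bdist_continuous closed_atMost)
 ultimately show "{y. bdist y <= 3 * ep} : sets borel" by simp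
 fix y a :: "real^'d" assume y: "y : dom G" "y ~: {y. bdist y <= 3 * ep}" and a: "norm a < ep"
 have yD: "y : Dom_inf G" using y(1) dom_subset by blast
 have "y - a : ball y (3 * ep)" using a assms(2) by (simp add: dist_norm)
 hence "y - a : Dom_inf G" using ball_subset_Dom_inf[OF yD, of "3 * ep"] y(2) by auto
 moreover have "2 * ep <= bdist (y - a)" using bdist_lip[of y "y - a"] y(2) a by simp
 ultimately show "cutoff ep (y - a) = cutoff ep y" using cutoff_eq_1[OF assms(2)] yD y(2) assms(2) by simp
qed

end

section \<open>A Hardy estimate in strips along the wall\<close>

context periodic_cell
begin

text \<open>Applied with \<open>w\<close> the weak gradient of the function under study; this mass
  controls both the Hardy bound and the part removed by the cut-off.\<close>

definition strip_mass :: "('d => real^'d => real) => real => ennreal" where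
 "strip_mass w t = (NI (%y. iD y * (indicator {y. bdist y <= t} y * ennreal (\<Sum>i\<in>UNIV. \<bar>w i y\<bar>))))"

lemma bdist_measurable [measurable]: "bdist : borel_measurable borel"
 by (rule bm_contI[OF bdist_continuous])

lemma bdist_set_borel [measurable]: "{y. bdist y <= t} : sets borel"
proof -
 have "{y. bdist y <= t} = bdist -` {..t}" by auto
 moreover have "closed (bdist -` {..t})" by (intro closed_vimage bdist_continuous closed_atMost)
 ultimately show ?thesis by simp
qed

lemma strip_mass_mono: "s <= t ==> strip_mass w s <= strip_mass w t"
 unfolding strip_mass_def by (intro nn_integral_mono mult_left_mono mult_right_mono) (auto simp: indicator_def)

text \<open>Every point of the domain has positive distance to the wall, so it leaves the strips
  eventually; dominated convergence does the rest.\<close>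

lemma strip_mass_tendsto:
 assumes w [measurable]: "!!i. w i : borel_measurable borel" and int: "!!i. integrable lborel (%y. iD y * w i y)"
 and t: "t ----> 0"
 shows "(%n. strip_mass w (t n)) ----> 0"
proof -
 have "(%n. strip_mass w (t n)) ----> (NI (%(y::real^'d). 0))"
 unfolding strip_mass_def
 proof (rule nn_integral_dominated_convergence[where w="%y. iD y * ennreal (\<Sum>i\<in>UNIV. \<bar>w i y\<bar>)"])
 show "AE y in lborel. iD y * (indicator {y. bdist y <= t n} y * ennreal (\<Sum>i\<in>UNIV. \<bar>w i y\<bar>)) <= iD y * ennreal (\<Sum>i\<in>UNIV. \<bar>w i y\<bar>)" for n
 by (intro always_eventually allI) (auto simp: indicator_def)
 have "integrable lborel (%y. \<Sum>i\<in>UNIV. \<bar>iD y * w i y\<bar>)"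
 using int by (intro Bochner_Integration.integrable_sum integrable_abs)
 hence "(NI (%y. ennreal (norm (\<Sum>i\<in>UNIV. \<bar>iD y * w i y\<bar>)))) < \<infinity>"
 by (simp add: integrable_iff_bounded)
 moreover have "ennreal (norm (\<Sum>i\<in>UNIV. \<bar>iD y * w i y\<bar>)) = iD y * ennreal (\<Sum>i\<in>UNIV. \<bar>w i y\<bar>)" for y
 by (cases "y : dom G") (simp_all add: sum_nonneg)
 ultimately show "(NI (%y. iD y * ennreal (\<Sum>i\<in>UNIV. \<bar>w i y\<bar>))) < \<infinity>" by simp
 show "AE y in lborel. (%n. iD y * (indicator {y. bdist y <= t n} y * ennreal (\<Sum>i\<in>UNIV. \<bar>w i y\<bar>))) ----> 0"
 proof (intro always_eventually allI)
 fix y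
 show "(%n. iD y * (indicator {y. bdist y <= t n} y * ennreal (\<Sum>i\<in>UNIV. \<bar>w i y\<bar>))) ----> 0"
 proof (cases "y : dom G")
 case True
 have "\<forall>\<^sub>F n in sequentially. t n < bdist y" by (rule order_tendstoD(2)[OF t bdist_pos[OF True]])
 thus ?thesis by (intro tendsto_eventually) (elim eventually_mono, simp)
 qed simp
 qed
 qed measurable
 thus ?thesis by simp
qed

text \<open>The approximants \<open>f k\<close> need not vanish on the wall, but their values at the
  foot points tend to zero almost everywhere. Fatou's lemma therefore carries the line estimate for
  \<open>f k (proj y) - f k y\<close> over to the limit \<open>v\<close>.\<close>

lemma hardy_chart:
 fixes f :: "nat => real^'d => real" and v :: "real^'d => real"
 assumes f: "!!k. smooth_per G (f k)" and v [measurable]: "v : borel_measurable borel"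
 and w [measurable]: "!!i. w i : borel_measurable borel"
 and dl: "!!i. (%k. NI (%y. iD y * ennreal \<bar>pd i (f k) y - w i y\<bar>)) ----> 0"
 and fv: "AE y in lborel. y : dom G --> (%k. f k y) ----> v y"
 and lim: "AE y in wall G. (%k. f k y) ----> 0"
 and p: "(x, r, e, F, La) : charts"
 shows "EX m::nat. ALL t1. 0 < t1 --> t1 <= r / 4 -->
 (NI (%y. indicator (dom G \<inter> {y : ball x (r / 2). - t1 < F y & F y < 0}) y * ennreal \<bar>v y\<bar>)) <= ennreal t1 * (of_nat m * strip_mass w t1)"
proof -
 let ?E = "%k. \<Sum>i\<in>UNIV. NI (%y. iD y * ennreal \<bar>pd i (f k) y - w i y\<bar>)"
 interpret boundary_chart "Dom_inf G" x r e F La using p by (rule chartsD)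
 have [measurable]: "F : borel_measurable borel" by (rule bm_contI[OF F_continuous])
 have fs: "smooth_on UNIV (f k)" and fp: "periodic G (f k)" for k using f by (auto simp: smooth_per_def)
 have fm [measurable]: "f k : borel_measurable borel" for k
 by (rule bm_contI[OF smooth_on_continuous0[OF fs]])
 have gm [measurable]: "gsum (f k) : borel_measurable borel" for k
 by (rule bm_contI[OF gsum_continuous[OF fs]])
 have pm [measurable]: "pd i (f k) : borel_measurable borel" for i k
 by (rule bm_contI[OF smooth_on_continuous0[OF smooth_on_pd[OF fs]]])
 obtain m :: nat where m: "!!g :: real^'d => ennreal. g : borel_measurable borel ==> periodic G g ==>
 (NI (%y. indicator (ball x r \<inter> Dom_inf G) y * g y)) <= of_nat m * (NI (%y. iD y * g y))"
 by (rule periodic_integral_le[OF bounded_ball[of x r]], rule that)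
 show ?thesis
 proof (intro exI[of _ m] allI impI)
 fix t1 assume t1: "0 < t1" "t1 <= r / 4"
 define D where "D = {y : ball x (r / 2). - t1 < F y & F y < 0}"
 define D' where "D' = {y : ball x (r / 2 + t1). - t1 < F y & F y < 0}"
 have Dm [measurable]: "D : sets borel"
 proof -
 have "D = ball x (r / 2) \<inter> F -` {- t1<..<0}" by (auto simp: D_def)
 moreover have "open (ball x (r / 2) \<inter> F -` {- t1<..<0})" by (intro open_Int open_ball open_vimage F_continuous open_greaterThanLessThan)
 ultimately show ?thesis by simp
 qed
 have proj_in: "proj y : Sig_inf G & dist y (proj y) = \<bar>F y\<bar>" if y: "dist x y < r / 2 + t1" "- t1 < F y" "F y < 0" for y
 proof -
 have d: "dist y (proj y) = \<bar>F y\<bar>" by (simp add: dist_norm norm_e)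
 hence "dist x (proj y) < r" using dist_triangle[of x "proj y" y] y t1 by simp
 thus ?thesis using frontier_iff[of "proj y"] F_proj[of y] d by (simp add: frontier_inf)
 qed
 \<comment> \<open>Convergence almost everywhere on the wall is moved to almost every
   \<open>y\<close> below it: the \<open>y\<close> whose foot point is a translate of a bad one lie
   in a cylinder over a Hausdorff null set.\<close>
 have trp: "AE y in lborel. y : D --> (%k. f k (proj y)) ----> 0"
 proof -
 define A where "A = {z : Sig G. \<not> (%k. f k z) ----> 0}"
 have "hausdorff_outer (real CARD('d) - 1) A = 0" using lim unfolding AE_surf_iff_null[OF Sig_borel] A_def by simp
 hence N0: "hausdorff_outer (real CARD('d) - 1) {y. EX k::int. y + of_int k *R S : A} = 0"
 by (intro Sig_inf_null) (auto simp: A_def)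
 obtain i where i: "e = axis i 1 \<or> e = - axis i 1" using e_axis by blast
 define Z where "Z = {y + t *R axis i 1 | y t. y : {y. EX k::int. y + of_int k *R S : A} & \<bar>t\<bar> <= t1}"
 have "Z : null_sets lebesgue" unfolding Z_def by (rule cylinder_null[OF card_d N0 t1(1)])
 hence "AE y in lebesgue. y ~: Z" by (rule AE_not_in)
 hence "AE y in lebesgue. y : D --> (%k. f k (proj y)) ----> 0"
 proof (rule eventually_mono)
 fix y assume yZ: "y ~: Z"
 show "y : D --> (%k. f k (proj y)) ----> 0"
 proof (intro impI, rule ccontr)
 assume y: "y : D" and n: "\<not> (%k. f k (proj y)) ----> 0"
 have "proj y : Sig_inf G" using proj_in[of y] y t1(1) by (auto simp: D_def)
 then obtain k :: int where k: "proj y + of_int k *R S : Sig G" unfolding Sig_inf_iff by blast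
 have "f j (proj y + of_int k *R S) = f j (proj y)" for j by (rule periodic_int[OF fp])
 hence "proj y + of_int k *R S : A" using n k by (simp add: A_def)
 moreover have "\<bar>F y\<bar> <= t1" using y by (auto simp: D_def)
 moreover have "y = proj y + (if e = axis i 1 then F y else - F y) *R axis i 1" using i by auto
 ultimately have "y : Z" unfolding Z_def mem_Collect_eq
 by (intro exI[of _ "proj y"] exI[of _ "if e = axis i 1 then F y else - F y"] conjI exI[of _ k]) auto
 thus False using yZ by blast
 qed
 qed
 thus ?thesis by (simp add: AE_completion_iff)
 qed
 have step: "(NI (%y. indicator (dom G \<inter> D) y * ennreal \<bar>f k (proj y) - f k y\<bar>)) <=
 ennreal t1 * (of_nat m * (strip_mass w t1 + ?E k))" for k
 proof -
 let ?g = "%y. indicator {y. bdist y <= t1} y * ennreal (gsum (f k) y)"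
 have "(NI (%y. indicator (dom G \<inter> D) y * ennreal \<bar>f k (proj y) - f k y\<bar>)) <= (NI (%y. indicator D y * ennreal \<bar>f k (proj y) - f k y\<bar>))"
 by (intro nn_integral_mono mult_right_mono) (auto simp: indicator_def)
 also have "... <= ennreal t1 * (NI (%y. indicator D' y * ennreal (gsum (f k) y)))"
 unfolding D'_def by (rule line_estimate[OF fs t1(1) Dm]) (simp add: D_def)
 also have "... <= ennreal t1 * (of_nat m * (NI (%y. iD y * ?g y)))"
 proof (rule mult_left_mono)
 have "(NI (%y. indicator D' y * ennreal (gsum (f k) y))) <= (NI (%y. indicator (ball x r \<inter> Dom_inf G) y * ?g y))"
 proof (rule nn_integral_mono)
 fix y
 show "indicator D' y * ennreal (gsum (f k) y) <= indicator (ball x r \<inter> Dom_inf G) y * ?g y"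
 proof (cases "y : D'")
 case True
 hence y: "dist x y < r / 2 + t1" "- t1 < F y" "F y < 0" by (auto simp: D'_def)
 have "bdist y <= t1" using infdist_le[of "proj y" "Sig_inf G" y] proj_in[OF y] y by simp
 moreover have "y : ball x r \<inter> Dom_inf G" using y dom_iff[of y] t1 by simp
 ultimately show ?thesis using True by simp
 qed simp
 qed
 also have "... <= of_nat m * (NI (%y. iD y * ?g y))"
 proof (rule m)
 show "periodic G ?g" using periodic_gsum[OF f[of k]] by (simp add: periodic_def bdist_shift indicator_def)
 qed measurable
 finally show "(NI (%y. indicator D' y * ennreal (gsum (f k) y))) <= of_nat m * (NI (%y. iD y * ?g y))" .
 qed simp
 also have "... <= ennreal t1 * (of_nat m * (strip_mass w t1 + ?E k))"
 proof (intro mult_left_mono)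
 have "(NI (%y. iD y * ?g y)) <= (NI (%y. iD y * (indicator {y. bdist y <= t1} y * ennreal (\<Sum>i\<in>UNIV. \<bar>w i y\<bar>)) + (\<Sum>i\<in>UNIV. iD y * ennreal \<bar>pd i (f k) y - w i y\<bar>)))"
 proof (rule nn_integral_mono)
 fix y
 have "gsum (f k) y <= (\<Sum>i\<in>UNIV. \<bar>w i y\<bar> + \<bar>pd i (f k) y - w i y\<bar>)" unfolding gsum_def by (rule sum_mono) linarith
 also have "... = (\<Sum>i\<in>UNIV. \<bar>w i y\<bar>) + (\<Sum>i\<in>UNIV. \<bar>pd i (f k) y - w i y\<bar>)" by (rule sum.distrib)
 finally have "ennreal (gsum (f k) y) <= ennreal (\<Sum>i\<in>UNIV. \<bar>w i y\<bar>) + ennreal (\<Sum>i\<in>UNIV. \<bar>pd i (f k) y - w i y\<bar>)"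
 by (simp add: ennreal_leI sum_nonneg flip: ennreal_plus)
 also have "ennreal (\<Sum>i\<in>UNIV. \<bar>pd i (f k) y - w i y\<bar>) = (\<Sum>i\<in>UNIV. ennreal \<bar>pd i (f k) y - w i y\<bar>)" by simp
 finally show "iD y * ?g y <= iD y * (indicator {y. bdist y <= t1} y * ennreal (\<Sum>i\<in>UNIV. \<bar>w i y\<bar>)) + (\<Sum>i\<in>UNIV. iD y * ennreal \<bar>pd i (f k) y - w i y\<bar>)"
 by (simp add: indicator_def)
 qed
 also have "... = strip_mass w t1 + ?E k"
 unfolding strip_mass_def by (subst nn_integral_add, measurable, subst nn_integral_sum, measurable)
 finally show "(NI (%y. iD y * ?g y)) <= ..." .
 qed simp_all
 finally show ?thesis .
 qed
 have "(%k. ennreal t1 * (of_nat m * (strip_mass w t1 + ?E k))) ---->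
 ennreal t1 * (of_nat m * (strip_mass w t1 + (\<Sum>i\<in>(UNIV::'d set). 0)))"
 by (intro tendsto_add ennreal_tendsto_cmult tendsto_sum tendsto_const dl) (auto simp: of_nat_less_top)
 hence limR: "liminf (%k. ennreal t1 * (of_nat m * (strip_mass w t1 + ?E k))) = ennreal t1 * (of_nat m * strip_mass w t1)"
 by (intro lim_imp_Liminf) simp_all
 have "(NI (%y. indicator (dom G \<inter> D) y * ennreal \<bar>v y\<bar>)) = (NI (%y. liminf (%k. indicator (dom G \<inter> D) y * ennreal \<bar>f k (proj y) - f k y\<bar>)))"
 proof (rule nn_integral_cong_AE)
 show "AE y in lborel. indicator (dom G \<inter> D) y * ennreal \<bar>v y\<bar> = liminf (%k. indicator (dom G \<inter> D) y * ennreal \<bar>f k (proj y) - f k y\<bar>)"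
 using trp fv
 proof eventually_elim
 case (elim y)
 show ?case
 proof (cases "y : dom G \<inter> D")
 case True
 hence "(%k. f k (proj y) - f k y) ----> 0 - v y" using elim by (intro tendsto_diff) auto
 hence "(%k. ennreal \<bar>f k (proj y) - f k y\<bar>) ----> ennreal \<bar>0 - v y\<bar>" by (intro tendsto_ennrealI tendsto_rabs)
 from lim_imp_Liminf[OF trivial_limit_sequentially this] show ?thesis using True by simp
 qed (simp add: Liminf_const)
 qed
 qed
 also have "... <= liminf (%k. NI (%y. indicator (dom G \<inter> D) y * ennreal \<bar>f k (proj y) - f k y\<bar>))"
 by (rule nn_integral_liminf) measurable
 also have "... <= ennreal t1 * (of_nat m * strip_mass w t1)"
 unfolding limR[symmetric] by (intro Liminf_mono always_eventually allI step)
 finally show "(NI (%y. indicator (dom G \<inter> {y : ball x (r / 2). - t1 < F y & F y < 0}) y * ennreal \<bar>v y\<bar>)) <= ennreal t1 * (of_nat m * strip_mass w t1)"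
 by (simp add: D_def)
 qed
qed

text \<open>A point of the domain within \<open>3 * ep\<close> of the wall lies under some chart at
  depth less than \<open>4 * La0 * ep\<close>, because \<open>F\<close> is Lipschitz and vanishes at
  the nearest wall point. The domain is bounded, so finitely many charts suffice and their bounds
  are added.\<close>

lemma hardy_strip:
 fixes f :: "nat => real^'d => real" and v :: "real^'d => real"
 assumes f: "!!k. smooth_per G (f k)" and v [measurable]: "v : borel_measurable borel"
 and w [measurable]: "!!i. w i : borel_measurable borel"
 and dl: "!!i. (%k. NI (%y. iD y * ennreal \<bar>pd i (f k) y - w i y\<bar>)) ----> 0"
 and fv: "AE y in lborel. y : dom G --> (%k. f k y) ----> v y"
 and lim: "AE y in wall G. (%k. f k y) ----> 0"
 obtains M :: nat and La0 de0 :: real where "La0 >= 1" "de0 > 0"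
 "!!ep. 0 < ep ==> ep <= de0 ==> (NI (%y. iD y * (indicator {y. bdist y <= 3 * ep} y * ennreal \<bar>v y\<bar>)))
 <= ennreal (4 * La0 * ep) * (of_nat M * strip_mass w (4 * La0 * ep))"
proof -
 obtain R where R: "R > 0" "!!x. x : dom G \<union> lft G ==> norm x <= R" by (rule dom_lft_bound, rule that)
 have cK: "compact (Sig_inf G \<inter> cball 0 (R + 1))" by (intro closed_Int_compact closed_Sig_inf compact_cball)
 obtain C where C: "finite C" "C \<subseteq> charts" "Sig_inf G \<inter> cball 0 (R + 1) \<subseteq> (\<Union>(x, r, e, F, La)\<in>C. ball x (r / 4))"
 by (rule chart_cover[OF cK Int_lower1], rule that)
 let ?rad = "%p. fst (snd p) :: real" and ?F = "%p. fst (snd (snd (snd p))) :: real^'d => real" and ?La = "%p. snd (snd (snd (snd p))) :: real"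
 define D where "D t p = {y : ball (fst p) (?rad p / 2). - t < ?F p y & ?F p y < 0}" for t and p :: "(real^'d) \<times> real \<times> (real^'d) \<times> (real^'d => real) \<times> real"
 have "EX m::nat. ALL t. 0 < t --> t <= ?rad p / 4 --> (NI (%y. indicator (dom G \<inter> D t p) y * ennreal \<bar>v y\<bar>)) <= ennreal t * (of_nat m * strip_mass w t)" if p: "p : C" for p
 proof -
 obtain x r e F La where pp: "p = (x, r, e, F, La)" by (cases p) auto
 have "(x, r, e, F, La) : charts" using C(2) p pp by blast
 from hardy_chart[OF f v w dl fv lim this] show ?thesis by (simp add: pp D_def)
 qed
 hence "ALL p:C. EX m::nat. ALL t. 0 < t --> t <= ?rad p / 4 --> (NI (%y. indicator (dom G \<inter> D t p) y * ennreal \<bar>v y\<bar>)) <= ennreal t * (of_nat m * strip_mass w t)"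
 by (rule ballI)
 from bchoice[OF this] obtain m :: "_ => nat" where m0: "ALL p:C. ALL t. 0 < t --> t <= ?rad p / 4 --> (NI (%y. indicator (dom G \<inter> D t p) y * ennreal \<bar>v y\<bar>)) <= ennreal t * (of_nat (m p) * strip_mass w t)"
 by (rule exE)
 have m: "(NI (%y. indicator (dom G \<inter> D t p) y * ennreal \<bar>v y\<bar>)) <= ennreal t * (of_nat (m p) * strip_mass w t)" if "p : C" "0 < t" "t <= ?rad p / 4" for p t
 using m0[rule_format, OF that] .
 have bc: "boundary_chart (Dom_inf G) (fst p) (?rad p) (fst (snd (snd p))) (?F p) (?La p)" if "p : C" for p
 using C(2) that by (intro chartsD) auto
 define La0 where "La0 = 1 + (\<Sum>p\<in>C. ?La p)"
 have Lap: "1 <= ?La p" "0 < ?rad p" if "p : C" for p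
 using boundary_chart.La_ge[OF bc[OF that]] boundary_chart.r_pos[OF bc[OF that]] by simp_all
 have La0: "1 <= La0" "!!p. p : C ==> ?La p <= La0"
 proof -
 show "1 <= La0" unfolding La0_def using Lap(1) by (simp add: sum_nonneg order_trans[OF zero_le_one])
 fix p assume "p : C"
 hence "?La p <= (\<Sum>p\<in>C. ?La p)" using Lap(1) C(1) by (intro member_le_sum) (auto intro: order_trans[OF zero_le_one])
 thus "?La p <= La0" by (simp add: La0_def)
 qed
 define r0 where "r0 = Min (insert 1 (?rad ` C))"
 have r0: "0 < r0" "r0 <= 1" "!!p. p : C ==> r0 <= ?rad p" using C(1) Lap(2) by (auto simp: r0_def)
 \<comment> \<open>Chosen so that \<open>4 * La0 * ep\<close> is at most \<open>r0 / 4\<close>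
   whenever \<open>ep \<le> de0\<close>.\<close>
 define de0 where "de0 = r0 / (16 * La0)"
 have de0: "0 < de0" using r0 La0(1) by (simp add: de0_def)
 show ?thesis
 proof (rule that[of La0 de0 "\<Sum>p\<in>C. m p"])
 fix ep assume ep: "0 < ep" "ep <= de0"
 define t1 where "t1 = 4 * La0 * ep"
 have "16 * La0 * ep <= r0" using ep(2) La0(1) by (simp add: de0_def pos_le_divide_eq mult.commute)
 hence t1r: "t1 <= r0 / 4" by (simp add: t1_def)
 have et: "4 * ep <= t1" using mult_right_mono[OF La0(1), of ep] ep(1) by (simp add: t1_def)
 have t1: "0 < t1" "!!p. p : C ==> t1 <= ?rad p / 4" using et ep(1) t1r r0(3) by fastforce+
 have cov: "EX p:C. y : D t1 p" if y: "y : dom G" "bdist y <= 3 * ep" for y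
 proof -
 obtain z where z: "z : Sig_inf G" "bdist y = dist y z" by (rule infdist_attains_inf[OF closed_Sig_inf Sig_inf_nonempty])
 have "norm y <= R" using R(2) y(1) by blast
 moreover have dz: "dist y z <= 3 * ep" using y(2) z(2) by simp
 ultimately have "z : cball 0 (R + 1)" using norm_triangle_sub[of z y] et t1r r0(2) by (simp add: dist_norm norm_minus_commute)
 hence "z : (\<Union>(x, r, e, F, La)\<in>C. ball x (r / 4))" using C(3) z(1) by blast
 then obtain p where p: "p : C" "dist (fst p) z < ?rad p / 4" by force
 interpret boundary_chart "Dom_inf G" "fst p" "?rad p" "fst (snd (snd p))" "?F p" "?La p" by (rule bc[OF p(1)])
 have dy: "dist (fst p) y < ?rad p / 2" using dist_triangle[of "fst p" y z] p(2) dz et t1(2)[OF p(1)] ep(1) by (simp add: dist_commute)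
 have zb: "z : ball (fst p) (?rad p)" "y : ball (fst p) (?rad p)" using p(2) dy r_pos by auto
 have "?F p z = 0" using frontier_iff[OF zb(1)] z(1) by (simp add: frontier_inf)
 hence "\<bar>?F p y\<bar> <= ?La p * norm (y - z)" using F_lip[OF zb(2,1)] by simp
 also have "... <= La0 * (3 * ep)" using dz La0(2)[OF p(1)] La_ge ep(1) by (intro mult_mono) (auto simp: dist_norm)
 also have "... < t1" using ep(1) La0(1) by (simp add: t1_def)
 finally have "\<bar>?F p y\<bar> < t1" .
 moreover have "?F p y < 0" using dom_iff[OF zb(2)] dom_subset y(1) by blast
 ultimately have "y : D t1 p" using dy by (simp add: D_def)
 thus ?thesis using p(1) by blast
 qed
 have Dm: "D t1 p : sets borel" if "p : C" for p
 proof -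
 interpret boundary_chart "Dom_inf G" "fst p" "?rad p" "fst (snd (snd p))" "?F p" "?La p" by (rule bc[OF that])
 have "D t1 p = ball (fst p) (?rad p / 2) \<inter> ?F p -` {- t1<..<0}" by (auto simp: D_def)
 moreover have "open (ball (fst p) (?rad p / 2) \<inter> ?F p -` {- t1<..<0})" by (intro open_Int open_ball open_vimage F_continuous open_greaterThanLessThan)
 ultimately show ?thesis by simp
 qed
 have "(NI (%y. iD y * (indicator {y. bdist y <= 3 * ep} y * ennreal \<bar>v y\<bar>))) <= (NI (%y. (\<Sum>p\<in>C. indicator (dom G \<inter> D t1 p) y * ennreal \<bar>v y\<bar>)))"
 proof (rule nn_integral_mono)
 fix y
 show "iD y * (indicator {y. bdist y <= 3 * ep} y * ennreal \<bar>v y\<bar>) <= (\<Sum>p\<in>C. indicator (dom G \<inter> D t1 p) y * ennreal \<bar>v y\<bar>)"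
 proof (cases "y : dom G & bdist y <= 3 * ep")
 case True
 then obtain p where p: "p : C" "y : D t1 p" using cov by blast
 have "indicator (dom G \<inter> D t1 p) y * ennreal \<bar>v y\<bar> <= (\<Sum>p\<in>C. indicator (dom G \<inter> D t1 p) y * ennreal \<bar>v y\<bar>)"
 using p(1) C(1) by (intro member_le_sum) auto
 thus ?thesis using True p(2) by simp
 qed auto
 qed
 also have "... = (\<Sum>p\<in>C. NI (%y. indicator (dom G \<inter> D t1 p) y * ennreal \<bar>v y\<bar>))"
 using Dm by (intro nn_integral_sum) simp
 also have "... <= (\<Sum>p\<in>C. ennreal t1 * (of_nat (m p) * strip_mass w t1))"
 by (intro sum_mono m t1)
 also have "... = ennreal t1 * (of_nat (\<Sum>p\<in>C. m p) * strip_mass w t1)"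
 by (simp add: sum_distrib_left sum_distrib_right)
 finally show "(NI (%y. iD y * (indicator {y. bdist y <= 3 * ep} y * ennreal \<bar>v y\<bar>)))
 <= ennreal (4 * La0 * ep) * (of_nat (\<Sum>p\<in>C. m p) * strip_mass w (4 * La0 * ep))" by (simp add: t1_def)
 qed (fact La0(1) de0)+
qed

text \<open>Split with the cut-off of width \<open>ep\<close>. Its gradient term is at most
  \<open>1 / ep\<close> times the integral of \<open>\<bar>v\<bar>\<close> over a strip, which
  \<open>hardy_strip\<close> bounds by \<open>ep\<close> times constants and a strip mass. The
  powers of \<open>ep\<close> cancel, and the strip mass tends to zero, as does the mass removed by
  the cut-off.\<close>

lemma integral_zero_trace:
 fixes f :: "nat => real^'d => real" and v :: "real^'d => real"
 assumes f: "!!k. smooth_per G (f k)" and v [measurable]: "v : borel_measurable borel"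
 and w [measurable]: "!!i. w i : borel_measurable borel" and int: "!!i. integrable lborel (%y. iD y * w i y)"
 and f0: "(%k. NI (%y. iD y * ennreal \<bar>f k y - v y\<bar>)) ----> 0"
 and dl: "!!i. (%k. NI (%y. iD y * ennreal \<bar>pd i (f k) y - w i y\<bar>)) ----> 0"
 and lim: "AE y in wall G. (%k. f k y) ----> 0"
 shows "(LINT y|lborel. iD y * w i y) = 0"
proof -
 have fs: "smooth_on UNIV (f k)" for k using f by (auto simp: smooth_per_def)
 have fc: "continuous_on UNIV (f k)" and pc: "continuous_on UNIV (pd i (f k))" for i k
 using smooth_on_continuous0[OF fs] smooth_on_continuous0[OF smooth_on_pd[OF fs]] by auto
 have fm [measurable]: "f k : borel_measurable borel" "pd i (f k) : borel_measurable borel" for i k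
 using fc pc by (auto intro: bm_contI)
 have um: "(%y. iD y * ennreal \<bar>f k y - v y\<bar>) : borel_measurable lborel" for k by measurable
 obtain s where s: "strict_mono s" "AE y in lborel. (%k. iD y * ennreal \<bar>f (s k) y - v y\<bar>) ----> 0"
 by (rule tendsto_zero_AE_subseq[OF um f0], rule that)
 have fv: "AE y in lborel. y : dom G --> (%k. f (s k) y) ----> v y"
 using s(2)
 proof (rule eventually_mono)
 fix y assume l: "(%k. iD y * ennreal \<bar>f (s k) y - v y\<bar>) ----> 0"
 show "y : dom G --> (%k. f (s k) y) ----> v y"
 proof
 assume "y : dom G"
 hence "(%k. ennreal \<bar>f (s k) y - v y\<bar>) ----> ennreal 0" using l by simp
 hence "(%k. \<bar>f (s k) y - v y\<bar>) ----> 0" by (subst (asm) tendsto_ennreal_iff) auto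
 thus "(%k. f (s k) y) ----> v y" by (simp add: tendsto_rabs_zero_iff LIM_zero_iff)
 qed
 qed
 have lim': "AE y in wall G. (%k. f (s k) y) ----> 0"
 using lim by (rule eventually_mono) (drule LIMSEQ_subseq_LIMSEQ[OF _ s(1)], simp add: o_def)
 have dl': "(%k. NI (%y. iD y * ennreal \<bar>pd i (f (s k)) y - w i y\<bar>)) ----> 0" for i
 using LIMSEQ_subseq_LIMSEQ[OF dl s(1)] by (simp add: o_def)
 have fps: "smooth_per G (f (s k))" for k by (rule f)
 obtain M :: nat and La0 de0 :: real where h: "La0 >= 1" "de0 > 0"
 "!!ep. 0 < ep ==> ep <= de0 ==> (NI (%y. iD y * (indicator {y. bdist y <= 3 * ep} y * ennreal \<bar>v y\<bar>)))
 <= ennreal (4 * La0 * ep) * (of_nat M * strip_mass w (4 * La0 * ep))"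
 by (rule hardy_strip[OF fps v w dl' fv lim'], rule that)
 have main: "ennreal \<bar>LINT y|lborel. iD y * w i y\<bar> <= ennreal (4 * La0) * (of_nat M * strip_mass w (4 * La0 * ep)) + strip_mass w (4 * La0 * ep)"
 if ep: "0 < ep" "ep <= de0" for ep
 proof -
 let ?hh = "cutoff ep"
 let ?A = "{y. bdist y <= 3 * ep}"
 have hhc: "continuous_on UNIV ?hh" by (rule cutoff_continuous[OF ep(1)])
 have [measurable]: "?hh : borel_measurable borel" by (rule bm_contI[OF hhc])
 have ihh: "integrable lborel (%y. iD y * (?hh y * w i y))"
 proof (rule Bochner_Integration.integrable_bound[OF int[of i]])
 show "AE y in lborel. norm (iD y * (?hh y * w i y)) <= norm (iD y * w i y)"
 using cutoff_bounds[of ep] by (intro always_eventually allI) (auto simp: indicator_def abs_mult mult_left_le_one_le)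
 qed measurable
 let ?de = "%k. NI (%y. iD y * ennreal \<bar>pd i (f k) y - w i y\<bar>)"
 let ?ht = "%k. NI (%y. iD y * ennreal \<bar>f k y - v y\<bar>)"
 let ?V = "NI (%y. iD y * (indicator ?A y * ennreal \<bar>v y\<bar>))"
 \<comment> \<open>For fixed \<open>ep\<close> the bound still contains the approximation errors of
   \<open>f k\<close>; letting \<open>k\<close> grow removes them and leaves \<open>v\<close> and
   \<open>w\<close> alone.\<close>
 have one: "ennreal \<bar>LINT y|lborel. iD y * (?hh y * w i y)\<bar> <= ennreal (1 / ep) * (?V + ?ht k) + ?de k" for k
 proof -
 have ip: "integrable lborel (%y. iD y * (?hh y * pd i (f k) y))"
 by (intro integrable_dom_continuous continuous_intros hhc pc)
 have "\<bar>LINT y|lborel. iD y * (?hh y * w i y)\<bar> <= \<bar>LINT y|lborel. iD y * (?hh y * pd i (f k) y)\<bar> + \<bar>LINT y|lborel. iD y * (?hh y * w i y) - iD y * (?hh y * pd i (f k) y)\<bar>"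
 unfolding Bochner_Integration.integral_diff[OF ihh ip] by linarith
 hence "ennreal \<bar>LINT y|lborel. iD y * (?hh y * w i y)\<bar> <= ennreal \<bar>LINT y|lborel. iD y * (?hh y * pd i (f k) y)\<bar> + ennreal \<bar>LINT y|lborel. iD y * (?hh y * w i y) - iD y * (?hh y * pd i (f k) y)\<bar>"
 by (simp add: ennreal_leI flip: ennreal_plus)
 also have "... <= ennreal (1 / ep) * (?V + ?ht k) + ?de k"
 proof (rule add_mono)
 have "ennreal \<bar>LINT y|lborel. iD y * (?hh y * w i y) - iD y * (?hh y * pd i (f k) y)\<bar> <= (NI (%y. ennreal (norm (iD y * (?hh y * w i y) - iD y * (?hh y * pd i (f k) y)))))"
 using integral_norm_bound_ennreal[OF Bochner_Integration.integrable_diff[OF ihh ip]] by simp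
 also have "... <= ?de k"
 proof (rule nn_integral_mono)
 fix y
 have "\<bar>?hh y * w i y - ?hh y * pd i (f k) y\<bar> = ?hh y * \<bar>pd i (f k) y - w i y\<bar>"
 using cutoff_bounds(1)[of ep y] by (simp add: abs_mult right_diff_distrib[symmetric] abs_minus_commute)
 also have "... <= \<bar>pd i (f k) y - w i y\<bar>" using cutoff_bounds[of ep y] by (simp add: mult_left_le_one_le)
 finally show "ennreal (norm (iD y * (?hh y * w i y) - iD y * (?hh y * pd i (f k) y))) <= iD y * ennreal \<bar>pd i (f k) y - w i y\<bar>"
 by (cases "y : dom G") (simp_all add: ennreal_leI)
 qed
 finally show "ennreal \<bar>LINT y|lborel. iD y * (?hh y * w i y) - iD y * (?hh y * pd i (f k) y)\<bar> <= ?de k" .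
 have "ennreal \<bar>LINT y|lborel. iD y * (?hh y * pd i (f k) y)\<bar> <= ennreal ((1 / ep) * (LINT y|lborel. iD y * (indicator ?A y * \<bar>f k y\<bar>)))"
 by (rule ennreal_leI[OF cutoff_parts'[OF f ep(1)]])
 also have "... = ennreal (1 / ep) * ennreal (LINT y|lborel. iD y * (indicator ?A y * \<bar>f k y\<bar>))"
 using ep(1) by (intro ennreal_mult integral_nonneg) auto
 also have "ennreal (LINT y|lborel. iD y * (indicator ?A y * \<bar>f k y\<bar>)) = (NI (%y. ennreal (iD y * (indicator ?A y * \<bar>f k y\<bar>))))"
 proof (rule nn_integral_eq_integral[symmetric])
 show "integrable lborel (%y. iD y * (indicator ?A y * \<bar>f k y\<bar>))"
 proof (rule Bochner_Integration.integrable_bound[OF integrable_dom_continuous[OF fc[of k]]])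
 show "AE y in lborel. norm (iD y * (indicator ?A y * \<bar>f k y\<bar>)) <= norm (iD y * f k y)"
 by (intro always_eventually allI) (auto simp: indicator_def)
 qed measurable
 qed (intro always_eventually allI, simp)
 also have "... <= (NI (%y. iD y * (indicator ?A y * ennreal \<bar>v y\<bar>) + iD y * ennreal \<bar>f k y - v y\<bar>))"
 proof (rule nn_integral_mono)
 fix y
 have "ennreal \<bar>f k y\<bar> <= ennreal \<bar>v y\<bar> + ennreal \<bar>f k y - v y\<bar>" by (simp add: ennreal_leI flip: ennreal_plus)
 thus "ennreal (iD y * (indicator ?A y * \<bar>f k y\<bar>)) <= iD y * (indicator ?A y * ennreal \<bar>v y\<bar>) + iD y * ennreal \<bar>f k y - v y\<bar>"
 by (simp add: indicator_def)
 qed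
 also have "... = ?V + ?ht k" by (rule nn_integral_add) measurable
 finally show "ennreal \<bar>LINT y|lborel. iD y * (?hh y * pd i (f k) y)\<bar> <= ennreal (1 / ep) * (?V + ?ht k)" by (simp add: mult_left_mono)
 qed
 finally show ?thesis .
 qed
 have "(%k. ennreal (1 / ep) * (?V + ?ht k) + ?de k) ----> ennreal (1 / ep) * (?V + 0) + 0"
 by (intro tendsto_add ennreal_tendsto_cmult tendsto_const f0 dl) simp
 hence "ennreal \<bar>LINT y|lborel. iD y * (?hh y * w i y)\<bar> <= ennreal (1 / ep) * (?V + 0) + 0"
 by (rule LIMSEQ_le_const) (use one in blast)
 also have "... <= ennreal (1 / ep) * (ennreal (4 * La0 * ep) * (of_nat M * strip_mass w (4 * La0 * ep)))"
 using h(3)[OF ep] by (simp add: mult_left_mono)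
 also have "... = ennreal (4 * La0) * (of_nat M * strip_mass w (4 * La0 * ep))"
 proof -
 have "ennreal (1 / ep) * ennreal (4 * La0 * ep) = ennreal (4 * La0)"
 using ep(1) h(1) by (simp flip: ennreal_mult)
 thus ?thesis by (simp add: mult.assoc[symmetric])
 qed
 finally have A: "ennreal \<bar>LINT y|lborel. iD y * (?hh y * w i y)\<bar> <= ennreal (4 * La0) * (of_nat M * strip_mass w (4 * La0 * ep))" .
 have "ennreal \<bar>LINT y|lborel. iD y * w i y - iD y * (?hh y * w i y)\<bar> <= (NI (%y. ennreal (norm (iD y * w i y - iD y * (?hh y * w i y)))))"
 using integral_norm_bound_ennreal[OF Bochner_Integration.integrable_diff[OF int[of i] ihh]] by simp
 also have "... <= strip_mass w (2 * ep)"
 unfolding strip_mass_def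
 proof (rule nn_integral_mono)
 fix y
 show "ennreal (norm (iD y * w i y - iD y * (?hh y * w i y))) <= iD y * (indicator {y. bdist y <= 2 * ep} y * ennreal (\<Sum>i\<in>UNIV. \<bar>w i y\<bar>))"
 proof (cases "y : dom G & bdist y <= 2 * ep")
 case True
 have "\<bar>w i y - ?hh y * w i y\<bar> = (1 - ?hh y) * \<bar>w i y\<bar>"
 using cutoff_bounds(2)[of ep y] by (metis abs_mult abs_of_nonneg diff_ge_0_iff_ge left_diff_distrib mult_1)
 also have "... <= 1 * \<bar>w i y\<bar>" using cutoff_bounds(1)[of ep y] by (intro mult_right_mono) auto
 also have "... <= (\<Sum>i\<in>UNIV. \<bar>w i y\<bar>)" by (simp only: mult_1, rule member_le_sum[of i UNIV "%i. \<bar>w i y\<bar>"]) auto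
 finally show ?thesis using True by (simp add: ennreal_leI)
 next
 case False
 thus ?thesis using cutoff_eq_1[OF ep(1), of y] dom_subset by (cases "y : dom G") auto
 qed
 qed
 also have "... <= strip_mass w (4 * La0 * ep)"
 proof (rule strip_mass_mono)
 show "2 * ep <= 4 * La0 * ep" using h(1) ep(1) by (intro mult_right_mono) auto
 qed
 finally have B: "ennreal \<bar>LINT y|lborel. iD y * w i y - iD y * (?hh y * w i y)\<bar> <= strip_mass w (4 * La0 * ep)" .
 have "\<bar>LINT y|lborel. iD y * w i y\<bar> <= \<bar>LINT y|lborel. iD y * (?hh y * w i y)\<bar> + \<bar>LINT y|lborel. iD y * w i y - iD y * (?hh y * w i y)\<bar>"
 unfolding Bochner_Integration.integral_diff[OF int ihh] by linarith
 hence "ennreal \<bar>LINT y|lborel. iD y * w i y\<bar> <= ennreal \<bar>LINT y|lborel. iD y * (?hh y * w i y)\<bar> + ennreal \<bar>LINT y|lborel. iD y * w i y - iD y * (?hh y * w i y)\<bar>"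
 by (simp add: ennreal_leI flip: ennreal_plus)
 also have "... <= ennreal (4 * La0) * (of_nat M * strip_mass w (4 * La0 * ep)) + strip_mass w (4 * La0 * ep)" by (rule add_mono[OF A B])
 finally show ?thesis .
 qed
 define ep where "ep n = de0 / (real n + 1)" for n
 have ep: "0 < ep n" "ep n <= de0" for n using h(2) by (auto simp: ep_def divide_le_eq mult_le_cancel_left1)
 have "ep ----> 0" unfolding ep_def using LIMSEQ_ignore_initial_segment[OF lim_const_over_n[of de0], of 1] by (simp add: add.commute)
 hence "(%n. 4 * La0 * ep n) ----> 4 * La0 * 0" by (intro tendsto_intros)
 hence "(%n. 4 * La0 * ep n) ----> 0" by simp
 note sm = strip_mass_tendsto[OF w int this]
 have "(%n. ennreal (4 * La0) * (of_nat M * strip_mass w (4 * La0 * ep n)) + strip_mass w (4 * La0 * ep n)) ----> ennreal (4 * La0) * (of_nat M * 0) + 0"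
 by (intro tendsto_add ennreal_tendsto_cmult sm) (auto simp: of_nat_less_top)
 hence "ennreal \<bar>LINT y|lborel. iD y * w i y\<bar> <= ennreal (4 * La0) * (of_nat M * 0) + 0"
 by (rule LIMSEQ_le_const) (use main[OF ep] in blast)
 thus ?thesis by simp
qed

end

section \<open>Tractions of discrete functions\<close>

text \<open>On each set of a countable compact exhaustion \<open>f\<close> is integrable, hence
  measurable.\<close>

lemma loc_integrable_measurable:
 fixes f :: "real^'d::finite => 'b::euclidean_space"
 assumes U: "open U" and f: "loc_integrable U f"
 shows "f : borel_measurable (lebesgue_on U)"
proof -
 obtain C where C: "!!n::nat. compact (C n)" "!!n. C n \<subseteq> U" "\<Union>(range C) = U"
 using open_Union_compact_subsets[OF U] by metis
 show ?thesis
 proof (rule measurable_piecewise_restrict[of "range C"])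
 show "countable (range C)" by simp
 show "space (lebesgue_on U) \<subseteq> \<Union>(range C)" using C(3) by simp
 fix Om assume "Om : range C"
 then obtain n where n: "Om = C n" by blast
 have s: "C n : sets lebesgue" "U : sets lebesgue" using C(1) U by (auto intro: lmeasurable_compact fmeasurableD)
 show "Om \<inter> space (lebesgue_on U) : sets (lebesgue_on U)" using s C(2)[of n] by (auto simp: n sets_restrict_space)
 have "restrict_space (lebesgue_on U) Om = lebesgue_on (C n)"
 using s C(2)[of n] by (subst restrict_restrict_space) (auto simp: n Int_absorb1)
 moreover have "integrable (lebesgue_on (C n)) f" using f C(1,2) unfolding loc_integrable_def by blast
 ultimately show "f : borel_measurable (restrict_space (lebesgue_on U) Om)" by simp
 qed
qed

section \<open>Lebesgue and Sobolev norms on subdomains\<close>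

lemma Lp_norm_2:
 assumes "f : borel_measurable M"
 shows "Lp_norm 2 M f = ennpowr (\<integral>\<^sup>+x. ennreal ((norm (f x))^2) \<partial>M) (1/2)"
proof -
 have 2: "enn2real 2 = 2" using enn2real_ennreal[of 2] by simp
 have "norm (f x) powr 2 = (norm (f x))^2" for x by (cases "f x = 0") auto
 thus ?thesis using assms by (simp add: Lp_norm_def 2)
qed

lemma Lp_norm_2_finite: "Lp_norm 2 M f < \<infinity> \<longleftrightarrow> l2_fun M f"
proof (cases "f : borel_measurable M")
 case True
 hence [measurable]: "f : borel_measurable M" .
 have "integrable M (%x. (norm (f x))^2) \<longleftrightarrow> (\<integral>\<^sup>+x. ennreal ((norm (f x))^2) \<partial>M) < \<infinity>"
 by (simp add: integrable_iff_bounded)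
 thus ?thesis using True by (auto simp: Lp_norm_2 ennpowr_def l2_fun_def less_top)
qed (simp add: Lp_norm_def l2_fun_def)

lemma Lp_norm_infinity_bound:
 assumes "Lp_norm \<infinity> M f < \<infinity>"
 obtains C where "0 <= C" "AE x in M. norm (f x) <= C" "f : borel_measurable M"
proof -
 have m: "f : borel_measurable M" using assms by (auto simp: Lp_norm_def split: if_splits)
 hence e: "esssup M (%x. ennreal (norm (f x))) < \<infinity>" using assms by (simp add: Lp_norm_def)
 have "AE x in M. norm (f x) <= enn2real (esssup M (%x. ennreal (norm (f x))))"
 using esssup_AE[of "%x. ennreal (norm (f x))" M]
 proof (rule eventually_mono)
 fix x assume "ennreal (norm (f x)) <= esssup M (%x. ennreal (norm (f x)))"
 from enn2real_mono[OF this] show "norm (f x) <= enn2real (esssup M (%x. ennreal (norm (f x))))" using e by (simp add: less_top)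
 qed
 thus ?thesis using m by (intro that) auto
qed

lemma l2_fun_AE_cong:
 assumes "l2_fun M f" "g : borel_measurable M" "AE x in M. f x = g x"
 shows "l2_fun M g"
proof -
 have [measurable]: "f : borel_measurable M" "g : borel_measurable M" using assms by (auto simp: l2_fun_def)
 have "integrable M (%x. (norm (g x))^2)"
 by (rule iffD1[OF integrable_cong_AE]) (use assms in \<open>auto simp: l2_fun_def elim!: eventually_mono\<close>)
 thus ?thesis by (simp add: l2_fun_def)
qed

lemma integrable_lebesgue_on_subset:
 fixes f :: "real^'d::finite => real"
 assumes f: "integrable (lebesgue_on U) f" and s: "U : sets lebesgue" "K : sets lebesgue" "K \<subseteq> U"
 shows "integrable (lebesgue_on K) f"
proof -
 have "set_integrable lebesgue U f" using f s(1) by (simp add: integrable_restrict_space set_integrable_def)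
 hence "set_integrable lebesgue K f" by (rule set_integrable_subset[OF _ s(2,3)])
 thus ?thesis using s(2) by (simp add: integrable_restrict_space set_integrable_def)
qed

lemma l2_fun_subset:
 fixes f :: "real^'d::finite => 'b::euclidean_space"
 assumes f: "l2_fun (lebesgue_on U) f" and UV: "V \<subseteq> U" "open U" "open V"
 shows "l2_fun (lebesgue_on V) f"
proof -
 have "f : borel_measurable (lebesgue_on V)" using f UV(1) by (auto simp: l2_fun_def intro: measurable_restrict_mono)
 moreover have "integrable (lebesgue_on V) (%x. (norm (f x))^2)"
 by (rule integrable_lebesgue_on_subset[of U]) (use f UV in \<open>auto simp: l2_fun_def\<close>)
 ultimately show ?thesis by (simp add: l2_fun_def)
qed

lemma sob_norm_finiteD:
 fixes f :: "real^'d::finite => 'b::euclidean_space"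
 assumes "sob_norm k p U f < \<infinity>" "length is <= k"
 shows "has_weak_deriv U is f (weak_deriv U is f)" "Lp_norm p (lebesgue_on U) (weak_deriv U is f) < \<infinity>"
proof -
 have ex: "ALL is. length is <= k --> (EX g. has_weak_deriv U is f g)" using assms(1) by (auto simp: sob_norm_def split: if_splits)
 thus "has_weak_deriv U is f (weak_deriv U is f)" using assms(2) weak_derivI by blast
 have fin: "finite {is :: 'd list. length is <= k}" using finite_lists_length_le[of "UNIV :: 'd set" k] by simp
 have "(\<Sum>is\<in>{is. length is <= k}. Lp_norm p (lebesgue_on U) (weak_deriv U is f)) < \<infinity>" using assms(1) ex by (simp add: sob_norm_def)
 thus "Lp_norm p (lebesgue_on U) (weak_deriv U is f) < \<infinity>"
 using assms(2) fin by (simp add: ennreal_sum_less_top less_top[symmetric])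
qed

lemma sob_norm_finiteI:
 fixes f :: "real^'d::finite => 'b::euclidean_space"
 assumes "!!is. length is <= k ==> EX g. has_weak_deriv U is f g"
 and "!!is. length is <= k ==> Lp_norm p (lebesgue_on U) (weak_deriv U is f) < \<infinity>"
 shows "sob_norm k p U f < \<infinity>"
proof -
 have fin: "finite {is :: 'd list. length is <= k}" using finite_lists_length_le[of "UNIV :: 'd set" k] by simp
 show ?thesis using assms fin by (simp add: sob_norm_def ennreal_sum_less_top less_top[symmetric])
qed

text \<open>\<open>weak_deriv\<close> on \<open>V\<close> is a choice of its own and not the
  restriction of the one on \<open>U\<close>; uniqueness almost everywhere transfers the
  bound.\<close>

lemma sob_norm_subset_finite:
 fixes f :: "real^'d::finite => 'b::euclidean_space"
 assumes f: "sob_norm k 2 U f < \<infinity>" and UV: "V \<subseteq> U" "open U" "open V"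
 shows "sob_norm k 2 V f < \<infinity>"
proof (rule sob_norm_finiteI)
 fix "is" :: "'d list" assume l: "length is <= k"
 have w: "has_weak_deriv V is f (weak_deriv U is f)"
 by (rule has_weak_deriv_subset[OF sob_norm_finiteD(1)[OF f l] UV(1,3,2)])
 thus "EX g. has_weak_deriv V is f g" by blast
 have "l2_fun (lebesgue_on V) (weak_deriv U is f)"
 by (rule l2_fun_subset[OF sob_norm_finiteD(2)[OF f l, unfolded Lp_norm_2_finite] UV])
 moreover have "weak_deriv V is f : borel_measurable (lebesgue_on V)"
 by (rule loc_integrable_measurable[OF UV(3) has_weak_derivD(2)[OF weak_derivI[OF w]]])
 moreover have "AE x in lebesgue_on V. weak_deriv U is f x = weak_deriv V is f x"
 using weak_deriv_AE_eq[OF UV(3) w] by (rule eventually_mono) simp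
 ultimately show "Lp_norm 2 (lebesgue_on V) (weak_deriv V is f) < \<infinity>"
 unfolding Lp_norm_2_finite by (rule l2_fun_AE_cong)
qed

lemma l2_fun_loc_integrable:
 fixes f :: "real^'d::finite => 'b::euclidean_space"
 assumes f: "l2_fun (lebesgue_on U) f" and U: "open U"
 shows "loc_integrable U f"
 unfolding loc_integrable_def
proof (intro allI impI, elim conjE)
 fix K assume K: "compact K" "K \<subseteq> U"
 have Ks: "K : sets lebesgue" using K(1) by (auto intro: lmeasurable_compact fmeasurableD)
 have i2: "integrable (lebesgue_on K) (%x. (norm (f x))^2)"
 by (rule integrable_lebesgue_on_subset[of U]) (use f U K Ks in \<open>auto simp: l2_fun_def\<close>)
 have m: "f : borel_measurable (lebesgue_on K)" using f K(2) by (auto simp: l2_fun_def intro: measurable_restrict_mono)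
 interpret finite_measure "lebesgue_on K"
 using K(1) by (intro finite_measure_lebesgue_on lmeasurable_compact)
 have "integrable (lebesgue_on K) (%x. 1 + (norm (f x))^2)" using i2 by simp
 thus "integrable (lebesgue_on K) f"
 proof (rule Bochner_Integration.integrable_bound)
 have "a <= 1 + a^2" for a :: real using zero_le_power2[of "a - 1/2"] by (simp add: power2_eq_square algebra_simps)
 thus "AE x in lebesgue_on K. norm (f x) <= norm (1 + (norm (f x))^2)"
 by (intro always_eventually allI) (simp add: abs_of_nonneg)
 qed (fact m)
qed

lemma matrix_eq_sum_axis:
 fixes M :: "real^'n^'m"
 shows "M = (\<Sum>a\<in>UNIV. M $ fst a $ snd a *R axis (fst a) (axis (snd a) 1))"
proof (simp add: vec_eq_iff, intro allI)
 fix r s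
 have "(\<Sum>a\<in>UNIV. M $ fst a $ snd a * axis (fst a) (axis (snd a) 1) $ r $ s) = (\<Sum>a\<in>UNIV. if a = (r, s) then M $ r $ s else 0)"
 by (rule sum.cong) (auto simp: axis_def)
 thus "M $ r $ s = (\<Sum>a\<in>UNIV. M $ fst a $ snd a * axis (fst a) (axis (snd a) 1) $ r $ s)" by simp
qed

lemma esslim_matrix:
 fixes f :: "real^'d::finite => real^'n^'m"
 assumes U: "open U" and l: "!!i j. esslim U (%y. f y $ i $ j) x (l $ i $ j)"
 shows "esslim U f x l"
proof -
 have "esslim U (%y. \<Sum>a\<in>UNIV. f y $ fst a $ snd a *R axis (fst a) (axis (snd a) 1)) x (\<Sum>a\<in>UNIV. l $ fst a $ snd a *R axis (fst a) (axis (snd a) (1::real)))"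
 by (rule esslim_sum[OF U]) (rule l)
 thus ?thesis by (simp flip: matrix_eq_sum_axis)
qed

text \<open>One mesh size is fixed, so the inverse inequalities are kept as finiteness statements: a
  finite norm on the right makes the maximum norm on the left finite.\<close>

locale fe_setting =
 fixes G :: "('d::finite) cell" and V :: "'d fe" and c h :: real
 assumes cell: "admissible_cell G" and mesh: "mesh_partition G c h (mesh V)" and spaces: "fe_spaces G V"
 and XF_sub: "XF V \<subseteq> X_space G" and SF_sub: "SF V \<subseteq> S_space G" and QF_sub: "QF V \<subseteq> Q_space G"
 and QF_const: "(%_. a) : QF V"
 and trace_ex: "v : XF V ==> EX w:SF V. is_trace G v w"
 and inverse_X: "K : mesh V ==> v : XF V ==> EX kp. sob_norm 2 \<infinity> (elset K) v <= ennreal kp * sob_norm 1 2 (elset K) v"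
 and inverse_Q: "K : mesh V ==> q : QF V ==> EX kp. sob_norm 1 \<infinity> (elset K) q <= ennreal kp * sob_norm 0 2 (elset K) q"
 and inf_sup: "EX C. ALL q:Q0F G V. ennreal (l2_norm (bulk G) q) <= ennreal C *
 (SUP v\<in>{v : X0F G V. \<not> (AE x in bulk G. v x = 0)}.
 ennreal (l2_inner (bulk G) (dvg G v) q / enn2real (sob_norm 1 2 (dom G) v)))"
begin

lemma finite_mesh: "finite (mesh V)" and curvi: "K : mesh V ==> curvilinear K" and elset_dom: "K : mesh V ==> elset K \<subseteq> dom G"
 and faces: "\<Union>(snd ` faces_in (mesh V) (Sig G)) = Sig G"
 using mesh by (auto simp: mesh_partition_def face_partition_def)

lemma face_compact:
 assumes "(K, a) : faces_in (mesh V) Ga"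
 shows "compact a" "a \<subseteq> snd K ` fst K"
proof -
 from assms have K: "K : mesh V" "a : elfaces K" by (auto simp: faces_in_def)
 then obtain A where A: "A facet_of fst K" "a = snd K ` A" by (auto simp: elfaces_def)
 have p: "polytope (fst K)" using curvi[OF K(1)] by (simp add: curvilinear_def)
 have "A face_of fst K" using A(1) by (simp add: facet_of_def)
 hence "polytope A" "A \<subseteq> fst K" using face_of_polytope_polytope[OF p] face_of_imp_subset by auto
 thus "compact a" "a \<subseteq> snd K ` fst K" unfolding A(2)
 using compact_continuous_image[OF continuous_on_subset[OF continuous_on_elem[OF curvi[OF K(1)]]] polytope_imp_compact] by auto
qed

lemma finite_faces: "finite (faces_in (mesh V) Ga)"
proof -
 have "faces_in (mesh V) Ga \<subseteq> (SIGMA K:mesh V. elfaces K)" by (auto simp: faces_in_def)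
 moreover have fe: "finite (elfaces K)" if "K : mesh V" for K
 proof -
 have "polytope (fst K)" using curvi[OF that] by (simp add: curvilinear_def)
 moreover have "elfaces K = (`) (snd K) ` {F. F facet_of fst K}" by (auto simp: elfaces_def)
 ultimately show ?thesis using finite_polytope_facets[of "fst K"] by simp
 qed
 ultimately show ?thesis by (intro finite_subset[OF _ finite_SigmaI[OF finite_mesh fe]])
qed

lemma compact_Sig: "compact (Sig G)"
proof -
 have "compact (\<Union>(snd ` faces_in (mesh V) (Sig G)))"
 using finite_faces face_compact(1) by (intro compact_Union) auto
 thus ?thesis by (simp add: faces)
qed

sublocale periodic_cell G
 using cell compact_Sig by (rule periodic_cell.intro)

lemma XF_weak:
 assumes "v : XF V" "length is <= 1"
 shows "has_weak_deriv (dom G) is v (wd is v)" "l2_fun (bulk G) (wd is v)"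
proof -
 have f: "sob_norm 1 2 (dom G) v < \<infinity>" using XF_sub assms(1) by (auto simp: X_space_def)
 show "has_weak_deriv (dom G) is v (wd is v)" by (rule sob_norm_finiteD(1)[OF f assms(2)])
 show "l2_fun (bulk G) (wd is v)" by (rule sob_norm_finiteD(2)[OF f assms(2), unfolded Lp_norm_2_finite])
qed

text \<open>The inverse inequality from \<open>H^1\<close> to \<open>W^(2,\<infinity>)\<close>
  bounds the second weak derivatives on the element; the gradient entries then have Lipschitz
  representatives, which extend to the closed element.\<close>

lemma XF_elem:
 assumes K: "K : mesh V" and v: "v : XF V"
 shows "EX W. continuous_on (snd K ` fst K) W & (ALL x:snd K ` fst K. esslim (elset K) (%y. wd [j] v y $ i) x (W x))"
proof -
 let ?U = "elset K"
 have U: "open ?U" by (rule open_elset[OF curvi[OF K]])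
 have "sob_norm 1 2 (dom G) v < \<infinity>" using XF_sub v by (auto simp: X_space_def)
 from sob_norm_subset_finite[OF this elset_dom[OF K] open_dom U] have f1: "sob_norm 1 2 ?U v < \<infinity>" .
 obtain kp where "sob_norm 2 \<infinity> ?U v <= ennreal kp * sob_norm 1 2 ?U v" using inverse_X[OF K v] by blast
 also have "... < \<infinity>" using f1 by (simp add: ennreal_mult_less_top)
 finally have f2: "sob_norm 2 \<infinity> ?U v < \<infinity>" .
 define g where "g = weak_deriv ?U [j] v"
 define w where "w k = weak_deriv ?U [j, k] v" for k
 have g: "has_weak_deriv ?U [j] v g" unfolding g_def by (rule sob_norm_finiteD(1)[OF f2]) simp
 have w: "has_weak_deriv ?U [j, k] v (w k)" "Lp_norm \<infinity> (lebesgue_on ?U) (w k) < \<infinity>" for k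
 unfolding w_def by (rule sob_norm_finiteD[OF f2], simp)+
 have "EX C>=0. AE x in lebesgue_on ?U. norm (w k x) <= C" for k
 using w(2)[of k] by (rule Lp_norm_infinity_bound) blast
 then obtain C where C: "!!k. 0 <= C k" "!!k. AE x in lebesgue_on ?U. norm (w k x) <= C k" by metis
 define M where "M = (\<Sum>k\<in>UNIV. C k)"
 have M: "C k <= M" for k unfolding M_def by (rule member_le_sum) (auto simp: C)
 have gi: "has_weak_deriv ?U [k] (%y. g y $ i) (%y. w k y $ i)" for k
 using has_weak_deriv_inner[OF U has_weak_deriv_swap[OF g w(1)], of k "axis i 1"] by (simp add: inner_axis)
 obtain W where W: "continuous_on (snd K ` fst K) W" "!!x. x : snd K ` fst K ==> esslim ?U (%y. g y $ i) x (W x)"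
 proof (rule elem_boundary_value[OF curvi[OF K] _ gi])
 show "(%y. g y $ i) : borel_measurable (lebesgue_on ?U)"
 by (rule loc_integrable_measurable[OF U has_weak_derivD(1)[OF gi]])
 show "AE x in lebesgue_on ?U. \<bar>w k x $ i\<bar> <= M" for k
 using C(2)[of k] by (rule eventually_mono) (rule order_trans[OF component_le_norm_cart order_trans[OF _ M]])
 show "0 <= M" unfolding M_def by (intro sum_nonneg C(1))
 qed (rule that)
 have "AE y in lebesgue_on ?U. g y = wd [j] v y"
 unfolding g_def by (rule weak_deriv_AE_eq[OF U has_weak_deriv_subset[OF XF_weak(1)[OF v] elset_dom[OF K] U open_dom]]) simp
 hence "AE y in lebesgue_on ?U. g y $ i = wd [j] v y $ i" by (rule eventually_mono) simp
 from esslim_AE_cong[OF U this] W show ?thesis by auto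
qed

text \<open>As for velocities with one derivative less: the inverse inequality leads from
  \<open>L^2\<close> to \<open>W^(1,\<infinity>)\<close>.\<close>

lemma QF_elem:
 assumes K: "K : mesh V" and q: "q : QF V"
 shows "EX W. continuous_on (snd K ` fst K) W & (ALL x:snd K ` fst K. esslim (elset K) q x (W x))"
proof -
 let ?U = "elset K"
 have U: "open ?U" by (rule open_elset[OF curvi[OF K]])
 have "l2_fun (bulk G) q" using QF_sub q by (auto simp: Q_space_def)
 from l2_fun_subset[OF this elset_dom[OF K] open_dom U] have l2: "l2_fun (lebesgue_on ?U) q" .
 have w0: "has_weak_deriv ?U [] q q" by (rule has_weak_deriv_Nil[OF l2_fun_loc_integrable[OF l2 U]])
 \<comment> \<open>The norm of order 0 is that of the chosen \<open>weak_deriv ?U [] q\<close>,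
   which equals \<open>q\<close> only almost everywhere.\<close>
 have "sob_norm 0 2 ?U q < \<infinity>"
 proof (rule sob_norm_finiteI)
 fix "is" :: "'d list" assume "length is <= 0"
 hence [simp]: "is = []" by simp
 show "EX g. has_weak_deriv ?U is q g" using w0 by auto
 have "weak_deriv ?U is q : borel_measurable (lebesgue_on ?U)"
 using loc_integrable_measurable[OF U has_weak_derivD(2)[OF weak_derivI[OF w0]]] by simp
 moreover have "AE x in lebesgue_on ?U. q x = weak_deriv ?U is q x"
 using weak_deriv_AE_eq[OF U w0] by (auto elim: eventually_mono)
 ultimately show "Lp_norm 2 (lebesgue_on ?U) (weak_deriv ?U is q) < \<infinity>"
 unfolding Lp_norm_2_finite by (intro l2_fun_AE_cong[OF l2])
 qed
 note f0 = this
 obtain kp where "sob_norm 1 \<infinity> ?U q <= ennreal kp * sob_norm 0 2 ?U q" using inverse_Q[OF K q] by blast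
 also have "... < \<infinity>" using f0 by (simp add: ennreal_mult_less_top)
 finally have f2: "sob_norm 1 \<infinity> ?U q < \<infinity>" .
 define w where "w k = weak_deriv ?U [k] q" for k
 have w: "has_weak_deriv ?U [k] q (w k)" "Lp_norm \<infinity> (lebesgue_on ?U) (w k) < \<infinity>" for k
 unfolding w_def by (rule sob_norm_finiteD[OF f2], simp)+
 have "EX C>=0. AE x in lebesgue_on ?U. norm (w k x) <= C" for k
 using w(2)[of k] by (rule Lp_norm_infinity_bound) blast
 then obtain C where C: "!!k. 0 <= C k" "!!k. AE x in lebesgue_on ?U. norm (w k x) <= C k" by metis
 define M where "M = (\<Sum>k\<in>UNIV. C k)"
 have M: "C k <= M" for k unfolding M_def by (rule member_le_sum) (auto simp: C)
 obtain W where "continuous_on (snd K ` fst K) W" "!!x. x : snd K ` fst K ==> esslim ?U q x (W x)"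
 proof (rule elem_boundary_value[OF curvi[OF K] _ w(1)])
 show "q : borel_measurable (lebesgue_on ?U)" using l2 by (simp add: l2_fun_def)
 show "AE x in lebesgue_on ?U. \<bar>w k x\<bar> <= M" for k
 using C(2)[of k] by (rule eventually_mono) (use M[of k] in simp)
 show "0 <= M" unfolding M_def by (intro sum_nonneg C(1))
 qed (rule that)
 thus ?thesis by blast
qed

text \<open>Written as nested combinations of two terms, the shape to which
  \<open>esslim_linear\<close> applies.\<close>

lemma stress_component: "stress G mv u p y $ i $ j = (- (if i = j then 1 else 0)) *R p y + mv *R (1 *R wd [j] u y $ i + 1 *R wd [i] u y $ j)"
 by (simp add: stress_def strain_def mat_def grad_def transpose_def)

lemma stress_elem:
 assumes K: "K : mesh V" and u: "u : XF V" and p: "p : QF V"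
 shows "EX W. continuous_on (snd K ` fst K) W & (ALL x:snd K ` fst K. esslim (elset K) (stress G mv u p) x (W x))"
proof -
 have U: "open (elset K)" by (rule open_elset[OF curvi[OF K]])
 obtain D where D: "!!i j. continuous_on (snd K ` fst K) (D i j)" "!!i j x. x : snd K ` fst K ==> esslim (elset K) (%y. wd [j] u y $ i) x (D i j x)"
 proof -
 define D where "D i j = (SOME W. continuous_on (snd K ` fst K) W & (ALL x:snd K ` fst K. esslim (elset K) (%y. wd [j] u y $ i) x (W x)))" for i j
 have "continuous_on (snd K ` fst K) (D i j) & (ALL x:snd K ` fst K. esslim (elset K) (%y. wd [j] u y $ i) x (D i j x))" for i j
 unfolding D_def by (rule someI_ex[OF XF_elem[OF K u]])
 note d = this
 show thesis by (rule that[of D]) (rule conjunct1[OF d], rule bspec[OF conjunct2[OF d]])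
 qed
 obtain P where P: "continuous_on (snd K ` fst K) P" "!!x. x : snd K ` fst K ==> esslim (elset K) p x (P x)"
 using QF_elem[OF K p] by blast
 define W where "W x = (\<chi> i j. (- (if i = j then 1 else 0)) *R P x + mv *R (1 *R D i j x + 1 *R D j i x))" for x
 have "continuous_on (snd K ` fst K) W" unfolding W_def by (intro continuous_intros D P)
 moreover have "esslim (elset K) (stress G mv u p) x (W x)" if x: "x : snd K ` fst K" for x
 proof (rule esslim_matrix[OF U])
 fix i j
 show "esslim (elset K) (%y. stress G mv u p y $ i $ j) x (W x $ i $ j)"
 unfolding stress_component W_def vec_lambda_beta by (intro esslim_linear[OF U] D P x)
 qed
 ultimately show ?thesis by blast
qed

lemma bdry_elem:
 assumes "x : Sig G"
 shows "bdry_elem G (mesh V) x : mesh V" "x : snd (bdry_elem G (mesh V) x) ` fst (bdry_elem G (mesh V) x)"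
proof -
 have "x : \<Union>(snd ` faces_in (mesh V) (Sig G))" using assms faces by simp
 then obtain z where z: "z : faces_in (mesh V) (Sig G)" "x : snd z" by blast
 hence "(fst z, snd z) : faces_in (mesh V) (Sig G)" by simp
 with z(2) have "EX K a. (K, a) : faces_in (mesh V) (Sig G) & x : a" by blast
 from someI_ex[OF this] obtain a where a: "(bdry_elem G (mesh V) x, a) : faces_in (mesh V) (Sig G)" "x : a"
 unfolding bdry_elem_def by blast
 thus "bdry_elem G (mesh V) x : mesh V" by (simp add: faces_in_def)
 show "x : snd (bdry_elem G (mesh V) x) ` fst (bdry_elem G (mesh V) x)" using face_compact(2)[OF a(1)] a(2) by blast
qed

lemma bdry_value_stress:
 assumes K: "K : mesh V" and u: "u : XF V" and p: "p : QF V" and x: "x : snd K ` fst K"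
 shows "esslim (elset K) (stress G mv u p) x (bdry_value (elset K) (stress G mv u p) x)"
proof -
 obtain W where W: "ALL x:snd K ` fst K. esslim (elset K) (stress G mv u p) x (W x)" using stress_elem[OF K u p] by blast
 have "x : closure (elset K)" using closure_elset[OF curvi[OF K]] x by simp
 from bdry_value_eqI[OF open_elset[OF curvi[OF K]] this] W x show ?thesis by metis
qed

lemma bdry_value_stress_continuous:
 assumes K: "K : mesh V" and u: "u : XF V" and p: "p : QF V"
 shows "continuous_on (snd K ` fst K) (bdry_value (elset K) (stress G mv u p))"
proof -
 obtain W where W: "continuous_on (snd K ` fst K) W" "ALL x:snd K ` fst K. esslim (elset K) (stress G mv u p) x (W x)" using stress_elem[OF K u p] by blast
 have "W x = bdry_value (elset K) (stress G mv u p) x" if "x : snd K ` fst K" for x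
 using bdry_value_eqI[OF open_elset[OF curvi[OF K]], of x] closure_elset[OF curvi[OF K]] W(2) that by metis
 thus ?thesis using W(1) by (simp cong: continuous_on_cong)
qed

lemma XF_linear: "u : XF V ==> v : XF V ==> (%x. a *R u x + b *R v x) : XF V"
 and QF_linear: "p : QF V ==> q : QF V ==> (%x. a *R p x + b *R q x) : QF V"
 and SF_linear: "s : SF V ==> t : SF V ==> (%x. a *R s x + b *R t x) : SF V"
 and zero_XF: "(%_. 0) : XF V" and zero_QF: "(%_. 0) : QF V" and zero_SF: "(%_. 0) : SF V"
 using spaces unfolding fe_spaces_def fin_dim_space_def by simp_all

lemma weak_linear:
 assumes "u : XF V" "v : XF V" "length is <= 1"
 shows "AE y in bulk G. wd is (%x. a *R u x + b *R v x) y = a *R wd is u y + b *R wd is v y"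
 by (rule weak_deriv_AE_eq[OF open_dom has_weak_deriv_linear[OF open_dom XF_weak(1)[OF assms(1,3)] XF_weak(1)[OF assms(2,3)]]])

lemma stress_linear:
 assumes u: "u : XF V" "v : XF V"
 shows "AE y in bulk G. stress G mv (%x. a *R u x + b *R v x) (%x. a *R p x + b *R q x) y = a *R stress G mv u p y + b *R stress G mv v q y"
proof -
 have "AE y in bulk G. ALL j:UNIV. wd [j] (%x. a *R u x + b *R v x) y = a *R wd [j] u y + b *R wd [j] v y"
 by (intro AE_finite_allI weak_linear u) auto
 thus ?thesis
 proof (rule eventually_mono)
 fix y assume h: "ALL j:UNIV. wd [j] (%x. a *R u x + b *R v x) y = a *R wd [j] u y + b *R wd [j] v y"
 show "stress G mv (%x. a *R u x + b *R v x) (%x. a *R p x + b *R q x) y = a *R stress G mv u p y + b *R stress G mv v q y"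
 unfolding vec_eq_iff vector_add_component vector_scaleR_component stress_component using h by (auto simp: algebra_simps)
 qed
qed

abbreviation "svn \<equiv> traction G (mesh V)"

text \<open>At a given \<open>x\<close> all tractions are limits from one and the same element, so
  linearity holds at every wall point and not only almost everywhere.\<close>

lemma traction_linear:
 assumes u: "u : XF V" "v : XF V" and p: "p : QF V" "q : QF V" and x: "x : Sig G"
 shows "svn mv (%x. a *R u x + b *R v x) (%x. a *R p x + b *R q x) x = a *R svn mv u p x + b *R svn mv v q x"
proof -
 define K where "K = bdry_elem G (mesh V) x"
 have K: "K : mesh V" "x : snd K ` fst K" using bdry_elem[OF x] by (auto simp: K_def)
 have U: "open (elset K)" by (rule open_elset[OF curvi[OF K(1)]])
 have cl: "x : closure (elset K)" using closure_elset[OF curvi[OF K(1)]] K(2) by simp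
 have "AE y in lebesgue_on (elset K). stress G mv (%x. a *R u x + b *R v x) (%x. a *R p x + b *R q x) y = a *R stress G mv u p y + b *R stress G mv v q y"
 using AE_lebesgue_on_subset[OF stress_linear[OF u] elset_dom[OF K(1)]] open_dom U by simp
 from esslim_AE_cong[OF U this] have "esslim (elset K) (stress G mv (%x. a *R u x + b *R v x) (%x. a *R p x + b *R q x)) x
 (a *R bdry_value (elset K) (stress G mv u p) x + b *R bdry_value (elset K) (stress G mv v q) x)"
 using esslim_linear[OF U bdry_value_stress[OF K(1) u(1) p(1) K(2)] bdry_value_stress[OF K(1) u(2) p(2) K(2)]] by simp
 from bdry_value_eqI[OF U cl this] show ?thesis
 unfolding traction_def K_def[symmetric] by (simp add: matrix_vector_mult_add_rdistrib scaleR_matrix_vector_assoc)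
qed

text \<open>\<open>bdry_elem\<close> is a choice among the elements with a face through
  \<open>x\<close>, so measurability is not automatic. But the choice depends only on that set of
  elements, which takes finitely many values, each on a Borel set. On every resulting piece the
  traction is the restriction of a continuous function on a compact set.\<close>

lemma traction_l2:
 assumes u: "u : XF V" and p: "p : QF V"
 shows "l2_fun (wall G) (svn mv u p)"
proof -
 define A where "A K = \<Union>{a. (K, a) : faces_in (mesh V) (Sig G)}" for K
 define B where "B K = {x : Sig G. bdry_elem G (mesh V) x = K}" for K
 define t where "t K x = bdry_value (elset K) (stress G mv u p) x *v nrm G x" for K x
 have A: "A K : sets borel" for K
 proof -
 have "finite {a. (K, a) : faces_in (mesh V) (Sig G)}"
 proof (rule finite_subset[OF _ finite_imageI[OF finite_faces[of "Sig G"], of snd]])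
 show "{a. (K, a) : faces_in (mesh V) (Sig G)} \<subseteq> snd ` faces_in (mesh V) (Sig G)"
 proof
 fix a assume "a : {a. (K, a) : faces_in (mesh V) (Sig G)}"
 hence "(K, a) : faces_in (mesh V) (Sig G)" by simp
 from imageI[OF this, of snd] show "a : snd ` faces_in (mesh V) (Sig G)" by simp
 qed
 qed
 hence "compact (A K)" unfolding A_def using face_compact(1) by (intro compact_Union) auto
 thus ?thesis by (rule borel_compact)
 qed
 have B: "B K : sets borel" for K
 proof -
 \<comment> \<open>The elements having a face through \<open>x\<close>; \<open>bdry_elem\<close> is
   a function of this set alone.\<close>
 define pat where "pat x = {K : mesh V. x : A K}" for x
 have bp: "bdry_elem G (mesh V) x = (SOME K. K : pat x)" for x
 unfolding bdry_elem_def by (rule arg_cong[where f=Eps]) (auto simp: pat_def A_def faces_in_def)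
 have e: "{x. pat x = P} = (\<Inter>K\<in>mesh V. if K : P then A K else - A K)" if "P \<subseteq> mesh V" for P
 using that by (auto simp: pat_def split: if_splits)
 have "{x. pat x = P} : sets borel" if "P \<subseteq> mesh V" for P
 proof (cases "mesh V = {}")
 case False
 thus ?thesis unfolding e[OF that] using A finite_mesh by (intro sets.finite_INT) auto
 next
 case True
 hence "{x. pat x = P} = UNIV" using that by (auto simp: pat_def)
 thus ?thesis by simp
 qed
 hence "(\<Union>P\<in>{P : Pow (mesh V). (SOME K. K : P) = K}. {x. pat x = P}) : sets borel"
 using finite_mesh by (intro sets.finite_UN) auto
 moreover have "B K = Sig G \<inter> (\<Union>P\<in>{P : Pow (mesh V). (SOME K. K : P) = K}. {x. pat x = P})"
 unfolding B_def bp by (auto simp: pat_def)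
 ultimately show ?thesis using Sig_borel by simp
 qed
 have BK: "B K \<subseteq> Sig G \<inter> snd K ` fst K" for K using bdry_elem(2) by (auto simp: B_def)
 have tc: "continuous_on (Sig G \<inter> snd K ` fst K) (t K)" if "K : mesh V" for K
 unfolding t_def matrix_vector_mult_def
 by (intro continuous_intros continuous_on_subset[OF bdry_value_stress_continuous[OF that u p]] continuous_on_subset[OF continuous_on_nrm]) auto
 have tb: "EX C. ALL x:Sig G \<inter> snd K ` fst K. norm (t K x) <= C" if "K : mesh V" for K
 proof -
 have "compact (snd K ` fst K)" by (rule compact_elem[OF curvi[OF that]])
 hence "compact (t K ` (Sig G \<inter> snd K ` fst K))" by (intro compact_continuous_image[OF tc[OF that]] compact_Int compact_Sig)
 from compact_imp_bounded[OF this] show ?thesis unfolding bounded_iff by auto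
 qed
 have tr: "svn mv u p x = t K x" if "x : B K" for x K using that by (simp add: traction_def t_def B_def)
 have "svn mv u p : borel_measurable (restrict_space borel (Sig G))"
 proof (rule measurable_piecewise_restrict[of "B ` mesh V"])
 show "countable (B ` mesh V)" using finite_mesh by (simp add: countable_finite)
 show "space (restrict_space borel (Sig G)) \<subseteq> \<Union>(B ` mesh V)" using bdry_elem(1) by (auto simp: B_def space_restrict_space)
 fix Om assume "Om : B ` mesh V"
 then obtain K where K: "K : mesh V" "Om = B K" by blast
 have sub: "B K \<subseteq> Sig G" using BK by blast
 show "Om \<inter> space (restrict_space borel (Sig G)) : sets (restrict_space borel (Sig G))"
 using B[of K] Sig_borel sub by (auto simp: K(2) sets_restrict_space_iff space_restrict_space)
 have "t K : borel_measurable (restrict_space borel (B K))"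
 by (rule borel_measurable_continuous_on_restrict[OF continuous_on_subset[OF tc[OF K(1)] BK]])
 hence "svn mv u p : borel_measurable (restrict_space borel (B K))"
 by (rule measurable_cong[THEN iffD1, rotated]) (simp add: tr space_restrict_space)
 moreover have "restrict_space (restrict_space borel (Sig G)) Om = restrict_space borel (B K)"
 using B[of K] Sig_borel sub by (subst restrict_restrict_space) (auto simp: K(2) Int_absorb1)
 ultimately show "svn mv u p : borel_measurable (restrict_space (restrict_space borel (Sig G)) Om)" by simp
 qed
 hence m: "svn mv u p : borel_measurable (wall G)" by (rule borel_measurable_surf)
 obtain C where C: "!!K x. K : mesh V ==> x : Sig G \<inter> snd K ` fst K ==> norm (t K x) <= C K" using tb by metis
 define M where "M = (\<Sum>K\<in>mesh V. \<bar>C K\<bar>)"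
 have bound: "norm (svn mv u p x) <= M" if "x : Sig G" for x
 proof -
 define K where "K = bdry_elem G (mesh V) x"
 have K: "K : mesh V" "x : B K" using bdry_elem(1)[OF that] that by (auto simp: K_def B_def)
 have "norm (svn mv u p x) <= \<bar>C K\<bar>" using C[OF K(1), of x] BK[of K] K(2) tr[OF K(2)] by (simp add: subset_iff)
 also have "... <= M" unfolding M_def using K(1) finite_mesh by (intro member_le_sum) auto
 finally show ?thesis .
 qed
 interpret finite_measure "wall G" by (rule finite_measureI) (use wall_finite in simp)
 have "integrable (wall G) (%x. (norm (svn mv u p x))^2)"
 proof (rule integrable_const_bound[where B="M^2"])
 show "AE x in wall G. norm ((norm (svn mv u p x))^2) <= M^2"
 using bound by (intro AE_I2) (simp add: power_mono)
 qed (use m in measurable)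
 thus ?thesis using m by (simp add: l2_fun_def)
qed

end

section \<open>Traces\<close>

lemma integrable_vec_nth:
 fixes f :: "'a => real^'n"
 shows "integrable M f ==> integrable M (%x. f x $ a)"
 by (rule integrable_bounded_linear[OF bounded_linear_vec_nth])

text \<open>\<open>L^1\<close> convergence is all that the trace arguments use. On the finite
  measures \<open>bulk G\<close> and \<open>wall G\<close> it follows from the \<open>L^2\<close>
  convergence in \<open>is_trace\<close>, and it passes to components, subsequences and other
  representatives of the limit.\<close>

definition L1_tendsto :: "'a measure => (nat => 'a => 'b::euclidean_space) => ('a => 'b) => bool" where
 "L1_tendsto M f g \<longleftrightarrow> (ALL k. f k : borel_measurable M) & g : borel_measurable M & (%k. \<integral>\<^sup>+x. ennreal (norm (f k x - g x)) \<partial>M) ----> 0"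

lemma tendsto_zero_mono:
 fixes u v :: "nat => ennreal"
 assumes "!!k. u k <= v k" "v ----> 0"
 shows "u ----> 0"
proof (rule tendsto_sandwich[OF _ _ tendsto_const assms(2)])
 show "\<forall>\<^sub>F k in sequentially. u k <= v k" by (rule always_eventually, rule allI, rule assms(1))
qed simp

lemma L1_tendsto_linear:
 assumes "L1_tendsto M f f'" "L1_tendsto M g g'"
 shows "L1_tendsto M (%k x. a *R f k x + b *R g k x) (%x. a *R f' x + b *R g' x)"
proof -
 let ?d = "%k x. (a *R f k x + b *R g k x) - (a *R f' x + b *R g' x)"
 have [measurable]: "f k : borel_measurable M" "g k : borel_measurable M" "f' : borel_measurable M" "g' : borel_measurable M" for k
 using assms by (auto simp: L1_tendsto_def)
 let ?F = "%k. \<integral>\<^sup>+x. ennreal (norm (f k x - f' x)) \<partial>M" and ?G = "%k. \<integral>\<^sup>+x. ennreal (norm (g k x - g' x)) \<partial>M"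
 have b: "(\<integral>\<^sup>+x. ennreal (norm (?d k x)) \<partial>M) <= ennreal \<bar>a\<bar> * ?F k + ennreal \<bar>b\<bar> * ?G k" for k
 proof -
 have "(\<integral>\<^sup>+x. ennreal (norm (?d k x)) \<partial>M) <= (\<integral>\<^sup>+x. ennreal \<bar>a\<bar> * ennreal (norm (f k x - f' x)) + ennreal \<bar>b\<bar> * ennreal (norm (g k x - g' x)) \<partial>M)"
 proof (rule nn_integral_mono)
 fix x
 have "(a *R f k x + b *R g k x) - (a *R f' x + b *R g' x) = a *R (f k x - f' x) + b *R (g k x - g' x)" by (simp add: algebra_simps)
 hence "norm (?d k x) <= \<bar>a\<bar> * norm (f k x - f' x) + \<bar>b\<bar> * norm (g k x - g' x)"
 using norm_triangle_ineq[of "a *R (f k x - f' x)" "b *R (g k x - g' x)"] by simp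
 thus "ennreal (norm (?d k x)) <= ennreal \<bar>a\<bar> * ennreal (norm (f k x - f' x)) + ennreal \<bar>b\<bar> * ennreal (norm (g k x - g' x))"
 by (simp add: ennreal_leI flip: ennreal_mult ennreal_plus)
 qed
 also have "... = ennreal \<bar>a\<bar> * ?F k + ennreal \<bar>b\<bar> * ?G k"
 by (subst nn_integral_add, measurable, subst (1 2) nn_integral_cmult, measurable)
 finally show ?thesis .
 qed
 have "(%k. ennreal \<bar>a\<bar> * ?F k + ennreal \<bar>b\<bar> * ?G k) ----> ennreal \<bar>a\<bar> * 0 + ennreal \<bar>b\<bar> * 0"
 using assms by (intro tendsto_add ennreal_tendsto_cmult) (auto simp: L1_tendsto_def)
 hence l: "(%k. ennreal \<bar>a\<bar> * ?F k + ennreal \<bar>b\<bar> * ?G k) ----> 0" by simp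
 have "(%k. \<integral>\<^sup>+x. ennreal (norm (?d k x)) \<partial>M) ----> 0"
 by (rule tendsto_zero_mono[OF b l])
 thus ?thesis by (simp add: L1_tendsto_def)
qed

lemma L1_tendsto_AE_cong:
 assumes f: "L1_tendsto M f g" and h: "h : borel_measurable M" "AE x in M. g x = h x"
 shows "L1_tendsto M f h"
proof -
 have "(\<integral>\<^sup>+x. ennreal (norm (f k x - g x)) \<partial>M) = (\<integral>\<^sup>+x. ennreal (norm (f k x - h x)) \<partial>M)" for k
 using h(2) by (intro nn_integral_cong_AE) (auto elim: eventually_mono)
 thus ?thesis using f h(1) by (simp add: L1_tendsto_def)
qed

lemma L1_tendsto_component:
 fixes f :: "nat => 'a => real^'n"
 assumes "L1_tendsto M f g"
 shows "L1_tendsto M (%k x. f k x $ a) (%x. g x $ a)"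
proof -
 have m: "(%x. F x $ a) : borel_measurable M" if "F : borel_measurable M" for F :: "'a => real^'n"
 by (rule measurable_compose[OF that bm_contI[OF continuous_on_component[OF continuous_on_id]]])
 have b: "(\<integral>\<^sup>+x. ennreal (norm (f k x $ a - g x $ a)) \<partial>M) <= (\<integral>\<^sup>+x. ennreal (norm (f k x - g x)) \<partial>M)" for k
 using component_le_norm_cart[of "f k _ - g _" a] by (intro nn_integral_mono ennreal_leI) simp
 have "(%k. \<integral>\<^sup>+x. ennreal (norm (f k x $ a - g x $ a)) \<partial>M) ----> 0"
 by (rule tendsto_zero_mono[OF b]) (use assms in \<open>simp add: L1_tendsto_def\<close>)
 thus ?thesis using assms m by (simp add: L1_tendsto_def)
qed

lemma L1_tendsto_subseq:
 "L1_tendsto M f g ==> strict_mono s ==> L1_tendsto M (%k. f (s k)) g"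
 using LIMSEQ_subseq_LIMSEQ[of "%k. \<integral>\<^sup>+x. ennreal (norm (f k x - g x)) \<partial>M" 0 s] by (simp add: L1_tendsto_def o_def)

text \<open>Cauchy-Schwarz against the constant 1.\<close>

lemma (in finite_measure) L1_tendsto_of_L2:
 assumes m: "!!k. f k : borel_measurable M" "g : borel_measurable M"
 and l: "(%k. \<integral>\<^sup>+x. ennreal ((norm (f k x - g x))^2) \<partial>M) ----> 0"
 shows "L1_tendsto M f g"
proof -
 have [measurable]: "f k : borel_measurable M" "g : borel_measurable M" for k using m by auto
 let ?x = "%k. \<integral>\<^sup>+x. ennreal (norm (f k x - g x)) \<partial>M"
 have cs: "(?x k)^2 <= emeasure M (space M) * (\<integral>\<^sup>+x. ennreal ((norm (f k x - g x))^2) \<partial>M)" for k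
 using Cauchy_Schwarz_nn_integral[of "%x. ennreal (norm (f k x - g x))" M "%_. 1"] by (simp add: ennreal_power mult.commute)
 have l2: "(%k. emeasure M (space M) * (\<integral>\<^sup>+x. ennreal ((norm (f k x - g x))^2) \<partial>M)) ----> emeasure M (space M) * 0"
 by (rule ennreal_tendsto_cmult[OF _ l]) (simp add: less_top[symmetric])
 have "?x ----> 0"
 proof (rule order_tendstoI)
 fix a :: ennreal assume a: "0 < a"
 obtain b where b: "0 < b" "b < a" using dense[OF a] by (elim exE conjE)
 have "b ~= top" using b(2) top_greatest[of a] by (auto simp: not_less[symmetric])
 then obtain de :: real where de: "0 < ennreal de" "ennreal de < a" using b by (cases b) auto
 hence de0: "0 < de" by simp
 have "\<forall>\<^sub>F k in sequentially. emeasure M (space M) * (\<integral>\<^sup>+x. ennreal ((norm (f k x - g x))^2) \<partial>M) < ennreal (de^2)"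
 using l2 by (rule order_tendstoD(2)) (use de0 in simp)
 thus "\<forall>\<^sub>F k in sequentially. ?x k < a"
 proof (rule eventually_mono)
 fix k assume k: "emeasure M (space M) * (\<integral>\<^sup>+x. ennreal ((norm (f k x - g x))^2) \<partial>M) < ennreal (de^2)"
 show "?x k < a"
 proof (rule ccontr)
 assume "\<not> ?x k < a"
 hence "ennreal de <= ?x k" using de(2) by simp
 hence "(ennreal de)^2 <= (?x k)^2" unfolding power2_eq_square by (intro mult_mono) auto
 thus False using order_trans[OF _ cs[of k]] k de0 by (simp add: ennreal_power not_le[symmetric])
 qed
 qed
 qed simp
 thus ?thesis using m by (simp add: L1_tendsto_def)
qed

lemma ennpowr_half: "(ennpowr x (1/2))^2 = x"
proof (cases "x = \<infinity>")
 case False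
 then obtain r where r: "x = ennreal r" "0 <= r" by (cases x) auto
 thus ?thesis by (simp add: ennpowr_def ennreal_power powr_half_sqrt)
qed (simp add: ennpowr_def power2_eq_square ennreal_top_mult)

lemma pd_component:
 fixes f :: "real^'d::finite => real^'n"
 assumes "f differentiable (at x)"
 shows "pd i (%y. f y $ a) x = pd i f x $ a"
proof -
 have "((%y. f y $ a) has_derivative (%h. (\<Sum>i\<in>UNIV. h $ i *R pd i f x) $ a)) (at x)"
 by (rule bounded_linear.has_derivative[OF bounded_linear_vec_nth has_derivative_pd[OF assms]])
 from pd_eqI[OF this, of i] show ?thesis by (simp add: axis_def if_distrib[of "%c. c * _"] cong: if_cong)
qed

lemma smooth_on_component:
 fixes f :: "real^'d::finite => real^'n"
 assumes f: "smooth_on UNIV f"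
 shows "smooth_on UNIV (%x. f x $ a)"
proof -
 have e: "pds is (%x. f x $ a) = (%x. pds is f x $ a)" for "is"
 proof (induction "is")
 case (Cons i js)
 show ?case unfolding pds.simps Cons by (rule ext) (rule pd_component[OF smooth_on_differentiable[OF f UNIV_I]])
 qed simp
 show ?thesis unfolding smooth_on_def e
 by (intro allI ballI differentiableI[OF bounded_linear.has_derivative[OF bounded_linear_vec_nth has_derivative_pd]] smooth_on_differentiable[OF f])
qed

context periodic_cell
begin

lemma L1_tendsto_AE_subseq:
 assumes "L1_tendsto M f g"
 obtains s where "strict_mono s" "AE x in M. (%k. f (s k) x) ----> g x"
proof -
 have m: "(%x. ennreal (norm (f k x - g x))) : borel_measurable M" for k
 proof -
 have [measurable]: "f k : borel_measurable M" "g : borel_measurable M" using assms by (auto simp: L1_tendsto_def)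
 show ?thesis by measurable
 qed
 have l: "(%k. \<integral>\<^sup>+x. ennreal (norm (f k x - g x)) \<partial>M) ----> 0" using assms by (simp add: L1_tendsto_def)
 obtain s where s: "strict_mono s" "AE x in M. (%k. ennreal (norm (f (s k) x - g x))) ----> 0"
 by (rule tendsto_zero_AE_subseq[OF m l], rule that)
 from s(2) have "AE x in M. (%k. f (s k) x) ----> g x"
 proof (rule eventually_mono)
 fix x assume "(%k. ennreal (norm (f (s k) x - g x))) ----> 0"
 hence "(%k. ennreal (norm (f (s k) x - g x))) ----> ennreal 0" by simp
 hence "(%k. norm (f (s k) x - g x)) ----> 0" by (subst (asm) tendsto_ennreal_iff) auto
 thus "(%k. f (s k) x) ----> g x" by (simp add: tendsto_norm_zero_iff LIM_zero_iff)
 qed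
 with s(1) show ?thesis by (rule that)
qed

lemma finite_bulk: "finite_measure (bulk G)"
 using bounded_dom open_dom by (intro finite_measure_lebesgue_on lmeasurable_open)

lemma finite_wall: "finite_measure (wall G)"
 by (rule finite_measureI) (use wall_finite in simp)

lemma nn_integral_bulk:
 fixes f :: "real^'d => real"
 shows "(\<integral>\<^sup>+x. ennreal (f x) \<partial>bulk G) = (NI (%x. iD x * ennreal (f x)))"
 using open_dom by (simp add: nn_integral_restrict_space nn_integral_completion mult.commute)

lemma continuous_bulk: "continuous_on UNIV f ==> f : borel_measurable (bulk G)" for f :: "real^'d => 'b::euclidean_space"
 by (rule measurable_restrict_space1[OF continuous_imp_lebesgue_measurable])

lemma continuous_wall: "continuous_on UNIV f ==> f : borel_measurable (wall G)" for f :: "real^'d => 'b::euclidean_space"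
 by (intro borel_measurable_surf measurable_restrict_space1 bm_contI)

text \<open>A relaxed \<open>is_trace\<close> with the gradient limits \<open>D\<close> as explicit
  data. This makes it a linear relation between \<open>u\<close>, \<open>D\<close> and
  \<open>g\<close>, in which the choices made by \<open>weak_deriv\<close> and \<open>tr\<close> do
  not interfere.\<close>

definition L1_trace :: "(real^'d => real^'d) => ('d => real^'d => real^'d) => (real^'d => real^'d) => bool" where
 "L1_trace u D g \<longleftrightarrow> (EX ph. (ALL k. smooth_per G (ph k)) & L1_tendsto (bulk G) ph u & (ALL i. L1_tendsto (bulk G) (%k. pd i (ph k)) (D i)) & L1_tendsto (wall G) ph g)"

lemma L1_trace_linear:
 assumes "L1_trace u D g" "L1_trace v E h"
 shows "L1_trace (%x. a *R u x + b *R v x) (%i x. a *R D i x + b *R E i x) (%x. a *R g x + b *R h x)"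
proof -
 obtain ph where ph: "!!k. smooth_per G (ph k)" "L1_tendsto (bulk G) ph u" "!!i. L1_tendsto (bulk G) (%k. pd i (ph k)) (D i)" "L1_tendsto (wall G) ph g"
 using assms(1) unfolding L1_trace_def by blast
 obtain pz where pz: "!!k. smooth_per G (pz k)" "L1_tendsto (bulk G) pz v" "!!i. L1_tendsto (bulk G) (%k. pd i (pz k)) (E i)" "L1_tendsto (wall G) pz h"
 using assms(2) unfolding L1_trace_def by blast
 have "pd i (%x. a *R ph k x + b *R pz k x) = (%x. a *R pd i (ph k) x + b *R pd i (pz k) x)" for i k
 using ph(1)[of k] pz(1)[of k] by (intro ext pd_linear) (auto simp: smooth_per_def intro: smooth_on_differentiable0)
 moreover have "smooth_per G (%x. a *R ph k x + b *R pz k x)" for k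
 using ph(1)[of k] pz(1)[of k] by (simp add: smooth_per_def smooth_on_linear periodic_def)
 ultimately show ?thesis unfolding L1_trace_def
 by (intro exI[of _ "%k x. a *R ph k x + b *R pz k x"]) (simp add: L1_tendsto_linear ph pz)
qed

lemma L1_trace_AE_cong:
 assumes t: "L1_trace u D g" and v: "v : borel_measurable (bulk G)" "AE x in bulk G. u x = v x"
 and E: "!!i. E i : borel_measurable (bulk G)" "!!i. AE x in bulk G. D i x = E i x"
 shows "L1_trace v E g"
proof -
 obtain ph where "!!k. smooth_per G (ph k)" "L1_tendsto (bulk G) ph u" "!!i. L1_tendsto (bulk G) (%k. pd i (ph k)) (D i)" "L1_tendsto (wall G) ph g"
 using t unfolding L1_trace_def by blast
 thus ?thesis unfolding L1_trace_def
 by (intro exI[of _ ph]) (auto intro: L1_tendsto_AE_cong[OF _ v] L1_tendsto_AE_cong[OF _ E])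
qed

text \<open>Uniqueness of traces. Each component of the approximants tends to zero together with its
  gradient, so \<open>trace_null\<close> applies along a subsequence converging almost everywhere on
  the wall.\<close>

lemma L1_trace_zero:
 assumes "L1_trace (%_. 0) (%_ _. 0) g"
 shows "AE x in wall G. g x = 0"
proof -
 obtain ph where ph: "!!k. smooth_per G (ph k)" "L1_tendsto (bulk G) ph (%_. 0)" "!!i. L1_tendsto (bulk G) (%k. pd i (ph k)) (%_. 0)" "L1_tendsto (wall G) ph g"
 using assms unfolding L1_trace_def by blast
 have "AE x in wall G. g x $ a = 0" for a
 proof -
 obtain s where s: "strict_mono s" "AE x in wall G. (%k. ph (s k) x $ a) ----> g x $ a"
 by (rule L1_tendsto_AE_subseq[OF L1_tendsto_component[OF ph(4), of a]], rule that)
 have df: "ph k differentiable (at x)" for k x using ph(1)[of k] by (auto simp: smooth_per_def intro: smooth_on_differentiable0)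
 show ?thesis
 proof (rule trace_null[OF _ _ _ s(2)])
 show "smooth_per G (%x. ph (s k) x $ a)" for k using ph(1)[of "s k"] by (simp add: smooth_per_def periodic_def smooth_on_component)
 show "(%k. NI (%y. iD y * ennreal \<bar>ph (s k) y $ a\<bar>)) ----> 0"
 using L1_tendsto_subseq[OF L1_tendsto_component[OF ph(2), of a] s(1)] by (simp add: L1_tendsto_def nn_integral_bulk)
 have g: "ennreal (gsum (%x. ph (s k) x $ a) y) = (\<Sum>i\<in>UNIV. ennreal \<bar>pd i (ph (s k)) y $ a\<bar>)" for k y
 unfolding gsum_def by (simp add: pd_component[OF df])
 have m: "(%y. iD y * ennreal \<bar>pd i (ph (s k)) y $ a\<bar>) : borel_measurable lborel" for i k
 proof -
 have "smooth_on UNIV (ph (s k))" using ph(1) by (simp add: smooth_per_def)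
 hence [measurable]: "pd i (ph (s k)) : borel_measurable borel"
 by (intro bm_contI smooth_on_continuous0 smooth_on_pd)
 hence [measurable]: "(%y. pd i (ph (s k)) y $ a) : borel_measurable borel"
 by (rule measurable_compose[OF _ bm_contI[OF continuous_on_component[OF continuous_on_id]]])
 show ?thesis by measurable
 qed
 have "(%k. \<Sum>i\<in>UNIV. NI (%y. iD y * ennreal \<bar>pd i (ph (s k)) y $ a\<bar>)) ----> (\<Sum>i\<in>(UNIV::'d set). 0)"
 proof (rule tendsto_sum)
 show "(%k. NI (%y. iD y * ennreal \<bar>pd i (ph (s k)) y $ a\<bar>)) ----> 0" for i
 using L1_tendsto_subseq[OF L1_tendsto_component[OF ph(3)[of i], of a] s(1)] by (simp add: L1_tendsto_def nn_integral_bulk)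
 qed
 moreover have "(\<Sum>i\<in>UNIV. NI (%y. iD y * ennreal \<bar>pd i (ph (s k)) y $ a\<bar>)) = (NI (%y. iD y * ennreal (gsum (%x. ph (s k) x $ a) y)))" for k
 unfolding g sum_distrib_left by (rule nn_integral_sum[symmetric]) (rule m)
 ultimately show "(%k. NI (%y. iD y * ennreal (gsum (%x. ph (s k) x $ a) y))) ----> 0" by simp
 qed
 qed
 hence "AE x in wall G. ALL a:UNIV. g x $ a = 0" by (intro AE_finite_allI) auto
 thus ?thesis by (rule eventually_mono) (simp add: vec_eq_iff)
qed

lemma borel_representative:
 fixes u :: "real^'d => real"
 assumes "u : borel_measurable (bulk G)"
 obtains u' where "u' : borel_measurable borel" "AE x in lebesgue. x : dom G --> u x = u' x"
proof -
 have "(%x. if x : dom G then u x else 0) : borel_measurable lebesgue"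
 using assms open_dom by (simp add: borel_measurable_if)
 then obtain u' where u': "u' : borel_measurable lborel" "AE x in lborel. (if x : dom G then u x else 0) = u' x"
 using completion_ex_borel_measurable_real by blast
 from AE_completion[OF u'(2)] have "AE x in lebesgue. x : dom G --> u x = u' x" by (rule eventually_mono) auto
 thus ?thesis using u'(1) by (intro that) auto
qed

text \<open>\<open>integral_zero_trace\<close> lives on Borel functions, so \<open>u\<close> and
  \<open>D\<close> are exchanged for Borel representatives; a subsequence provides the pointwise
  convergence on the wall.\<close>

lemma L1_trace_integral:
 assumes t: "L1_trace u D g" and g0: "AE x in wall G. g x = 0" and int: "!!i. integrable (bulk G) (D i)"
 shows "(LINT x|bulk G. D i x $ a) = 0"
proof -
 obtain ph where ph: "!!k. smooth_per G (ph k)" "L1_tendsto (bulk G) ph u" "!!i. L1_tendsto (bulk G) (%k. pd i (ph k)) (D i)" "L1_tendsto (wall G) ph g"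
 using t unfolding L1_trace_def by blast
 have df: "ph k differentiable (at x)" for k x using ph(1)[of k] by (auto simp: smooth_per_def intro: smooth_on_differentiable0)
 obtain s where s: "strict_mono s" "AE x in wall G. (%k. ph (s k) x $ a) ----> g x $ a"
 by (rule L1_tendsto_AE_subseq[OF L1_tendsto_component[OF ph(4), of a]], rule that)
 have "(%x. u x $ a) : borel_measurable (bulk G)" using L1_tendsto_component[OF ph(2), of a] by (simp add: L1_tendsto_def)
 then obtain v where v: "v : borel_measurable borel" "AE x in lebesgue. x : dom G --> u x $ a = v x" by (rule borel_representative)
 have "EX w. w : borel_measurable borel & (AE x in lebesgue. x : dom G --> D i x $ a = w x)" for i
 proof -
 have "(%x. D i x $ a) : borel_measurable (bulk G)" using L1_tendsto_component[OF ph(3), of i a] by (simp add: L1_tendsto_def)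
 then obtain w where "w : borel_measurable borel" "AE x in lebesgue. x : dom G --> D i x $ a = w x" by (rule borel_representative)
 thus ?thesis by blast
 qed
 hence "ALL i. EX w. w : borel_measurable borel & (AE x in lebesgue. x : dom G --> D i x $ a = w x)" by (rule allI)
 from choice[OF this] obtain w where w0: "ALL i. w i : borel_measurable borel & (AE x in lebesgue. x : dom G --> D i x $ a = w i x)" by (rule exE)
 have w: "!!i. w i : borel_measurable borel" "!!i. AE x in lebesgue. x : dom G --> D i x $ a = w i x"
 by (rule conjunct1[OF spec[OF w0]], rule conjunct2[OF spec[OF w0]])
 have v': "AE x in bulk G. u x $ a = v x" and w': "!!i. AE x in bulk G. D i x $ a = w i x"
 using v(2) w(2) open_dom by (simp_all add: AE_restrict_space_iff)
 have meas: "f : borel_measurable (bulk G)" if "f : borel_measurable borel" for f :: "real^'d => real"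
 using that by (intro measurable_restrict_space1 measurable_completion) simp
 have mD: "(%x. D i x $ a) : borel_measurable (bulk G)" for i
 using L1_tendsto_component[OF ph(3)[of i], of a] by (simp add: L1_tendsto_def)
 have lint: "(LINT x|bulk G. w i x) = (LINT x|lborel. iD x * w i x)"
 using open_dom w(1)[of i] by (simp add: integral_restrict_space integral_completion)
 have iw: "integrable lborel (%x. iD x * w i x)" for i
 proof -
 have "integrable (bulk G) (%x. D i x $ a)" by (rule integrable_vec_nth[OF int])
 hence "integrable (bulk G) (w i)"
 using integrable_cong_AE[OF mD meas[OF w(1)] w'] by blast
 thus ?thesis using open_dom w(1)[of i] by (simp add: integrable_restrict_space integrable_completion)
 qed
 have "(LINT x|lborel. iD x * w i x) = 0"
 proof (rule integral_zero_trace[where f="%k x. ph (s k) x $ a" and v=v, OF _ v(1) w(1) iw])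
 show "smooth_per G (%x. ph (s k) x $ a)" for k using ph(1)[of "s k"] by (simp add: smooth_per_def periodic_def smooth_on_component)
 have "L1_tendsto (bulk G) (%k x. ph (s k) x $ a) v"
 by (rule L1_tendsto_AE_cong[OF L1_tendsto_subseq[OF L1_tendsto_component[OF ph(2)] s(1)] meas[OF v(1)] v'])
 thus "(%k. NI (%y. iD y * ennreal \<bar>ph (s k) y $ a - v y\<bar>)) ----> 0"
 by (simp add: L1_tendsto_def nn_integral_bulk)
 have "L1_tendsto (bulk G) (%k x. pd i (ph (s k)) x $ a) (w i)" for i
 by (rule L1_tendsto_AE_cong[OF L1_tendsto_subseq[OF L1_tendsto_component[OF ph(3)] s(1)] meas[OF w(1)] w'])
 thus "(%k. NI (%y. iD y * ennreal \<bar>pd i (%x. ph (s k) x $ a) y - w i y\<bar>)) ----> 0" for i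
 by (simp add: L1_tendsto_def nn_integral_bulk pd_component[OF df])
 show "AE y in wall G. (%k. ph (s k) y $ a) ----> 0"
 using s(2) g0 by eventually_elim simp
 qed
 hence "(LINT x|bulk G. w i x) = 0" by (simp add: lint)
 moreover have "(LINT x|bulk G. D i x $ a) = (LINT x|bulk G. w i x)"
 by (rule integral_cong_AE[OF mD meas[OF w(1)] w'])
 ultimately show ?thesis by simp
qed

lemma L2_continuous_wall:
 fixes f :: "real^'d => real^'d"
 assumes "continuous_on UNIV f"
 shows "l2_fun (wall G) f"
proof -
 have "bounded (f ` Sig G)" by (intro compact_imp_bounded compact_continuous_image continuous_on_subset[OF assms] compact_Sig subset_UNIV)
 then obtain B where B: "!!x. x : Sig G ==> norm (f x) <= B" by (auto simp: bounded_iff)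
 interpret finite_measure "wall G" by (rule finite_wall)
 have "integrable (wall G) (%x. (norm (f x))^2)"
 by (rule integrable_const_bound[where B="B^2"]) (use B continuous_wall[OF assms] in \<open>auto intro!: AE_I2 power_mono\<close>)
 thus ?thesis using continuous_wall[OF assms] by (simp add: l2_fun_def)
qed

text \<open>The weak derivatives of \<open>ph k x - u x\<close> are \<open>pds is (ph k)\<close>
  minus those of \<open>u\<close>, and the Sobolev norm dominates the \<open>L^2\<close> norm of
  each of them.\<close>

lemma L1_trace_is_trace:
 fixes u :: "real^'d => real^'d"
 assumes u: "!!is. length is <= 1 ==> has_weak_deriv (dom G) is u (wd is u)" and um: "u : borel_measurable (bulk G)" and t: "is_trace G u g"
 shows "L1_trace u (%i. wd [i] u) g"
proof -
 obtain ph where g: "l2_fun (wall G) g" and ph: "!!k. smooth_per G (ph k)" "(%k::nat. sob_norm 1 2 (dom G) (%x. ph k x - u x)) ----> 0"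
 "(%k. l2_norm (wall G) (%x. ph k x - g x)) ----> 0"
 using t unfolding is_trace_def by blast
 have fs: "smooth_on UNIV (ph k)" for k using ph(1) by (simp add: smooth_per_def)
 have fc: "continuous_on UNIV (ph k)" "continuous_on UNIV (pd i (ph k))" for k i
 using fs by (auto intro: smooth_on_continuous0 smooth_on_pd)
 have bulk1: "L1_tendsto (bulk G) (%k. pds is (ph k)) (wd is u)" if l: "length is <= 1" for "is" :: "'d list"
 proof -
 interpret finite_measure "bulk G" by (rule finite_bulk)
 have pc: "continuous_on UNIV (pds is (ph k))" for k by (intro smooth_on_continuous0 smooth_on_pds fs)
 have wm: "wd is u : borel_measurable (bulk G)"
 by (rule loc_integrable_measurable[OF open_dom has_weak_derivD(2)[OF u[OF l]]])
 show ?thesis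
 proof (rule L1_tendsto_of_L2[OF continuous_bulk[OF pc] wm])
 have hw: "has_weak_deriv (dom G) is (%x. 1 *R ph k x + (-1) *R u x) (%x. 1 *R pds is (ph k) x + (-1) *R wd is u x)" for k
 proof (rule has_weak_deriv_linear[OF open_dom _ u[OF l]])
 show "has_weak_deriv (dom G) is (ph k) (pds is (ph k))"
 proof (cases "is")
 case Nil
 thus ?thesis using has_weak_deriv_Nil[OF loc_integrable_continuous[OF continuous_on_subset[OF fc(1) subset_UNIV]]] by simp
 next
 case (Cons i js)
 thus ?thesis using l smooth_has_weak_deriv[OF open_dom fs, of i k] by simp
 qed
 qed
 have e: "(\<integral>\<^sup>+x. ennreal ((norm (pds is (ph k) x - wd is u x))^2) \<partial>bulk G) <= (sob_norm 1 2 (dom G) (%x. ph k x - u x))^2" for k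
 proof (cases "sob_norm 1 2 (dom G) (%x. ph k x - u x) = \<infinity>")
 \<comment> \<open>Convergence does not prevent finitely many of these norms from being infinite;
   the bound is then trivial.\<close>
 case True
 thus ?thesis by (simp add: power2_eq_square ennreal_top_mult)
 next
 case False
 let ?d = "%x. ph k x - u x"
 have fin: "finite {is :: 'd list. length is <= 1}" using finite_lists_length_le[of "UNIV :: 'd set" 1] by simp
 have "sob_norm 1 2 (dom G) ?d = (\<Sum>is\<in>{is. length is <= 1}. Lp_norm 2 (bulk G) (wd is ?d))"
 using False by (auto simp: sob_norm_def split: if_splits)
 hence le: "Lp_norm 2 (bulk G) (wd is ?d) <= sob_norm 1 2 (dom G) ?d"
 using l fin by (auto intro!: member_le_sum)
 have w: "has_weak_deriv (dom G) is ?d (%x. pds is (ph k) x - wd is u x)" using hw[of k] by simp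
 have m: "wd is ?d : borel_measurable (bulk G)"
 by (rule loc_integrable_measurable[OF open_dom has_weak_derivD(2)[OF weak_derivI[OF w]]])
 have "(\<integral>\<^sup>+x. ennreal ((norm (pds is (ph k) x - wd is u x))^2) \<partial>bulk G) = (\<integral>\<^sup>+x. ennreal ((norm (wd is ?d x))^2) \<partial>bulk G)"
 using weak_deriv_AE_eq[OF open_dom w] by (intro nn_integral_cong_AE) (auto elim: eventually_mono)
 also have "... = (Lp_norm 2 (bulk G) (wd is ?d))^2" by (simp only: Lp_norm_2[OF m] ennpowr_half)
 also have "... <= (sob_norm 1 2 (dom G) ?d)^2" unfolding power2_eq_square by (intro mult_mono le) auto
 finally show ?thesis .
 qed
 have "(%k. (sob_norm 1 2 (dom G) (%x. ph k x - u x))^2) ----> 0 * 0"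
 unfolding power2_eq_square by (rule tendsto_mult_ennreal[OF ph(2) ph(2)]) simp
 hence z: "(%k. (sob_norm 1 2 (dom G) (%x. ph k x - u x))^2) ----> 0" by simp
 show "(%k. \<integral>\<^sup>+x. ennreal ((norm (pds is (ph k) x - wd is u x))^2) \<partial>bulk G) ----> 0"
 by (rule tendsto_zero_mono[OF e z])
 qed
 qed
 have b0: "L1_tendsto (bulk G) ph u"
 proof (rule L1_tendsto_AE_cong[OF _ um])
 show "L1_tendsto (bulk G) ph (wd [] u)" using bulk1[of "[]"] by simp
 show "AE x in bulk G. wd [] u x = u x"
 by (rule weak_deriv_AE_eq[OF open_dom has_weak_deriv_Nil[OF has_weak_derivD(1)[OF u[of "[]"]]]]) simp
 qed
 have b1: "L1_tendsto (bulk G) (%k. pd i (ph k)) (wd [i] u)" for i using bulk1[of "[i]"] by simp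
 have "L1_tendsto (wall G) ph g"
 proof -
 interpret finite_measure "wall G" by (rule finite_wall)
 have gm: "g : borel_measurable (wall G)" using g by (simp add: l2_fun_def)
 show ?thesis
 proof (rule L1_tendsto_of_L2[OF continuous_wall[OF fc(1)] gm])
 have e: "(\<integral>\<^sup>+x. ennreal ((norm (ph k x - g x))^2) \<partial>wall G) = ennreal ((l2_norm (wall G) (%x. ph k x - g x))^2)" for k
 proof -
 have [measurable]: "ph k : borel_measurable (wall G)" "g : borel_measurable (wall G)" using continuous_wall[OF fc(1)] gm by auto
 have "integrable (wall G) (%x. 2 * (norm (ph k x))^2 + 2 * (norm (g x))^2)"
 using g L2_continuous_wall[OF fc(1), of k] by (auto simp: l2_fun_def)
 hence i: "integrable (wall G) (%x. (norm (ph k x - g x))^2)"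
 proof (rule Bochner_Integration.integrable_bound)
 have "(norm (a - b))^2 <= 2 * (norm a)^2 + 2 * (norm b)^2" for a b :: "real^'d"
 proof -
 have "(norm (a - b))^2 <= (norm a + norm b)^2" by (intro power_mono norm_triangle_ineq4) simp
 also have "... <= 2 * (norm a)^2 + 2 * (norm b)^2" using zero_le_power2[of "norm a - norm b"] by (simp add: power2_eq_square algebra_simps)
 finally show ?thesis .
 qed
 thus "AE x in wall G. norm ((norm (ph k x - g x))^2) <= norm (2 * (norm (ph k x))^2 + 2 * (norm (g x))^2)"
 by (intro AE_I2) simp
 qed measurable
 have "(\<integral>\<^sup>+x. ennreal ((norm (ph k x - g x))^2) \<partial>wall G) = ennreal (LINT x|wall G. (norm (ph k x - g x))^2)"
 by (rule nn_integral_eq_integral[OF i]) simp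
 also have "(LINT x|wall G. (norm (ph k x - g x))^2) = (l2_norm (wall G) (%x. ph k x - g x))^2"
 proof -
 have n: "0 <= (LINT x|wall G. (norm (ph k x - g x))^2)" by (intro Bochner_Integration.integral_nonneg) simp
 thus ?thesis by (simp add: l2_norm_def l2_inner_def power2_norm_eq_inner)
 qed
 finally show ?thesis .
 qed
 have "(%k. ennreal ((l2_norm (wall G) (%x. ph k x - g x))^2)) ----> ennreal (0^2)"
 by (intro tendsto_ennrealI tendsto_power ph(3))
 thus "(%k. \<integral>\<^sup>+x. ennreal ((norm (ph k x - g x))^2) \<partial>wall G) ----> 0" by (simp add: e)
 qed
 qed
 with b0 b1 ph(1) show ?thesis unfolding L1_trace_def by blast
qed

end

section \<open>Traces of discrete velocities\<close>

context fe_setting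
begin

lemma tr_is_trace: "v : XF V ==> is_trace G v (tr G v)"
 unfolding tr_def using trace_ex by (metis someI_ex)

lemma tr_l2: "v : XF V ==> l2_fun (wall G) (tr G v)"
 using tr_is_trace by (auto simp: is_trace_def)

lemma XF_measurable: "v : XF V ==> v : borel_measurable (bulk G)"
 using loc_integrable_measurable[OF open_dom has_weak_derivD(1)[OF XF_weak(1)[of v "[]"]]] by simp

lemma XF_L1_trace: "v : XF V ==> is_trace G v g ==> L1_trace v (%i. wd [i] v) g"
 by (rule L1_trace_is_trace[OF XF_weak(1) XF_measurable])

lemma trace_unique:
 fixes g g' :: "real^'d => real^'d"
 assumes u: "u : XF V" and v: "v : XF V" and e: "AE x in bulk G. u x = v x" and g: "is_trace G u g" and h: "is_trace G v g'"
 shows "AE x in wall G. g x = g' x"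
proof -
 have "L1_trace (%x. 1 *R u x + (-1) *R v x) (%i x. 1 *R wd [i] u x + (-1) *R wd [i] v x) (%x. 1 *R g x + (-1) *R g' x)"
 by (intro L1_trace_linear XF_L1_trace u v g h)
 hence "L1_trace (%_. 0) (%_ _. 0) (%x. 1 *R g x + (-1) *R g' x)"
 proof (rule L1_trace_AE_cong)
 show "AE x in bulk G. 1 *R u x + (-1) *R v x = 0" using e by (rule eventually_mono) simp
 show "AE x in bulk G. 1 *R wd [i] u x + (-1) *R wd [i] v x = 0" for i
 by (simp add: weak_deriv_AE_cong[OF open_dom e])
 qed simp_all
 from L1_trace_zero[OF this] show ?thesis by (rule eventually_mono) simp
qed

text \<open>\<open>tr\<close> picks a trace of each function separately, so additivity is not built
  in. The difference of the two sides is a trace of zero.\<close>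

lemma tr_linear:
 assumes u: "u : XF V" and v: "v : XF V"
 shows "AE x in wall G. tr G (%x. a *R u x + b *R v x) x = a *R tr G u x + b *R tr G v x"
proof -
 let ?w = "%x. a *R u x + b *R v x"
 have w: "?w : XF V" by (rule XF_linear[OF u v])
 have "L1_trace (%x. 1 *R ?w x + (-1) *R (a *R u x + b *R v x))
 (%i x. 1 *R wd [i] ?w x + (-1) *R (a *R wd [i] u x + b *R wd [i] v x))
 (%x. 1 *R tr G ?w x + (-1) *R (a *R tr G u x + b *R tr G v x))"
 by (intro L1_trace_linear XF_L1_trace tr_is_trace u v w)
 hence "L1_trace (%_. 0) (%_ _. 0) (%x. 1 *R tr G ?w x + (-1) *R (a *R tr G u x + b *R tr G v x))"
 proof (rule L1_trace_AE_cong)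
 show "AE x in bulk G. 1 *R wd [i] ?w x + (-1) *R (a *R wd [i] u x + b *R wd [i] v x) = 0" for i
 proof -
 have "length [i] <= 1" by simp
 from weak_linear[OF u v this, of a b] show ?thesis by (rule eventually_mono) simp
 qed
 qed simp_all
 from L1_trace_zero[OF this] show ?thesis by (rule eventually_mono) (simp only: scaleR_one scaleR_minus1_left add_uminus_conv_diff right_minus_eq)
qed

lemma tr_cong: "u : XF V ==> v : XF V ==> AE x in bulk G. u x = v x ==> AE x in wall G. tr G u x = tr G v x"
 by (rule trace_unique) (auto intro: tr_is_trace)

lemma dvg_weak: "dvg G v = (%x. \<Sum>i\<in>UNIV. wd [i] v x $ i)"
 by (simp add: dvg_def grad_def fun_eq_iff)

text \<open>The diagonal entries of the gradient integrate to zero one by one. Hence constants are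
  orthogonal to these divergences, and the inf-sup condition can be applied to a pressure minus its
  mean.\<close>

lemma integral_dvg_zero:
 assumes v: "v : X0F G V"
 shows "(LINT x|bulk G. dvg G v x) = 0"
proof -
 interpret finite_measure "bulk G" by (rule finite_bulk)
 have vX: "v : XF V" and v0: "AE x in wall G. tr G v x = 0" using v by (auto simp: X0F_def)
 have int: "integrable (bulk G) (wd [i] v)" for i
 proof -
 have "l2_fun (bulk G) (wd [i] v)" by (rule XF_weak(2)[OF vX]) simp
 hence w: "wd [i] v : borel_measurable (bulk G)" "integrable (bulk G) (%x. (norm (wd [i] v x))^2)"
 by (auto simp: l2_fun_def)
 have "integrable (bulk G) (%x. 1 + (norm (wd [i] v x))^2)" using w(2) by simp
 thus ?thesis
 proof (rule Bochner_Integration.integrable_bound[OF _ w(1)])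
 have "a <= 1 + a^2" for a :: real using zero_le_power2[of "a - 1/2"] by (simp add: power2_eq_square algebra_simps)
 thus "AE x in bulk G. norm (wd [i] v x) <= norm (1 + (norm (wd [i] v x))^2)"
 by (intro always_eventually allI) (simp add: abs_of_nonneg)
 qed
 qed
 have "(LINT x|bulk G. dvg G v x) = (\<Sum>i\<in>UNIV. LINT x|bulk G. wd [i] v x $ i)"
 unfolding dvg_weak by (intro Bochner_Integration.integral_sum integrable_vec_nth int)
 also have "... = 0"
 using L1_trace_integral[OF XF_L1_trace[OF vX tr_is_trace[OF vX]] v0 int] by simp
 finally show ?thesis .
qed

end

section \<open>Linear systems up to null sets\<close>

lemma l2_fun_linear:
 assumes "l2_fun M f" "l2_fun M g"
 shows "l2_fun M (%x. a *R f x + b *R g x)"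
proof -
 have [measurable]: "f : borel_measurable M" "g : borel_measurable M" using assms by (auto simp: l2_fun_def)
 have "integrable M (%x. 2 * a^2 * (norm (f x))^2 + 2 * b^2 * (norm (g x))^2)" using assms by (auto simp: l2_fun_def)
 hence "integrable M (%x. (norm (a *R f x + b *R g x))^2)"
 proof (rule Bochner_Integration.integrable_bound)
 have "(norm (a *R u + b *R v))^2 <= 2 * a^2 * (norm u)^2 + 2 * b^2 * (norm v)^2" for u v :: 'b
 proof -
 have "(norm (a *R u + b *R v))^2 <= (\<bar>a\<bar> * norm u + \<bar>b\<bar> * norm v)^2"
 using norm_triangle_ineq[of "a *R u" "b *R v"] by (intro power_mono) auto
 also have "... <= 2 * (\<bar>a\<bar> * norm u)^2 + 2 * (\<bar>b\<bar> * norm v)^2"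
 using zero_le_power2[of "\<bar>a\<bar> * norm u - \<bar>b\<bar> * norm v"] by (simp add: power2_sum power2_diff)
 finally show ?thesis by (simp add: power_mult_distrib mult.assoc)
 qed
 thus "AE x in M. norm ((norm (a *R f x + b *R g x))^2) <= norm (2 * a^2 * (norm (f x))^2 + 2 * b^2 * (norm (g x))^2)"
 by (intro always_eventually allI) simp
 qed measurable
 thus ?thesis by (simp add: l2_fun_def)
qed

lemma l2_fun_zero: "l2_fun M (%_. 0)"
 by (simp add: l2_fun_def)

lemma l2_integrable:
 assumes "l2_fun M f" "l2_fun M g"
 shows "integrable M (%x. f x \<bullet> g x)"
proof -
 have [measurable]: "f : borel_measurable M" "g : borel_measurable M" using assms by (auto simp: l2_fun_def)
 have "integrable M (%x. (norm (f x))^2 + (norm (g x))^2)" using assms by (auto simp: l2_fun_def)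
 thus ?thesis
 proof (rule Bochner_Integration.integrable_bound)
 have "\<bar>u \<bullet> v\<bar> <= (norm u)^2 + (norm v)^2" for u v :: 'b
 proof -
 have "\<bar>u \<bullet> v\<bar> <= norm u * norm v" by (rule Cauchy_Schwarz_ineq2)
 also have "2 * (norm u * norm v) <= (norm u)^2 + (norm v)^2" using sum_squares_bound[of "norm u" "norm v"] by (simp add: mult.assoc)
 hence "norm u * norm v <= (norm u)^2 + (norm v)^2" using mult_nonneg_nonneg[OF norm_ge_zero[of u] norm_ge_zero[of v]] by linarith
 finally show ?thesis .
 qed
 thus "AE x in M. norm (f x \<bullet> g x) <= norm ((norm (f x))^2 + (norm (g x))^2)" by (intro always_eventually allI) simp
 qed measurable
qed

lemma l2_inner_commute: "l2_inner M f g = l2_inner M g f"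
 by (simp add: l2_inner_def inner_commute)

lemma l2_inner_linear:
 assumes "l2_fun M f" "l2_fun M g" "l2_fun M h"
 shows "l2_inner M (%x. a *R f x + b *R g x) h = a * l2_inner M f h + b * l2_inner M g h"
 using l2_integrable[OF assms(1,3)] l2_integrable[OF assms(2,3)] by (simp add: l2_inner_def inner_add_left)

lemma l2_inner_linear_right:
 assumes "l2_fun M f" "l2_fun M g" "l2_fun M h"
 shows "l2_inner M h (%x. a *R f x + b *R g x) = a * l2_inner M h f + b * l2_inner M h g"
 using l2_inner_linear[OF assms] by (simp add: l2_inner_commute)

lemma l2_inner_cong_AE:
 assumes "l2_fun M f" "l2_fun M f'" "l2_fun M g" "l2_fun M g'" "AE x in M. f x = f' x" "AE x in M. g x = g' x"
 shows "l2_inner M f g = l2_inner M f' g'"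
proof -
 have "AE x in M. f x \<bullet> g x = f' x \<bullet> g' x" using assms(5,6) by eventually_elim simp
 thus ?thesis unfolding l2_inner_def
 using l2_integrable[OF assms(1,3)] l2_integrable[OF assms(2,4)] by (intro integral_cong_AE) auto
qed

lemma l2_inner_nonneg: "0 <= l2_inner M f f"
 by (simp add: l2_inner_def Bochner_Integration.integral_nonneg)

lemma l2_norm_power2: "(l2_norm M f)^2 = l2_inner M f f"
 by (simp add: l2_norm_def l2_inner_nonneg)

lemma l2_inner_eq_0:
 assumes "l2_fun M f" "l2_inner M f f = 0"
 shows "AE x in M. f x = 0"
proof -
 have "AE x in M. f x \<bullet> f x = 0"
 using assms(2) integral_nonneg_eq_0_iff_AE[OF l2_integrable[OF assms(1,1)]] by (simp add: l2_inner_def)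
 thus ?thesis by (rule eventually_mono) simp
qed

lemma l2_inner_square:
 assumes "l2_fun M f" "l2_fun M g"
 shows "l2_inner M (%x. a *R f x + b *R g x) (%x. a *R f x + b *R g x) = a^2 * l2_inner M f f + 2 * a * b * l2_inner M f g + b^2 * l2_inner M g g"
 by (simp add: l2_inner_linear l2_inner_linear_right l2_fun_linear assms l2_inner_commute[of M g f] power2_eq_square algebra_simps)

lemma l2_inner_diff_square:
 assumes "l2_fun M f" "l2_fun M g"
 shows "l2_inner M (%x. f x - g x) (%x. f x - g x) = l2_inner M f f - 2 * l2_inner M f g + l2_inner M g g"
 using l2_inner_square[OF assms, of 1 "-1"] by simp

text \<open>Gaussian elimination: an equation \<open>w0\<close> with a nonzero coefficient expresses
  the unknown \<open>j0\<close> through the others, and \<open>a'\<close> is the reduced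
  system.\<close>

lemma homogeneous_solution:
 fixes a :: "'j => 'k => real"
 assumes "finite W"
 shows "finite J ==> card W < card J ==> EX c. (EX j:J. c j ~= 0) & (ALL w:W. (\<Sum>j\<in>J. c j * a j w) = 0)"
 using assms
proof (induction W arbitrary: J a rule: finite_induct)
 case empty
 hence "J ~= {}" by auto
 thus ?case by (intro exI[of _ "%_. 1"]) auto
next
 case (insert w0 W)
 show ?case
 proof (cases "ALL j:J. a j w0 = 0")
 case True
 have "card W < card J" using insert by simp
 from insert.IH[OF insert.prems(1) this, of a] obtain c where c: "EX j:J. c j ~= 0" "ALL w:W. (\<Sum>j\<in>J. c j * a j w) = 0" by (elim exE conjE)
 thus ?thesis using True by (intro exI[of _ c]) simp
 next
 case False
 then obtain j0 where j0: "j0 : J" "a j0 w0 ~= 0" by blast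
 define J' where "J' = J - {j0}"
 have J': "finite J'" "card W < card J'" "J = insert j0 J'" "j0 ~: J'"
 using insert j0(1) by (auto simp: J'_def card_Diff_singleton)
 define a' where "a' j w = a j w - (a j w0 / a j0 w0) * a j0 w" for j w
 from insert.IH[OF J'(1,2), of a'] obtain c where c: "EX j:J'. c j ~= 0" "ALL w:W. (\<Sum>j\<in>J'. c j * a' j w) = 0" by (elim exE conjE)
 define d where "d j = (if j = j0 then - (\<Sum>j\<in>J'. c j * a j w0) / a j0 w0 else c j)" for j
 have sd: "(\<Sum>j\<in>J. d j * a j w) = - (\<Sum>j\<in>J'. c j * a j w0) / a j0 w0 * a j0 w + (\<Sum>j\<in>J'. c j * a j w)" for w
 proof -
 have "(\<Sum>j\<in>J'. d j * a j w) = (\<Sum>j\<in>J'. c j * a j w)" using J'(4) by (intro sum.cong) (auto simp: d_def)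
 thus ?thesis unfolding J'(3) using J'(1,4) by (simp add: d_def)
 qed
 have "(\<Sum>j\<in>J. d j * a j w) = (\<Sum>j\<in>J'. c j * a' j w)" for w
 unfolding sd a'_def by (simp add: right_diff_distrib sum_subtractf sum_distrib_right sum_divide_distrib mult.assoc)
 moreover have "(\<Sum>j\<in>J. d j * a j w0) = 0" unfolding sd using j0(2) by simp
 moreover have "EX j:J. d j ~= 0" using c(1) J'(3,4) by (auto simp: d_def)
 ultimately show ?thesis using c(2) by (intro exI[of _ d]) simp
 qed
qed

text \<open>The right-hand side becomes one more unknown, \<open>None\<close>, with coefficients
  \<open>- l k\<close>. The homogeneous system then has more unknowns than equations. In a
  nontrivial solution the unknown \<open>None\<close> cannot vanish, by injectivity, and dividing by
  it solves the system.\<close>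

lemma square_system_solvable:
 fixes a :: "'j => 'j => real"
 assumes J: "finite J" and inj: "!!c. (ALL k:J. (\<Sum>j\<in>J. c j * a j k) = 0) ==> ALL j:J. c j = 0"
 shows "EX c. ALL k:J. (\<Sum>j\<in>J. c j * a j k) = l k"
proof -
 define a' where "a' j k = (case j of Some i => a i k | None => - l k)" for j k
 let ?J = "insert None (Some ` J)"
 have "card J < card ?J" using J by (simp add: card_image)
 from homogeneous_solution[OF J _ this, of a'] J
 obtain c where c: "EX j:?J. c j ~= 0" "ALL k:J. (\<Sum>j\<in>?J. c j * a' j k) = 0" by auto
 have s: "(\<Sum>j\<in>J. c (Some j) * a j k) = c None * l k" if "k : J" for k
 using c(2)[rule_format, OF that] J by (simp add: a'_def sum.reindex)
 have n: "c None ~= 0"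
 proof
 assume z: "c None = 0"
 hence "ALL k:J. (\<Sum>j\<in>J. c (Some j) * a j k) = 0" using s by simp
 from inj[OF this] have "ALL j:J. c (Some j) = 0" .
 thus False using c(1) z by auto
 qed
 have "(\<Sum>j\<in>J. c (Some j) / c None * a j k) = l k" if "k : J" for k
 using s[OF that] n by (simp add: sum_divide_distrib[symmetric] divide_simps)
 thus ?thesis by (intro exI[of _ "%j. c (Some j) / c None"]) blast
qed

section \<open>Linear functionals and bilinear forms modulo null sets\<close>

definition lin_closed :: "('a => 'b::euclidean_space) set => bool" where
 "lin_closed V \<longleftrightarrow> (%_. 0) : V & (ALL f:V. ALL g:V. ALL a b. (%x. a *R f x + b *R g x) : V)"

text \<open>The second clause makes \<open>l\<close> a functional on classes modulo null functions;
  it does not follow from linearity.\<close>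

definition lin_functional :: "'a measure => ('a => 'b::euclidean_space) set => (('a => 'b) => real) => bool" where
 "lin_functional M V l \<longleftrightarrow> (ALL f:V. ALL g:V. ALL a b. l (%x. a *R f x + b *R g x) = a * l f + b * l g) &
 (ALL f:V. (AE x in M. f x = 0) --> l f = 0)"

definition bilin_form :: "'a measure => ('a => 'b::euclidean_space) set => (('a => 'b) => ('a => 'b) => real) => bool" where
 "bilin_form M V A \<longleftrightarrow> (ALL w:V. lin_functional M V (A w) & lin_functional M V (%f. A f w))"

lemma lin_closedD: "lin_closed V ==> f : V ==> g : V ==> (%x. a *R f x + b *R g x) : V"
 by (simp add: lin_closed_def)

lemma lin_functionalD:
 assumes "lin_functional M V l" "f : V"
 shows "g : V ==> l (%x. a *R f x + b *R g x) = a * l f + b * l g" and "AE x in M. f x = 0 ==> l f = 0"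
 using assms by (simp_all add: lin_functional_def)

lemma lin_functional_add: "lin_functional M V l ==> lin_functional M V m ==> lin_functional M V (%f. l f + m f)"
 unfolding lin_functional_def by (simp add: algebra_simps)

lemma lin_functional_cmult: "lin_functional M V l ==> lin_functional M V (%f. c * l f)"
 unfolding lin_functional_def by (simp add: algebra_simps)

lemma bilin_form_add: "bilin_form M V A ==> bilin_form M V B ==> bilin_form M V (%f g. A f g + B f g)"
 unfolding bilin_form_def by (simp add: lin_functional_add)

lemma bilin_form_cmult: "bilin_form M V A ==> bilin_form M V (%f g. c * A f g)"
 unfolding bilin_form_def by (simp add: lin_functional_cmult)

lemma bilin_form_flip: "bilin_form M V A ==> bilin_form M V (%f g. A g f)"
 unfolding bilin_form_def by blast

lemma lin_functional_diff:
 assumes "lin_functional M V l" "f : V" "g : V"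
 shows "l (%x. f x - g x) = l f - l g"
proof -
 have "l (%x. 1 *R f x + (-1) *R g x) = 1 * l f + (-1) * l g" by (rule lin_functionalD(1)[OF assms])
 thus ?thesis by simp
qed

lemma lin_closed_sum:
 assumes "lin_closed V" "finite J" "!!j. j : J ==> e j : V"
 shows "(%x. \<Sum>j\<in>J. c j *R e j x) : V"
 using assms(2,3)
proof (induction J rule: finite_induct)
 case empty
 thus ?case using assms(1) by (simp add: lin_closed_def)
next
 case (insert j J)
 have s: "(%x. \<Sum>j\<in>J. c j *R e j x) : V" using insert by simp
 have "e j : V" using insert by simp
 hence "(%x. c j *R e j x + 1 *R (\<Sum>j\<in>J. c j *R e j x)) : V" using s by (rule lin_closedD[OF assms(1)])
 thus ?case using insert by simp
qed

lemma lin_functional_sum: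
 assumes V: "lin_closed V" and l: "lin_functional M V l" and J: "finite J" "!!j. j : J ==> e j : V"
 shows "l (%x. \<Sum>j\<in>J. c j *R e j x) = (\<Sum>j\<in>J. c j * l (e j))"
 using J
proof (induction J rule: finite_induct)
 case empty
 thus ?case using l V by (simp add: lin_functional_def lin_closed_def)
next
 case (insert j J)
 have s: "(%x. \<Sum>j\<in>J. c j *R e j x) : V" by (rule lin_closed_sum[OF V insert.hyps(1)]) (use insert in simp)
 have ej: "e j : V" using insert by simp
 have "l (%x. c j *R e j x + 1 *R (\<Sum>j\<in>J. c j *R e j x)) = c j * l (e j) + 1 * l (%x. \<Sum>j\<in>J. c j *R e j x)"
 by (rule lin_functionalD(1)[OF l ej s])
 thus ?case using insert by simp
qed

text \<open>An indexed family rather than a set, since velocity-pressure pairs will be spanned by a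
  family over a sum type.\<close>

definition spans :: "'a measure => ('a => 'b::euclidean_space) set => 'j set => ('j => 'a => 'b) => bool" where
 "spans M V J e \<longleftrightarrow> finite J & (ALL j:J. e j : V) & (ALL f:V. EX c. AE x in M. f x = (\<Sum>j\<in>J. c j *R e j x))"

text \<open>A spanning subfamily of least cardinality is independent: a nontrivial relation would
  allow one member to be discarded.\<close>

lemma spans_basis:
 assumes "spans M V J e"
 obtains I where "spans M V I e" "!!c. AE x in M. (\<Sum>j\<in>I. c j *R e j x) = 0 ==> ALL j:I. c j = 0"
proof -
 define I where "I = (ARG_MIN card I. spans M V I e)"
 have I: "spans M V I e" unfolding I_def by (rule arg_min_natI[of "%I. spans M V I e", OF assms])
 have least: "card I <= card K" if "spans M V K e" for K unfolding I_def by (rule arg_min_nat_le[of "%I. spans M V I e", OF that])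
 have fin: "finite I" using I by (simp add: spans_def)
 show ?thesis
 proof (rule that[OF I])
 fix c assume z: "AE x in M. (\<Sum>j\<in>I. c j *R e j x) = 0"
 show "ALL j:I. c j = 0"
 proof (rule ccontr)
 assume "\<not> (ALL j:I. c j = 0)"
 then obtain k where k: "k : I" "c k ~= 0" by blast
 define K where "K = I - {k}"
 have K: "finite K" "I = insert k K" "k ~: K" using fin k(1) by (auto simp: K_def)
 have "spans M V K e"
 unfolding spans_def
 proof (intro conjI ballI)
 fix f assume "f : V"
 then obtain d where d: "AE x in M. f x = (\<Sum>j\<in>I. d j *R e j x)" using I unfolding spans_def by blast
 have "AE x in M. f x = (\<Sum>j\<in>K. (d j - d k / c k * c j) *R e j x)"
 using d z
 proof eventually_elim
 case (elim x)
 have "f x = (\<Sum>j\<in>I. d j *R e j x) - (d k / c k) *R (\<Sum>j\<in>I. c j *R e j x)" using elim by simp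
 also have "... = (\<Sum>j\<in>I. (d j - d k / c k * c j) *R e j x)"
 by (simp add: scaleR_sum_right sum_subtractf[symmetric] scaleR_diff_left)
 also have "... = (\<Sum>j\<in>K. (d j - d k / c k * c j) *R e j x)" using K k(2) by simp
 finally show ?case .
 qed
 thus "EX c. AE x in M. f x = (\<Sum>j\<in>K. c j *R e j x)" by (rule exI[of _ "%j. d j - d k / c k * c j"])
 qed (use I K in \<open>auto simp: spans_def\<close>)
 from least[OF this] show False using K by simp
 qed
 qed
qed

text \<open>In a basis the problem is a square system, injective because \<open>A\<close> is
  nondegenerate in its first argument; \<open>ext\<close> passes from basis functions to all test
  functions.\<close>

lemma bilin_solve:
 assumes V: "lin_closed V" and J: "spans M V J e" and A: "bilin_form M V A" and l: "lin_functional M V l"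
 and inj: "!!f. f : V ==> ALL w:V. A f w = 0 ==> AE x in M. f x = 0"
 shows "EX f:V. ALL w:V. A f w = l w"
proof -
 obtain I where I: "spans M V I e" and ind: "!!c. AE x in M. (\<Sum>j\<in>I. c j *R e j x) = 0 ==> ALL j:I. c j = 0"
 by (rule spans_basis[OF J], rule that)
 have fin: "finite I" and eV: "!!j. j : I ==> e j : V" using I by (auto simp: spans_def)
 let ?f = "%c x. \<Sum>j\<in>I. c j *R e j x"
 have fV: "?f c : V" for c by (rule lin_closed_sum[OF V fin eV])
 \<comment> \<open>A functional that vanishes on a spanning family vanishes everywhere, precisely
   because it ignores the null function by which \<open>w\<close> differs from its
   expansion.\<close>
 have ext: "m w = 0" if w: "w : V" and m: "lin_functional M V m" and z: "ALL k:I. m (e k) = 0" for w m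
 proof -
 obtain d where d: "AE x in M. w x = ?f d x" using w I unfolding spans_def by blast
 have "(%x. 1 *R w x + (-1) *R ?f d x) : V" by (rule lin_closedD[OF V w fV[of d]])
 moreover have "AE x in M. 1 *R w x + (-1) *R ?f d x = 0" using d by (rule eventually_mono) simp
 ultimately have "m (%x. 1 *R w x + (-1) *R ?f d x) = 0" by (rule lin_functionalD(2)[OF m])
 hence "m (%x. w x - ?f d x) = 0" by simp
 hence "m w = m (?f d)" using lin_functional_diff[OF m w fV[of d]] by simp
 also have "... = 0" using lin_functional_sum[OF V m fin, of e d] eV z by simp
 finally show ?thesis .
 qed
 have Af: "A (?f c) w = (\<Sum>j\<in>I. c j * A (e j) w)" if "w : V" for c w
 proof -
 have "lin_functional M V (%f. A f w)" using A that unfolding bilin_form_def by blast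
 from lin_functional_sum[OF V this fin eV] show ?thesis by simp
 qed
 have "EX c. ALL k:I. (\<Sum>j\<in>I. c j * A (e j) (e k)) = l (e k)"
 proof (rule square_system_solvable[OF fin])
 fix c assume z: "ALL k:I. (\<Sum>j\<in>I. c j * A (e j) (e k)) = 0"
 have "ALL k:I. A (?f c) (e k) = 0" using z Af eV by simp
 moreover have "lin_functional M V (A (?f c))" using A fV unfolding bilin_form_def by blast
 ultimately have "ALL w:V. A (?f c) w = 0" using ext by blast
 from ind[OF inj[OF fV this]] show "ALL j:I. c j = 0" .
 qed
 then obtain c where c: "ALL k:I. (\<Sum>j\<in>I. c j * A (e j) (e k)) = l (e k)" by blast
 show ?thesis
 proof (intro bexI[of _ "?f c"] ballI fV)
 fix w assume w: "w : V"
 have "lin_functional M V (%f. A (?f c) f + (-1) * l f)"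
 using A fV[of c] l unfolding bilin_form_def by (intro lin_functional_add lin_functional_cmult) blast+
 from ext[OF w this] show "A (?f c) w = l w" using c Af eV by simp
 qed
qed

text \<open>Maps into \<open>L\<^sup>2(N)\<close> that are linear up to null sets; their inner products are the forms of the scheme.\<close>

definition l2_op :: "'a measure => ('a => 'b::euclidean_space) set => 'c measure => (('a => 'b) => 'c => 'd::euclidean_space) => bool" where
 "l2_op M V N T \<longleftrightarrow> (ALL f:V. l2_fun N (T f)) &
 (ALL f:V. ALL g:V. ALL a b. AE x in N. T (%x. a *R f x + b *R g x) x = a *R T f x + b *R T g x) &
 (ALL f:V. (AE x in M. f x = 0) --> (AE x in N. T f x = 0))"

lemma l2_opD:
 assumes "l2_op M V N T" "f : V"
 shows "l2_fun N (T f)" and "g : V ==> AE x in N. T (%x. a *R f x + b *R g x) x = a *R T f x + b *R T g x"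
 and "AE x in M. f x = 0 ==> AE x in N. T f x = 0"
 using assms by (simp_all add: l2_op_def)

lemma lin_functional_l2_inner:
 assumes V: "lin_closed V" and T: "l2_op M V N T" and F: "l2_fun N F"
 shows "lin_functional M V (%f. l2_inner N F (T f))"
 unfolding lin_functional_def
proof (intro conjI ballI allI impI)
 fix f g a b assume f: "f : V" "g : V"
 have h: "(%x. a *R f x + b *R g x) : V" by (rule lin_closedD[OF V f])
 have l2: "l2_fun N (T f)" "l2_fun N (T g)" "l2_fun N (T (%x. a *R f x + b *R g x))" using l2_opD(1)[OF T] f h by auto
 have "AE x in N. T (%x. a *R f x + b *R g x) x = a *R T f x + b *R T g x" by (rule l2_opD(2)[OF T f])
 hence "l2_inner N F (T (%x. a *R f x + b *R g x)) = l2_inner N F (%x. a *R T f x + b *R T g x)"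
 by (intro l2_inner_cong_AE F l2 l2_fun_linear) simp_all
 thus "l2_inner N F (T (%x. a *R f x + b *R g x)) = a * l2_inner N F (T f) + b * l2_inner N F (T g)"
 by (simp add: l2_inner_linear_right l2 F)
next
 fix f assume f: "f : V" "AE x in M. f x = 0"
 have "l2_fun N (T f)" "AE x in N. T f x = 0" by (rule l2_opD[OF T f(1)], rule l2_opD(3)[OF T f])
 hence "l2_inner N F (T f) = l2_inner N F (%_. 0)" by (intro l2_inner_cong_AE F l2_fun_zero) simp_all
 thus "l2_inner N F (T f) = 0" by (simp add: l2_inner_def)
qed

lemma bilin_form_l2_inner:
 assumes V: "lin_closed V" and T: "l2_op M V N T" and S: "l2_op M V N S"
 shows "bilin_form M V (%f g. l2_inner N (T f) (S g))"
 unfolding bilin_form_def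
proof (intro ballI conjI)
 fix w assume "w : V"
 hence l2: "l2_fun N (T w)" "l2_fun N (S w)" using l2_opD(1)[OF T] l2_opD(1)[OF S] by auto
 show "lin_functional M V (%g. l2_inner N (T w) (S g))" by (rule lin_functional_l2_inner[OF V S l2(1)])
 show "lin_functional M V (%f. l2_inner N (T f) (S w))"
 unfolding l2_inner_commute[of N "T _"] by (rule lin_functional_l2_inner[OF V T l2(2)])
qed

lemma fin_dim_space_spans:
 assumes "fin_dim_space M V"
 obtains B where "spans M V B (%g. g)"
 using assms unfolding fin_dim_space_def spans_def by blast

lemma fin_dim_space_lin_closed: "fin_dim_space M V ==> lin_closed V"
 unfolding fin_dim_space_def lin_closed_def by blast

lemma l2_fun_sum:
 assumes "finite J" "!!j. j : J ==> l2_fun M (f j)"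
 shows "l2_fun M (%x. \<Sum>j\<in>J. f j x)"
 using assms
proof (induction J rule: finite_induct)
 case (insert j J)
 thus ?case using l2_fun_linear[of M "f j" "%x. \<Sum>j\<in>J. f j x" 1 1] by simp
qed (simp add: l2_fun_zero)

lemma l2_fun_scaleR_const:
 assumes "l2_fun M f"
 shows "l2_fun M (%x. f x *R (c :: 'b::euclidean_space))"
proof -
 have [measurable]: "f : borel_measurable M" using assms by (simp add: l2_fun_def)
 have "integrable M (%x. (norm (f x))^2 * (norm c)^2)" using assms by (simp add: l2_fun_def)
 thus ?thesis by (simp add: l2_fun_def power_mult_distrib)
qed

lemma l2_fun_component:
 fixes f :: "'a => real^'n"
 assumes "l2_fun M f"
 shows "l2_fun M (%x. f x $ i)"
proof -
 have m: "f : borel_measurable M" using assms by (simp add: l2_fun_def)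
 have m': "(%x. f x $ i) : borel_measurable M"
 by (rule measurable_compose[OF m bm_contI[OF continuous_on_component[OF continuous_on_id]]])
 have "integrable M (%x. (norm (f x))^2)" using assms by (simp add: l2_fun_def)
 hence "integrable M (%x. (norm (f x $ i))^2)"
 proof (rule Bochner_Integration.integrable_bound)
 show "(%x. (norm (f x $ i))^2) : borel_measurable M" using m' by measurable
 have "(norm (f x $ i))^2 <= (norm (f x))^2" for x using component_le_norm_cart[of "f x" i] by (intro power_mono) auto
 thus "AE x in M. norm ((norm (f x $ i))^2) <= norm ((norm (f x))^2)" by (intro always_eventually allI) simp
 qed
 thus ?thesis using m' by (simp add: l2_fun_def)
qed

lemma l2_fun_matrix:
 fixes f :: "'a => real^'n^'m"
 assumes "!!i j. l2_fun M (%x. f x $ i $ j)"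
 shows "l2_fun M f"
proof -
 have "l2_fun M (%x. \<Sum>a\<in>UNIV. f x $ fst a $ snd a *R axis (fst a) (axis (snd a) (1::real)))"
 by (intro l2_fun_sum l2_fun_scaleR_const assms) simp
 thus ?thesis by (simp flip: matrix_eq_sum_axis)
qed

lemma l2_fun_diff: "l2_fun M f ==> l2_fun M g ==> l2_fun M (%x. f x - g x)"
 using l2_fun_linear[of M f g 1 "-1"] by simp

lemma l2_fun_add_scaleR: "l2_fun M f ==> l2_fun M g ==> l2_fun M (%x. f x + c *R g x)"
 using l2_fun_linear[of M f g 1 c] by simp

lemma l2_inner_diff:
 "l2_fun M f ==> l2_fun M g ==> l2_fun M h ==> l2_inner M (%x. f x - g x) h = l2_inner M f h - l2_inner M g h"
 using l2_inner_linear[of M f g h 1 "-1"] by simp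

lemma l2_inner_diff_right:
 "l2_fun M f ==> l2_fun M g ==> l2_fun M h ==> l2_inner M h (%x. f x - g x) = l2_inner M h f - l2_inner M h g"
 using l2_inner_linear_right[of M f g h 1 "-1"] by simp

lemma l2_inner_diff_scaled:
 assumes "l2_fun M f" "l2_fun M g" "l2_fun M h"
 shows "l2_inner M (%x. (f x - g x) /\<^sub>R t) h = (l2_inner M f h - l2_inner M g h) / t"
proof -
 have "l2_inner M (%x. (f x - g x) /\<^sub>R t) h = l2_inner M (%x. (1 / t) *R f x + (- 1 / t) *R g x) h"
 by (rule arg_cong[where f="%F. l2_inner M F h"]) (simp add: fun_eq_iff algebra_simps divide_inverse)
 also have "... = (1 / t) * l2_inner M f h + (- 1 / t) * l2_inner M g h" by (rule l2_inner_linear[OF assms])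
 finally show ?thesis by (simp add: diff_divide_distrib)
qed

lemma l2_inner_add_scaleR_right:
 "l2_fun M f ==> l2_fun M g ==> l2_fun M h ==> l2_inner M h (%x. f x + c *R g x) = l2_inner M h f + c * l2_inner M h g"
 using l2_inner_linear_right[of M f g h 1 c] by simp

lemma spansD: "spans M V J e ==> f : V ==> EX c. AE x in M. f x = (\<Sum>j\<in>J. c j *R e j x)"
 by (simp add: spans_def)

section \<open>Velocity-pressure pairs and the operators of Step 2\<close>

context fe_setting
begin

lemma weak_linear_all:
 assumes u: "u : XF V" "v : XF V"
 shows "AE y in bulk G. ALL j. wd [j] (%x. a *R u x + b *R v x) y = a *R wd [j] u y + b *R wd [j] v y"
proof -
 have "AE y in bulk G. ALL j:UNIV. wd [j] (%x. a *R u x + b *R v x) y = a *R wd [j] u y + b *R wd [j] v y"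
 by (intro AE_finite_allI weak_linear u) auto
 thus ?thesis by simp
qed

lemma weak_null_all:
 assumes u: "u : XF V" "AE y in bulk G. u y = 0"
 shows "AE y in bulk G. ALL j. wd [j] u y = 0"
proof -
 have "AE y in bulk G. wd [j] u y = 0" for j
 proof -
 have "has_weak_deriv (dom G) [j] u (wd [j] u)" by (rule XF_weak(1)[OF u(1)]) simp
 from has_weak_deriv_linear[OF open_dom this this, of 0 0]
 have "has_weak_deriv (dom G) [j] (%_. 0) (%_. 0 :: real^'d)" by simp
 hence "has_weak_deriv (dom G) [j] u (%_. 0)" using has_weak_deriv_AE_cong[OF open_dom u(2)] by simp
 from weak_deriv_AE_eq[OF open_dom this] show ?thesis .
 qed
 hence "AE y in bulk G. ALL j:UNIV. wd [j] u y = 0" by (intro AE_finite_allI) auto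
 thus ?thesis by simp
qed

lemma XF_l2: "u : XF V ==> l2_fun (bulk G) u"
proof -
 assume u: "u : XF V"
 have w: "has_weak_deriv (dom G) [] u (wd [] u)" by (rule XF_weak(1)[OF u]) simp
 have e: "AE x in bulk G. wd [] u x = u x"
 by (rule weak_deriv_AE_eq[OF open_dom has_weak_deriv_Nil[OF has_weak_derivD(1)[OF w]]])
 have "l2_fun (bulk G) (wd [] u)" by (rule XF_weak(2)[OF u]) simp
 thus ?thesis using XF_measurable[OF u] e by (rule l2_fun_AE_cong)
qed

lemma QF_l2: "p : QF V ==> l2_fun (bulk G) p"
 using QF_sub by (auto simp: Q_space_def)

lemma SF_l2: "s : SF V ==> l2_fun (wall G) s"
 using SF_sub by (auto simp: HsS_def surf_approx_def)

lemma wd_l2: "u : XF V ==> l2_fun (bulk G) (%x. wd [j] u x $ i)"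
 by (rule l2_fun_component[OF XF_weak(2)]) simp_all

lemma strain_component: "strain G u x $ i $ j = (1/2) *R wd [j] u x $ i + (1/2) *R wd [i] u x $ j"
 by (simp add: strain_def grad_def transpose_def)

lemma strain_l2: "u : XF V ==> l2_fun (bulk G) (strain G u)"
 by (rule l2_fun_matrix) (simp only: strain_component l2_fun_linear[OF wd_l2 wd_l2])

lemma dvg_l2: "u : XF V ==> l2_fun (bulk G) (dvg G u)"
 unfolding dvg_weak by (intro l2_fun_sum wd_l2) simp_all

lemma traction_const:
 assumes e: "AE y in bulk G. stress G mv u p y = C" and x: "x : Sig G"
 shows "svn mv u p x = C *v nrm G x"
proof -
 define K where "K = bdry_elem G (mesh V) x"
 have K: "K : mesh V" "x : snd K ` fst K" using bdry_elem[OF x] by (auto simp: K_def)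
 have U: "open (elset K)" by (rule open_elset[OF curvi[OF K(1)]])
 have cl: "x : closure (elset K)" using closure_elset[OF curvi[OF K(1)]] K(2) by simp
 have a: "AE y in lebesgue_on (elset K). stress G mv u p y = C"
 using AE_lebesgue_on_subset[OF e elset_dom[OF K(1)]] open_dom U by simp
 have "esslim (elset K) (%_. C) x C" unfolding esslim_def by (auto intro: exI[of _ 1])
 hence "esslim (elset K) (stress G mv u p) x C" using esslim_AE_cong[OF U a] by simp
 from bdry_value_eqI[OF U cl this] show ?thesis unfolding traction_def K_def[symmetric] by simp
qed

text \<open>Two uses: with \<open>m = 0\<close> it shows that the traction ignores null sets, and
  for general \<open>m\<close> it gives the traction of a constant pressure at the end of the
  uniqueness proof.\<close>

lemma traction_null:
 assumes u: "u : XF V" "AE y in bulk G. u y = 0" and p: "AE y in bulk G. p y = m" and x: "x : Sig G"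
 shows "svn mv u p x = (- m) *R nrm G x"
proof -
 have "AE y in bulk G. stress G mv u p y = mat (- m)"
 using weak_null_all[OF u] p
 proof eventually_elim
 case (elim y)
 thus ?case unfolding vec_eq_iff stress_component by (simp add: mat_def)
 qed
 from traction_const[OF this x] have "svn mv u p x = mat (- m) *v nrm G x" .
 also have "... = (- m) *R nrm G x"
 by (simp add: vec_eq_iff matrix_vector_mult_def mat_def if_distrib[of "%a. a * _"] cong: if_cong)
 finally show ?thesis .
qed

text \<open>Velocity and pressure are paired pointwise into one function, so that Step 2 has a
  single unknown and \<open>bilin_solve\<close> applies.\<close>

definition XQ :: "(real^'d => (real^'d) \<times> real) set" where
 "XQ = {f. (%x. fst (f x)) : XF V & (%x. snd (f x)) : QF V}"

abbreviation "bu f \<equiv> %x. fst (f x)"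
abbreviation "bp f \<equiv> %x. snd (f x)"

lemma XQ_D: "f : XQ ==> bu f : XF V" "f : XQ ==> bp f : QF V"
 by (simp_all add: XQ_def)

lemma XQ_I: "u : XF V ==> p : QF V ==> (%x. (u x, p x)) : XQ"
 by (simp add: XQ_def)

lemma XQ_closed: "lin_closed XQ"
 by (simp add: lin_closed_def XQ_def XF_linear QF_linear[unfolded real_scaleR_def] zero_XF zero_QF)

lemma XQ_spans: "EX (J :: ((real^'d => real^'d) + (real^'d => real)) set) e. spans (bulk G) XQ J e"
proof -
 obtain B where B: "spans (bulk G) (XF V) B (%g. g)"
 using spaces fin_dim_space_spans unfolding fe_spaces_def by blast
 obtain C where C: "spans (bulk G) (QF V) C (%g. g)"
 using spaces fin_dim_space_spans unfolding fe_spaces_def by blast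
 define e where "e = case_sum (%(g :: real^'d => real^'d) x. (g x, 0::real)) (%(q :: real^'d => real) x. (0, q x))"
 have fin: "finite B" "finite C" using B C by (auto simp: spans_def)
 have "spans (bulk G) XQ (B <+> C) e"
 unfolding spans_def
 proof (intro conjI ballI)
 show "finite (B <+> C)" using fin by simp
 show "e j : XQ" if "j : B <+> C" for j
 using that B C zero_XF zero_QF by (auto simp: e_def XQ_def spans_def)
 fix f assume f: "f : XQ"
 obtain c where c: "AE x in bulk G. bu f x = (\<Sum>g\<in>B. c g *R g x)" using spansD[OF B XQ_D(1)[OF f]] by (rule exE)
 obtain d where d: "AE x in bulk G. bp f x = (\<Sum>g\<in>C. d g *R g x)" using spansD[OF C XQ_D(2)[OF f]] by (rule exE)
 have "AE x in bulk G. f x = (\<Sum>j\<in>B <+> C. case_sum c d j *R e j x)"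
 using c d
 proof eventually_elim
 case (elim x)
 show ?case using elim fin by (simp add: sum.Plus e_def prod_eq_iff fst_sum snd_sum)
 qed
 thus "EX c. AE x in bulk G. f x = (\<Sum>j\<in>B <+> C. c j *R e j x)" by blast
 qed
 thus ?thesis by blast
qed

lemma XQ_null: "f : XQ ==> AE x in bulk G. f x = 0 ==> (AE x in bulk G. bu f x = 0) & (AE x in bulk G. bp f x = 0)"
 by (auto elim: eventually_mono)

lemma comb_fst: "bu (%x. a *R f x + b *R g x) = (%x. a *R bu f x + b *R bu g x)"
 and comb_snd: "bp (%x. a *R f x + b *R g x) = (%x. a *R bp f x + b *R bp g x)"
 by simp_all

text \<open>The building blocks of Step 2 in the form that \<open>bilin_form_l2_inner\<close> and
  \<open>lin_functional_l2_inner\<close> ask for; linearity of weak derivatives, traces and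
  tractions enters here.\<close>

lemma ops:
 "l2_op (bulk G) XQ (bulk G) (%f. bu f)"
 "l2_op (bulk G) XQ (bulk G) (%f. bp f)"
 "l2_op (bulk G) XQ (bulk G) (%f. strain G (bu f))"
 "l2_op (bulk G) XQ (bulk G) (%f. dvg G (bu f))"
 "l2_op (bulk G) XQ (wall G) (%f. tr G (bu f))"
 "l2_op (bulk G) XQ (wall G) (%f. svn mv (bu f) (bp f))"
proof -
 show "l2_op (bulk G) XQ (bulk G) (%f. bu f)" "l2_op (bulk G) XQ (bulk G) (%f. bp f)"
 unfolding l2_op_def using XQ_null by (auto simp: XF_l2 QF_l2 XQ_D)
 show "l2_op (bulk G) XQ (bulk G) (%f. strain G (bu f))"
 unfolding l2_op_def
 proof (intro conjI ballI allI impI)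
 fix f g a b assume f: "f : XQ" "g : XQ"
 show "AE x in bulk G. strain G (bu (%x. a *R f x + b *R g x)) x = a *R strain G (bu f) x + b *R strain G (bu g) x"
 using weak_linear_all[OF XQ_D(1)[OF f(1)] XQ_D(1)[OF f(2)], of a b] unfolding comb_fst
 proof (rule eventually_mono)
 fix x assume h: "ALL j. wd [j] (%x. a *R bu f x + b *R bu g x) x = a *R wd [j] (bu f) x + b *R wd [j] (bu g) x"
 show "strain G (%x. a *R bu f x + b *R bu g x) x = a *R strain G (bu f) x + b *R strain G (bu g) x"
 unfolding vec_eq_iff vector_add_component vector_scaleR_component strain_component using h by (simp add: algebra_simps)
 qed
 next
 fix f assume f: "f : XQ" "AE x in bulk G. f x = 0"
 have z: "AE x in bulk G. bu f x = 0" using XQ_null[OF f] by (rule conjunct1)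
 from weak_null_all[OF XQ_D(1)[OF f(1)] z] show "AE x in bulk G. strain G (bu f) x = 0"
 by (rule eventually_mono) (simp add: vec_eq_iff strain_component)
 qed (simp add: strain_l2 XQ_D)
 show "l2_op (bulk G) XQ (bulk G) (%f. dvg G (bu f))"
 unfolding l2_op_def
 proof (intro conjI ballI allI impI)
 fix f g a b assume f: "f : XQ" "g : XQ"
 show "AE x in bulk G. dvg G (bu (%x. a *R f x + b *R g x)) x = a *R dvg G (bu f) x + b *R dvg G (bu g) x"
 using weak_linear_all[OF XQ_D(1)[OF f(1)] XQ_D(1)[OF f(2)], of a b] unfolding comb_fst
 by (rule eventually_mono) (simp add: dvg_weak sum.distrib sum_distrib_left)
 next
 fix f assume f: "f : XQ" "AE x in bulk G. f x = 0"
 have z: "AE x in bulk G. bu f x = 0" using XQ_null[OF f] by (rule conjunct1)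
 from weak_null_all[OF XQ_D(1)[OF f(1)] z] show "AE x in bulk G. dvg G (bu f) x = 0"
 by (rule eventually_mono) (simp add: dvg_weak)
 qed (simp add: dvg_l2 XQ_D)
 show "l2_op (bulk G) XQ (wall G) (%f. tr G (bu f))"
 unfolding l2_op_def
 proof (intro conjI ballI allI impI)
 fix f g a b assume f: "f : XQ" "g : XQ"
 show "AE x in wall G. tr G (bu (%x. a *R f x + b *R g x)) x = a *R tr G (bu f) x + b *R tr G (bu g) x"
 unfolding comb_fst by (rule tr_linear[OF XQ_D(1)[OF f(1)] XQ_D(1)[OF f(2)]])
 next
 fix f assume f: "f : XQ" "AE x in bulk G. f x = 0"
 have z: "AE x in bulk G. bu f x = 0" using XQ_null[OF f] by (rule conjunct1)
 note u = XQ_D(1)[OF f(1)]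
 have "AE x in wall G. tr G (bu f) x = tr G (%x. 0 *R bu f x + 0 *R bu f x) x"
 by (rule tr_cong[OF u XF_linear[OF u u]]) (use z in simp)
 with tr_linear[OF u u, of 0 0] show "AE x in wall G. tr G (bu f) x = 0" by eventually_elim simp
 qed (simp add: tr_l2 XQ_D)
 show "l2_op (bulk G) XQ (wall G) (%f. svn mv (bu f) (bp f))"
 unfolding l2_op_def
 proof (intro conjI ballI allI impI)
 fix f g a b assume f: "f : XQ" "g : XQ"
 show "AE x in wall G. svn mv (bu (%x. a *R f x + b *R g x)) (bp (%x. a *R f x + b *R g x)) x = a *R svn mv (bu f) (bp f) x + b *R svn mv (bu g) (bp g) x"
 unfolding comb_fst comb_snd by (rule AE_I2) (simp only: space_surf, rule traction_linear[OF XQ_D(1)[OF f(1)] XQ_D(1)[OF f(2)] XQ_D(2)[OF f(1)] XQ_D(2)[OF f(2)]])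
 next
 fix f assume f: "f : XQ" "AE x in bulk G. f x = 0"
 have z: "AE x in bulk G. bu f x = 0" "AE x in bulk G. bp f x = 0" using XQ_null[OF f] by auto
 show "AE x in wall G. svn mv (bu f) (bp f) x = 0"
 by (rule AE_I2) (use traction_null[OF XQ_D(1)[OF f(1)] z] in simp)
 qed (simp add: traction_l2 XQ_D)
qed

end

section \<open>The scheme\<close>

locale fe_scheme = fe_setting G V c h for G :: "('d::finite) cell" and V c h +
 fixes P :: param and Ls :: "'d surface_op"
 assumes visc: "visc P > 0" and rhof: "rhof P > 0" and rhos: "rhos P > 0" and epss: "epss P > 0"
 and Ls: "surface_operator G Ls" and step: "step P > 0" and stab: "stab P >= 0"
begin

abbreviation "mv \<equiv> visc P"
abbreviation "ro \<equiv> rhof P"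
abbreviation "kp \<equiv> rhos P * epss P"
abbreviation "ta \<equiv> step P"
abbreviation "bt \<equiv> stab P"
abbreviation "sv \<equiv> traction G (mesh V) (visc P)"
abbreviation ib (infix "\<diamondop>" 70) where "f \<diamondop> g \<equiv> l2_inner (bulk G) f g"
abbreviation iw (infix "\<bullet>w" 70) where "f \<bullet>w g \<equiv> l2_inner (wall G) f g"

lemma kappa: "kp > 0" using rhos epss by simp

lemma as_linear:
 assumes "f : SF V" "g : SF V" "w : SF V"
 shows "a_s Ls (%x. a *R f x + b *R g x) w = a * a_s Ls f w + b * a_s Ls g w"
 "a_s Ls w (%x. a *R f x + b *R g x) = a * a_s Ls w f + b * a_s Ls w g"
proof -
 have S: "f : S_space G" "g : S_space G" "w : S_space G" using assms SF_sub by auto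
 have "Ls (%x. a *R f x + b *R g x) w = a * Ls f w + b * Ls g w & Ls w (%x. a *R f x + b *R g x) = a * Ls w f + b * Ls w g"
 by (rule conjunct1[OF Ls[unfolded surface_operator_def], rule_format, OF S])
 thus "a_s Ls (%x. a *R f x + b *R g x) w = a * a_s Ls f w + b * a_s Ls g w"
 "a_s Ls w (%x. a *R f x + b *R g x) = a * a_s Ls w f + b * a_s Ls w g"
 by (simp_all add: a_s_def)
qed

lemma as_sym: "f : SF V ==> g : SF V ==> a_s Ls f g = a_s Ls g f"
 and as_nonneg: "f : SF V ==> 0 <= a_s Ls f f"
 using Ls SF_sub unfolding surface_operator_def by (simp_all add: subset_iff)

lemma norm_s_power2: "f : SF V ==> (norm_s Ls f)\<^sup>2 = a_s Ls f f"
 by (simp add: norm_s_def as_nonneg)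

text \<open>\<open>a_s\<close> acts on functions, not on classes, so this needs proof. The zero
  sequence approximates \<open>z\<close>, hence its \<open>H^1\<close> norm vanishes, and the norm
  equivalence gives \<open>a_s Ls z z = 0\<close>. Nonnegativity on the span of \<open>z\<close> and
  \<open>w\<close> then forces the mixed value to vanish.\<close>

lemma as_null:
 assumes z: "z : SF V" "AE x in wall G. z x = 0" and w: "w : SF V"
 shows "a_s Ls z w = 0"
proof -
 have "(%_. 0) : S_space G" using zero_SF SF_sub by blast
 then obtain ph :: "nat => real^'d => real^'d" where ph: "surf_approx G (smooth_per G) 1 (Sig G) (%_. 0) ph" by (auto simp: HsS_def)
 \<comment> \<open>Derivatives within \<open>Sig_inf G\<close> are choices, so the norm of the zero
   function is not computed from its definition; the Cauchy condition of an approximating sequence,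
   read at equal indices, bounds it.\<close>
 have s0: "smooth_surf_norm G 1 (Sig G) (%_. 0 :: real^'d) < ep" if e: "0 < ep" for ep
 proof -
 have "ALL ep>0. EX M. ALL m>=M. ALL n>=M. smooth_surf_norm G 1 (Sig G) (%x. ph m x - ph n x) < ep"
 using ph unfolding surf_approx_def by (elim conjE)
 hence "EX M. ALL m>=M. ALL n>=M. smooth_surf_norm G 1 (Sig G) (%x. ph m x - ph n x) < ep" using e by simp
 then obtain M where M: "ALL m>=M. ALL n>=M. smooth_surf_norm G 1 (Sig G) (%x. ph m x - ph n x) < ep" by (rule exE)
 have "smooth_surf_norm G 1 (Sig G) (%x. ph M x - ph M x) < ep" by (rule M[rule_format, OF order_refl order_refl])
 thus ?thesis by simp
 qed
 have s0le: "smooth_surf_norm G 1 (Sig G) (%_. 0 :: real^'d) <= 0"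
 proof (rule ccontr)
 assume "\<not> ?thesis"
 hence "0 < smooth_surf_norm G 1 (Sig G) (%_. 0 :: real^'d)" by simp
 from s0[OF this] show False by simp
 qed
 hence s0': "smooth_surf_norm G 1 (Sig G) (%_. 0 :: real^'d) <= 0" .
 have n0: "l2_norm (wall G) z = 0"
 proof -
 have "z \<bullet>w z = (%_. 0) \<bullet>w (%_. 0 :: real^'d)" by (intro l2_inner_cong_AE SF_l2 z l2_fun_zero)
 thus ?thesis by (simp add: l2_norm_def l2_inner_def)
 qed
 have "l2_norm (wall G) (%x. 0 - z x) = 0" using n0 by (simp add: l2_norm_def l2_inner_def)
 hence "surf_approx G (smooth_per G) 1 (Sig G) z (%_ _. 0)"
 using SF_l2[OF z(1)] s0 by (auto simp: surf_approx_def smooth_per_def periodic_def)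
 hence "HsS_norm G 1 z <= liminf (%k::nat. ennreal (smooth_surf_norm G 1 (Sig G) (%_. 0 :: real^'d)))"
 unfolding HsS_norm_def surf_norm_def by (intro INF_lower2[where i="%_ _. 0"]) simp_all
 also have "... = 0" using s0' by (simp add: Liminf_const ennreal_neg)
 finally have H0: "HsS_norm G 1 z = 0" by simp
 obtain c C where "ALL ht:S_space G. ennreal c * HsS_norm G 1 ht <= ennreal (norm_s Ls ht + l2_norm (wall G) ht) &
 ennreal (norm_s Ls ht + l2_norm (wall G) ht) <= ennreal C * HsS_norm G 1 ht"
 using Ls unfolding surface_operator_def by blast
 hence "ennreal (norm_s Ls z + l2_norm (wall G) z) <= ennreal C * HsS_norm G 1 z" using z(1) SF_sub by blast
 hence "norm_s Ls z <= 0" using H0 n0 by (simp add: ennreal_eq_0_iff)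
 hence zz: "a_s Ls z z = 0" using as_nonneg[OF z(1)] by (simp add: norm_s_def)
 show ?thesis
 proof (rule ccontr)
 assume b: "a_s Ls z w ~= 0"
 \<comment> \<open>With \<open>a_s Ls z z = 0\<close> the form at \<open>t *R z + w\<close> is
   affine in \<open>t\<close>; this \<open>t\<close> would give it the value -1.\<close>
 define t where "t = - (a_s Ls w w + 1) / (2 * a_s Ls z w)"
 let ?f = "%x. t *R z x + 1 *R w x"
 have f: "?f : SF V" by (rule SF_linear[OF z(1) w])
 have "a_s Ls ?f ?f = t * (t * a_s Ls z z + a_s Ls z w) + (t * a_s Ls w z + a_s Ls w w)"
 using as_linear(1)[OF z(1) w f, of t 1] as_linear(2)[OF z(1) w z(1), of t 1] as_linear(2)[OF z(1) w w, of t 1] by simp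
 also have "... = 2 * t * a_s Ls z w + a_s Ls w w" using zz as_sym[OF w z(1)] by simp
 also have "... = - 1"
 proof -
 have "2 * t * a_s Ls z w = - (a_s Ls w w + 1)" using b unfolding t_def by (simp add: field_simps)
 thus ?thesis by simp
 qed
 finally show False using as_nonneg[OF f] by simp
 qed
qed

section \<open>Solvability and uniqueness of Step 1\<close>

lemma SF_closed: "lin_closed (SF V)"
 using spaces unfolding fe_spaces_def by (blast intro: fin_dim_space_lin_closed)

lemma as_bilin: "bilin_form (wall G) (SF V) (a_s Ls)"
proof -
 have "a_s Ls w z = 0" if "z : SF V" "AE x in wall G. z x = 0" "w : SF V" for w z
 using as_sym[OF that(3,1)] as_null[OF that] by simp
 thus ?thesis unfolding bilin_form_def lin_functional_def using as_linear as_null by simp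
qed

text \<open>Step 1 multiplied out: the terms with the unknown \<open>s\<close> are collected here,
  the known data in \<open>l1f\<close>. The summand with \<open>a_s\<close> is the contribution of
  \<open>step P *R s x\<close> to the new displacement.\<close>

definition A1f where "A1f s w = kp / ta * (s \<bullet>w w) + ta * a_s Ls s w"
definition l1f where "l1f u' p' ht' w = kp / ta * (tr G u' \<bullet>w w) + ((-1) * (sv u' p' \<bullet>w w) + (-1) * a_s Ls ht' w)"

lemma step1_iff:
 assumes u: "u' : XF V" and p: "p' : QF V" and ht: "ht' : SF V"
 shows "step1 G P Ls V u' p' ht' s \<longleftrightarrow> s : SF V & (ALL w:SF V. A1f s w = l1f u' p' ht' w)"
proof -
 have "rhos P * epss P * ((%x. (s x - tr G u' x) /\<^sub>R ta) \<bullet>w w) + a_s Ls (%x. ht' x + ta *R s x) w = - (sv u' p' \<bullet>w w)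
 \<longleftrightarrow> A1f s w = l1f u' p' ht' w" if s: "s : SF V" and w: "w : SF V" for w
 proof -
 have "a_s Ls (%x. ht' x + ta *R s x) w = a_s Ls ht' w + ta * a_s Ls s w" using as_linear(1)[OF ht s w, of 1 ta] by simp
 moreover have "(%x. (s x - tr G u' x) /\<^sub>R ta) \<bullet>w w = (s \<bullet>w w - tr G u' \<bullet>w w) / ta"
 by (rule l2_inner_diff_scaled[OF SF_l2[OF s] tr_l2[OF u] SF_l2[OF w]])
 ultimately show ?thesis unfolding A1f_def l1f_def by (simp add: diff_divide_distrib right_diff_distrib) (auto simp: algebra_simps)
 qed
 thus ?thesis unfolding step1_def by blast
qed

lemma id_op: "l2_op (wall G) (SF V) (wall G) (%f. f)"
 by (simp add: l2_op_def SF_l2)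

lemma A1f_bilin: "bilin_form (wall G) (SF V) A1f"
 unfolding A1f_def by (intro bilin_form_add bilin_form_cmult bilin_form_l2_inner[OF SF_closed id_op id_op] as_bilin)

lemma A1f_inj:
 assumes f: "f : SF V" and z: "ALL w:SF V. A1f f w = 0"
 shows "AE x in wall G. f x = 0"
proof (rule l2_inner_eq_0[OF SF_l2[OF f]])
 have "kp / ta * (f \<bullet>w f) + ta * a_s Ls f f = 0" using z f by (simp add: A1f_def)
 moreover have "0 <= ta * a_s Ls f f" using step as_nonneg[OF f] by simp
 moreover have "0 <= kp / ta * (f \<bullet>w f)" using kappa step l2_inner_nonneg[of "wall G" f] by simp
 ultimately have "kp / ta * (f \<bullet>w f) = 0" by linarith
 thus "f \<bullet>w f = 0" using rhos epss step by simp
qed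

lemma l1f_lin:
 assumes u: "u' : XF V" and p: "p' : QF V" and ht: "ht' : SF V"
 shows "lin_functional (wall G) (SF V) (l1f u' p' ht')"
 unfolding l1f_def using as_bilin ht
 by (intro lin_functional_add lin_functional_cmult lin_functional_l2_inner[OF SF_closed id_op] tr_l2 traction_l2 u p) (simp add: bilin_form_def)

lemma step1_ex:
 assumes "u' : XF V" "p' : QF V" "ht' : SF V"
 shows "EX s. step1 G P Ls V u' p' ht' s"
proof -
 have "fin_dim_space (wall G) (SF V)" using spaces by (simp add: fe_spaces_def)
 then obtain B where "spans (wall G) (SF V) B (%g. g)" by (rule fin_dim_space_spans)
 from bilin_solve[OF SF_closed this A1f_bilin l1f_lin[OF assms] A1f_inj]
 show ?thesis using step1_iff[OF assms] by blast
qed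

lemma step1_unique:
 assumes a: "u' : XF V" "p' : QF V" "ht' : SF V" and s: "step1 G P Ls V u' p' ht' s" "step1 G P Ls V u' p' ht' s2"
 shows "AE x in wall G. s x = s2 x"
proof -
 have S: "s : SF V" "s2 : SF V" and e: "ALL w:SF V. A1f s w = A1f s2 w" using s step1_iff[OF a] by simp_all
 have d: "(%x. s x - s2 x) : SF V" using SF_linear[OF S, of 1 "-1"] by simp
 have "A1f (%x. s x - s2 x) w = 0" if w: "w : SF V" for w
 proof -
 have "lin_functional (wall G) (SF V) (%f. A1f f w)" using A1f_bilin w by (simp add: bilin_form_def)
 from lin_functional_diff[OF this S] show ?thesis using e w by simp
 qed
 hence "AE x in wall G. s x - s2 x = 0" by (intro A1f_inj d) blast
 thus ?thesis by (rule eventually_mono) simp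
qed

text \<open>Step 2 sorted into unknowns, here, and data, in \<open>l2f\<close>. The pairing of the
  new traction with \<open>tr G v\<close> occurs twice with opposite signs and cancels. The pairing
  of \<open>tr G u\<close> with the traction of the test pair keeps the coefficient 1, the product
  of \<open>kp / ta\<close> and \<open>ta / kp\<close>.\<close>

definition A2f where
 "A2f f g = ro / ta * (bu f \<diamondop> bu g) + (2 * mv * (strain G (bu f) \<diamondop> strain G (bu g)) + ((-1) * (bp f \<diamondop> dvg G (bu g)) + ((bp g \<diamondop> dvg G (bu f))
 + (kp / ta * (tr G (bu f) \<bullet>w tr G (bu g)) + ((tr G (bu f) \<bullet>w sv (bu g) (bp g)) + ta * (1 + bt) / kp * (sv (bu f) (bp f) \<bullet>w sv (bu g) (bp g)))))))"
definition l2f where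
 "l2f u' p' s g = ro / ta * (u' \<diamondop> bu g) + (kp / ta * (s \<bullet>w tr G (bu g)) + ((s \<bullet>w sv (bu g) (bp g)) + ((sv u' p' \<bullet>w tr G (bu g)) + ta * (1 + bt) / kp * (sv u' p' \<bullet>w sv (bu g) (bp g)))))"

lemma A2f_bilin: "bilin_form (bulk G) XQ A2f"
 unfolding A2f_def
 by (intro bilin_form_add bilin_form_cmult bilin_form_l2_inner[OF XQ_closed] bilin_form_flip[OF bilin_form_l2_inner[OF XQ_closed, of "bulk G" "bulk G" "%g. bp g" "%f. dvg G (bu f)"]] ops)

lemma l2f_lin:
 assumes "u' : XF V" "p' : QF V" "s : SF V"
 shows "lin_functional (bulk G) XQ (l2f u' p' s)"
 unfolding l2f_def
 by (intro lin_functional_add lin_functional_cmult lin_functional_l2_inner[OF XQ_closed] ops XF_l2 SF_l2 traction_l2 assms)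

lemma step2_iff:
 assumes u': "u' : XF V" and p': "p' : QF V" and s: "s : SF V"
 shows "step2 G P V u' p' s u p \<longleftrightarrow> u : XF V & p : QF V & (ALL g:XQ. A2f (%x. (u x, p x)) g = l2f u' p' s g)"
proof -
 have e: "ro * ((%x. (u x - u' x) /\<^sub>R ta) \<diamondop> v) + a_f G mv u v
 - b_form G p v + b_form G q u - (sv u p \<bullet>w tr G v)
 + kp * ((%x. (tr G u x - s x) /\<^sub>R ta) \<bullet>w (%x. tr G v x + (ta / kp) *R sv v q x))
 + ((%x. sv u p x - sv u' p' x) \<bullet>w (%x. tr G v x + (ta * (1 + bt) / kp) *R sv v q x))
 = A2f (%x. (u x, p x)) (%x. (v x, q x)) - l2f u' p' s (%x. (v x, q x))"
 if u: "u : XF V" and p: "p : QF V" and v: "v : XF V" and q: "q : QF V" for v q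
 proof -
 note l2 = SF_l2[OF s] tr_l2[OF u] tr_l2[OF v] traction_l2[OF u p, of mv] traction_l2[OF v q, of mv] traction_l2[OF u' p', of mv]
 have 1: "(%x. (u x - u' x) /\<^sub>R ta) \<diamondop> v = (u \<diamondop> v - u' \<diamondop> v) / ta" by (rule l2_inner_diff_scaled[OF XF_l2[OF u] XF_l2[OF u'] XF_l2[OF v]])
 have 2: "(%x. (tr G u x - s x) /\<^sub>R ta) \<bullet>w (%x. tr G v x + (ta / kp) *R sv v q x)
 = (tr G u \<bullet>w tr G v + ta / kp * (tr G u \<bullet>w sv v q) - (s \<bullet>w tr G v + ta / kp * (s \<bullet>w sv v q))) / ta"
 by (simp only: l2_inner_diff_scaled[OF l2(2) l2(1) l2_fun_add_scaleR[OF l2(3,5)]] l2_inner_add_scaleR_right[OF l2(3,5) l2(2)] l2_inner_add_scaleR_right[OF l2(3,5) l2(1)])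
 have 3: "(%x. sv u p x - sv u' p' x) \<bullet>w (%x. tr G v x + (ta * (1 + bt) / kp) *R sv v q x)
 = (sv u p \<bullet>w tr G v + ta * (1 + bt) / kp * (sv u p \<bullet>w sv v q)) - (sv u' p' \<bullet>w tr G v + ta * (1 + bt) / kp * (sv u' p' \<bullet>w sv v q))"
 by (simp only: l2_inner_diff[OF l2(4) l2(6) l2_fun_add_scaleR[OF l2(3,5)]] l2_inner_add_scaleR_right[OF l2(3,5) l2(4)] l2_inner_add_scaleR_right[OF l2(3,5) l2(6)])
 have k: "kp * ((a + ta / kp * b - (c + ta / kp * d)) / ta) = kp / ta * a + b - kp / ta * c - d" for a b c d
 using rhos epss step by (simp add: field_simps)
 show ?thesis
 unfolding 1 2 3 k A2f_def l2f_def a_f_def b_form_def fst_conv snd_conv by (simp add: diff_divide_distrib right_diff_distrib)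
 qed
 have XQ: "(ALL g:XQ. Q g) \<longleftrightarrow> (ALL v:XF V. ALL q:QF V. Q (%x. (v x, q x)))" for Q
 proof
 assume h: "ALL v:XF V. ALL q:QF V. Q (%x. (v x, q x))"
 show "ALL g:XQ. Q g"
 proof
 fix g assume g: "g : XQ"
 have "Q (%x. (bu g x, bp g x))" by (rule h[rule_format, OF XQ_D(1)[OF g] XQ_D(2)[OF g]])
 thus "Q g" by simp
 qed
 qed (simp add: XQ_I)
 show ?thesis unfolding step2_def Let_def XQ
 proof (rule conj_cong[OF refl], rule conj_cong[OF refl], intro ball_cong refl)
 fix v q assume "u : XF V" "p : QF V" "v : XF V" "q : QF V"
 note e = e[OF this]
 show "(ro * ((%x. (u x - u' x) /\<^sub>R ta) \<diamondop> v) + a_f G mv u v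
 - b_form G p v + b_form G q u - (sv u p \<bullet>w tr G v)
 + kp * ((%x. (tr G u x - s x) /\<^sub>R ta) \<bullet>w (%x. tr G v x + (ta / kp) *R sv v q x))
 + ((%x. sv u p x - sv u' p' x) \<bullet>w (%x. tr G v x + (ta * (1 + bt) / kp) *R sv v q x)) = 0)
 = (A2f (%x. (u x, p x)) (%x. (v x, q x)) = l2f u' p' s (%x. (v x, q x)))"
 unfolding e by simp
 qed
qed

end

section \<open>Uniqueness and solvability of Step 2\<close>

context fe_scheme
begin

text \<open>Tested with itself the form loses its pressure terms, and the indefinite pairing of
  trace and traction is absorbed into a square that spends part of the traction term. What remains
  determines the velocity and the traction; the pressure is recovered from test pairs
  \<open>(v, 0)\<close>.\<close>

lemma A2f_inj:
 assumes f: "f : XQ" and z: "ALL g:XQ. A2f f g = 0"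
 shows "AE x in bulk G. f x = 0"
proof -
 note fu = XQ_D(1)[OF f] and fp = XQ_D(2)[OF f]
 let ?u = "bu f" and ?p = "bp f" and ?t = "tr G (bu f)" and ?s = "sv (bu f) (bp f)"
 have E: "ro / ta * (?u \<diamondop> ?u) + 2 * mv * (strain G ?u \<diamondop> strain G ?u) + (kp / ta * (?t \<bullet>w ?t) + ?t \<bullet>w ?s + ta * (1 + bt) / kp * (?s \<bullet>w ?s)) = 0"
 proof -
 have "A2f f f = 0" using z f by blast
 thus ?thesis by (simp add: A2f_def)
 qed
 \<comment> \<open>The square of the trace plus \<open>ta / (2 * kp)\<close> times the traction.
   Scaled by \<open>kp / ta\<close> it produces the pairing with coefficient 1 and uses
   \<open>ta / (4 * kp)\<close> of the traction term, which leaves the factor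
   \<open>3 / 4 + bt\<close>.\<close>
 have sq: "0 <= 1^2 * (?t \<bullet>w ?t) + 2 * 1 * (ta / (2 * kp)) * (?t \<bullet>w ?s) + (ta / (2 * kp))^2 * (?s \<bullet>w ?s)"
 unfolding l2_inner_square[OF tr_l2[OF fu] traction_l2[OF fu fp], symmetric] by (rule l2_inner_nonneg)
 have "0 <= kp / ta * (1^2 * (?t \<bullet>w ?t) + 2 * 1 * (ta / (2 * kp)) * (?t \<bullet>w ?s) + (ta / (2 * kp))^2 * (?s \<bullet>w ?s))"
 using sq kappa step by (intro mult_nonneg_nonneg) auto
 also have "... = kp / ta * (?t \<bullet>w ?t) + ?t \<bullet>w ?s + ta / (4 * kp) * (?s \<bullet>w ?s)"
 proof -
 have "k / ta * (1^2 * a + 2 * 1 * (ta / (2 * k)) * b + (ta / (2 * k))^2 * d) = k / ta * a + b + ta / (4 * k) * d" if "k > 0" for k a b d :: real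
 using that step by (simp add: field_simps power2_eq_square)
 from this[OF kappa] show ?thesis .
 qed
 finally have q: "0 <= kp / ta * (?t \<bullet>w ?t) + ?t \<bullet>w ?s + ta / (4 * kp) * (?s \<bullet>w ?s)" .
 have split: "ta * (1 + bt) / kp * (?s \<bullet>w ?s) = ta / (4 * kp) * (?s \<bullet>w ?s) + ta * (3 / 4 + bt) / kp * (?s \<bullet>w ?s)"
 proof -
 have "ta * (1 + bt) / k * d = ta / (4 * k) * d + ta * (3 / 4 + bt) / k * d" if "k > 0" for k d :: real
 using that by (simp add: field_simps)
 from this[OF kappa] show ?thesis .
 qed
 have n1: "0 <= ro / ta * (?u \<diamondop> ?u)" using rhof step l2_inner_nonneg by (intro mult_nonneg_nonneg) auto
 have n2: "0 <= 2 * mv * (strain G ?u \<diamondop> strain G ?u)" using visc l2_inner_nonneg by (intro mult_nonneg_nonneg) auto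
 have n3: "0 <= ta * (3 / 4 + bt) / kp * (?s \<bullet>w ?s)" using kappa step stab l2_inner_nonneg by (intro mult_nonneg_nonneg divide_nonneg_pos) auto
 have z1: "ro / ta * (?u \<diamondop> ?u) = 0" and z3: "ta * (3 / 4 + bt) / kp * (?s \<bullet>w ?s) = 0"
 using E q split n1 n2 n3 by linarith+
 have u0: "AE x in bulk G. ?u x = 0" by (rule l2_inner_eq_0[OF XF_l2[OF fu]]) (use z1 rhof step in simp)
 have "ta * (3 / 4 + bt) / kp > 0" using rhos epss step stab by (intro divide_pos_pos mult_pos_pos) auto
 hence "?s \<bullet>w ?s = 0" using z3 by (metis less_irrefl mult_eq_0_iff)
 hence s0: "AE x in wall G. ?s x = 0" by (rule l2_inner_eq_0[OF traction_l2[OF fu fp]])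
 have inner0: "l2_inner M F g = 0" if "l2_fun M F" "l2_fun M g" "AE x in M. F x = 0" for M and F g :: "real^'d => 'z::euclidean_space"
 proof -
 have "l2_inner M F g = l2_inner M (%_. 0) g" by (rule l2_inner_cong_AE[OF that(1) l2_fun_zero that(2) that(2) that(3)]) simp
 thus ?thesis by (simp add: l2_inner_def)
 qed
 define u0f :: "real^'d => (real^'d) \<times> real" where "u0f = (%x. (bu f x, 0))"
 \<comment> \<open>Against \<open>(v, 0)\<close> every term but the one with the pressure contains
   the velocity, its strain, its trace or the traction of \<open>f\<close>, all of which vanish
   almost everywhere.\<close>
 have div0: "?p \<diamondop> dvg G v = 0" if v: "v : XF V" for v
 proof -
 have g: "(%x. (v x, 0::real)) : XQ" by (rule XQ_I[OF v zero_QF])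
 have zs: "AE x in bulk G. strain G ?u x = 0"
 using weak_null_all[OF fu u0] by (rule eventually_mono) (simp add: vec_eq_iff strain_component)
 have zt: "AE x in wall G. ?t x = 0"
 proof -
 have "AE x in wall G. ?t x = tr G (%x. 0 *R ?u x + 0 *R ?u x) x"
 by (rule tr_cong[OF fu XF_linear[OF fu fu]]) (use u0 in simp)
 with tr_linear[OF fu fu, of 0 0] show ?thesis by eventually_elim simp
 qed
 have "A2f f (%x. (v x, 0)) = 0" using z g by blast
 thus ?thesis
 by (simp add: A2f_def inner0[OF XF_l2[OF fu] XF_l2[OF v] u0] inner0[OF strain_l2[OF fu] strain_l2[OF v] zs]
 inner0[OF tr_l2[OF fu] tr_l2[OF v] zt] inner0[OF tr_l2[OF fu] traction_l2[OF v zero_QF] zt]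
 inner0[OF traction_l2[OF fu fp] traction_l2[OF v zero_QF] s0] l2_inner_def[of _ "%_. 0"])
 qed
 interpret B: finite_measure "bulk G" by (rule finite_bulk)
 have ip: "integrable (bulk G) ?p"
 proof (rule B.square_integrable_imp_integrable)
 show "?p : borel_measurable (bulk G)" using QF_l2[OF fp] unfolding l2_fun_def by (rule conjunct1)
 have "integrable (bulk G) (%x. (norm (?p x))^2)" using QF_l2[OF fp] unfolding l2_fun_def by (rule conjunct2)
 thus "integrable (bulk G) (%x. (?p x)^2)" by (simp only: real_norm_def power2_abs)
 qed
 \<comment> \<open>The mean of the pressure. Constants belong to \<open>QF V\<close>, so the
   pressure minus \<open>m\<close> is a discrete pressure of mean zero.\<close>
 define m where "m = (LINT x|bulk G. ?p x) / measure (bulk G) (space (bulk G))"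
 have pos: "measure (bulk G) (space (bulk G)) > 0"
 proof -
 have n: "\<not> negligible (dom G)" by (rule open_not_negligible[OF open_dom dom_nonempty])
 have ds: "dom G : sets lebesgue" using open_dom by simp
 have "emeasure lebesgue (dom G) ~= 0"
 proof
 assume "emeasure lebesgue (dom G) = 0"
 with ds have "dom G : null_sets lebesgue" by (rule null_setsI[rotated])
 hence "negligible (dom G)" unfolding negligible_iff_null_sets .
 thus False by (rule notE[OF n])
 qed
 hence "emeasure (bulk G) (space (bulk G)) ~= 0" using ds by (simp add: emeasure_restrict_space)
 thus ?thesis unfolding B.emeasure_eq_measure by (simp add: ennreal_eq_0_iff not_le)
 qed
 let ?q = "%x. ?p x - m"
 have qQ: "?q : QF V" using QF_linear[OF fp QF_const[of m], of 1 "-1"] by simp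
 have "(LINT x|bulk G. ?q x) = (LINT x|bulk G. ?p x) - m * measure (bulk G) (space (bulk G))"
 using ip by (subst Bochner_Integration.integral_diff) (simp_all add: mult.commute)
 hence "(LINT x|bulk G. ?q x) = 0" using pos by (simp add: m_def)
 hence q0: "?q : Q0F G V" using qQ by (simp add: Q0F_def)
 obtain C where C: "ALL q:Q0F G V. ennreal (l2_norm (bulk G) q) <= ennreal C *
 (SUP v\<in>{v : X0F G V. \<not> (AE x in bulk G. v x = 0)}.
 ennreal (l2_inner (bulk G) (dvg G v) q / enn2real (sob_norm 1 2 (dom G) v)))" using inf_sup by (rule exE)
 have "(SUP v\<in>{v : X0F G V. \<not> (AE x in bulk G. v x = 0)}.
 ennreal (l2_inner (bulk G) (dvg G v) ?q / enn2real (sob_norm 1 2 (dom G) v))) <= 0"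
 proof (rule SUP_least)
 fix v assume "v : {v : X0F G V. \<not> (AE x in bulk G. v x = 0)}"
 hence v: "v : X0F G V" "v : XF V" by (auto simp: X0F_def)
 have "dvg G v \<diamondop> ?q = dvg G v \<diamondop> ?p - dvg G v \<diamondop> (%_. m)"
 by (rule l2_inner_diff_right[OF QF_l2[OF fp] QF_l2[OF QF_const] dvg_l2[OF v(2)]])
 also have "dvg G v \<diamondop> (%_. m) = 0" using integral_dvg_zero[OF v(1)] by (simp add: l2_inner_def)
 also have "dvg G v \<diamondop> ?p = 0" using div0[OF v(2)] by (simp add: l2_inner_commute)
 finally show "ennreal (l2_inner (bulk G) (dvg G v) ?q / enn2real (sob_norm 1 2 (dom G) v)) <= 0" by simp
 qed
 hence "ennreal (l2_norm (bulk G) ?q) <= 0" using C[rule_format, OF q0] by (simp add: le_zero_eq)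
 hence "(l2_norm (bulk G) ?q)^2 = 0" using l2_inner_nonneg[of "bulk G" ?q] by (simp add: ennreal_eq_0_iff l2_norm_def)
 hence "?q \<diamondop> ?q = 0" by (simp only: l2_norm_power2)
 from l2_inner_eq_0[OF QF_l2[OF qQ] this] have pm: "AE x in bulk G. ?p x = m" by (rule eventually_mono) simp
 have "m = 0"
 proof (rule ccontr)
 assume m: "m ~= 0"
 have ne: "?s x ~= 0" if x: "x : Sig G" for x
 proof
 assume "?s x = 0"
 hence "(- m) *R nrm G x = 0" using traction_null[OF fu u0 pm x] by simp
 thus False using norm_nrm[OF x] m by auto
 qed
 have "AE x in wall G. False" using s0 AE_space[of "wall G"]
 proof eventually_elim
 case (elim x)
 thus ?case using ne by simp
 qed
 hence "AE x in wall G. x ~: space (wall G)" by (rule eventually_mono) simp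
 hence "space (wall G) : null_sets (wall G)" by (simp only: AE_iff_null_sets[OF sets.top])
 hence "emeasure (wall G) (space (wall G)) = 0" by (rule null_setsD1)
 thus False using wall_positive by simp
 qed
 hence "AE x in bulk G. ?p x = 0" using pm by simp
 with u0 show ?thesis by eventually_elim (simp add: prod_eq_iff)
qed

lemma step2_ex:
 assumes "u' : XF V" "p' : QF V" "s : SF V"
 shows "EX u p. step2 G P V u' p' s u p"
proof -
 obtain J :: "((real^'d => real^'d) + (real^'d => real)) set" and e where "spans (bulk G) XQ J e" using XQ_spans by blast
 from bilin_solve[OF XQ_closed this A2f_bilin l2f_lin[OF assms] A2f_inj]
 obtain f where f: "f : XQ" "ALL g:XQ. A2f f g = l2f u' p' s g" by (rule bexE)
 hence "step2 G P V u' p' s (bu f) (bp f)" unfolding step2_iff[OF assms] using XQ_D[OF f(1)] by simp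
 thus ?thesis by (intro exI)
qed

text \<open>Step 1 determines \<open>s\<close> only almost everywhere, so uniqueness of Step 2 has
  to allow two versions of it.\<close>

lemma step2_cong:
 assumes u': "u' : XF V" and p': "p' : QF V" and s: "s : SF V" "s2 : SF V" "AE x in wall G. s x = s2 x"
 and st: "step2 G P V u' p' s u p" "step2 G P V u' p' s2 u2 p2"
 shows "(AE x in bulk G. u x = u2 x) & (AE x in bulk G. p x = p2 x)"
proof -
 let ?f = "%x. (u x, p x)" and ?f2 = "%x. (u2 x, p2 x)"
 have a: "u : XF V" "p : QF V" "ALL g:XQ. A2f ?f g = l2f u' p' s g" and b: "u2 : XF V" "p2 : QF V" "ALL g:XQ. A2f ?f2 g = l2f u' p' s2 g"
 using st unfolding step2_iff[OF u' p' s(1)] step2_iff[OF u' p' s(2)] by simp_all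
 have l: "l2f u' p' s g = l2f u' p' s2 g" if g: "g : XQ" for g
 proof -
 have "s \<bullet>w F = s2 \<bullet>w F" if "l2_fun (wall G) F" for F
 by (rule l2_inner_cong_AE[OF SF_l2[OF s(1)] SF_l2[OF s(2)] that that s(3)]) simp
 from this[OF tr_l2[OF XQ_D(1)[OF g]]] this[OF traction_l2[OF XQ_D[OF g]]] show ?thesis unfolding l2f_def by simp
 qed
 have F: "?f : XQ" "?f2 : XQ" using a b by (auto intro: XQ_I)
 have d: "(%x. ?f x - ?f2 x) : XQ" using lin_closedD[OF XQ_closed F, of 1 "-1"] by simp
 have "A2f (%x. ?f x - ?f2 x) g = 0" if g: "g : XQ" for g
 proof -
 have "lin_functional (bulk G) XQ (%f. A2f f g)" using A2f_bilin g by (simp add: bilin_form_def)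
 from lin_functional_diff[OF this F] show ?thesis using a(3) b(3) l g by simp
 qed
 hence "AE x in bulk G. ?f x - ?f2 x = 0" by (intro A2f_inj d) blast
 thus ?thesis
 by (intro conjI) (rule eventually_mono, assumption, simp add: prod_eq_iff)+
qed

end

text \<open>Pure algebra in the values of the forms. \<open>U\<close>, \<open>V\<close> stand for
  the new and old velocity, \<open>t\<close>, \<open>t'\<close> for their traces, \<open>sv\<close>,
  \<open>s'\<close> for the new and old traction, a single \<open>s\<close> for the structure
  velocity; thus \<open>s's\<close> pairs the old traction with it. \<open>DD\<close> is the squared
  strain, and \<open>ee\<close>, \<open>e'e'\<close>, \<open>a's\<close>, \<open>as\<close> are
  values of \<open>a_s\<close>. The subtracted last line is the quadratic form in the increments
  \<open>s - t\<close> and \<open>sv - s'\<close>.\<close>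

lemma energy_identity:
 fixes ta kp bt bt0 :: real
 assumes pos: "ta > 0" "kp > 0"
 and step1: "kp / ta * ss + ta * as = kp / ta * st' - s's - a's"
 and step2: "ro / ta * UU + (2 * mv * DD + (kp / ta * tt + (tsv + ta * (1 + bt) / kp * svsv)))
 = ro / ta * UV + (kp / ta * st + (ssv + (s't + ta * (1 + bt) / kp * svs')))"
 and ee: "ee = e'e' + 2 * ta * a's + ta^2 * as"
 shows "ro / 2 * UU + 1 / 2 * ee + ta^2 * (1 + bt) / (2 * kp) * svsv + kp / 2 * tt
 + ta * (2 * mv * DD + ro / (2 * ta) * (UU - 2 * UV + VV) + kp / (2 * ta) * (ss - 2 * st' + t't')
 + kp * bt0 / (2 * ta) * (ss - 2 * st + tt) + ta * bt0 / (2 * kp) * (svsv - 2 * svs' + s's') + ta / 2 * as)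
 = ro / 2 * VV + 1 / 2 * e'e' + ta^2 * (1 + bt) / (2 * kp) * s's' + kp / 2 * t't'
 - (kp * (1 - bt0) / 2 * (ss - 2 * st + tt) - ta * (ssv - s's - tsv + s't) + ta^2 * (1 + bt - bt0) / (2 * kp) * (svsv - 2 * svs' + s's'))"
proof -
 have "a's = kp / ta * st' - s's - kp / ta * ss - ta * as" using step1 by linarith
 hence "ta * a's = ta * (kp / ta * st' - s's - kp / ta * ss - ta * as)" by simp
 also have "... = kp * st' - ta * s's - kp * ss - ta^2 * as" using pos by (simp add: field_simps power2_eq_square)
 finally have 1: "ta * a's = ..." .
 have "2 * mv * DD = ro / ta * UV + kp / ta * st + ssv + s't + ta * (1 + bt) / kp * svs' - ro / ta * UU - kp / ta * tt - tsv - ta * (1 + bt) / kp * svsv"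
 using step2 by linarith
 hence "ta * (2 * mv * DD) = ta * (ro / ta * UV + kp / ta * st + ssv + s't + ta * (1 + bt) / kp * svs' - ro / ta * UU - kp / ta * tt - tsv - ta * (1 + bt) / kp * svsv)" by simp
 also have "... = ro * UV + kp * st + ta * ssv + ta * s't + ta^2 * (1 + bt) / kp * svs' - ro * UU - kp * tt - ta * tsv - ta^2 * (1 + bt) / kp * svsv"
 using pos by (simp add: field_simps power2_eq_square)
 finally have 2: "ta * (2 * mv * DD) = ..." .
 have 3: "ta * (2 * mv * DD + ro / (2 * ta) * (UU - 2 * UV + VV) + kp / (2 * ta) * (ss - 2 * st' + t't')
 + kp * bt0 / (2 * ta) * (ss - 2 * st + tt) + ta * bt0 / (2 * kp) * (svsv - 2 * svs' + s's') + ta / 2 * as)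
 = ta * (2 * mv * DD) + ro / 2 * (UU - 2 * UV + VV) + kp / 2 * (ss - 2 * st' + t't') + kp * bt0 / 2 * (ss - 2 * st + tt)
 + ta^2 * bt0 / (2 * kp) * (svsv - 2 * svs' + s's') + ta^2 / 2 * as"
 using pos by (simp add: field_simps power2_eq_square)
 define A where "A = ta^2 / (2 * kp)"
 have r: "ta^2 * (1 + bt) / (2 * kp) = A * (1 + bt)" "ta^2 * (1 + bt) / kp = 2 * A * (1 + bt)"
 "ta^2 * bt0 / (2 * kp) = A * bt0" "ta^2 * (1 + bt - bt0) / (2 * kp) = A * (1 + bt - bt0)"
 by (simp_all add: A_def)
 show ?thesis unfolding 3 2 ee r using 1 by (simp add: field_simps)
qed

text \<open>With \<open>r = sqrt (4 + bt^2)\<close> the two factors are \<open>(r - bt) / 2\<close>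
  and \<open>(r + bt) / 2\<close>. The product rule says that the matrix with rows (1, -1) and (-1,
  1 + \<beta>) becomes singular when \<open>beta0\<close> is subtracted on the diagonal.\<close>

lemma beta0_eigenvalue:
 assumes "bt >= 0"
 shows "0 < 1 - beta0 bt" "(1 - beta0 bt) * (1 + bt - beta0 bt) = 1"
proof -
 define r where "r = sqrt (4 + bt^2)"
 have r2: "r * r = 4 + bt^2" by (simp add: r_def)
 have "sqrt (bt^2) < sqrt (4 + bt^2)" by (rule real_sqrt_less_mono) simp
 hence "bt < r" using assms unfolding r_def by (metis real_sqrt_unique)
 thus "0 < 1 - beta0 bt" by (simp add: beta0_def r_def)
 have "(r - bt) / 2 * ((r - bt) / 2 + bt) = (r * r - bt^2) / 4" by (simp add: field_simps power2_eq_square)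
 also have "... = 1" by (simp add: r2)
 finally have "(r - bt) / 2 * ((r - bt) / 2 + bt) = 1" .
 moreover have "1 - beta0 bt = (r - bt) / 2" "1 + bt - beta0 bt = (r - bt) / 2 + bt" by (simp_all add: beta0_def r_def)
 ultimately show "(1 - beta0 bt) * (1 + bt - beta0 bt) = 1" by (simp only:)
qed

section \<open>The energy balance of one time step\<close>

context fe_scheme
begin

lemma energy_step:
 assumes u': "u' : XF V" and p': "p' : QF V" and ht': "ht' : SF V"
 and st1: "step1 G P Ls V u' p' ht' s" and ht: "ht = (%x. ht' x + ta *R s x)" and st2: "step2 G P V u' p' s u p"
 shows "E0 G P Ls V u p ht + ta * E1 G P Ls V u' p' ht' s u p ht <= E0 G P Ls V u' p' ht'"
proof -
 have s: "s : SF V" and e1: "ALL w:SF V. A1f s w = l1f u' p' ht' w" using st1 step1_iff[OF u' p' ht'] by simp_all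
 have u: "u : XF V" and p: "p : QF V" and e2: "ALL g:XQ. A2f (%x. (u x, p x)) g = l2f u' p' s g" using st2 step2_iff[OF u' p' s] by simp_all
 have htS: "ht : SF V" unfolding ht using SF_linear[OF ht' s, of 1 ta] by simp
 let ?t = "tr G u" and ?t' = "tr G u'" and ?z = "sv u p" and ?z' = "sv u' p'"
 note l2 = SF_l2[OF s] tr_l2[OF u] tr_l2[OF u'] traction_l2[OF u p, of mv] traction_l2[OF u' p', of mv]
 define bt0 where "bt0 = beta0 bt"
 define af where "af = 1 - bt0"
 have af: "af > 0" "af * (1 + bt - bt0) = 1" using beta0_eigenvalue[OF stab] by (simp_all add: af_def bt0_def)
 have s1: "kp / ta * (s \<bullet>w s) + ta * a_s Ls s s = kp / ta * (s \<bullet>w ?t') - (?z' \<bullet>w s) - a_s Ls ht' s"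
 using e1 s by (simp add: A1f_def l1f_def l2_inner_commute[of "wall G" "tr G u'" s])
 have g: "(%x. (u x, p x)) : XQ" by (rule XQ_I[OF u p])
 have s2: "ro / ta * (u \<diamondop> u) + (2 * mv * (strain G u \<diamondop> strain G u) + (kp / ta * (?t \<bullet>w ?t) + ((?t \<bullet>w ?z) + ta * (1 + bt) / kp * (?z \<bullet>w ?z))))
 = ro / ta * (u \<diamondop> u') + (kp / ta * (s \<bullet>w ?t) + ((s \<bullet>w ?z) + ((?z' \<bullet>w ?t) + ta * (1 + bt) / kp * (?z \<bullet>w ?z'))))"
 using e2[rule_format, OF g] by (simp add: A2f_def l2f_def l2_inner_commute[of "bulk G" u' u] l2_inner_commute[of "wall G" ?z' ?z])
 have ee: "a_s Ls ht ht = a_s Ls ht' ht' + 2 * ta * a_s Ls ht' s + ta^2 * a_s Ls s s"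
 proof -
 have ht1: "ht = (%x. 1 *R ht' x + ta *R s x)" by (simp add: ht)
 have "a_s Ls ht ht = 1 * a_s Ls ht' ht + ta * a_s Ls s ht" by (subst ht1) (rule as_linear(1)[OF ht' s htS])
 moreover have "a_s Ls ht' ht = 1 * a_s Ls ht' ht' + ta * a_s Ls ht' s" by (subst ht1) (rule as_linear(2)[OF ht' s ht'])
 moreover have "a_s Ls s ht = 1 * a_s Ls s ht' + ta * a_s Ls s s" by (subst ht1) (rule as_linear(2)[OF ht' s s])
 ultimately show ?thesis using as_sym[OF s ht'] by (simp add: power2_eq_square algebra_simps)
 qed
 have ds: "(%x. (ht x - ht' x) /\<^sub>R ta) = s" using step by (simp add: ht fun_eq_iff)
 have nf: "(norm_f G u)^2 = strain G u \<diamondop> strain G u" by (simp add: norm_f_def l2_inner_nonneg)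
 have k2: "2 * rhos P * epss P = 2 * kp" by simp
 have E0u: "E0 G P Ls V u p ht = ro / 2 * (u \<diamondop> u) + 1 / 2 * a_s Ls ht ht + ta^2 * (1 + bt) / (2 * kp) * (?z \<bullet>w ?z) + kp / 2 * (?t \<bullet>w ?t)"
 unfolding E0_def l2_norm_power2 norm_s_power2[OF htS] k2 ..
 have E0u': "E0 G P Ls V u' p' ht' = ro / 2 * (u' \<diamondop> u') + 1 / 2 * a_s Ls ht' ht' + ta^2 * (1 + bt) / (2 * kp) * (?z' \<bullet>w ?z') + kp / 2 * (?t' \<bullet>w ?t')"
 unfolding E0_def l2_norm_power2 norm_s_power2[OF ht'] k2 ..
 have E1u: "E1 G P Ls V u' p' ht' s u p ht = 2 * mv * (strain G u \<diamondop> strain G u) + ro / (2 * ta) * (u \<diamondop> u - 2 * (u \<diamondop> u') + u' \<diamondop> u')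
 + kp / (2 * ta) * (s \<bullet>w s - 2 * (s \<bullet>w ?t') + ?t' \<bullet>w ?t') + kp * bt0 / (2 * ta) * (s \<bullet>w s - 2 * (s \<bullet>w ?t) + ?t \<bullet>w ?t)
 + ta * bt0 / (2 * kp) * (?z \<bullet>w ?z - 2 * (?z \<bullet>w ?z') + ?z' \<bullet>w ?z') + ta / 2 * a_s Ls s s"
 unfolding E1_def Let_def l2_norm_power2 ds norm_s_power2[OF s] nf bt0_def
 l2_inner_diff_square[OF XF_l2[OF u] XF_l2[OF u']] l2_inner_diff_square[OF l2(1,3)] l2_inner_diff_square[OF l2(1,2)] l2_inner_diff_square[OF l2(4,5)] ..
 let ?x = "%x. s x - ?t x" and ?y = "%x. ?z x - ?z' x"
 have lx: "l2_fun (wall G) ?x" "l2_fun (wall G) ?y" by (intro l2_fun_diff l2)+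
 have xx: "?x \<bullet>w ?x = s \<bullet>w s - 2 * (s \<bullet>w ?t) + ?t \<bullet>w ?t" by (rule l2_inner_diff_square[OF l2(1,2)])
 have yy: "?y \<bullet>w ?y = ?z \<bullet>w ?z - 2 * (?z \<bullet>w ?z') + ?z' \<bullet>w ?z'" by (rule l2_inner_diff_square[OF l2(4,5)])
 have xy: "?x \<bullet>w ?y = s \<bullet>w ?z - ?z' \<bullet>w s - ?t \<bullet>w ?z + ?z' \<bullet>w ?t"
 by (simp add: l2_inner_diff[OF l2(1,2) lx(2)] l2_inner_diff_right[OF l2(4,5) l2(1)] l2_inner_diff_right[OF l2(4,5) l2(2)] l2_inner_commute[of "wall G" ?z'])
 \<comment> \<open>Because \<open>1 + bt - bt0 = 1 / af\<close>, the remainder of the energy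
   identity is exactly \<open>kp * af / 2\<close> times the squared norm of
   \<open>?x - c ?y\<close>.\<close>
 define c where "c = ta / (kp * af)"
 have "0 <= kp * af / 2 * (1^2 * (?x \<bullet>w ?x) + 2 * 1 * (- c) * (?x \<bullet>w ?y) + (- c)^2 * (?y \<bullet>w ?y))"
 unfolding l2_inner_square[OF lx, symmetric] using kappa af(1) l2_inner_nonneg by (intro mult_nonneg_nonneg) auto
 also have "... = kp * af / 2 * (?x \<bullet>w ?x) - ta * (?x \<bullet>w ?y) + ta^2 * (1 + bt - bt0) / (2 * kp) * (?y \<bullet>w ?y)"
 proof -
 have b: "1 + bt - bt0 = 1 / af" using af by (simp add: field_simps)
 have "k * af / 2 * (1^2 * a + 2 * 1 * (- (ta / (k * af))) * b + (- (ta / (k * af)))^2 * d)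
 = k * af / 2 * a - ta * b + ta^2 * (1 / af) / (2 * k) * d" if "k > 0" for k a b d :: real
 using that af(1) by (simp add: field_simps power2_eq_square)
 from this[OF kappa] show ?thesis unfolding c_def b .
 qed
 finally have Q: "0 <= kp * (1 - bt0) / 2 * (s \<bullet>w s - 2 * (s \<bullet>w ?t) + ?t \<bullet>w ?t) - ta * (s \<bullet>w ?z - ?z' \<bullet>w s - ?t \<bullet>w ?z + ?z' \<bullet>w ?t)
 + ta^2 * (1 + bt - bt0) / (2 * kp) * (?z \<bullet>w ?z - 2 * (?z \<bullet>w ?z') + ?z' \<bullet>w ?z')"
 unfolding af_def xx yy xy .
 show ?thesis
 unfolding E0u E0u' E1u energy_identity[OF step kappa s1 s2 ee] using Q by linarith
qed

end

section \<open>Assembly over all time levels\<close>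

theorem theorem2p1:
  fixes G :: "('d::finite) cell" and P :: param and Ls :: "'d surface_op"
    and F :: "real \<Rightarrow> 'd fe" and H :: "real set" and h T :: real and r N :: nat
    and u0 \<eta>0 :: "real^'d \<Rightarrow> real^'d" and p0 :: "real^'d \<Rightarrow> real"
  assumes cell: "admissible_cell G"
    and constants: "visc P > 0" "rhof P > 0" "rhos P > 0" "epss P > 0"
    and Ls: "surface_operator G Ls"
    and sizes: "H \<subseteq> {0<..}"
    and mesh: "quasi_uniform G H F"
    and spaces: "\<forall>h\<in>H. fe_spaces G (F h)"
    and r: "r \<ge> 1"
    and A: "A1 G H F" "A2 G H F" "A3 G r H F" "A4 G H F"
    and time_step: "T > 0" "N \<ge> 1" "step P = T / real N"
    and \<beta>: "stab P \<ge> 0"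
    and h: "h \<in> H"
    and init: "u0 \<in> XF (F h)" "p0 \<in> QF (F h)" "\<eta>0 \<in> SF (F h)"
  shows
    \<comment> \<open>unique solvability of each time step\<close>
    "(\<forall>u'\<in>XF (F h). \<forall>p'\<in>QF (F h). \<forall>\<eta>'\<in>SF (F h).
        (\<exists>s u p. step1 G P Ls (F h) u' p' \<eta>' s \<and> step2 G P (F h) u' p' s u p) \<and>
        (\<forall>s u p s2 u2 p2.
           step1 G P Ls (F h) u' p' \<eta>' s \<and> step2 G P (F h) u' p' s u p \<and>
           step1 G P Ls (F h) u' p' \<eta>' s2 \<and> step2 G P (F h) u' p' s2 u2 p2 \<longrightarrow>
           (AE x in wall G. s x = s2 x) \<and> (AE x in bulk G. u x = u2 x) \<and>
           (AE x in bulk G. p x = p2 x)))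
     \<and>
     (\<exists>u p \<eta> s. u 0 = u0 \<and> p 0 = p0 \<and> \<eta> 0 = \<eta>0 \<and> scheme G P Ls (F h) N u p \<eta> s)
     \<and>
     (\<forall>u p \<eta> s. u 0 = u0 \<and> p 0 = p0 \<and> \<eta> 0 = \<eta>0 \<and> scheme G P Ls (F h) N u p \<eta> s \<longrightarrow>
        (\<forall>n\<in>{1..N}.
           E0 G P Ls (F h) (u n) (p n) (\<eta> n)
           + (\<Sum>m=1..n. step P * E1 G P Ls (F h) (u (m - 1)) (p (m - 1)) (\<eta> (m - 1))
                                   (s m) (u m) (p m) (\<eta> m))
           \<le> E0 G P Ls (F h) u0 p0 \<eta>0))"
proof -
 let ?V = "F h"
 obtain c where mp: "mesh_partition G c h (mesh ?V)" using mesh h unfolding quasi_uniform_def by blast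
 note a1 = A(1)[unfolded A1_def, rule_format, OF h]
 \<comment> \<open>At the fixed mesh size the power of \<open>h\<close> is absorbed into one
   number.\<close>
 have inv: "EX \<kappa>. ALL K:mesh ?V. (ALL v:XF ?V. sob_norm k p (elset K) v <= ennreal \<kappa> * sob_norm l q (elset K) v) &
 (ALL v:QF ?V. sob_norm k p (elset K) v <= ennreal \<kappa> * sob_norm l q (elset K) v)" if lk: "l <= k" "1 <= p" "1 <= q" for k l p q
 proof -
 note ex = conjunct1[OF A(2)[unfolded A2_def], rule_format, OF conjI[OF lk(1) conjI[OF lk(2,3)]]]
 obtain C where "ALL h:H. ALL K:mesh (F h).
 let \<kappa> = ennreal (C * h powr (- (real k - real l) +
 (real CARD('d) * enn2real (inverse p) - real CARD('d) * enn2real (inverse q))))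
 in (ALL v:XF (F h). sob_norm k p (elset K) v <= \<kappa> * sob_norm l q (elset K) v) &
 (ALL v:QF (F h). sob_norm k p (elset K) v <= \<kappa> * sob_norm l q (elset K) v)"
 using ex by (elim exE conjE)
 from bspec[OF this h] show ?thesis unfolding Let_def by (rule exI)
 qed
 have S: "fe_scheme G ?V c h P Ls"
 proof
 show "admissible_cell G" "mesh_partition G c h (mesh ?V)" "fe_spaces G ?V" by (fact cell, fact mp, use spaces h in blast)
 show "XF ?V \<subseteq> X_space G" "SF ?V \<subseteq> S_space G" "QF ?V \<subseteq> Q_space G" "(%_. a) : QF ?V" for a using a1 by simp_all
 show "EX w:SF ?V. is_trace G v w" if "v : XF ?V" for v using a1 that by blast
 \<comment> \<open>Velocities pass from order 1 to order 2 and pressures, just below, from order 0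
   to order 1, both from exponent 2 to exponent \<infinity>.\<close>
 show "EX \<kappa>. sob_norm 2 \<infinity> (elset K) v <= ennreal \<kappa> * sob_norm 1 2 (elset K) v" if "K : mesh ?V" "v : XF ?V" for K v
 using inv[of 1 2 \<infinity> 2] that by auto
 show "EX \<kappa>. sob_norm 1 \<infinity> (elset K) q <= ennreal \<kappa> * sob_norm 0 2 (elset K) q" if "K : mesh ?V" "q : QF ?V" for K q
 using inv[of 0 1 \<infinity> 2] that by auto
 show "EX C. ALL q:Q0F G ?V. ennreal (l2_norm (bulk G) q) <= ennreal C *
 (SUP v\<in>{v : X0F G ?V. \<not> (AE x in bulk G. v x = 0)}.
 ennreal (l2_inner (bulk G) (dvg G v) q / enn2real (sob_norm 1 2 (dom G) v)))"
 using A(4) h unfolding A4_def by blast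
 show "visc P > 0" "rhof P > 0" "rhos P > 0" "epss P > 0" "surface_operator G Ls" "stab P >= 0" by (fact constants Ls \<beta>)+
 show "step P > 0" using time_step by simp
 qed
 interpret fe_scheme G ?V c h P Ls by (rule S)
 have ex: "EX s u p. step1 G P Ls ?V u' p' \<eta>' s & step2 G P ?V u' p' s u p" if a: "u' : XF ?V" "p' : QF ?V" "\<eta>' : SF ?V" for u' p' \<eta>'
 proof -
 obtain s where s: "step1 G P Ls ?V u' p' \<eta>' s" using step1_ex[OF a] by (rule exE)
 hence "s : SF ?V" by (simp add: step1_def)
 from step2_ex[OF a(1,2) this] s show ?thesis by blast
 qed
 have uniq: "(AE x in wall G. s x = s2 x) & (AE x in bulk G. u x = u2 x) & (AE x in bulk G. p x = p2 x)"
 if a: "u' : XF ?V" "p' : QF ?V" "\<eta>' : SF ?V" and st: "step1 G P Ls ?V u' p' \<eta>' s" "step2 G P ?V u' p' s u p" "step1 G P Ls ?V u' p' \<eta>' s2" "step2 G P ?V u' p' s2 u2 p2"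
 for u' p' \<eta>' s u p s2 u2 p2
 proof -
 have e: "AE x in wall G. s x = s2 x" by (rule step1_unique[OF a st(1,3)])
 have "s : SF ?V" "s2 : SF ?V" using st(1,3) by (simp_all add: step1_def)
 from step2_cong[OF a(1,2) this e st(2,4)] e show ?thesis by blast
 qed
 have scheme_ex: "EX u p \<eta> s. u 0 = u0 & p 0 = p0 & \<eta> 0 = \<eta>0 & scheme G P Ls ?V N u p \<eta> s"
 proof -
 \<comment> \<open>The time levels are generated by dependent choice. The fourth component is the
   structure velocity that led to the state; at level 0 there is none, and any value, here
   \<open>\<eta>0\<close>, will do.\<close>
 define inv' where "inv' n x = (case x of (u, p, \<eta>, s :: real^'d => real^'d) => u : XF ?V & p : QF ?V & \<eta> : SF ?V & (n = (0::nat) --> u = u0 & p = p0 & \<eta> = \<eta>0))" for n x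
 define rel where "rel x y = (case x of (u', p', \<eta>', s' :: real^'d => real^'d) => case y of (u, p, \<eta>, s) =>
 step1 G P Ls ?V u' p' \<eta>' s & \<eta> = (%x. \<eta>' x + step P *R s x) & step2 G P ?V u' p' s u p)" for x y
 have "EX f. ALL n. inv' n (f n) & rel (f n) (f (Suc n))"
 proof (rule dependent_nat_choice)
 show "EX x. inv' 0 x" using init by (intro exI[of _ "(u0, p0, \<eta>0, \<eta>0)"]) (simp add: inv'_def)
 fix x n assume "inv' n x"
 then obtain u' p' \<eta>' s' where x: "x = (u', p', \<eta>', s')" "u' : XF ?V" "p' : QF ?V" "\<eta>' : SF ?V" by (cases x) (auto simp: inv'_def)
 obtain s u p where st: "step1 G P Ls ?V u' p' \<eta>' s" "step2 G P ?V u' p' s u p" using ex[OF x(2-4)] by blast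
 have "s : SF ?V" "u : XF ?V" "p : QF ?V" using st by (simp_all add: step1_def step2_def)
 moreover have "(%x. \<eta>' x + step P *R s x) : SF ?V" using SF_linear[OF x(4) \<open>s : SF ?V\<close>, of 1 "step P"] by simp
 ultimately show "EX y. inv' (Suc n) y & rel x y"
 using st by (intro exI[of _ "(u, p, %x. \<eta>' x + step P *R s x, s)"]) (simp add: inv'_def rel_def x(1))
 qed
 then obtain f where f: "!!n. inv' n (f n)" "!!n. rel (f n) (f (Suc n))" by blast
 let ?u = "%n. fst (f n)" and ?p = "%n. fst (snd (f n))" and ?\<eta> = "%n. fst (snd (snd (f n)))" and ?s = "%n. snd (snd (snd (f n)))"
 have "?u 0 = u0 & ?p 0 = p0 & ?\<eta> 0 = \<eta>0" using f(1)[of 0] by (simp add: inv'_def split: prod.splits)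
 moreover have "scheme G P Ls ?V N ?u ?p ?\<eta> ?s"
 unfolding scheme_def
 proof
 fix n assume "n : {1..N}"
 then obtain m where n: "n = Suc m" by (cases n) auto
 show "step1 G P Ls ?V (?u (n - 1)) (?p (n - 1)) (?\<eta> (n - 1)) (?s n) & ?\<eta> n = (%x. ?\<eta> (n - 1) x + step P *R ?s n x) &
 step2 G P ?V (?u (n - 1)) (?p (n - 1)) (?s n) (?u n) (?p n)"
 using f(2)[of m] unfolding n rel_def by (simp add: case_prod_beta)
 qed
 ultimately show ?thesis by (intro exI[of _ ?u] exI[of _ ?p] exI[of _ ?\<eta>] exI[of _ ?s]) simp
 qed
 have energy: "E0 G P Ls ?V (u n) (p n) (\<eta> n) + (\<Sum>m=1..n. step P * E1 G P Ls ?V (u (m - 1)) (p (m - 1)) (\<eta> (m - 1)) (s m) (u m) (p m) (\<eta> m))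
 <= E0 G P Ls ?V u0 p0 \<eta>0"
 if i: "u 0 = u0" "p 0 = p0" "\<eta> 0 = \<eta>0" and sc: "scheme G P Ls ?V N u p \<eta> s" and n: "n <= N" for u p \<eta> s n
 proof -
 \<comment> \<open>Membership in the discrete spaces is carried through the induction, since
   \<open>energy_step\<close> asks for it at every level.\<close>
 have "u n : XF ?V & p n : QF ?V & \<eta> n : SF ?V & E0 G P Ls ?V (u n) (p n) (\<eta> n) + (\<Sum>m=1..n. step P * E1 G P Ls ?V (u (m - 1)) (p (m - 1)) (\<eta> (m - 1)) (s m) (u m) (p m) (\<eta> m))
 <= E0 G P Ls ?V u0 p0 \<eta>0"
 using n
 proof (induction n)
 case 0
 thus ?case using init i by simp
 next
 case (Suc n)
 hence IH: "u n : XF ?V" "p n : QF ?V" "\<eta> n : SF ?V" "E0 G P Ls ?V (u n) (p n) (\<eta> n) + (\<Sum>m=1..n. step P * E1 G P Ls ?V (u (m - 1)) (p (m - 1)) (\<eta> (m - 1)) (s m) (u m) (p m) (\<eta> m)) <= E0 G P Ls ?V u0 p0 \<eta>0"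
 by simp_all
 have "Suc n : {1..N}" using Suc.prems by simp
 from bspec[OF sc[unfolded scheme_def] this]
 have st: "step1 G P Ls ?V (u n) (p n) (\<eta> n) (s (Suc n))" "\<eta> (Suc n) = (%x. \<eta> n x + step P *R s (Suc n) x)" "step2 G P ?V (u n) (p n) (s (Suc n)) (u (Suc n)) (p (Suc n))"
 by simp_all
 have "u (Suc n) : XF ?V" "p (Suc n) : QF ?V" "s (Suc n) : SF ?V" using st by (simp_all add: step1_def step2_def)
 moreover have "\<eta> (Suc n) : SF ?V" unfolding st(2) using SF_linear[OF IH(3) \<open>s (Suc n) : SF ?V\<close>, of 1 "step P"] by simp
 ultimately show ?case using energy_step[OF IH(1-3) st] IH(4) by simp
 qed
 thus ?thesis by blast
 qed
 show ?thesis
 apply (intro conjI ballI)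
 apply (erule (2) ex)
 apply (intro allI impI, elim conjE, erule (6) uniq)
 apply (rule scheme_ex)
 apply (intro allI impI ballI, elim conjE, erule (3) energy, simp)
 done
qed

end
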